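(* Let $A$ be the indefinite Sturm--Liouville operator associated with $-y''+qy=\lambda ry$ on $\mathbb{R}$, with Weyl--Titchmarsh $m$-coefficients $M_\pm$ (all as defined in the context), and assume that $A$ is $J$-nonnegative. Consider the functions $$\frac{\operatorname{Im} M_+(\lambda)}{M_+(\lambda)-M_-(\lambda)}\quad\text{and}\quad \frac{\operatorname{Im} M_-(\lambda)}{M_+(\lambda)-M_-(\lambda)}.\qquad( * )$$ Then: (i) If $\infty$ is a regular critical point of $A$, then for all $R>0$ the functions $( * )$ are bounded on the set $\{\lambda\in\mathbb{C}_+:|\lambda|>R\}$. (ii) If $0$ is a regular critical point of $A$ and $\ker A=\ker A^2$, then for all $R>0$ the functions $( * )$ are bounded on the set $\{\lambda\in\mathbb{C}_+:|\lambda|<R\}$.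
   Context: Let $q,r\in L^1_{loc}(\mathbb{R})$ be real-valued with $x\,r(x)>0$ for $x\in\mathbb{R}\setminus\{0\}$. Put $\ell[y]=\frac{1}{|r|}(-y''+qy)$ and $a[y]=\frac1r(-y''+qy)$. In the Hilbert space $\mathfrak{H}=L^2(\mathbb{R},|r(x)|dx)$ let $$\mathfrak{D}=\{f\in L^2(\mathbb{R},|r|dx): f,f'\in AC_{loc}(\mathbb{R}),\ \ell[f]\in L^2(\mathbb{R},|r|dx)\},$$ and let $L$ and $A$ be the operators with domain $\mathfrak{D}$ given by $Lf=\ell[f]$, $Af=a[f]$. With $(Jf)(x)=(\operatorname{sgn}x)f(x)$ one has $A=JL$. Put $[f,g]=(Jf,g)$. Standing assumption: $\ell[\cdot]$ is in the limit point case at $+\infty$ and $-\infty$, i.e. $L$ is self-adjoint (equivalently, $A$ is $J$-self-adjoint). $A$ is called $J$-nonnegative if $[Af,f]\ge 0$ for all $f\in\operatorname{dom}(A)$, i.e. $L\ge0$. $\mathbb{C}_+=\{\lambda:\operatorname{Im}\lambda>0\}$. Let $c(x,\lambda)$, $s(x,\lambda)$ be the solutions of $-y''+qy=\lambda|r|y$ with $c(0,\lambda)=s'(0,\lambda)=1$, $c'(0,\lambda)=s(0,\lambda)=0$. Let $m_\pm:\mathbb{C}\setminus\mathbb{R}\to\mathbb{C}$ be the unique holomorphic functions such that $s(\cdot,\lambda)-m_+(\lambda)c(\cdot,\lambda)\in L^2(\mathbb{R}_+,|r|dx)$ and $s(\cdot,\lambda)+m_-(\lambda)c(\cdot,\lambda)\in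 L^2(\mathbb{R}_-,|r|dx)$. Set $M_\pm(\lambda)=\pm m_\pm(\pm\lambda)$. Spectral function (Langer): let $\mathfrak{S}$ be the semiring of all bounded intervals with endpoints different from $0,\pm\infty$ and their complements in $\overline{\mathbb{R}}=\mathbb{R}\cup\{\infty\}$. A $J$-self-adjoint $J$-nonnegative operator $T$ with $\rho(T)\ne\emptyset$ has real spectrum and a spectral function $E:\mathfrak{S}\to\{\text{bounded operators}\}$ such that for $\Delta,\Delta'\in\mathfrak{S}$: (E1) $E(\Delta\cap\Delta')=E(\Delta)E(\Delta')$, $E(\emptyset)=0$, $E(\overline{\mathbb{R}})=I$, $E(\Delta)=JE(\Delta)^*J$; (E2) $E(\Delta\cup\Delta')=E(\Delta)+E(\Delta')$ if $\Delta\cap\Delta'=\emptyset$; (E3) $\pm[\cdot,\cdot]$ is positive definite on $E(\Delta)\mathfrak{H}$ if $\Delta\subset\mathbb{R}_\pm$; (E4) $E(\Delta)$ is in the double commutant of the resolvent of $T$ and $\sigma(T\upharpoonright E(\Delta)\mathfrak{H})\subset\overline{\Delta}$; (E5) if $\Delta$ is bounded, $E(\Delta)\mathfrak{H}\subset\operatorname{dom}(T)$ and $T\upharpoonright E(\Delta)\mathfrak{H}$ is bounded. (For the $J$-nonnegative operators $A$ considered here, $\rho(A)\neq\emptyset$ holds.) A point $\alpha\in\{0,\infty\}$ is a critical point of $T$ if $[\cdot,\cdot]$ is indefinite on $E(\Delta)\mathfrak{H}$ (takes both positive and negative values of $[f,f]$) for every $\Delta\in\mathfrak{S}$ with $\alpha\in\Delta$;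 $c(T)$ denotes the set of critical points. A critical point $\alpha$ is regular if the limits $\lim_{\lambda\uparrow\alpha}E([\lambda_0,\lambda])$ and $\lim_{\lambda\downarrow\alpha}E([\lambda,\lambda_1])$ exist in the strong operator topology for $\lambda_0<\alpha<\lambda_1$, $\lambda_0,\lambda_1\in\mathbb{R}\setminus c(T)$, $\lambda_0,\lambda_1\neq0$; otherwise it is singular. For $\alpha=\infty$, "$\lambda_1>\alpha$" and "$\lambda\downarrow\alpha$" mean $\lambda_1>-\infty$ and $\lambda\downarrow-\infty$. *)

theory Defs
  imports "HOL-Complex_Analysis.Complex_Analysis"
begin

section \<open>Square-integrable functions and operators\<close>

text \<open>
  Elements of an \<open>L\<^sup>2\<close> space are represented by square-integrable functions, and
  equality in the Hilbert space is equality almost everywhere.  An everywhere defined operator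
  is a map on representatives; an operator with a smaller domain is given by its graph, a set of
  pairs of representatives that is closed under a.e. modification of either component.
\<close>

definition L2 :: "real measure \<Rightarrow> (real \<Rightarrow> complex) set" where
  "L2 M = {f. f \<in> borel_measurable M \<and> integrable M (\<lambda>x. (cmod (f x))\<^sup>2)}"

definition l2_inner :: "real measure \<Rightarrow> (real \<Rightarrow> complex) \<Rightarrow> (real \<Rightarrow> complex) \<Rightarrow> complex" where
  "l2_inner M f g = (LINT x|M. f x * cnj (g x))"

definition l2_norm :: "real measure \<Rightarrow> (real \<Rightarrow> complex) \<Rightarrow> real" where
  "l2_norm M f = sqrt (LINT x|M. (cmod (f x))\<^sup>2)"

type_synonym l2_op = "(real \<Rightarrow> complex) \<Rightarrow> (real \<Rightarrow> complex)"
type_synonym l2_graph = "((real \<Rightarrow> complex) \<times> (real \<Rightarrow> complex)) set"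

text \<open>Bounded linear operators on a subspace \<open>K\<close> of \<open>L2 M\<close>.  Linearity together with the norm
  bound forces such a map to respect a.e. equality.\<close>

definition bounded_op :: "real measure \<Rightarrow> (real \<Rightarrow> complex) set \<Rightarrow> l2_op \<Rightarrow> bool" where
  "bounded_op M K B \<longleftrightarrow>
     (\<forall>f\<in>K. B f \<in> K) \<and>
     (\<forall>f\<in>K. \<forall>g\<in>K. \<forall>a b. AE x in M. B (\<lambda>t. a * f t + b * g t) x = a * B f x + b * B g x) \<and>
     (\<exists>C. \<forall>f\<in>K. l2_norm M (B f) \<le> C * l2_norm M f)"

definition op_eq :: "real measure \<Rightarrow> l2_op \<Rightarrow> l2_op \<Rightarrow> bool" where
  "op_eq M B C \<longleftrightarrow> (\<forall>f\<in>L2 M. AE x in M. B f x = C f x)"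

definition op_range :: "real measure \<Rightarrow> l2_op \<Rightarrow> (real \<Rightarrow> complex) set" where
  "op_range M B = {g \<in> L2 M. \<exists>f\<in>L2 M. AE x in M. g x = B f x}"

definition op_graph :: "real measure \<Rightarrow> (real \<Rightarrow> complex) set \<Rightarrow> l2_op \<Rightarrow> l2_graph" where
  "op_graph M D F = {(f, g). f \<in> L2 M \<and> g \<in> L2 M \<and>
     (\<exists>y\<in>D. (AE x in M. f x = y x) \<and> (AE x in M. g x = F y x))}"

definition adjoint_graph :: "real measure \<Rightarrow> l2_graph \<Rightarrow> l2_graph" where
  "adjoint_graph M T = {(g, h). g \<in> L2 M \<and> h \<in> L2 M \<and>
     (\<forall>(u, v)\<in>T. l2_inner M v g = l2_inner M u h)}"

definition densely_defined :: "real measure \<Rightarrow> l2_graph \<Rightarrow> bool" where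
  "densely_defined M T \<longleftrightarrow>
     (\<forall>f\<in>L2 M. \<forall>\<epsilon>>0. \<exists>u\<in>Domain T. l2_norm M (\<lambda>x. f x - u x) < \<epsilon>)"

definition self_adjoint :: "real measure \<Rightarrow> l2_graph \<Rightarrow> bool" where
  "self_adjoint M T \<longleftrightarrow> densely_defined M T \<and> adjoint_graph M T = T"

definition op_kernel :: "l2_graph \<Rightarrow> (real \<Rightarrow> complex) set" where
  "op_kernel T = {f. (f, \<lambda>_. 0) \<in> T}"

text \<open>\<open>R\<close> is the bounded inverse, on the subspace \<open>K\<close>, of \<open>T - z\<close> restricted to \<open>K\<close>:
  for \<open>f, g\<close> in \<open>K\<close>, \<open>(T - z) f = g\<close> iff \<open>f = R g\<close>.\<close>

definition is_resolvent ::
    "real measure \<Rightarrow> (real \<Rightarrow> complex) set \<Rightarrow> l2_graph \<Rightarrow> complex \<Rightarrow> l2_op \<Rightarrow> bool" where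
  "is_resolvent M K T z R \<longleftrightarrow> bounded_op M K R \<and>
     (\<forall>f\<in>K. \<forall>g\<in>K. (f, \<lambda>x. g x + z * f x) \<in> T \<longleftrightarrow> (AE x in M. f x = R g x))"

definition restr_spectrum ::
    "real measure \<Rightarrow> (real \<Rightarrow> complex) set \<Rightarrow> l2_graph \<Rightarrow> complex set" where
  "restr_spectrum M K T = {z. \<nexists>R. is_resolvent M K T z R}"

definition in_bicommutant :: "real measure \<Rightarrow> l2_graph \<Rightarrow> l2_op \<Rightarrow> bool" where
  "in_bicommutant M T B \<longleftrightarrow>
     (\<forall>C. bounded_op M (L2 M) C \<and>
          (\<forall>z R. is_resolvent M (L2 M) T z R \<longrightarrow> op_eq M (C \<circ> R) (R \<circ> C))
        \<longrightarrow> op_eq M (C \<circ> B) (B \<circ> C))"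

definition sot_convergent ::
    "real measure \<Rightarrow> (real \<Rightarrow> l2_op) \<Rightarrow> real filter \<Rightarrow> bool" where
  "sot_convergent M B F \<longleftrightarrow> (\<exists>C. bounded_op M (L2 M) C \<and>
     (\<forall>f\<in>L2 M. ((\<lambda>t. l2_norm M (\<lambda>x. B t f x - C f x)) \<longlongrightarrow> 0) F))"


section \<open>The indefinite inner product\<close>

definition Jop :: l2_op where
  "Jop f = (\<lambda>x. of_real (sgn x) * f x)"

definition j_inner :: "real measure \<Rightarrow> (real \<Rightarrow> complex) \<Rightarrow> (real \<Rightarrow> complex) \<Rightarrow> complex" where
  "j_inner M f g = l2_inner M (Jop f) g"

definition j_nonnegative :: "real measure \<Rightarrow> l2_graph \<Rightarrow> bool" where
  "j_nonnegative M T \<longleftrightarrow> (\<forall>(f, g)\<in>T. j_inner M g f \<in> \<real>\<^sub>\<ge>\<^sub>0)"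


section \<open>Spectral functions and critical points\<close>

text \<open>The extended line \<open>\<real> \<union> {\<infinity>}\<close> is \<open>real option\<close>, with \<open>None\<close> as the single point at infinity
  and the topology \<open>Alexandroff_compactification euclideanreal\<close>.\<close>

definition bounded_intervals :: "real set set" where
  "bounded_intervals = (\<Union>a\<in>- {0}. \<Union>b\<in>- {0} \<inter> {a..}. {{a..b}, {a..<b}, {a<..b}, {a<..<b}})"

definition spec_ring :: "real option set set" where
  "spec_ring = (\<lambda>I. Some ` I) ` bounded_intervals \<union> (\<lambda>I. - (Some ` I)) ` bounded_intervals"

text \<open>\<open>spec_ring\<close> is not closed under intersections or unions (two disjoint bounded intervals
  have complements whose intersection is not in it), so multiplicativity and additivity are
  required whenever the resulting set belongs to it.  The identity \<open>E \<Delta> = J (E \<Delta>)\<^sup>* J\<close> is written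
  with graphs: \<open>(E \<Delta>) f = g\<close> iff \<open>(E \<Delta>)\<^sup>* (J f) = J g\<close>.\<close>

definition spectral_function ::
    "real measure \<Rightarrow> l2_graph \<Rightarrow> (real option set \<Rightarrow> l2_op) \<Rightarrow> bool" where
  "spectral_function M T E \<longleftrightarrow>
     (\<forall>\<Delta>\<in>spec_ring. bounded_op M (L2 M) (E \<Delta>)) \<and>
     (\<forall>\<Delta>\<in>spec_ring. \<forall>\<Delta>'\<in>spec_ring. \<Delta> \<inter> \<Delta>' \<in> spec_ring \<longrightarrow>
        op_eq M (E (\<Delta> \<inter> \<Delta>')) (E \<Delta> \<circ> E \<Delta>')) \<and>
     op_eq M (E {}) (\<lambda>f x. 0) \<and>
     op_eq M (E UNIV) (\<lambda>f. f) \<and>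
     (\<forall>\<Delta>\<in>spec_ring. op_graph M (L2 M) (E \<Delta>) =
        {(f, g). f \<in> L2 M \<and> g \<in> L2 M \<and>
           (Jop f, Jop g) \<in> adjoint_graph M (op_graph M (L2 M) (E \<Delta>))}) \<and>
     (\<forall>\<Delta>\<in>spec_ring. \<forall>\<Delta>'\<in>spec_ring. \<Delta> \<union> \<Delta>' \<in> spec_ring \<and> \<Delta> \<inter> \<Delta>' = {} \<longrightarrow>
        op_eq M (E (\<Delta> \<union> \<Delta>')) (\<lambda>f x. E \<Delta> f x + E \<Delta>' f x)) \<and>
     (\<forall>\<Delta>\<in>spec_ring. \<Delta> \<subseteq> Some ` {0<..} \<longrightarrow>
        (\<forall>f\<in>op_range M (E \<Delta>). \<not> (AE x in M. f x = 0) \<longrightarrow> Re (j_inner M f f) > 0)) \<and>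
     (\<forall>\<Delta>\<in>spec_ring. \<Delta> \<subseteq> Some ` {..<0} \<longrightarrow>
        (\<forall>f\<in>op_range M (E \<Delta>). \<not> (AE x in M. f x = 0) \<longrightarrow> Re (j_inner M f f) < 0)) \<and>
     (\<forall>\<Delta>\<in>spec_ring. in_bicommutant M T (E \<Delta>)) \<and>
     (\<forall>\<Delta>\<in>spec_ring. \<forall>z\<in>restr_spectrum M (op_range M (E \<Delta>)) T.
        \<exists>t. z = of_real t \<and> Some t \<in> Alexandroff_compactification euclideanreal closure_of \<Delta>) \<and>
     (\<forall>I\<in>bounded_intervals. op_range M (E (Some ` I)) \<subseteq> Domain T \<and>
        (\<exists>C. \<forall>(f, g)\<in>T. f \<in> op_range M (E (Some ` I)) \<longrightarrow> l2_norm M g \<le> C * l2_norm M f))"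

definition critical_points ::
    "real measure \<Rightarrow> (real option set \<Rightarrow> l2_op) \<Rightarrow> real option set" where
  "critical_points M E = {\<alpha> \<in> {Some 0, None}. \<forall>\<Delta>\<in>spec_ring. \<alpha> \<in> \<Delta> \<longrightarrow>
     (\<exists>f\<in>op_range M (E \<Delta>). Re (j_inner M f f) > 0) \<and>
     (\<exists>f\<in>op_range M (E \<Delta>). Re (j_inner M f f) < 0)}"

text \<open>At the point \<open>None\<close> every real number lies on both sides: approaching \<open>\<infinity>\<close> from the left
  means tending to \<open>+\<infinity>\<close>, approaching it from the right means tending to \<open>-\<infinity>\<close>.\<close>

definition regular_critical_point ::
    "real measure \<Rightarrow> (real option set \<Rightarrow> l2_op) \<Rightarrow> real option \<Rightarrow> bool" where
  "regular_critical_point M E \<alpha> \<longleftrightarrow> \<alpha> \<in> critical_points M E \<and>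
     (\<forall>t0 t1. t0 \<noteq> 0 \<and> t1 \<noteq> 0 \<and> Some t0 \<notin> critical_points M E \<and> Some t1 \<notin> critical_points M E \<and>
        (case \<alpha> of Some a \<Rightarrow> t0 < a \<and> a < t1 | None \<Rightarrow> True) \<longrightarrow>
        sot_convergent M (\<lambda>t. E (Some ` {t0..t}))
          (case \<alpha> of Some a \<Rightarrow> at_left a | None \<Rightarrow> at_top) \<and>
        sot_convergent M (\<lambda>t. E (Some ` {t..t1}))
          (case \<alpha> of Some a \<Rightarrow> at_right a | None \<Rightarrow> at_bot))"


section \<open>The Sturm--Liouville operators\<close>

definition AC_on :: "real \<Rightarrow> real \<Rightarrow> (real \<Rightarrow> complex) \<Rightarrow> bool" where
  "AC_on a b f \<longleftrightarrow> (\<forall>\<epsilon>>0. \<exists>\<delta>>0. \<forall>(n::nat) u v.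
     (\<forall>i<n. a \<le> u i \<and> u i \<le> v i \<and> v i \<le> b) \<and>
     disjoint_family_on (\<lambda>i. {u i<..<v i}) {..<n} \<and> (\<Sum>i<n. v i - u i) < \<delta>
     \<longrightarrow> (\<Sum>i<n. cmod (f (v i) - f (u i))) < \<epsilon>)"

definition AC_loc :: "(real \<Rightarrow> complex) \<Rightarrow> bool" where
  "AC_loc f \<longleftrightarrow> (\<forall>a b. AC_on a b f)"

abbreviation vderiv :: "(real \<Rightarrow> complex) \<Rightarrow> real \<Rightarrow> complex" where
  "vderiv f \<equiv> (\<lambda>x. vector_derivative f (at x))"

text \<open>\<open>f\<close> and \<open>f'\<close> are locally absolutely continuous; in particular \<open>f'\<close> exists everywhere, while
  \<open>f''\<close> exists only almost everywhere (\<open>vderiv\<close> has an arbitrary value on the exceptional set).\<close>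

definition AC_loc_deriv :: "(real \<Rightarrow> complex) \<Rightarrow> bool" where
  "AC_loc_deriv f \<longleftrightarrow> AC_loc f \<and> (\<forall>x. f differentiable (at x)) \<and> AC_loc (vderiv f)"

definition weighted :: "(real \<Rightarrow> real) \<Rightarrow> real measure" where
  "weighted r = density lebesgue (\<lambda>x. ennreal \<bar>r x\<bar>)"

definition ell :: "(real \<Rightarrow> real) \<Rightarrow> (real \<Rightarrow> real) \<Rightarrow> l2_op" where
  "ell q r y = (\<lambda>x. (- vderiv (vderiv y) x + of_real (q x) * y x) / of_real \<bar>r x\<bar>)"

definition a_expr :: "(real \<Rightarrow> real) \<Rightarrow> (real \<Rightarrow> real) \<Rightarrow> l2_op" where
  "a_expr q r y = (\<lambda>x. (- vderiv (vderiv y) x + of_real (q x) * y x) / of_real (r x))"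

definition max_dom :: "(real \<Rightarrow> real) \<Rightarrow> (real \<Rightarrow> real) \<Rightarrow> (real \<Rightarrow> complex) set" where
  "max_dom q r = {f \<in> L2 (weighted r). AC_loc_deriv f \<and> ell q r f \<in> L2 (weighted r)}"

definition L_op :: "(real \<Rightarrow> real) \<Rightarrow> (real \<Rightarrow> real) \<Rightarrow> l2_graph" where
  "L_op q r = op_graph (weighted r) (max_dom q r) (ell q r)"

definition A_op :: "(real \<Rightarrow> real) \<Rightarrow> (real \<Rightarrow> real) \<Rightarrow> l2_graph" where
  "A_op q r = op_graph (weighted r) (max_dom q r) (a_expr q r)"

definition sl_solution ::
    "(real \<Rightarrow> real) \<Rightarrow> (real \<Rightarrow> real) \<Rightarrow> complex \<Rightarrow> (real \<Rightarrow> complex) \<Rightarrow> bool" where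
  "sl_solution q r z y \<longleftrightarrow> AC_loc_deriv y \<and>
     (AE x in lebesgue. - vderiv (vderiv y) x + of_real (q x) * y x = z * of_real \<bar>r x\<bar> * y x)"

text \<open>\<open>c\<close> and \<open>s\<close> take the spectral parameter as their first argument.\<close>

definition fundamental_system ::
    "(real \<Rightarrow> real) \<Rightarrow> (real \<Rightarrow> real) \<Rightarrow> (complex \<Rightarrow> real \<Rightarrow> complex) \<Rightarrow>
     (complex \<Rightarrow> real \<Rightarrow> complex) \<Rightarrow> bool" where
  "fundamental_system q r c s \<longleftrightarrow> (\<forall>z.
     sl_solution q r z (c z) \<and> c z 0 = 1 \<and> vderiv (c z) 0 = 0 \<and>
     sl_solution q r z (s z) \<and> s z 0 = 0 \<and> vderiv (s z) 0 = 1)"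

definition weyl_coeff_plus ::
    "(real \<Rightarrow> real) \<Rightarrow> (complex \<Rightarrow> real \<Rightarrow> complex) \<Rightarrow> (complex \<Rightarrow> real \<Rightarrow> complex) \<Rightarrow>
     (complex \<Rightarrow> complex) \<Rightarrow> bool" where
  "weyl_coeff_plus r c s m \<longleftrightarrow> m holomorphic_on (- \<real>) \<and>
     (\<forall>z\<in>- \<real>. (\<lambda>x. s z x - m z * c z x) \<in> L2 (restrict_space (weighted r) {0..}))"

definition weyl_coeff_minus ::
    "(real \<Rightarrow> real) \<Rightarrow> (complex \<Rightarrow> real \<Rightarrow> complex) \<Rightarrow> (complex \<Rightarrow> real \<Rightarrow> complex) \<Rightarrow>
     (complex \<Rightarrow> complex) \<Rightarrow> bool" where
  "weyl_coeff_minus r c s m \<longleftrightarrow> m holomorphic_on (- \<real>) \<and>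
     (\<forall>z\<in>- \<real>. (\<lambda>x. s z x + m z * c z x) \<in> L2 (restrict_space (weighted r) {..0}))"

end

theory Submission
  imports Defs
begin

text \<open>
  Regularity of the critical point makes the spectral subspaces on either side of it uniformly
  definite, so the restrictions of \<open>A\<close> to them are symmetric for inner products equivalent to the
  original one.  The spectral subspace away from the critical point is harmless by
  compactness, and what remains at the critical point is quasi-nilpotent: it vanishes at \<open>\<infinity>\<close>, and
  at \<open>0\<close> the operator vanishes on it because \<open>ker A = ker A\<^sup>2\<close>.  Hence
  \<open>\<bar>Im \<lambda>\<bar> \<parallel>(A - \<lambda>)\<^sup>-\<^sup>1\<parallel> \<le> C\<close> on the set in question.

  The solutions \<open>\<Psi>\<^sub>\<plusminus>\<close> of \<open>-y'' + q y = \<lambda> r y\<close> that are square-integrable at \<open>\<plusminus>\<infinity>\<close>, normalised by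
  \<open>\<Psi>\<^sub>\<plusminus>(0) = -M\<^sub>\<plusminus>\<close> and \<open>\<Psi>\<^sub>\<plusminus>'(0) = 1\<close>, have the Wronskian \<open>M\<^sub>- - M\<^sub>+\<close> and satisfy
  \<open>Im \<lambda> \<integral> \<bar>r\<bar> \<bar>\<Psi>\<^sub>\<plusminus>\<bar>\<^sup>2 = Im M\<^sub>\<plusminus>\<close> (integrals over the half-lines).  Applying the resolvent to
  truncations of \<open>cnj \<Psi>\<^sub>+\<close> therefore turns the resolvent bound into
  \<open>Im M\<^sub>+ Im M\<^sub>- \<le> C\<^sup>2 \<bar>M\<^sub>+ - M\<^sub>-\<bar>\<^sup>2\<close>.  Together with \<open>\<bar>Im M\<^sub>+ - Im M\<^sub>-\<bar> \<le> \<bar>M\<^sub>+ - M\<^sub>-\<bar>\<close> this bounds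
  both quotients.
\<close>

section \<open>Locally absolutely continuous functions\<close>

text \<open>The spectral function is only finitely additive and \<open>[.,.]\<close> is indefinite,
  so the part left over at the critical point is treated through the semi-definite form
  \<open>[S u, v]\<close> of a nonnegative operator \<open>S\<close>. In it \<open>S\<close> is
  symmetric, and the growth of its powers, controlled by the Hilbert norm, bounds its Rayleigh
  quotient by its spectral radius. When the spectrum shrinks to a point this quotient vanishes,
  which forces \<open>S\<close> to have square zero. At infinity \<open>S\<close> is an inverse,
  hence injective; at 0 it is \<open>A\<close> itself, hence the kernel condition.

  Weyl theory is extracted from two facts: \<open>A\<close> is symmetric for \<open>[.,.]\<close>,
  and \<open>(A - \<lambda>) y = f\<close> is solvable since the spectral function makes the
  spectrum real. Solving with compactly supported \<open>f\<close> and following the boundary form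
  to infinity gives the formula for \<open>Im M\<close>.

  The product of the imaginary parts appears because a source on the right half-line, built from the
  conjugate of \<open>\<Psi>_+\<close>, produces a multiple of \<open>\<Psi>_-\<close> on the left;
  the ratio of the norms is
  \<open>sqrt (Im M_+ Im M_-) / (Im \<lambda> |M_+ - M_-|)\<close>.\<close>

lemma additive_division_1:
  fixes g :: "real \<Rightarrow> real"
  assumes "a \<le> b" and p: "p division_of {a..b}"
  shows "(\<Sum>K\<in>p. g (Sup K) - g (Inf K)) = g b - g a"
proof -
  \<comment> \<open>Each interval is tagged by its left end point.\<close>
  let ?t = "(\<lambda>K. (Inf K, K)) ` p"
  have inj: "inj_on (\<lambda>K. (Inf K, K)) p" by (auto intro: inj_onI)
  have K: "\<exists>u v. K = {u..v} \<and> u \<le> v" if "K \<in> p" for K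
    using division_ofD(3,4)[OF p that] by (metis atLeastatMost_empty_iff2 box_real(2))
  have "?t tagged_division_of {a..b}"
  proof (rule tagged_division_ofI)
    show "finite ?t" using division_of_finite[OF p] by simp
  next
    fix x K assume "(x, K) \<in> ?t"
    then have "K \<in> p" "x = Inf K" by auto
    then show "x \<in> K" "K \<subseteq> {a..b}" "\<exists>u v. K = cbox u v"
      using K[of K] division_ofD(2)[OF p, of K] by auto
  next
    fix x K y L assume "(x, K) \<in> ?t" "(y, L) \<in> ?t" "(x, K) \<noteq> (y, L)"
    then show "interior K \<inter> interior L = {}" using division_ofD(5)[OF p] by auto
  next
    have "\<Union>{K. \<exists>x. (x, K) \<in> ?t} = \<Union>p" by auto
    then show "\<Union>{K. \<exists>x. (x, K) \<in> ?t} = {a..b}" using division_ofD(6)[OF p] by simp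
  qed
  from additive_tagged_division_1[OF \<open>a \<le> b\<close> this, of g] show ?thesis
    by (simp add: sum.reindex[OF inj] o_def)
qed

section \<open>Absolute continuity over finite families of intervals\<close>

lemma AC_onE:
  assumes "AC_on a b f" "\<epsilon> > 0"
  obtains \<delta> where "\<delta> > 0"
    "\<And>n u v. \<lbrakk>\<And>i. i < n \<Longrightarrow> a \<le> u i \<and> u i \<le> v i \<and> v i \<le> b;
      disjoint_family_on (\<lambda>i. {u i<..<v i}) {..<n}; (\<Sum>i<n. v i - u i) < \<delta>\<rbrakk>
      \<Longrightarrow> (\<Sum>i<(n::nat). cmod (f (v i) - f (u i))) < \<epsilon>"
proof -
  from assms(1)[unfolded AC_on_def, rule_format, OF assms(2)] obtain \<delta> where "\<delta> > 0"
    and \<delta>: "\<forall>(n::nat) u v. (\<forall>i<n. a \<le> u i \<and> u i \<le> v i \<and> v i \<le> b) \<and>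
     disjoint_family_on (\<lambda>i. {u i<..<v i}) {..<n} \<and> (\<Sum>i<n. v i - u i) < \<delta>
     \<longrightarrow> (\<Sum>i<n. cmod (f (v i) - f (u i))) < \<epsilon>" by (elim exE conjE)
  show thesis
    by (rule that[OF \<open>\<delta> > 0\<close>]) (use \<delta> in simp)
qed

text \<open>An enumeration of the index set reduces this to the initial segments of the definition.
  The families met below are indexed by sets of intervals and by sets of tagged intervals.\<close>

lemma AC_on_finite_family:
  assumes "AC_on a b f" "\<epsilon> > 0"
  obtains \<delta> where "\<delta> > 0"
    "\<And>(I::'i set) u v. \<lbrakk>finite I; \<And>i. i \<in> I \<Longrightarrow> a \<le> u i \<and> u i \<le> v i \<and> v i \<le> b;
       disjoint_family_on (\<lambda>i. {u i<..<v i}) I; (\<Sum>i\<in>I. v i - u i) < \<delta>\<rbrakk>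
       \<Longrightarrow> (\<Sum>i\<in>I. cmod (f (v i) - f (u i))) < \<epsilon>"
proof -
  obtain \<delta> where "\<delta> > 0" and \<delta>: "\<And>n u v. \<lbrakk>\<And>i. i < n \<Longrightarrow> a \<le> u i \<and> u i \<le> v i \<and> v i \<le> b;
      disjoint_family_on (\<lambda>i. {u i<..<v i}) {..<n}; (\<Sum>i<n. v i - u i) < \<delta>\<rbrakk>
      \<Longrightarrow> (\<Sum>i<(n::nat). cmod (f (v i) - f (u i))) < \<epsilon>"
    by (rule AC_onE[OF assms]) blast
  show thesis
  proof (rule that[OF \<open>\<delta> > 0\<close>])
    fix I :: "'i set" and u v assume fin: "finite I" and uv: "\<And>i. i \<in> I \<Longrightarrow> a \<le> u i \<and> u i \<le> v i \<and> v i \<le> b"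
      and disj: "disjoint_family_on (\<lambda>i. {u i<..<v i}) I" and sm: "(\<Sum>i\<in>I. v i - u i) < \<delta>"
    obtain h where h: "bij_betw h {..<card I} I"
      using ex_bij_betw_nat_finite[OF fin] by (auto simp: atLeast0LessThan)
    then have hi: "h i \<in> I" if "i < card I" for i using that by (auto simp: bij_betw_def)
    have "(\<Sum>i<card I. cmod (f (v (h i)) - f (u (h i)))) < \<epsilon>"
    proof (rule \<delta>)
      show "a \<le> u (h i) \<and> u (h i) \<le> v (h i) \<and> v (h i) \<le> b" if "i < card I" for i
        using uv[OF hi[OF that]] .
      show "disjoint_family_on (\<lambda>i. {u (h i)<..<v (h i)}) {..<card I}"
        using disj h unfolding disjoint_family_on_def bij_betw_def inj_on_def by blast
      have "(\<Sum>i<card I. v (h i) - u (h i)) = (\<Sum>i\<in>I. v i - u i)"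
        by (rule sum.reindex_bij_betw[OF h])
      with sm show "(\<Sum>i<card I. v (h i) - u (h i)) < \<delta>" by (simp only:)
    qed
    also have "(\<Sum>i<card I. cmod (f (v (h i)) - f (u (h i)))) = (\<Sum>i\<in>I. cmod (f (v i) - f (u i)))"
      by (rule sum.reindex_bij_betw[OF h])
    finally show "(\<Sum>i\<in>I. cmod (f (v i) - f (u i))) < \<epsilon>" .
  qed
qed

text \<open>The intervals index themselves, with end points read off as \<open>Inf\<close> and
  \<open>Sup\<close>. Degenerate intervals are allowed: their interior is empty and they contribute
  nothing.\<close>

lemma AC_on_sum_intervals:
  assumes "AC_on a b f" "\<epsilon> > 0"
  obtains \<delta> where "\<delta> > 0"
    "\<And>\<D>. \<lbrakk>finite \<D>; \<And>K. K \<in> \<D> \<Longrightarrow> \<exists>u v. K = {u..v} \<and> a \<le> u \<and> u \<le> v \<and> v \<le> b;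
       pairwise (\<lambda>K L. interior K \<inter> interior L = {}) \<D>; (\<Sum>K\<in>\<D>. Sup K - Inf K) < \<delta>\<rbrakk>
       \<Longrightarrow> (\<Sum>K\<in>\<D>. cmod (f (Sup K) - f (Inf K))) < \<epsilon>"
proof -
  obtain \<delta> where "\<delta> > 0" and \<delta>: "\<And>(I::real set set) u v. \<lbrakk>finite I; \<And>i. i \<in> I \<Longrightarrow> a \<le> u i \<and> u i \<le> v i \<and> v i \<le> b;
       disjoint_family_on (\<lambda>i. {u i<..<v i}) I; (\<Sum>i\<in>I. v i - u i) < \<delta>\<rbrakk>
       \<Longrightarrow> (\<Sum>i\<in>I. cmod (f (v i) - f (u i))) < \<epsilon>"
    by (rule AC_on_finite_family[OF assms]) blast
  show thesis
  proof (rule that[OF \<open>\<delta> > 0\<close>])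
    fix \<D> assume fin: "finite \<D>" and K: "\<And>K. K \<in> \<D> \<Longrightarrow> \<exists>u v. K = {u..v} \<and> a \<le> u \<and> u \<le> v \<and> v \<le> b"
      and disj: "pairwise (\<lambda>K L. interior K \<inter> interior L = {}) \<D>" and sm: "(\<Sum>K\<in>\<D>. Sup K - Inf K) < \<delta>"
    show "(\<Sum>K\<in>\<D>. cmod (f (Sup K) - f (Inf K))) < \<epsilon>"
    proof (rule \<delta>[OF fin _ _ sm])
      show "a \<le> Inf K \<and> Inf K \<le> Sup K \<and> Sup K \<le> b" if "K \<in> \<D>" for K
        using K[OF that] by force
      have "interior K = {Inf K<..<Sup K}" if "K \<in> \<D>" for K
        using K[OF that] by force
      then show "disjoint_family_on (\<lambda>K. {Inf K<..<Sup K}) \<D>"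
        using disj by (auto simp: disjoint_family_on_def pairwise_def)
    qed
  qed
qed

section \<open>Vitali coverings and sets of exceptional slopes\<close>

text \<open>Vitali's theorem gives countably many disjoint intervals covering \<open>E\<close> up to
  a null set. Their union lies in \<open>G\<close>, so it has finite measure and finitely many of
  them exhaust it up to \<epsilon>; \<open>H\<close> collects the null set and the discarded
  tail.\<close>

lemma Vitali_finite_intervals:
  fixes E G :: "real set" and P :: "real \<Rightarrow> real \<Rightarrow> bool"
  assumes "open G" "G \<in> lmeasurable" "E \<subseteq> G" "\<epsilon> > 0"
    and P: "\<And>x d. x \<in> E \<Longrightarrow> d > 0 \<Longrightarrow> \<exists>u v. u < v \<and> u \<le> x \<and> x \<le> v \<and> v - u < d \<and> P u v"
  obtains \<D> H where "finite \<D>" "\<And>K. K \<in> \<D> \<Longrightarrow> \<exists>u v. K = {u..v} \<and> u < v \<and> P u v \<and> {u..v} \<subseteq> G"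
    "pairwise disjnt \<D>" "H \<in> lmeasurable" "measure lebesgue H < \<epsilon>" "E \<subseteq> \<Union>\<D> \<union> H"
    "(\<Sum>K\<in>\<D>. Sup K - Inf K) \<le> measure lebesgue G"
proof -
  define S where "S = {(u, v). u < v \<and> P u v \<and> {u..v} \<subseteq> G}"
  \<comment> \<open>The covering theorem speaks of balls, so an interval is encoded by its midpoint
    and half its length.\<close>
  define c r where "c = (\<lambda>(u, v). (u + v) / 2 :: real)" and "r = (\<lambda>(u, v). (v - u) / 2 :: real)"
  have cb: "cball (c i) (r i) = {fst i..snd i}" for i
    by (simp add: cball_eq_atLeastAtMost c_def r_def case_prod_beta field_simps)
  obtain C where C: "countable C" "C \<subseteq> S" "pairwise (\<lambda>i j. disjnt (cball (c i) (r i)) (cball (c j) (r j))) C"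
     "negligible (E - (\<Union>i\<in>C. cball (c i) (r i)))"
  proof (rule Vitali_covering_theorem_cballs[of S r E c])
    show "0 < r i" if "i \<in> S" for i using that by (auto simp: S_def r_def)
    show "\<exists>i. i \<in> S \<and> x \<in> cball (c i) (r i) \<and> r i < d" if "x \<in> E" "d > 0" for x d
    proof -
      obtain e where "e > 0" "ball x e \<subseteq> G" using \<open>open G\<close> \<open>x \<in> E\<close> \<open>E \<subseteq> G\<close> open_contains_ball by blast
      obtain u v where uv: "u < v" "u \<le> x" "x \<le> v" "v - u < min d e" "P u v"
        using P[OF \<open>x \<in> E\<close>, of "min d e"] \<open>d > 0\<close> \<open>e > 0\<close> by auto
      have "{u..v} \<subseteq> ball x e" using uv by (auto simp: dist_real_def)
      then have "(u, v) \<in> S" using uv \<open>ball x e \<subseteq> G\<close> by (auto simp: S_def)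
      then show ?thesis using uv cb[of "(u, v)"] by (intro exI[of _ "(u,v)"]) (auto simp: r_def)
    qed
  qed auto
  define \<C> where "\<C> = (\<lambda>i. {fst i..snd i}) ` C"
  have dC: "pairwise disjnt \<C>"
    using C(3) unfolding cb pairwise_def \<C>_def ball_simps by metis
  have mC: "K \<in> lmeasurable \<and> Sup K - Inf K = measure lebesgue K" if KC: "K \<in> \<C>" for K
    proof -
    obtain i where "i \<in> C" "K = {fst i..snd i}" using KC unfolding \<C>_def by blast
    moreover then have "fst i \<le> snd i" using C(2) by (auto simp: S_def)
    ultimately show ?thesis by simp
  qed
  have CG: "\<Union>\<C> \<subseteq> G" using C(2) by (force simp: \<C>_def S_def)
  have cC: "countable \<C>" using C(1) by (simp add: \<C>_def)
  have B: "\<Union>D' \<in> lmeasurable \<and> measure lebesgue (\<Union>D') \<le> measure lebesgue G" if "D' \<subseteq> \<C>" "finite D'" for D'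
  proof -
    have "\<Union>D' \<in> lmeasurable" using that mC by blast
    moreover have "\<Union>D' \<subseteq> G" using that CG by blast
    ultimately show ?thesis using \<open>G \<in> lmeasurable\<close> by (auto intro!: measure_mono_fmeasurable)
  qed
  have UC: "\<Union>\<C> \<in> lmeasurable"
    by (rule fmeasurableI2[OF \<open>G \<in> lmeasurable\<close> CG]) (use cC mC in \<open>auto intro!: sets.countable_Union\<close>)
  obtain \<D> where D: "\<D> \<subseteq> \<C>" "finite \<D>" "measure lebesgue (\<Union>\<C>) - \<epsilon> < measure lebesgue (\<Union>\<D>)"
    by (rule measure_countable_Union_approachable[OF cC \<open>\<epsilon> > 0\<close>, of "measure lebesgue G"]) (use mC B in auto)
  define H where "H = (E - \<Union>\<C>) \<union> (\<Union>\<C> - \<Union>\<D>)"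
  have n: "negligible (E - \<Union>\<C>)" using C(4) by (simp add: \<C>_def cb)
  have Dm: "\<Union>\<D> \<in> lmeasurable" using B D by blast
  have CD: "\<Union>\<C> - \<Union>\<D> \<in> lmeasurable" "measure lebesgue (\<Union>\<C> - \<Union>\<D>) < \<epsilon>"
    using UC Dm D measurable_measure_Diff[OF UC fmeasurableD[OF Dm] Union_mono[OF D(1)]] by auto
  have H: "H \<in> lmeasurable" using n CD by (auto simp: H_def negligible_imp_measurable)
  have "measure lebesgue H \<le> measure lebesgue (E - \<Union>\<C>) + measure lebesgue (\<Union>\<C> - \<Union>\<D>)"
    unfolding H_def by (rule measure_Un_le) (use n CD in \<open>auto simp: negligible_imp_sets\<close>)
  then have H2: "measure lebesgue H < \<epsilon>" using n CD by (simp add: negligible_imp_measure0)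
  show thesis
  proof (rule that[OF D(2) _ _ H H2])
    show "\<exists>u v. K = {u..v} \<and> u < v \<and> P u v \<and> {u..v} \<subseteq> G" if "K \<in> \<D>" for K
      using that D(1) C(2) by (force simp: \<C>_def S_def)
    show pd: "pairwise disjnt \<D>" using dC D(1) by (rule pairwise_subset)
    show "E \<subseteq> \<Union>\<D> \<union> H" by (auto simp: H_def)
    have "(\<Sum>K\<in>\<D>. Sup K - Inf K) = sum (measure lebesgue) \<D>" using mC D(1) by (intro sum.cong) auto
    also have "\<dots> = measure lebesgue (\<Union>\<D>)"
      by (rule measure_Union'[symmetric]) (use pd D mC in auto)
    also have "\<dots> \<le> measure lebesgue G" using B D by blast
    finally show "(\<Sum>K\<in>\<D>. Sup K - Inf K) \<le> measure lebesgue G" .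
  qed
qed

text \<open>Since each weight is below \<epsilon>, the partial sum that first reaches \<epsilon> is
  still below \<open>2 * \<epsilon>\<close>.\<close>

lemma subset_sum_between:
  fixes w :: "'a \<Rightarrow> real"
  assumes "finite D" "\<And>K. K \<in> D \<Longrightarrow> w K < \<epsilon>" "sum w D \<ge> \<epsilon>" "\<epsilon> > 0"
  obtains D' where "D' \<subseteq> D" "\<epsilon> \<le> sum w D'" "sum w D' < 2 * \<epsilon>"
proof -
  have "\<exists>D'\<subseteq>D. \<epsilon> \<le> sum w D' \<and> sum w D' < 2 * \<epsilon>"
    using assms
  proof (induction D)
    case (insert K D)
    show ?case
    proof (cases "sum w D \<ge> \<epsilon>")
      case True
      with insert show ?thesis by (meson subset_insertI2 insertI2)
    next
      case False
      moreover have "w K < \<epsilon>" using insert.prems(1)[of K] by blast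
      moreover have "sum w (insert K D) = w K + sum w D" using insert.hyps by simp
      ultimately have "\<epsilon> \<le> sum w (insert K D)" "sum w (insert K D) < 2 * \<epsilon>"
        using insert.prems(2) False by linarith+
      then show ?thesis by blast
    qed
  qed simp
  then show thesis using that by blast
qed

text \<open>Cover \<open>E\<close> by disjoint intervals of slope at most \<open>-d\<close>, and almost all of \<open>E\<close> again by disjoint
  intervals of slope at least \<open>d\<close> inside these.  The gaps between the two covers have small total
  length, yet \<open>g\<close> must decrease across them by at least \<open>d\<close> times the length of the covers.\<close>

lemma negligible_opposite_slopes:
  fixes g :: "real \<Rightarrow> real"
  assumes AC: "AC_on a b (\<lambda>x. complex_of_real (g x))" and E: "E \<subseteq> {a<..<b}" and "d > 0"
    and low: "\<And>x \<delta>. x \<in> E \<Longrightarrow> \<delta> > 0 \<Longrightarrow>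
      \<exists>u v. u < v \<and> u \<le> x \<and> x \<le> v \<and> v - u < \<delta> \<and> g v - g u \<le> - d * (v - u)"
    and high: "\<And>x \<delta>. x \<in> E \<Longrightarrow> \<delta> > 0 \<Longrightarrow>
      \<exists>u v. u < v \<and> u \<le> x \<and> x \<le> v \<and> v - u < \<delta> \<and> g v - g u \<ge> d * (v - u)"
  shows "negligible E"
proof -
  let ?\<mu> = "measure lebesgue"
  \<comment> \<open>\<open>E\<close> is not known to be measurable; \<open>e\<close> is its outer
    measure, taken over open supersets.\<close>
  define X where "X = ?\<mu> ` {G. open G \<and> G \<in> lmeasurable \<and> E \<subseteq> G}"
  define e where "e = Inf X"
  have ne: "{a<..<b} \<in> {G. open G \<and> G \<in> lmeasurable \<and> E \<subseteq> G}"
    using E by (auto simp flip: box_real)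
  then have Xne: "X \<noteq> {}" by (auto simp: X_def)
  have bdd: "bdd_below X" by (rule bdd_belowI[of _ 0]) (auto simp: X_def)
  have e_le: "e \<le> ?\<mu> S" if S: "S \<in> lmeasurable" "E \<subseteq> S" for S
  proof (rule field_le_epsilon)
    fix \<epsilon> :: real assume "\<epsilon> > 0"
    obtain T where T: "open T" "S \<subseteq> T" "T - S \<in> lmeasurable" "emeasure lebesgue (T - S) < ennreal \<epsilon>"
      using sets_lebesgue_outer_open[OF fmeasurableD[OF S(1)] \<open>\<epsilon> > 0\<close>] by blast
    have eq: "T = S \<union> (T - S)" using T(2) by blast
    have Tm: "T \<in> lmeasurable" using T(3) S(1) eq by (metis fmeasurable.Un)
    have "?\<mu> T \<le> ?\<mu> S + ?\<mu> (T - S)"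
      using measure_Un_le[of S lebesgue "T - S"] S(1) T(3) eq by (metis fmeasurableD)
    moreover have "?\<mu> (T - S) < \<epsilon>"
      using T(3,4) \<open>\<epsilon> > 0\<close> by (simp add: emeasure_eq_measure2 ennreal_less_iff)
    moreover have "e \<le> ?\<mu> T"
      unfolding e_def using T Tm S(2) bdd by (intro cInf_lower) (auto simp: X_def)
    ultimately show "e \<le> ?\<mu> S + \<epsilon>" by linarith
  qed
  have main: "d * e \<le> \<eta>" if "\<eta> > 0" for \<eta>
  proof -
    obtain \<delta> where "\<delta> > 0" and \<delta>: "\<And>\<D>. \<lbrakk>finite \<D>; \<And>K. K \<in> \<D> \<Longrightarrow> \<exists>u v. K = {u..v} \<and> a \<le> u \<and> u \<le> v \<and> v \<le> b;
       pairwise (\<lambda>K L. interior K \<inter> interior L = {}) \<D>; (\<Sum>K\<in>\<D>. Sup K - Inf K) < \<delta>\<rbrakk>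
       \<Longrightarrow> (\<Sum>K\<in>\<D>. cmod (complex_of_real (g (Sup K)) - complex_of_real (g (Inf K)))) < \<eta> / 2"
      using AC_on_sum_intervals[OF AC, of "\<eta>/2"] \<open>\<eta> > 0\<close> by auto
    \<comment> \<open>The gaps have total length below
      \<open>(e + \<epsilon>) - (e - 2 * \<epsilon>)\<close>, which must not exceed \<delta>; the
      second bound absorbs the loss \<open>2 * d * \<epsilon>\<close> at the end.\<close>
    define \<epsilon> where "\<epsilon> = min (\<delta> / 3) (\<eta> / (4 * d))"
    have \<epsilon>: "\<epsilon> > 0" "3 * \<epsilon> \<le> \<delta>" "4 * d * \<epsilon> \<le> \<eta>"
      using \<open>\<delta> > 0\<close> \<open>\<eta> > 0\<close> \<open>d > 0\<close> by (auto simp: \<epsilon>_def min_def field_simps)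
    have "\<exists>y\<in>X. y < e + \<epsilon>"
      using cInf_lessD[OF Xne, of "e + \<epsilon>"] \<epsilon>(1) by (simp add: e_def)
    then obtain G0 where G0: "open G0" "G0 \<in> lmeasurable" "E \<subseteq> G0" "?\<mu> G0 < e + \<epsilon>"
      by (auto simp: X_def)
    define G where "G = G0 \<inter> {a<..<b}"
    have Gm: "G \<in> lmeasurable" unfolding G_def using G0 ne by (intro fmeasurable.Int) auto
    have "?\<mu> G \<le> ?\<mu> G0" using G0 Gm by (intro measure_mono_fmeasurable) (auto simp: G_def)
    then have G: "open G" "E \<subseteq> G" "?\<mu> G < e + \<epsilon>" "G \<subseteq> {a<..<b}"
      using G0 E by (auto simp: G_def)
    obtain \<I> H1 where I: "finite \<I>" "\<And>K. K \<in> \<I> \<Longrightarrow> \<exists>u v. K = {u..v} \<and> u < v \<and> g v - g u \<le> - d * (v - u) \<and> {u..v} \<subseteq> G"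
      "pairwise disjnt \<I>" "H1 \<in> lmeasurable" "?\<mu> H1 < \<epsilon>" "E \<subseteq> \<Union>\<I> \<union> H1"
      "(\<Sum>K\<in>\<I>. Sup K - Inf K) \<le> ?\<mu> G"
      by (rule Vitali_finite_intervals[OF G(1) Gm G(2) \<epsilon>(1), where P = "\<lambda>u v. g v - g u \<le> - d * (v - u)"])
        (use low in blast)+
    \<comment> \<open>Only interiors are kept, so that the second cover can be nested in single
      intervals of the first; the lost end points form the finite set \<open>N\<close>.\<close>
    define G' where "G' = \<Union>(interior ` \<I>)"
    have "G' \<subseteq> G" unfolding G'_def using I(2) interior_subset by blast
    have oG': "open G'" by (auto simp: G'_def)
    then have G'm: "G' \<in> lmeasurable" using \<open>G' \<subseteq> G\<close> Gm by (intro fmeasurableI2[OF Gm]) auto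
    define N where "N = Inf ` \<I> \<union> Sup ` \<I>"
    have N: "negligible N" using I(1) by (simp add: N_def negligible_finite)
    have "\<Union>\<I> \<subseteq> G' \<union> N"
    proof
      fix x assume "x \<in> \<Union>\<I>"
      then obtain K where K: "K \<in> \<I>" "x \<in> K" by blast
      then obtain u v where uv: "K = {u..v}" "u < v" using I(2) by blast
      then have "u = Inf K" "v = Sup K" "interior K = {u<..<v}" by auto
      moreover have "x = u \<or> x = v \<or> x \<in> {u<..<v}" using K(2) uv by auto
      ultimately have "x = Inf K \<or> x = Sup K \<or> x \<in> interior K" by simp
      then show "x \<in> G' \<union> N" using K(1) unfolding G'_def N_def by blast
    qed
    then have EG': "E \<subseteq> (E \<inter> G') \<union> N \<union> H1" using I(6) by blast
    obtain \<J> H2 where J: "finite \<J>" "\<And>K. K \<in> \<J> \<Longrightarrow> \<exists>u v. K = {u..v} \<and> u < v \<and>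
        (g v - g u \<ge> d * (v - u) \<and> (\<exists>K\<in>\<I>. {u..v} \<subseteq> K)) \<and> {u..v} \<subseteq> G'"
      "pairwise disjnt \<J>" "H2 \<in> lmeasurable" "?\<mu> H2 < \<epsilon>" "E \<inter> G' \<subseteq> \<Union>\<J> \<union> H2"
    proof (rule Vitali_finite_intervals[OF oG' G'm _ \<epsilon>(1), of "E \<inter> G'" "\<lambda>u v. g v - g u \<ge> d * (v - u) \<and> (\<exists>K\<in>\<I>. {u..v} \<subseteq> K)"])
      fix x r :: real assume x: "x \<in> E \<inter> G'" "r > 0"
      then obtain K where K: "K \<in> \<I>" "x \<in> interior K" by (auto simp: G'_def)
      then obtain \<rho> where "\<rho> > 0" "ball x \<rho> \<subseteq> K" by (meson mem_interior)
      obtain u v where uv: "u < v" "u \<le> x" "x \<le> v" "v - u < min r \<rho>" "g v - g u \<ge> d * (v - u)"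
        using high[of x "min r \<rho>"] x \<open>\<rho> > 0\<close> by auto
      have "{u..v} \<subseteq> ball x \<rho>" using uv by (auto simp: dist_real_def)
      then show "\<exists>u v. u < v \<and> u \<le> x \<and> x \<le> v \<and> v - u < r \<and> (g v - g u \<ge> d * (v - u) \<and> (\<exists>K\<in>\<I>. {u..v} \<subseteq> K))"
        using uv K \<open>ball x \<rho> \<subseteq> K\<close> by (intro exI[of _ u] exI[of _ v]) auto
    qed (blast, blast)
    have Jlen: "e - 2 * \<epsilon> \<le> (\<Sum>K\<in>\<J>. Sup K - Inf K)"
    proof -
      have Jm: "K \<in> lmeasurable \<and> ?\<mu> K = Sup K - Inf K" if K: "K \<in> \<J>" for K
        using J(2)[OF K] by auto
      have m: "\<Union>\<J> \<in> lmeasurable" using J(1) Jm by blast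
      have U: "?\<mu> (\<Union>\<J>) = (\<Sum>K\<in>\<J>. Sup K - Inf K)"
        using measure_Union'[of \<J> lebesgue] J(1,3) Jm by auto
      have NH: "N \<union> H1 \<in> lmeasurable" "?\<mu> (N \<union> H1) < \<epsilon>"
        using measure_Un_le[of N lebesgue H1] N I(4,5)
        by (auto simp: negligible_imp_measurable negligible_imp_sets negligible_imp_measure0)
      have "e \<le> ?\<mu> (\<Union>\<J> \<union> H2 \<union> (N \<union> H1))"
        using EG' J(4,6) m NH by (intro e_le) auto
      also have "\<dots> \<le> ?\<mu> (\<Union>\<J>) + ?\<mu> H2 + ?\<mu> (N \<union> H1)"
        using measure_Un_le[of "\<Union>\<J> \<union> H2" lebesgue "N \<union> H1"] measure_Un_le[of "\<Union>\<J>" lebesgue H2] m NH J(4)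
        by (auto simp: fmeasurableD)
      finally show ?thesis using U NH J(5) by linarith
    qed
    have "\<exists>q. {J\<in>\<J>. J \<subseteq> K} \<subseteq> q \<and> q division_of K" if KI: "K \<in> \<I>" for K
    proof -
      obtain u v where uv: "K = {u..v}" using I(2)[OF KI] by blast
      have "{J\<in>\<J>. J \<subseteq> K} division_of \<Union>{J\<in>\<J>. J \<subseteq> K}"
      proof (rule division_ofI)
        show "finite {J \<in> \<J>. J \<subseteq> K}" using J(1) by simp
        show "\<exists>a b. L = cbox a b" "L \<noteq> {}" if "L \<in> {J \<in> \<J>. J \<subseteq> K}" for L
          using J(2)[of L] that by auto
        show "interior K1 \<inter> interior K2 = {}" if "K1 \<in> {J \<in> \<J>. J \<subseteq> K}" "K2 \<in> {J \<in> \<J>. J \<subseteq> K}" "K1 \<noteq> K2" for K1 K2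
        proof -
          have "K1 \<inter> K2 = {}" using J(3) that by (auto simp: pairwise_def disjnt_def)
          then show ?thesis using interior_subset[of K1] interior_subset[of K2] by blast
        qed
      qed auto
      moreover have "\<Union>{J\<in>\<J>. J \<subseteq> K} \<subseteq> cbox u v" using uv by auto
      ultimately obtain q where "{J\<in>\<J>. J \<subseteq> K} \<subseteq> q" "q division_of cbox u v"
        by (rule partial_division_extend_interval)
      then show ?thesis using uv by auto
    qed
    then obtain q where q: "\<And>K. K \<in> \<I> \<Longrightarrow> {J\<in>\<J>. J \<subseteq> K} \<subseteq> q K" "\<And>K. K \<in> \<I> \<Longrightarrow> q K division_of K"
      by metis
    \<comment> \<open>The intervals of the second cover inside \<open>K\<close> extend to a division
      of \<open>K\<close>; the gaps are its remaining members.\<close>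
    define gap where "gap K = q K - {J\<in>\<J>. J \<subseteq> K}" for K
    have gapK: "finite (gap K)" "\<And>L. L \<in> gap K \<Longrightarrow> L \<subseteq> K \<and> L \<noteq> {} \<and> (\<exists>u v. L = {u..v})" if "K \<in> \<I>" for K
      using division_ofD(1,2,3,4)[OF q(2)[OF that]] unfolding gap_def by auto
    have split: "(\<Sum>L\<in>gap K. F (Sup L) - F (Inf L)) = F (Sup K) - F (Inf K) - (\<Sum>L\<in>{J\<in>\<J>. J \<subseteq> K}. F (Sup L) - F (Inf L))"
      if KI: "K \<in> \<I>" for K and F :: "real \<Rightarrow> real"
    proof -
      obtain u v where uv: "K = {u..v}" "u < v" using I(2)[OF KI] by blast
      have "(\<Sum>L\<in>q K. F (Sup L) - F (Inf L)) = F (Sup K) - F (Inf K)"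
        using additive_division_1[of u v "q K" F] q(2)[OF KI] uv by auto
      moreover have "finite (q K)" using q(2)[OF KI] by blast
      ultimately show ?thesis unfolding gap_def using q(1)[OF KI] by (simp add: sum_diff)
    qed
    have Jeq: "(\<Sum>K\<in>\<I>. \<Sum>L\<in>{J\<in>\<J>. J \<subseteq> K}. F L) = sum F \<J>" for F :: "real set \<Rightarrow> real"
    proof -
      have "(\<Sum>K\<in>\<I>. \<Sum>L\<in>{J\<in>\<J>. J \<subseteq> K}. F L) = sum F (\<Union>K\<in>\<I>. {J\<in>\<J>. J \<subseteq> K})"
      proof (rule sum.UNION_disjoint[symmetric])
        show "\<forall>i\<in>\<I>. \<forall>j\<in>\<I>. i \<noteq> j \<longrightarrow> {J \<in> \<J>. J \<subseteq> i} \<inter> {J \<in> \<J>. J \<subseteq> j} = {}"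
        proof (intro ballI impI)
          fix i j assume ij: "i \<in> \<I>" "j \<in> \<I>" "i \<noteq> j"
          then have d: "i \<inter> j = {}" using I(3) by (auto simp: pairwise_def disjnt_def)
          have "J \<noteq> {}" if "J \<in> \<J>" for J using J(2)[OF that] by auto
          then show "{J \<in> \<J>. J \<subseteq> i} \<inter> {J \<in> \<J>. J \<subseteq> j} = {}" using d by blast
        qed
      qed (use I(1) J(1) in auto)
      also have "(\<Union>K\<in>\<I>. {J\<in>\<J>. J \<subseteq> K}) = \<J>" using J(2) by blast
      finally show ?thesis .
    qed
    define \<G> where "\<G> = (\<Union>K\<in>\<I>. gap K)"
    have Geq: "(\<Sum>K\<in>\<I>. \<Sum>L\<in>gap K. F L) = sum F \<G>" for F :: "real set \<Rightarrow> real"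
      unfolding \<G>_def
    proof (rule sum.UNION_disjoint[symmetric])
      show "\<forall>i\<in>\<I>. \<forall>j\<in>\<I>. i \<noteq> j \<longrightarrow> gap i \<inter> gap j = {}"
      proof (intro ballI impI)
        fix i j assume ij: "i \<in> \<I>" "j \<in> \<I>" "i \<noteq> j"
        then have "i \<inter> j = {}" using I(3) by (auto simp: pairwise_def disjnt_def)
        then show "gap i \<inter> gap j = {}" using gapK(2)[OF ij(1)] gapK(2)[OF ij(2)] by blast
      qed
    qed (use I(1) gapK(1) in auto)
    have gsum: "(\<Sum>L\<in>\<G>. F (Sup L) - F (Inf L)) = (\<Sum>K\<in>\<I>. F (Sup K) - F (Inf K)) - (\<Sum>L\<in>\<J>. F (Sup L) - F (Inf L))"
      for F :: "real \<Rightarrow> real"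
    proof -
      have "(\<Sum>L\<in>\<G>. F (Sup L) - F (Inf L)) = (\<Sum>K\<in>\<I>. F (Sup K) - F (Inf K) - (\<Sum>L\<in>{J\<in>\<J>. J \<subseteq> K}. F (Sup L) - F (Inf L)))"
        unfolding Geq[symmetric] by (rule sum.cong[OF refl]) (rule split)
      then show ?thesis by (simp only: sum_subtractf Jeq)
    qed
    have "(\<Sum>L\<in>\<G>. cmod (complex_of_real (g (Sup L)) - complex_of_real (g (Inf L)))) < \<eta> / 2"
    proof (rule \<delta>)
      show "finite \<G>" using I(1) gapK(1) by (auto simp: \<G>_def)
      show "\<exists>u v. L = {u..v} \<and> a \<le> u \<and> u \<le> v \<and> v \<le> b" if LG: "L \<in> \<G>" for L
      proof -
        obtain K where K: "K \<in> \<I>" "L \<in> gap K" using LG by (auto simp: \<G>_def)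
        then obtain u v where uv: "L = {u..v}" "L \<noteq> {}" "L \<subseteq> K" using gapK(2) by blast
        have "K \<subseteq> {a<..<b}" using I(2)[OF K(1)] G(4) by blast
        then have "{u..v} \<subseteq> {a<..<b}" "u \<le> v" using uv by auto
        then have "a < u" "v < b" by (auto simp: subset_iff)
        then show ?thesis using uv \<open>u \<le> v\<close> by (intro exI[of _ u] exI[of _ v]) auto
      qed
      show "pairwise (\<lambda>K L. interior K \<inter> interior L = {}) \<G>"
      proof (rule pairwiseI)
        fix L1 L2 assume L: "L1 \<in> \<G>" "L2 \<in> \<G>" "L1 \<noteq> L2"
        then obtain K1 K2 where K: "K1 \<in> \<I>" "L1 \<in> gap K1" "K2 \<in> \<I>" "L2 \<in> gap K2" by (auto simp: \<G>_def)
        show "interior L1 \<inter> interior L2 = {}"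
        proof (cases "K1 = K2")
          case True
          then show ?thesis using division_ofD(5)[OF q(2)[OF K(1)], of L1 L2] K L(3) by (auto simp: gap_def)
        next
          case False
          then have "K1 \<inter> K2 = {}" using I(3) K by (auto simp: pairwise_def disjnt_def)
          moreover have "interior L1 \<subseteq> K1" "interior L2 \<subseteq> K2"
            using gapK(2)[OF K(1,2)] gapK(2)[OF K(3,4)] interior_subset[of L1] interior_subset[of L2] by auto
          ultimately show ?thesis by blast
        qed
      qed
      show "(\<Sum>K\<in>\<G>. Sup K - Inf K) < \<delta>" using gsum[of "\<lambda>x. x"] I(7) G(3) Jlen \<epsilon>(2) by linarith
    qed
    then have "(\<Sum>L\<in>\<G>. \<bar>g (Sup L) - g (Inf L)\<bar>) < \<eta> / 2"
      by (simp flip: of_real_diff)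
    then have 1: "- (\<eta> / 2) < (\<Sum>L\<in>\<G>. g (Sup L) - g (Inf L))"
      using sum_abs[of "\<lambda>L. g (Sup L) - g (Inf L)" \<G>] by linarith
    have 2: "(\<Sum>K\<in>\<I>. g (Sup K) - g (Inf K)) \<le> - d * (\<Sum>K\<in>\<I>. Sup K - Inf K)"
      unfolding sum_distrib_left
    proof (rule sum_mono)
      fix K assume "K \<in> \<I>"
      from I(2)[OF this] show "g (Sup K) - g (Inf K) \<le> - d * (Sup K - Inf K)" by auto
    qed
    have 3: "(\<Sum>K\<in>\<J>. g (Sup K) - g (Inf K)) \<ge> d * (\<Sum>K\<in>\<J>. Sup K - Inf K)"
      unfolding sum_distrib_left
    proof (rule sum_mono)
      fix K assume "K \<in> \<J>"
      from J(2)[OF this] show "d * (Sup K - Inf K) \<le> g (Sup K) - g (Inf K)" by auto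
    qed
    have 4: "(\<Sum>K\<in>\<I>. Sup K - Inf K) \<ge> 0"
    proof (rule sum_nonneg)
      fix K assume "K \<in> \<I>"
      from I(2)[OF this] show "Sup K - Inf K \<ge> 0" by auto
    qed
    \<comment> \<open>The increment over the gaps is the one over \<I> minus the one over \<J>. Both
      terms push it down, yet it exceeds \<open>- \<eta> / 2\<close>.\<close>
    have "d * (e - 2 * \<epsilon>) \<le> d * (\<Sum>K\<in>\<J>. Sup K - Inf K)" using Jlen \<open>d > 0\<close> by simp
    also have "\<dots> \<le> \<eta> / 2" using 1 2 3 gsum[of g] mult_nonneg_nonneg[OF less_imp_le[OF \<open>d > 0\<close>] 4] by linarith
    finally show "d * e \<le> \<eta>" using \<epsilon>(3) by (simp add: algebra_simps)
  qed
  have "d * e \<le> 0" using main by (rule field_le_epsilon) simp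
  then have "e \<le> 0" using \<open>d > 0\<close> by (simp add: mult_le_0_iff)
  show ?thesis unfolding negligible_outer
  proof (intro allI impI)
    fix \<epsilon> :: real assume "\<epsilon> > 0"
    then have "\<exists>y\<in>X. y < \<epsilon>" using cInf_lessD[OF Xne, of \<epsilon>] \<open>e \<le> 0\<close> by (simp add: e_def)
    then show "\<exists>T. E \<subseteq> T \<and> T \<in> lmeasurable \<and> ?\<mu> T < \<epsilon>" by (auto simp: X_def)
  qed
qed

text \<open>Cover almost all of \<open>E\<close> by disjoint intervals shorter than \<epsilon> and
  of slope at least \<open>1 / \<epsilon>\<close> in modulus. If their total length reached
  \<open>2 * \<epsilon>\<close>, a subfamily of total length between \<epsilon> and
  \<open>2 * \<epsilon> \<le> \<delta>\<close> would have variation at least 1, against the choice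
  of \<delta>.\<close>

lemma negligible_infinite_slopes:
  fixes g :: "real \<Rightarrow> real"
  assumes AC: "AC_on a b (\<lambda>x. complex_of_real (g x))" and E: "E \<subseteq> {a<..<b}"
    and steep: "\<And>x \<delta> k. x \<in> E \<Longrightarrow> \<delta> > 0 \<Longrightarrow>
      \<exists>u v. u < v \<and> u \<le> x \<and> x \<le> v \<and> v - u < \<delta> \<and> \<bar>g v - g u\<bar> \<ge> k * (v - u)"
  shows "negligible E"
  unfolding negligible_outer
proof (intro allI impI)
  fix \<eta> :: real assume "\<eta> > 0"
  let ?\<mu> = "measure lebesgue"
  obtain \<delta> where "\<delta> > 0" and \<delta>: "\<And>\<D>. \<lbrakk>finite \<D>; \<And>K. K \<in> \<D> \<Longrightarrow> \<exists>u v. K = {u..v} \<and> a \<le> u \<and> u \<le> v \<and> v \<le> b;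
     pairwise (\<lambda>K L. interior K \<inter> interior L = {}) \<D>; (\<Sum>K\<in>\<D>. Sup K - Inf K) < \<delta>\<rbrakk>
     \<Longrightarrow> (\<Sum>K\<in>\<D>. cmod (complex_of_real (g (Sup K)) - complex_of_real (g (Inf K)))) < 1"
    using AC_on_sum_intervals[OF AC, of 1] by auto
  define \<epsilon> where "\<epsilon> = min (\<delta> / 2) (\<eta> / 3)"
  have \<epsilon>: "\<epsilon> > 0" "2 * \<epsilon> \<le> \<delta>" "3 * \<epsilon> \<le> \<eta>"
    using \<open>\<delta> > 0\<close> \<open>\<eta> > 0\<close> by (auto simp: \<epsilon>_def)
  obtain \<D> H where D: "finite \<D>" "\<And>K. K \<in> \<D> \<Longrightarrow> \<exists>u v. K = {u..v} \<and> u < v \<and>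
      (v - u < \<epsilon> \<and> \<bar>g v - g u\<bar> \<ge> (1 / \<epsilon>) * (v - u)) \<and> {u..v} \<subseteq> {a<..<b}"
    "pairwise disjnt \<D>" "H \<in> lmeasurable" "?\<mu> H < \<epsilon>" "E \<subseteq> \<Union>\<D> \<union> H"
  proof (rule Vitali_finite_intervals[OF _ _ E \<epsilon>(1), of "\<lambda>u v. v - u < \<epsilon> \<and> \<bar>g v - g u\<bar> \<ge> (1 / \<epsilon>) * (v - u)"])
    show "\<exists>u v. u < v \<and> u \<le> x \<and> x \<le> v \<and> v - u < r \<and> v - u < \<epsilon> \<and> 1 / \<epsilon> * (v - u) \<le> \<bar>g v - g u\<bar>"
      if "x \<in> E" "r > 0" for x r
      using steep[OF that(1), of "min r \<epsilon>" "1 / \<epsilon>"] that(2) \<epsilon>(1) by auto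
  qed auto
  have small: "(\<Sum>K\<in>\<D>. Sup K - Inf K) < 2 * \<epsilon>"
  proof (rule ccontr)
    assume "\<not> ?thesis"
    then have "\<epsilon> \<le> (\<Sum>K\<in>\<D>. Sup K - Inf K)" using \<epsilon>(1) by linarith
    moreover have "Sup K - Inf K < \<epsilon>" if "K \<in> \<D>" for K using D(2)[OF that] by auto
    ultimately obtain \<D>' where D': "\<D>' \<subseteq> \<D>" "\<epsilon> \<le> (\<Sum>K\<in>\<D>'. Sup K - Inf K)" "(\<Sum>K\<in>\<D>'. Sup K - Inf K) < 2 * \<epsilon>"
      using subset_sum_between[OF D(1), of "\<lambda>K. Sup K - Inf K" \<epsilon>] \<epsilon>(1) by blast
    have "(\<Sum>K\<in>\<D>'. cmod (complex_of_real (g (Sup K)) - complex_of_real (g (Inf K)))) < 1"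
    proof (rule \<delta>)
      show "finite \<D>'" using D(1) D'(1) by (rule rev_finite_subset)
      show "\<exists>u v. K = {u..v} \<and> a \<le> u \<and> u \<le> v \<and> v \<le> b" if KD: "K \<in> \<D>'" for K
      proof -
        obtain u v where uv: "K = {u..v}" "u < v" "{u..v} \<subseteq> {a<..<b}" using D(2)[of K] D'(1) KD by auto
        then have "a < u" "v < b" by (auto simp: subset_iff)
        then show ?thesis using uv by (intro exI[of _ u] exI[of _ v]) auto
      qed
      show "pairwise (\<lambda>K L. interior K \<inter> interior L = {}) \<D>'"
      proof (rule pairwiseI)
        fix K L assume "K \<in> \<D>'" "L \<in> \<D>'" "K \<noteq> L"
        then have "K \<inter> L = {}" using D(3) D'(1) by (auto simp: pairwise_def disjnt_def)
        then show "interior K \<inter> interior L = {}" using interior_subset[of K] interior_subset[of L] by blast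
      qed
    qed (use D'(3) \<epsilon>(2) in linarith)
    then have "(\<Sum>K\<in>\<D>'. \<bar>g (Sup K) - g (Inf K)\<bar>) < 1" by (simp flip: of_real_diff)
    moreover have "(\<Sum>K\<in>\<D>'. \<bar>g (Sup K) - g (Inf K)\<bar>) \<ge> (1 / \<epsilon>) * (\<Sum>K\<in>\<D>'. Sup K - Inf K)"
      unfolding sum_distrib_left
    proof (rule sum_mono)
      fix K assume "K \<in> \<D>'"
      then have "K \<in> \<D>" using D'(1) by blast
      from D(2)[OF this] show "(1 / \<epsilon>) * (Sup K - Inf K) \<le> \<bar>g (Sup K) - g (Inf K)\<bar>" by auto
    qed
    moreover have "(1 / \<epsilon>) * (\<Sum>K\<in>\<D>'. Sup K - Inf K) \<ge> (1 / \<epsilon>) * \<epsilon>"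
      using D'(2) \<epsilon>(1) by (intro mult_left_mono) auto
    moreover have "(1 / \<epsilon>) * \<epsilon> = 1" using \<epsilon>(1) by simp
    ultimately show False by linarith
  qed
  have Dm: "K \<in> lmeasurable \<and> ?\<mu> K = Sup K - Inf K" if K: "K \<in> \<D>" for K
    using D(2)[OF K] by auto
  have m: "\<Union>\<D> \<in> lmeasurable" using D(1) Dm by blast
  have "?\<mu> (\<Union>\<D>) = (\<Sum>K\<in>\<D>. Sup K - Inf K)"
    using measure_Union'[of \<D> lebesgue] D(1,3) Dm by auto
  then have "?\<mu> (\<Union>\<D> \<union> H) < \<eta>"
    using measure_Un_le[of "\<Union>\<D>" lebesgue H] m D(4,5) small \<epsilon>(3) by (auto simp: fmeasurableD)
  then show "\<exists>T. E \<subseteq> T \<and> T \<in> lmeasurable \<and> ?\<mu> T < \<eta>"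
    using D(4,6) m by (intro exI[of _ "\<Union>\<D> \<union> H"]) auto
qed

section \<open>Closure properties of absolutely continuous functions\<close>

lemma AC_on_lipschitz_image:
  assumes "AC_on a b f" "\<And>x y. x \<in> {a..b} \<Longrightarrow> y \<in> {a..b} \<Longrightarrow> cmod (h x - h y) \<le> C * cmod (f x - f y)"
  shows "AC_on a b h"
  unfolding AC_on_def
proof (intro allI impI)
  fix \<epsilon> :: real assume "\<epsilon> > 0"
  \<comment> \<open>\<open>C\<close> may be zero or negative, so a positive majorant is
    used.\<close>
  define D where "D = \<bar>C\<bar> + 1"
  have D: "D > 0" "C \<le> D" by (auto simp: D_def)
  have e: "\<epsilon> / D > 0" using \<open>\<epsilon> > 0\<close> D by simp
  obtain \<delta> where "\<delta> > 0" and \<delta>: "\<And>n u v. \<lbrakk>\<And>i. i < n \<Longrightarrow> a \<le> u i \<and> u i \<le> v i \<and> v i \<le> b;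
      disjoint_family_on (\<lambda>i. {u i<..<v i}) {..<n}; (\<Sum>i<n. v i - u i) < \<delta>\<rbrakk>
      \<Longrightarrow> (\<Sum>i<(n::nat). cmod (f (v i) - f (u i))) < \<epsilon> / D"
    by (rule AC_onE[OF assms(1) e]) blast
  show "\<exists>\<delta>>0. \<forall>n u v. (\<forall>i<n. a \<le> u i \<and> u i \<le> v i \<and> v i \<le> b) \<and>
     disjoint_family_on (\<lambda>i. {u i<..<v i}) {..<n} \<and> (\<Sum>i<n. v i - u i) < \<delta> \<longrightarrow>
     (\<Sum>i<(n::nat). cmod (h (v i) - h (u i))) < \<epsilon>"
  proof (intro exI[of _ \<delta>] conjI allI impI \<open>\<delta> > 0\<close>)
    fix n :: nat and u v assume *: "(\<forall>i<n. a \<le> u i \<and> u i \<le> v i \<and> v i \<le> b) \<and>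
     disjoint_family_on (\<lambda>i. {u i<..<v i}) {..<n} \<and> (\<Sum>i<n. v i - u i) < \<delta>"
    have "(\<Sum>i<n. cmod (h (v i) - h (u i))) \<le> (\<Sum>i<n. D * cmod (f (v i) - f (u i)))"
    proof (rule sum_mono)
      fix i assume "i \<in> {..<n}"
      then have "a \<le> u i" "u i \<le> v i" "v i \<le> b" using * by auto
      then have "cmod (h (v i) - h (u i)) \<le> C * cmod (f (v i) - f (u i))" by (intro assms(2)) auto
      also have "\<dots> \<le> D * cmod (f (v i) - f (u i))" using D by (intro mult_right_mono) auto
      finally show "cmod (h (v i) - h (u i)) \<le> D * cmod (f (v i) - f (u i))" .
    qed
    also have "\<dots> = D * (\<Sum>i<n. cmod (f (v i) - f (u i)))" by (simp add: sum_distrib_left)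
    also have "\<dots> < D * (\<epsilon> / D)" using \<delta> * D by (intro mult_strict_left_mono) auto
    finally show "(\<Sum>i<n. cmod (h (v i) - h (u i))) < \<epsilon>" using D by simp
  qed
qed

text \<open>Sums and products are both instances: the increment of a product is dominated in this
  way once both factors are bounded on the compact interval.\<close>

lemma AC_on_dominated_sum:
  assumes f: "AC_on a b f" and g: "AC_on a b g"
    and h: "\<And>x y. x \<in> {a..b} \<Longrightarrow> y \<in> {a..b} \<Longrightarrow> cmod (h x - h y) \<le> C * (cmod (f x - f y) + cmod (g x - g y))"
  shows "AC_on a b h"
  unfolding AC_on_def
proof (intro allI impI)
  fix \<epsilon> :: real assume "\<epsilon> > 0"
  define D where "D = \<bar>C\<bar> + 1"
  have D: "D > 0" "C \<le> D" by (auto simp: D_def)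
  have e: "\<epsilon> / (2 * D) > 0" using \<open>\<epsilon> > 0\<close> D by simp
  obtain \<delta>1 where "\<delta>1 > 0" and \<delta>1: "\<And>n u v. \<lbrakk>\<And>i. i < n \<Longrightarrow> a \<le> u i \<and> u i \<le> v i \<and> v i \<le> b;
      disjoint_family_on (\<lambda>i. {u i<..<v i}) {..<n}; (\<Sum>i<n. v i - u i) < \<delta>1\<rbrakk>
      \<Longrightarrow> (\<Sum>i<(n::nat). cmod (f (v i) - f (u i))) < \<epsilon> / (2 * D)"
    by (rule AC_onE[OF f e]) blast
  obtain \<delta>2 where "\<delta>2 > 0" and \<delta>2: "\<And>n u v. \<lbrakk>\<And>i. i < n \<Longrightarrow> a \<le> u i \<and> u i \<le> v i \<and> v i \<le> b;
      disjoint_family_on (\<lambda>i. {u i<..<v i}) {..<n}; (\<Sum>i<n. v i - u i) < \<delta>2\<rbrakk>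
      \<Longrightarrow> (\<Sum>i<(n::nat). cmod (g (v i) - g (u i))) < \<epsilon> / (2 * D)"
    by (rule AC_onE[OF g e]) blast
  show "\<exists>\<delta>>0. \<forall>n u v. (\<forall>i<n. a \<le> u i \<and> u i \<le> v i \<and> v i \<le> b) \<and>
     disjoint_family_on (\<lambda>i. {u i<..<v i}) {..<n} \<and> (\<Sum>i<n. v i - u i) < \<delta> \<longrightarrow>
     (\<Sum>i<(n::nat). cmod (h (v i) - h (u i))) < \<epsilon>"
  proof (intro exI[of _ "min \<delta>1 \<delta>2"] conjI allI impI)
    fix n :: nat and u v assume *: "(\<forall>i<n. a \<le> u i \<and> u i \<le> v i \<and> v i \<le> b) \<and>
     disjoint_family_on (\<lambda>i. {u i<..<v i}) {..<n} \<and> (\<Sum>i<n. v i - u i) < min \<delta>1 \<delta>2"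
    have "(\<Sum>i<n. cmod (h (v i) - h (u i))) \<le> (\<Sum>i<n. D * (cmod (f (v i) - f (u i)) + cmod (g (v i) - g (u i))))"
    proof (rule sum_mono)
      fix i assume "i \<in> {..<n}"
      then have "a \<le> u i" "u i \<le> v i" "v i \<le> b" using * by auto
      then have "cmod (h (v i) - h (u i)) \<le> C * (cmod (f (v i) - f (u i)) + cmod (g (v i) - g (u i)))" by (intro h) auto
      also have "\<dots> \<le> D * (cmod (f (v i) - f (u i)) + cmod (g (v i) - g (u i)))" using D by (intro mult_right_mono) auto
      finally show "cmod (h (v i) - h (u i)) \<le> D * (cmod (f (v i) - f (u i)) + cmod (g (v i) - g (u i)))" .
    qed
    also have "\<dots> = D * ((\<Sum>i<n. cmod (f (v i) - f (u i))) + (\<Sum>i<n. cmod (g (v i) - g (u i))))"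
      by (simp only: sum_distrib_left sum.distrib distrib_left)
    also have "\<dots> < D * (\<epsilon> / (2 * D) + \<epsilon> / (2 * D))"
      using \<delta>1[of n u v] \<delta>2[of n u v] * D by (intro mult_strict_left_mono add_strict_mono) auto
    finally show "(\<Sum>i<n. cmod (h (v i) - h (u i))) < \<epsilon>" using D by (simp add: field_simps)
  qed (use \<open>\<delta>1 > 0\<close> \<open>\<delta>2 > 0\<close> in auto)
qed

lemma AC_on_const: "AC_on a b (\<lambda>x. k)"
  unfolding AC_on_def by (auto intro: exI[of _ 1])

lemma AC_on_of_real: "AC_on a b complex_of_real"
  unfolding AC_on_def
proof (intro allI impI)
  fix \<epsilon> :: real assume "\<epsilon> > 0"
  show "\<exists>\<delta>>0. \<forall>n u v. (\<forall>i<n. a \<le> u i \<and> u i \<le> v i \<and> v i \<le> b) \<and>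
     disjoint_family_on (\<lambda>i. {u i<..<v i}) {..<n} \<and> (\<Sum>i<n. v i - u i) < \<delta> \<longrightarrow>
     (\<Sum>i<(n::nat). cmod (complex_of_real (v i) - complex_of_real (u i))) < \<epsilon>"
  proof (intro exI[of _ \<epsilon>] conjI allI impI \<open>\<epsilon> > 0\<close>)
    fix n :: nat and u v assume *: "(\<forall>i<n. a \<le> u i \<and> u i \<le> v i \<and> v i \<le> b) \<and>
     disjoint_family_on (\<lambda>i. {u i<..<v i}) {..<n} \<and> (\<Sum>i<n. v i - u i) < \<epsilon>"
    then have "(\<Sum>i<n. cmod (complex_of_real (v i) - complex_of_real (u i))) = (\<Sum>i<n. v i - u i)"
      by (intro sum.cong) (auto simp flip: of_real_diff)
    with * show "(\<Sum>i<n. cmod (complex_of_real (v i) - complex_of_real (u i))) < \<epsilon>" by simp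
  qed
qed

lemma AC_on_add: "AC_on a b f \<Longrightarrow> AC_on a b g \<Longrightarrow> AC_on a b (\<lambda>x. f x + g x)"
  by (erule (1) AC_on_dominated_sum[where C = 1]) (simp add: add_diff_add norm_triangle_ineq)

lemma AC_on_imp_continuous_on:
  assumes "AC_on a b f"
  shows "continuous_on {a..b} f"
  unfolding continuous_on_iff
proof (intro ballI allI impI)
  fix x \<epsilon> :: real assume x: "x \<in> {a..b}" and "\<epsilon> > 0"
  obtain \<delta> where "\<delta> > 0" and \<delta>: "\<And>n u v. \<lbrakk>\<And>i. i < n \<Longrightarrow> a \<le> u i \<and> u i \<le> v i \<and> v i \<le> b;
      disjoint_family_on (\<lambda>i. {u i<..<v i}) {..<n}; (\<Sum>i<n. v i - u i) < \<delta>\<rbrakk>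
      \<Longrightarrow> (\<Sum>i<(n::nat). cmod (f (v i) - f (u i))) < \<epsilon>"
    by (rule AC_onE[OF assms \<open>\<epsilon> > 0\<close>]) blast
  have *: "cmod (f v - f u) < \<epsilon>" if "a \<le> u" "u \<le> v" "v \<le> b" "v - u < \<delta>" for u v
    using \<delta>[of 1 "\<lambda>_. u" "\<lambda>_. v"] that by (auto simp: disjoint_family_on_def)
  show "\<exists>d>0. \<forall>x'\<in>{a..b}. dist x' x < d \<longrightarrow> dist (f x') (f x) < \<epsilon>"
  proof (intro exI[of _ \<delta>] conjI ballI impI \<open>\<delta> > 0\<close>)
    fix y assume "y \<in> {a..b}" "dist y x < \<delta>"
    then show "dist (f y) (f x) < \<epsilon>"
      using *[of x y] *[of y x] x by (cases "x \<le> y") (auto simp: dist_norm norm_minus_commute)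
  qed
qed

lemma AC_on_mult:
  assumes f: "AC_on a b f" and g: "AC_on a b g"
  shows "AC_on a b (\<lambda>x. f x * g x)"
proof -
  have "bounded (f ` {a..b})" "bounded (g ` {a..b})"
    using AC_on_imp_continuous_on[OF f] AC_on_imp_continuous_on[OF g]
    by (auto intro!: compact_imp_bounded compact_continuous_image)
  then obtain B C where B: "\<And>x. x \<in> {a..b} \<Longrightarrow> cmod (f x) \<le> B" and C: "\<And>x. x \<in> {a..b} \<Longrightarrow> cmod (g x) \<le> C"
    unfolding bounded_iff by blast
  show ?thesis
  proof (rule AC_on_dominated_sum[OF f g, where C = "\<bar>B\<bar> + \<bar>C\<bar>"])
    fix x y assume xy: "x \<in> {a..b}" "y \<in> {a..b}"
    have "f x * g x - f y * g y = f x * (g x - g y) + (f x - f y) * g y" by (simp add: algebra_simps)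
    then have "cmod (f x * g x - f y * g y) \<le> cmod (f x) * cmod (g x - g y) + cmod (f x - f y) * cmod (g y)"
      by (metis norm_triangle_ineq norm_mult)
    also have "\<dots> \<le> (\<bar>B\<bar> + \<bar>C\<bar>) * cmod (g x - g y) + cmod (f x - f y) * (\<bar>B\<bar> + \<bar>C\<bar>)"
      using B[OF xy(1)] C[OF xy(2)] by (intro add_mono mult_mono) auto
    finally show "cmod (f x * g x - f y * g y) \<le> (\<bar>B\<bar> + \<bar>C\<bar>) * (cmod (f x - f y) + cmod (g x - g y))"
      by (simp add: algebra_simps)
  qed
qed

section \<open>Differentiation and integration of absolutely continuous functions\<close>

text \<open>The bilateral difference quotient has equal lower and upper limits outside countably many
  sets on which, after subtracting a linear function, slopes of both signs occur at all scales.\<close>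

lemma AC_on_differentiable_ae_real:
  fixes g :: "real \<Rightarrow> real"
  assumes AC: "AC_on a b (\<lambda>x. complex_of_real (g x))"
  shows "negligible {x \<in> {a<..<b}. \<not> g differentiable (at x)}"
proof -
  define \<phi> where "\<phi> x h = (g (x + h) - g x) / h" for x h :: real
  define E where "E p p' = {x \<in> {a<..<b}. (\<exists>\<^sub>F h in at 0. \<phi> x h \<le> p) \<and> (\<exists>\<^sub>F h in at 0. \<phi> x h \<ge> p')}" for p p'
  define F where "F = {x \<in> {a<..<b}. \<forall>k. \<exists>\<^sub>F h in at 0. \<bar>\<phi> x h\<bar> \<ge> k}"
  \<comment> \<open>Frequently in \<open>at 0\<close> means at arbitrarily small scales on either
    side; a negative increment gives an interval with \<open>x\<close> as its right end point and
    the same slope.\<close>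
  have interval: "\<exists>u v. u < v \<and> u \<le> x \<and> x \<le> v \<and> v - u < \<delta> \<and> P ((g v - g u) / (v - u))"
    if fr: "\<exists>\<^sub>F h in at 0. P (\<phi> x h)" and "\<delta> > 0" for x \<delta> P
  proof -
    have "\<forall>\<^sub>F h in at 0. h \<noteq> 0 \<and> \<bar>h\<bar> < (\<delta>::real)"
      unfolding eventually_at using \<open>\<delta> > 0\<close> by (auto simp: dist_real_def)
    with fr have "\<exists>\<^sub>F h in at 0. P (\<phi> x h) \<and> h \<noteq> 0 \<and> \<bar>h\<bar> < \<delta>"
      by (rule frequently_eventually_frequently)
    then obtain h where h: "P (\<phi> x h)" "h \<noteq> 0" "\<bar>h\<bar> < \<delta>" by (auto dest: frequently_ex)
    show ?thesis
    proof (cases "h > 0")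
      case True
      then show ?thesis using h by (intro exI[of _ x] exI[of _ "x + h"]) (auto simp: \<phi>_def)
    next
      case False
      moreover have "(g x - g (x + h)) / (x - (x + h)) = \<phi> x h"
        using h(2) by (simp add: \<phi>_def field_simps)
      ultimately show ?thesis using h by (intro exI[of _ "x + h"] exI[of _ x]) auto
    qed
  qed
  have E: "negligible (E p p')" if "p < p'" for p p'
  proof -
    \<comment> \<open>Subtracting the line whose slope \<open>m\<close> is the midpoint of
      \<open>p\<close> and \<open>p'\<close> turns the slopes \<open>p\<close>, \<open>p'\<close>
      into \<open>- d\<close>, \<open>d\<close>.\<close>
    define d m where "d = (p' - p) / 2" and "m = (p + p') / 2"
    have "d > 0" using that by (simp add: d_def)
    have sl: "(g v - m * v) - (g u - m * u) = ((g v - g u) / (v - u) - m) * (v - u)" if "u < v" for u v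
      using that by (simp add: field_simps)
    show ?thesis
    proof (rule negligible_opposite_slopes[of a b "\<lambda>x. g x - m * x" _ d])
      have "AC_on a b (\<lambda>x. complex_of_real (g x) + complex_of_real (- m) * complex_of_real x)"
        by (intro AC_on_add AC AC_on_mult AC_on_const AC_on_of_real)
      then show "AC_on a b (\<lambda>x. complex_of_real (g x - m * x))" by simp
      fix x \<delta> :: real assume x: "x \<in> E p p'" "\<delta> > 0"
      obtain u v where uv: "u < v" "u \<le> x" "x \<le> v" "v - u < \<delta>" "(g v - g u) / (v - u) \<le> p"
        using interval[of "\<lambda>y. y \<le> p" x \<delta>] x by (auto simp: E_def)
      have "(g v - m * v) - (g u - m * u) \<le> (p - m) * (v - u)"
        unfolding sl[OF uv(1)] using uv by (intro mult_right_mono) auto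
      then show "\<exists>u v. u < v \<and> u \<le> x \<and> x \<le> v \<and> v - u < \<delta> \<and> g v - m * v - (g u - m * u) \<le> - d * (v - u)"
        using uv by (intro exI[of _ u] exI[of _ v]) (auto simp: d_def m_def field_simps)
      obtain u v where uv: "u < v" "u \<le> x" "x \<le> v" "v - u < \<delta>" "(g v - g u) / (v - u) \<ge> p'"
        using interval[of "\<lambda>y. y \<ge> p'" x \<delta>] x by (auto simp: E_def)
      have "(g v - m * v) - (g u - m * u) \<ge> (p' - m) * (v - u)"
        unfolding sl[OF uv(1)] using uv by (intro mult_right_mono) auto
      then show "\<exists>u v. u < v \<and> u \<le> x \<and> x \<le> v \<and> v - u < \<delta> \<and> d * (v - u) \<le> g v - m * v - (g u - m * u)"
        using uv by (intro exI[of _ u] exI[of _ v]) (auto simp: d_def m_def field_simps)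
    qed (use \<open>d > 0\<close> in \<open>auto simp: E_def\<close>)
  qed
  have F: "negligible F"
  proof (rule negligible_infinite_slopes[OF AC])
    fix x \<delta> k :: real assume x: "x \<in> F" "\<delta> > 0"
    obtain u v where uv: "u < v" "u \<le> x" "x \<le> v" "v - u < \<delta>" "\<bar>(g v - g u) / (v - u)\<bar> \<ge> k"
      using interval[of "\<lambda>y. \<bar>y\<bar> \<ge> k" x \<delta>] x by (auto simp: F_def)
    then show "\<exists>u v. u < v \<and> u \<le> x \<and> x \<le> v \<and> v - u < \<delta> \<and> k * (v - u) \<le> \<bar>g v - g u\<bar>"
      by (intro exI[of _ u] exI[of _ v]) (auto simp: field_simps)
  qed (auto simp: F_def)
  have "negligible (\<Union>(p, p') \<in> {(p, p'). p \<in> \<rat> \<and> p' \<in> \<rat> \<and> p < p'}. E p p')"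
  proof (rule negligible_countable_Union)
    have "countable ((\<rat>::real set) \<times> (\<rat>::real set))" by (simp add: countable_rat)
    then show "countable ((\<lambda>(p, p'). E p p') ` {(p, p'). p \<in> \<rat> \<and> p' \<in> \<rat> \<and> p < p'})"
      by (intro countable_image) (rule countable_subset, auto)
  qed (use E in auto)
  then have N: "negligible (F \<union> (\<Union>(p, p') \<in> {(p, p'). p \<in> \<rat> \<and> p' \<in> \<rat> \<and> p < p'}. E p p'))"
    using F by simp
  show ?thesis
  proof (rule negligible_subset[OF N], rule subsetI, rule ccontr)
    fix x assume x: "x \<in> {x \<in> {a<..<b}. \<not> g differentiable at x}"
      and n: "x \<notin> F \<union> (\<Union>(p, p') \<in> {(p, p'). p \<in> \<rat> \<and> p' \<in> \<rat> \<and> p < p'}. E p p')"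
    \<comment> \<open>Both limits are taken in the extended reals, where they always exist; that
      \<open>x\<close> is outside \<open>F\<close> makes the common value finite.\<close>
    let ?l = "Liminf (at 0) (\<lambda>h. ereal (\<phi> x h))" and ?L = "Limsup (at 0) (\<lambda>h. ereal (\<phi> x h))"
    have le: "?l \<le> ?L" by (rule Liminf_le_Limsup) simp
    have "\<not> ?l < ?L"
    proof
      assume "?l < ?L"
      then obtain y where y: "?l < ereal y" "ereal y < ?L" using ereal_dense2 by blast
      then obtain y' where y': "ereal y < ereal y'" "ereal y' < ?L" using ereal_dense2 by blast
      \<comment> \<open>Rational thresholds keep the exceptional union countable.\<close>
      obtain p where p: "p \<in> \<rat>" "y < p" "p < y'" using Rats_dense_in_real y'(1) by auto
      obtain p' where p': "p' \<in> \<rat>" "p < p'" "p' < y'" using Rats_dense_in_real p(3) by auto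
      have "\<exists>\<^sub>F h in at 0. \<phi> x h \<le> p"
      proof (rule ccontr)
        assume "\<not> ?thesis"
        then have "\<forall>\<^sub>F h in at 0. ereal p \<le> ereal (\<phi> x h)"
          by (auto simp: frequently_def elim: eventually_mono)
        then have "ereal p \<le> ?l" by (rule Liminf_bounded)
        then show False using y(1) p(2) by (meson ereal_less_eq(3) leD le_less_trans less_ereal.simps(1) order_less_imp_le order.strict_trans)
      qed
      moreover have "\<exists>\<^sub>F h in at 0. \<phi> x h \<ge> p'"
      proof (rule ccontr)
        assume "\<not> ?thesis"
        then have "\<forall>\<^sub>F h in at 0. ereal (\<phi> x h) \<le> ereal p'"
          by (auto simp: frequently_def elim: eventually_mono)
        then have "?L \<le> ereal p'" by (rule Limsup_bounded)
        then show False using y'(2) p'(3) by (meson leD le_less_trans less_ereal.simps(1) order.strict_trans)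
      qed
      ultimately have "x \<in> E p p'" using x by (auto simp: E_def)
      then show False using n p p' by blast
    qed
    then have eq: "?l = ?L" using le by simp
    have lim: "((\<lambda>h. ereal (\<phi> x h)) \<longlongrightarrow> ?L) (at 0)"
      using eq by (subst tendsto_iff_Liminf_eq_Limsup) auto
    obtain k where k: "\<forall>\<^sub>F h in at 0. \<bar>\<phi> x h\<bar> < k"
      using n x by (auto simp: F_def frequently_def not_le)
    have "?L \<le> ereal k" by (rule Limsup_bounded) (use k in \<open>auto elim: eventually_mono\<close>)
    moreover have "ereal (-k) \<le> ?l" by (rule Liminf_bounded) (use k in \<open>auto elim: eventually_mono\<close>)
    ultimately obtain D where D: "?L = ereal D" using eq by (cases ?L) auto
    have "((\<lambda>h. \<phi> x h) \<longlongrightarrow> D) (at 0)" using lim unfolding D by simp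
    then have "(g has_field_derivative D) (at x)" by (simp add: DERIV_def \<phi>_def)
    then have "g differentiable (at x)" unfolding differentiable_def has_field_derivative_def by blast
    then show False using x by simp
  qed
qed

lemma AC_loc_differentiable_ae:
  assumes "AC_loc f"
  shows "negligible {x. \<not> f differentiable (at x)}"
proof -
  have AC: "AC_on a b f" for a b using assms by (simp add: AC_loc_def)
  have re: "AC_on a b (\<lambda>x. complex_of_real (Re (f x)))" and im: "AC_on a b (\<lambda>x. complex_of_real (Im (f x)))" for a b
    by (rule AC_on_lipschitz_image[OF AC, where C = 1]; simp flip: of_real_diff minus_complex.sel add: abs_Re_le_cmod abs_Im_le_cmod)+
  have "negligible (\<Union>n::nat. {x \<in> {- real n<..<real n}. \<not> (\<lambda>x. Re (f x)) differentiable (at x)} \<union>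
       {x \<in> {- real n<..<real n}. \<not> (\<lambda>x. Im (f x)) differentiable (at x)})"
    using AC_on_differentiable_ae_real[OF re] AC_on_differentiable_ae_real[OF im]
    by (intro negligible_countable_Union) auto
  then show ?thesis
  proof (rule negligible_subset, intro subsetI)
    fix x assume x: "x \<in> {x. \<not> f differentiable (at x)}"
    obtain n :: nat where n: "\<bar>x\<bar> < real n" using reals_Archimedean2 by blast
    have "f differentiable (at x)" if reim: "(\<lambda>x. Re (f x)) differentiable (at x)" "(\<lambda>x. Im (f x)) differentiable (at x)"
    proof -
      obtain c d where "((\<lambda>x. Re (f x)) has_field_derivative c) (at x)" "((\<lambda>x. Im (f x)) has_field_derivative d) (at x)"
        using reim by (auto simp: real_differentiable_def)
      then have "(f has_vector_derivative Complex c d) (at x)"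
        by (simp add: has_vector_derivative_complex_iff)
      then show ?thesis by (rule differentiableI_vector)
    qed
    then show "x \<in> (\<Union>n::nat. {x \<in> {- real n<..<real n}. \<not> (\<lambda>x. Re (f x)) differentiable (at x)} \<union>
       {x \<in> {- real n<..<real n}. \<not> (\<lambda>x. Im (f x)) differentiable (at x)})"
      using x n by (auto intro!: exI[of _ n])
  qed
qed

text \<open>Fundamental theorem of calculus for the gauge integral. Tags in \<open>N\<close> get an
  open neighbourhood of \<open>N\<close> of measure below \<delta>, so that absolute continuity
  bounds the increments there; at other tags differentiability bounds the error by \<open>e'\<close>
  times the length of the interval.\<close>

lemma AC_on_has_integral:
  assumes AC: "AC_on a b f" and "a \<le> b" and N: "negligible N"
    and der: "\<And>x. x \<in> {a..b} \<Longrightarrow> x \<notin> N \<Longrightarrow> (f has_vector_derivative g x) (at x)"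
  shows "(g has_integral f b - f a) {a..b}"
proof -
  \<comment> \<open>The value zero on \<open>N\<close> removes the Riemann terms with tags in
    \<open>N\<close>; the values of \<open>g\<close> there are restored at the end by changing
    \<open>h\<close> on a null set.\<close>
  define h where "h x = (if x \<in> N then 0 else g x)" for x
  have "(h has_integral f b - f a) {a..b}"
    unfolding has_integral_real
  proof (intro allI impI)
    fix e :: real assume "e > 0"
    obtain \<delta> where "\<delta> > 0" and \<delta>: "\<And>(I::(real \<times> real set) set) u v. \<lbrakk>finite I; \<And>i. i \<in> I \<Longrightarrow> a \<le> u i \<and> u i \<le> v i \<and> v i \<le> b;
       disjoint_family_on (\<lambda>i. {u i<..<v i}) I; (\<Sum>i\<in>I. v i - u i) < \<delta>\<rbrakk>
       \<Longrightarrow> (\<Sum>i\<in>I. cmod (f (v i) - f (u i))) < e / 2"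
      by (rule AC_on_finite_family[OF AC half_gt_zero[OF \<open>e > 0\<close>]]) blast
    obtain S where S: "N \<subseteq> S" "S \<in> lmeasurable" "measure lebesgue S < \<delta> / 2"
      using N \<open>\<delta> > 0\<close> unfolding negligible_outer by (meson half_gt_zero)
    obtain T where T: "open T" "S \<subseteq> T" "T - S \<in> lmeasurable" "emeasure lebesgue (T - S) < ennreal (\<delta> / 2)"
      using sets_lebesgue_outer_open[OF fmeasurableD[OF S(2)], of "\<delta> / 2"] \<open>\<delta> > 0\<close> by auto
    have TS: "T = S \<union> (T - S)" using T(2) by blast
    have Tm: "T \<in> lmeasurable" by (subst TS) (intro fmeasurable.Un S(2) T(3))
    have "measure lebesgue T \<le> measure lebesgue S + measure lebesgue (T - S)"
      by (subst TS) (intro measure_Un_le fmeasurableD S(2) T(3))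
    moreover have "measure lebesgue (T - S) < \<delta> / 2"
      using T(3,4) \<open>\<delta> > 0\<close> by (simp add: emeasure_eq_measure2 ennreal_less_iff)
    ultimately have T\<delta>: "measure lebesgue T < \<delta>" using S(3) by linarith
    \<comment> \<open>The \<open>+ 1\<close> admits \<open>a = b\<close> and makes the total error
      \<open>e' * (b - a)\<close> strictly smaller than \<open>e / 2\<close>.\<close>
    define e' where "e' = e / (2 * (b - a + 1))"
    have e': "e' > 0" "e' * (b - a) < e / 2"
      using \<open>e > 0\<close> \<open>a \<le> b\<close> by (auto simp: e'_def field_simps)
    have "\<exists>d>0. \<forall>y. \<bar>y - x\<bar> < d \<longrightarrow> cmod (f y - f x - (y - x) *\<^sub>R g x) \<le> e' * \<bar>y - x\<bar>"
      if "x \<in> {a..b}" "x \<notin> N" for x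
      using der[OF that] e'(1) unfolding has_vector_derivative_def has_derivative_at_alt by auto
    then obtain d where d: "\<And>x. x \<in> {a..b} \<Longrightarrow> x \<notin> N \<Longrightarrow> d x > 0"
      "\<And>x y. x \<in> {a..b} \<Longrightarrow> x \<notin> N \<Longrightarrow> \<bar>y - x\<bar> < d x \<Longrightarrow> cmod (f y - f x - (y - x) *\<^sub>R g x) \<le> e' * \<bar>y - x\<bar>"
      by metis
    define \<gamma> where "\<gamma> x = (if x \<in> N then T else if x \<in> {a..b} then ball x (d x) else UNIV)" for x
    show "\<exists>\<gamma>. gauge \<gamma> \<and> (\<forall>\<D>. \<D> tagged_division_of {a..b} \<and> \<gamma> fine \<D> \<longrightarrow>
        norm ((\<Sum>(x, K)\<in>\<D>. measure lborel K *\<^sub>R h x) - (f b - f a)) < e)"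
    proof (intro exI[of _ \<gamma>] conjI allI impI)
      show "gauge \<gamma>" unfolding gauge_def \<gamma>_def using S(1) T(1,2) d(1) by auto
      fix \<D> assume "\<D> tagged_division_of {a..b} \<and> \<gamma> fine \<D>"
      then have D: "\<D> tagged_division_of {a..b}" and fine: "\<gamma> fine \<D>" by auto
      have fin: "finite \<D>" using D by blast
      have K: "x \<in> K \<and> K = {Inf K..Sup K} \<and> Inf K \<le> Sup K \<and> a \<le> Inf K \<and> Sup K \<le> b \<and> K \<subseteq> \<gamma> x" if xK: "(x, K) \<in> \<D>" for x K
      proof -
        obtain u v where uv: "K = {u..v}" using tagged_division_ofD(4)[OF D xK] by auto
        moreover have "x \<in> K" "K \<subseteq> {a..b}" using tagged_division_ofD(2,3)[OF D xK] by auto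
        moreover have "K \<subseteq> \<gamma> x" using fine xK by (auto simp: fine_def)
        ultimately show ?thesis by auto
      qed
      define D1 where "D1 = {p \<in> \<D>. fst p \<in> N}"
      let ?F = "\<lambda>p. measure lborel (snd p) *\<^sub>R h (fst p) - (f (Sup (snd p)) - f (Inf (snd p)))"
      have "(\<Sum>(x, K)\<in>\<D>. measure lborel K *\<^sub>R h x) - (f b - f a) = (\<Sum>p\<in>\<D>. ?F p)"
        using additive_tagged_division_1[OF \<open>a \<le> b\<close> D, of f] by (simp add: sum_subtractf case_prod_beta)
      also have "\<dots> = (\<Sum>p\<in>D1. ?F p) + (\<Sum>p\<in>\<D> - D1. ?F p)"
        using sum.subset_diff[of D1 \<D> ?F] fin by (simp add: D1_def add.commute)
      finally have eq: "(\<Sum>(x, K)\<in>\<D>. measure lborel K *\<^sub>R h x) - (f b - f a) = (\<Sum>p\<in>D1. ?F p) + (\<Sum>p\<in>\<D> - D1. ?F p)" .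
      have "(\<Sum>p\<in>D1. cmod (f (Sup (snd p)) - f (Inf (snd p)))) < e / 2"
      proof (rule \<delta>)
        show "finite D1" using fin by (simp add: D1_def)
        show "a \<le> Inf (snd i) \<and> Inf (snd i) \<le> Sup (snd i) \<and> Sup (snd i) \<le> b" if "i \<in> D1" for i
          using K[of "fst i" "snd i"] that by (simp add: D1_def)
        show dj: "disjoint_family_on (\<lambda>i. {Inf (snd i)<..<Sup (snd i)}) D1"
          unfolding disjoint_family_on_def
        proof (intro ballI impI)
          fix p p' assume p: "p \<in> D1" "p' \<in> D1" "p \<noteq> p'"
          obtain x K x' K' where pp: "p = (x, K)" "p' = (x', K')" by (cases p, cases p')
          then have "interior K \<inter> interior K' = {}"
            using p tagged_division_ofD(5)[OF D, of x K x' K'] by (auto simp: D1_def)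
          moreover have "interior L = {Inf L<..<Sup L}" if "(y, L) \<in> \<D>" for y L
            using K[OF that] by (metis interior_atLeastAtMost_real)
          with p pp have "interior K = {Inf K<..<Sup K}" "interior K' = {Inf K'<..<Sup K'}"
            by (auto simp: D1_def)
          ultimately show "{Inf (snd p)<..<Sup (snd p)} \<inter> {Inf (snd p')<..<Sup (snd p')} = {}" using pp by simp
        qed
        have "(\<Sum>i\<in>D1. Sup (snd i) - Inf (snd i)) = (\<Sum>i\<in>D1. measure lebesgue {Inf (snd i)<..<Sup (snd i)})"
          using K by (intro sum.cong) (auto simp: D1_def)
        also have "\<dots> = measure lebesgue (\<Union>i\<in>D1. {Inf (snd i)<..<Sup (snd i)})"
          using fin dj K by (intro measure_finite_Union[symmetric]) (auto simp: D1_def emeasure_lborel_Ioo)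
        also have "\<dots> \<le> measure lebesgue T"
        proof (rule measure_mono_fmeasurable[OF _ _ Tm])
          show "(\<Union>i\<in>D1. {Inf (snd i)<..<Sup (snd i)}) \<subseteq> T"
          proof
            fix y assume "y \<in> (\<Union>i\<in>D1. {Inf (snd i)<..<Sup (snd i)})"
            then obtain x L where L: "(x, L) \<in> \<D>" "x \<in> N" "Inf L < y" "y < Sup L" by (auto simp: D1_def)
            then have "y \<in> {Inf L..Sup L}" by simp
            then have "y \<in> L" using K[OF L(1)] by simp
            then show "y \<in> T" using K[OF L(1)] L(2) by (auto simp: \<gamma>_def)
          qed
        qed (use fin in \<open>auto simp: D1_def\<close>)
        finally show "(\<Sum>i\<in>D1. Sup (snd i) - Inf (snd i)) < \<delta>" using T\<delta> by linarith
      qed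
      moreover have "cmod (\<Sum>p\<in>D1. ?F p) \<le> (\<Sum>p\<in>D1. cmod (f (Sup (snd p)) - f (Inf (snd p))))"
        by (rule sum_norm_le) (simp add: D1_def h_def norm_minus_commute)
      ultimately have 1: "cmod (\<Sum>p\<in>D1. ?F p) < e / 2" by linarith
      have "cmod (\<Sum>p\<in>\<D> - D1. ?F p) \<le> (\<Sum>p\<in>\<D> - D1. e' * (Sup (snd p) - Inf (snd p)))"
      proof (rule sum_norm_le)
        fix p assume p: "p \<in> \<D> - D1"
        obtain x L where pL: "p = (x, L)" by (cases p)
        then have xL: "(x, L) \<in> \<D>" "x \<notin> N" using p by (auto simp: D1_def)
        define u v where "u = Inf L" and "v = Sup L"
        have L: "L = {u..v}" "u \<le> x" "x \<le> v" "a \<le> u" "v \<le> b" "L \<subseteq> \<gamma> x"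
          using K[OF xL(1)] unfolding u_def v_def by (auto dest: arg_cong[where f = "\<lambda>S. x \<in> S"])
        then have "L \<subseteq> ball x (d x)" using xL(2) by (auto simp: \<gamma>_def)
        moreover have "u \<in> L" "v \<in> L" using L(1-3) by auto
        ultimately have "u \<in> ball x (d x)" "v \<in> ball x (d x)" by blast+
        then have uv: "\<bar>u - x\<bar> < d x" "\<bar>v - x\<bar> < d x" by (auto simp: dist_real_def)
        \<comment> \<open>The tag \<open>x\<close> lies between \<open>u\<close> and
          \<open>v\<close>, so the two one-sided linear errors add up to at most
          \<open>e' * (v - u)\<close>.\<close>
        have "?F p = (f u - f x - (u - x) *\<^sub>R g x) - (f v - f x - (v - x) *\<^sub>R g x)"
          using L xL(2) unfolding pL by (simp add: h_def u_def[symmetric] v_def[symmetric] scaleR_diff_left)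
        also have "cmod \<dots> \<le> cmod (f u - f x - (u - x) *\<^sub>R g x) + cmod (f v - f x - (v - x) *\<^sub>R g x)"
          by (rule norm_triangle_ineq4)
        also have "\<dots> \<le> e' * \<bar>u - x\<bar> + e' * \<bar>v - x\<bar>"
          using L by (intro add_mono d(2) uv xL(2)) auto
        also have "\<dots> = e' * (v - u)" using L by (simp add: algebra_simps)
        finally show "cmod (?F p) \<le> e' * (Sup (snd p) - Inf (snd p))" by (simp add: pL u_def v_def)
      qed
      also have "\<dots> \<le> (\<Sum>p\<in>\<D>. e' * (Sup (snd p) - Inf (snd p)))"
        using fin e'(1) K by (intro sum_mono2) (auto simp: zero_le_mult_iff)
      also have "\<dots> = e' * (b - a)"
        using additive_tagged_division_1[OF \<open>a \<le> b\<close> D, of "\<lambda>x. x"]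
        by (simp add: sum_distrib_left[symmetric] case_prod_beta)
      finally have 2: "cmod (\<Sum>p\<in>\<D> - D1. ?F p) < e / 2" using e'(2) by linarith
      show "norm ((\<Sum>(x, K)\<in>\<D>. measure lborel K *\<^sub>R h x) - (f b - f a)) < e"
        unfolding eq by (rule le_less_trans[OF norm_triangle_ineq]) (use 1 2 in linarith)
    qed
  qed
  then show ?thesis by (rule has_integral_spike[OF N, rotated]) (auto simp: h_def)
qed

section \<open>Gluing and differentiating locally absolutely continuous functions\<close>

text \<open>A monotone contraction maps disjoint intervals to disjoint intervals that are no longer.
  It is applied to \<open>max x 0\<close> and \<open>min x 0\<close>, which freeze a function on a
  half-line.\<close>

lemma AC_on_compose_contraction:
  assumes AC: "AC_on (h a) (h b) f" and h: "\<And>x y. a \<le> x \<Longrightarrow> x \<le> y \<Longrightarrow> y \<le> b \<Longrightarrow> h x \<le> h y \<and> h y - h x \<le> y - x"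
  shows "AC_on a b (\<lambda>x. f (h x))"
  unfolding AC_on_def
proof (intro allI impI)
  fix \<epsilon> :: real assume "\<epsilon> > 0"
  obtain \<delta> where "\<delta> > 0" and \<delta>: "\<And>n u v. \<lbrakk>\<And>i. i < n \<Longrightarrow> h a \<le> u i \<and> u i \<le> v i \<and> v i \<le> h b;
      disjoint_family_on (\<lambda>i. {u i<..<v i}) {..<n}; (\<Sum>i<n. v i - u i) < \<delta>\<rbrakk>
      \<Longrightarrow> (\<Sum>i<(n::nat). cmod (f (v i) - f (u i))) < \<epsilon>"
    by (rule AC_onE[OF AC \<open>\<epsilon> > 0\<close>]) blast
  show "\<exists>\<delta>>0. \<forall>n u v. (\<forall>i<n. a \<le> u i \<and> u i \<le> v i \<and> v i \<le> b) \<and>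
     disjoint_family_on (\<lambda>i. {u i<..<v i}) {..<n} \<and> (\<Sum>i<n. v i - u i) < \<delta> \<longrightarrow>
     (\<Sum>i<(n::nat). cmod (f (h (v i)) - f (h (u i)))) < \<epsilon>"
  proof (intro exI[of _ \<delta>] conjI allI impI \<open>\<delta> > 0\<close>)
    fix n :: nat and u v assume *: "(\<forall>i<n. a \<le> u i \<and> u i \<le> v i \<and> v i \<le> b) \<and>
     disjoint_family_on (\<lambda>i. {u i<..<v i}) {..<n} \<and> (\<Sum>i<n. v i - u i) < \<delta>"
    show "(\<Sum>i<n. cmod (f (h (v i)) - f (h (u i)))) < \<epsilon>"
    proof (rule \<delta>)
      show "h a \<le> h (u i) \<and> h (u i) \<le> h (v i) \<and> h (v i) \<le> h b" if "i < n" for i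
        using * h[of a "u i"] h[of "u i" "v i"] h[of "v i" b] that by auto
      show "disjoint_family_on (\<lambda>i. {h (u i)<..<h (v i)}) {..<n}"
        unfolding disjoint_family_on_def
      proof (intro ballI impI)
        fix i j assume ij: "i \<in> {..<n}" "j \<in> {..<n}" "i \<noteq> j"
        then have uv: "a \<le> u i" "u i \<le> v i" "v i \<le> b" "a \<le> u j" "u j \<le> v j" "v j \<le> b" using * by auto
        have "{u i<..<v i} \<inter> {u j<..<v j} = {}" using * ij by (auto simp: disjoint_family_on_def)
        then have "u i = v i \<or> u j = v j \<or> v i \<le> u j \<or> v j \<le> u i"
          using dense[of "max (u i) (u j)" "min (v i) (v j)"] uv by (force simp: max_def min_def split: if_splits)
        then show "{h (u i)<..<h (v i)} \<inter> {h (u j)<..<h (v j)} = {}"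
          using h[of "v i" "u j"] h[of "v j" "u i"] uv by fastforce
      qed
      have "(\<Sum>i<n. h (v i) - h (u i)) \<le> (\<Sum>i<n. v i - u i)"
        using * h by (intro sum_mono) auto
      then show "(\<Sum>i<n. h (v i) - h (u i)) < \<delta>" using * by linarith
    qed
  qed
qed

lemma AC_loc_add: "AC_loc f \<Longrightarrow> AC_loc g \<Longrightarrow> AC_loc (\<lambda>x. f x + g x)"
  by (simp add: AC_loc_def AC_on_add)

lemma AC_loc_mult: "AC_loc f \<Longrightarrow> AC_loc g \<Longrightarrow> AC_loc (\<lambda>x. f x * g x)"
  by (simp add: AC_loc_def AC_on_mult)

lemma AC_loc_const: "AC_loc (\<lambda>x. k)"
  by (simp add: AC_loc_def AC_on_const)

lemma AC_loc_cnj: "AC_loc f \<Longrightarrow> AC_loc (\<lambda>x. cnj (f x))"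
  unfolding AC_loc_def
  by (intro allI) (rule AC_on_lipschitz_image[where C = 1], blast, simp flip: complex_cnj_diff)

lemma AC_loc_imp_continuous_on: "AC_loc f \<Longrightarrow> continuous_on S f"
proof -
  assume "AC_loc f"
  then have "continuous_on {a..b} f" for a b by (simp add: AC_loc_def AC_on_imp_continuous_on)
  then have "isCont f x" for x
    using continuous_on_interior[of "{x - 1..x + 1}" f x] by simp
  then show ?thesis by (simp add: continuous_at_imp_continuous_on)
qed

text \<open>The glued function is \<open>f (max x 0) + g (min x 0) - f 0\<close>.\<close>

lemma AC_loc_glue:
  assumes f: "AC_loc f" and g: "AC_loc g" and eq: "f 0 = g 0"
  shows "AC_loc (\<lambda>x. if x \<ge> 0 then f x else g x)"
proof -
  have 1: "AC_loc (\<lambda>x. f (max x 0))" unfolding AC_loc_def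
    by (intro allI AC_on_compose_contraction[where h = "\<lambda>x. max x 0"]) (use f in \<open>auto simp: AC_loc_def\<close>)
  have 2: "AC_loc (\<lambda>x. g (min x 0))" unfolding AC_loc_def
    by (intro allI AC_on_compose_contraction[where h = "\<lambda>x. min x 0"]) (use g in \<open>auto simp: AC_loc_def\<close>)
  have "AC_loc (\<lambda>x. f (max x 0) + g (min x 0) + (- f 0))"
    by (intro AC_loc_add 1 2 AC_loc_const)
  moreover have "(\<lambda>x. f (max x 0) + g (min x 0) + (- f 0)) = (\<lambda>x. if x \<ge> 0 then f x else g x)"
    using eq by (auto simp: max_def min_def)
  ultimately show ?thesis by simp
qed

text \<open>\<open>vderiv\<close> is a choice operator, so equality must also hold where no
  derivative exists; there both functions have the same empty set of derivatives, hence the same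
  chosen value.\<close>

lemma vderiv_cong_open:
  assumes "open S" "x \<in> S" "\<And>y. y \<in> S \<Longrightarrow> f y = g y"
  shows "vderiv f x = vderiv g x"
proof -
  have "(f has_vector_derivative D) (at x) \<longleftrightarrow> (g has_vector_derivative D) (at x)" for D
    using has_vector_derivative_transform_within_open[OF _ assms(1,2), of f D g]
      has_vector_derivative_transform_within_open[OF _ assms(1,2), of g D f] assms(3) by auto
  then show ?thesis by (simp add: vector_derivative_def)
qed

lemma AC_loc_derivD:
  assumes "AC_loc_deriv f"
  shows "AC_loc f" "AC_loc (vderiv f)" "(f has_vector_derivative vderiv f x) (at x)"
  using assms by (auto simp: AC_loc_deriv_def vector_derivative_works)

lemma AC_loc_derivI:
  assumes "AC_loc f" "\<And>x. (f has_vector_derivative f' x) (at x)" "AC_loc f'"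
  shows "AC_loc_deriv f" "vderiv f = f'"
proof -
  show *: "vderiv f = f'" using assms(2) by (auto intro: vector_derivative_at)
  show "AC_loc_deriv f" unfolding AC_loc_deriv_def * using assms by (auto intro: differentiableI_vector)
qed

lemma AC_loc_has_vderiv_ae:
  assumes "AC_loc f"
  shows "AE x in lebesgue. (f has_vector_derivative vderiv f x) (at x)"
proof (rule AE_I)
  show "{x \<in> space lebesgue. \<not> (f has_vector_derivative vderiv f x) (at x)} \<subseteq> {x. \<not> f differentiable (at x)}"
    by (auto simp: vector_derivative_works)
  show "emeasure lebesgue {x. \<not> f differentiable (at x)} = 0" "{x. \<not> f differentiable (at x)} \<in> sets lebesgue"
    using AC_loc_differentiable_ae[OF assms] by (auto simp: negligible_iff_null_sets null_sets_def)
qed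

lemma AC_loc_deriv_lincomb:
  assumes f: "AC_loc_deriv f" and g: "AC_loc_deriv g"
  shows "AC_loc_deriv (\<lambda>x. a * f x + b * g x)"
    "vderiv (\<lambda>x. a * f x + b * g x) = (\<lambda>x. a * vderiv f x + b * vderiv g x)"
    "AE x in lebesgue. vderiv (vderiv (\<lambda>x. a * f x + b * g x)) x = a * vderiv (vderiv f) x + b * vderiv (vderiv g) x"
proof -
  let ?h = "\<lambda>x. a * f x + b * g x" and ?h' = "\<lambda>x. a * vderiv f x + b * vderiv g x"
  have 1: "AC_loc ?h" "AC_loc ?h'" by (intro AC_loc_add AC_loc_mult AC_loc_const AC_loc_derivD f g)+
  have 2: "(?h has_vector_derivative ?h' x) (at x)" for x
    by (intro has_vector_derivative_add has_vector_derivative_mult_right AC_loc_derivD f g)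
  show "AC_loc_deriv ?h" and eq: "vderiv ?h = ?h'" using AC_loc_derivI[OF 1(1) 2 1(2)] by auto
  show "AE x in lebesgue. vderiv (vderiv ?h) x = a * vderiv (vderiv f) x + b * vderiv (vderiv g) x"
    using AC_loc_has_vderiv_ae[OF AC_loc_derivD(2)[OF f]] AC_loc_has_vderiv_ae[OF AC_loc_derivD(2)[OF g]]
  proof eventually_elim
    case (elim x)
    have "(?h' has_vector_derivative a * vderiv (vderiv f) x + b * vderiv (vderiv g) x) (at x)"
      by (intro has_vector_derivative_add has_vector_derivative_mult_right elim)
    then show ?case unfolding eq by (rule vector_derivative_at)
  qed
qed

lemma AC_loc_deriv_cnj:
  assumes f: "AC_loc_deriv f"
  shows "AC_loc_deriv (\<lambda>x. cnj (f x))" "vderiv (\<lambda>x. cnj (f x)) = (\<lambda>x. cnj (vderiv f x))"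
    "AE x in lebesgue. vderiv (vderiv (\<lambda>x. cnj (f x))) x = cnj (vderiv (vderiv f) x)"
proof -
  have 2: "((\<lambda>x. cnj (f x)) has_vector_derivative cnj (vderiv f x)) (at x)" for x
    by (rule has_vector_derivative_cnj[OF AC_loc_derivD(3)[OF f]])
  note * = AC_loc_derivI[OF AC_loc_cnj[OF AC_loc_derivD(1)[OF f]] 2 AC_loc_cnj[OF AC_loc_derivD(2)[OF f]]]
  show "AC_loc_deriv (\<lambda>x. cnj (f x))" and eq: "vderiv (\<lambda>x. cnj (f x)) = (\<lambda>x. cnj (vderiv f x))"
    using * by auto
  show "AE x in lebesgue. vderiv (vderiv (\<lambda>x. cnj (f x))) x = cnj (vderiv (vderiv f) x)"
    using AC_loc_has_vderiv_ae[OF AC_loc_derivD(2)[OF f]]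
  proof eventually_elim
    case (elim x)
    show ?case unfolding eq by (rule vector_derivative_at[OF has_vector_derivative_cnj[OF elim]])
  qed
qed

text \<open>The weight changes sign at 0, so solutions of the indefinite equation are assembled from
  two half-lines. Matching values and slopes give a derivative at 0 and an absolutely continuous
  \<open>vderiv h\<close>; off 0 the second derivatives agree at every point, by locality of
  \<open>vderiv\<close>.\<close>

lemma AC_loc_deriv_glue:
  assumes f: "AC_loc_deriv f" and g: "AC_loc_deriv g" and eq: "f 0 = g 0" "vderiv f 0 = vderiv g 0"
  defines "h \<equiv> \<lambda>x. if x \<ge> 0 then f x else g x"
  shows "AC_loc_deriv h" "vderiv h = (\<lambda>x. if x \<ge> 0 then vderiv f x else vderiv g x)"
    "x > 0 \<Longrightarrow> vderiv (vderiv h) x = vderiv (vderiv f) x"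
    "x < 0 \<Longrightarrow> vderiv (vderiv h) x = vderiv (vderiv g) x"
proof -
  have 1: "AC_loc h" unfolding h_def by (intro AC_loc_glue AC_loc_derivD f g eq)
  have 2: "AC_loc (\<lambda>x. if x \<ge> 0 then vderiv f x else vderiv g x)" by (intro AC_loc_glue AC_loc_derivD f g eq)
  have 3: "(h has_vector_derivative (if x \<ge> 0 then vderiv f x else vderiv g x)) (at x)" for x
  proof -
    consider "x > 0" | "x < 0" | "x = 0" by linarith
    then show ?thesis
    proof cases
      case 1
      then show ?thesis
        using has_vector_derivative_transform_within_open[OF AC_loc_derivD(3)[OF f], of "{0<..}" x h] by (auto simp: h_def)
    next
      case 2
      then show ?thesis
        using has_vector_derivative_transform_within_open[OF AC_loc_derivD(3)[OF g], of "{..<0}" x h] by (auto simp: h_def)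
    next
      case 3
      have r: "(h has_vector_derivative vderiv f 0) (at 0 within {0..})"
        by (rule has_vector_derivative_transform[OF _ _ has_vector_derivative_at_within[OF AC_loc_derivD(3)[OF f]]]) (auto simp: h_def)
      have l: "(h has_vector_derivative vderiv f 0) (at 0 within {..0})"
        unfolding eq(2) by (rule has_vector_derivative_transform[OF _ _ has_vector_derivative_at_within[OF AC_loc_derivD(3)[OF g]]])
          (use eq(1) in \<open>auto simp: h_def\<close>)
      have "(h has_vector_derivative vderiv f 0) (at 0 within {..0} \<union> {0..})"
        using l r unfolding has_vector_derivative_def has_derivative_within
        by (auto intro: Lim_Un)
      moreover have "{..0} \<union> {0..} = (UNIV :: real set)" by auto
      ultimately show ?thesis using 3 by simp
    qed
  qed
  show "AC_loc_deriv h" and v: "vderiv h = (\<lambda>x. if x \<ge> 0 then vderiv f x else vderiv g x)"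
    using AC_loc_derivI[OF 1 3 2] by auto
  show "x > 0 \<Longrightarrow> vderiv (vderiv h) x = vderiv (vderiv f) x"
    by (rule vderiv_cong_open[of "{0<..}"]) (simp_all add: fun_cong[OF v])
  show "x < 0 \<Longrightarrow> vderiv (vderiv h) x = vderiv (vderiv g) x"
    by (rule vderiv_cong_open[of "{..<0}"]) (simp_all add: fun_cong[OF v])
qed

section \<open>The Wronskian\<close>

definition wronskian :: "(real \<Rightarrow> complex) \<Rightarrow> (real \<Rightarrow> complex) \<Rightarrow> real \<Rightarrow> complex" where
  "wronskian y p x = y x * vderiv p x - vderiv y x * p x"

text \<open>The products \<open>y' p'\<close> cancel in the derivative of the Wronskian.
  Integrability of \<open>F\<close> is part of the conclusion.\<close>

lemma wronskian_has_integral: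
  assumes y: "AC_loc_deriv y" and p: "AC_loc_deriv p" and "a \<le> b"
    and F: "AE x in lebesgue. x \<in> {a..b} \<longrightarrow> y x * vderiv (vderiv p) x - vderiv (vderiv y) x * p x = F x"
  shows "(F has_integral wronskian y p b - wronskian y p a) {a..b}"
proof -
  have AC: "AC_loc (\<lambda>x. y x * vderiv p x + (- 1) * (vderiv y x * p x))"
    by (intro AC_loc_add AC_loc_mult AC_loc_const AC_loc_derivD y p)
  then have AC: "AC_on a b (wronskian y p)" by (simp add: AC_loc_def wronskian_def[abs_def])
  let ?P = "\<lambda>x. x \<in> {a..b} \<longrightarrow> (wronskian y p has_vector_derivative F x) (at x)"
  have "AE x in lebesgue. ?P x"
    using F AC_loc_has_vderiv_ae[OF AC_loc_derivD(2)[OF y]] AC_loc_has_vderiv_ae[OF AC_loc_derivD(2)[OF p]]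
  proof eventually_elim
    case (elim x)
    have "(wronskian y p has_vector_derivative
        (y x * vderiv (vderiv p) x + vderiv y x * vderiv p x) - (vderiv y x * vderiv p x + vderiv (vderiv y) x * p x)) (at x)"
      unfolding wronskian_def[abs_def]
      by (intro has_vector_derivative_diff has_vector_derivative_mult elim(2,3) AC_loc_derivD y p)
    then show ?case using elim(1) by (auto simp: algebra_simps)
  qed
  then obtain N where N: "{x. \<not> ?P x} \<subseteq> N" "N \<in> null_sets lebesgue" by (auto elim!: AE_E simp: null_sets_def)
  show ?thesis
    by (rule AC_on_has_integral[OF AC \<open>a \<le> b\<close>, of N]) (use N in \<open>auto simp: negligible_iff_null_sets\<close>)
qed

section \<open>Square-integrable functions and semi-inner products\<close>

lemma borel_measurable_cnj [measurable]:
  "f \<in> borel_measurable M \<Longrightarrow> (\<lambda>x. cnj (f x)) \<in> borel_measurable M"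
  by (rule borel_measurable_continuous_on[where f = cnj]) (auto intro!: continuous_intros)

lemma L2_D: "f \<in> L2 M \<Longrightarrow> f \<in> borel_measurable M" "f \<in> L2 M \<Longrightarrow> integrable M (\<lambda>x. (cmod (f x))\<^sup>2)"
  by (auto simp: L2_def)

lemma L2_lincomb:
  assumes "f \<in> L2 M" "g \<in> L2 M"
  shows "(\<lambda>x. a * f x + b * g x) \<in> L2 M"
proof -
  note [measurable] = assms[THEN L2_D(1)]
  have "integrable M (\<lambda>x. 2 * (cmod a)\<^sup>2 * (cmod (f x))\<^sup>2 + 2 * (cmod b)\<^sup>2 * (cmod (g x))\<^sup>2)"
    using assms by (auto simp: L2_def)
  then have "integrable M (\<lambda>x. (cmod (a * f x + b * g x))\<^sup>2)"
  proof (rule Bochner_Integration.integrable_bound)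
    show "AE x in M. norm ((cmod (a * f x + b * g x))\<^sup>2) \<le> norm (2 * (cmod a)\<^sup>2 * (cmod (f x))\<^sup>2 + 2 * (cmod b)\<^sup>2 * (cmod (g x))\<^sup>2)"
    proof (rule AE_I2)
      fix x
      have "(cmod (a * f x + b * g x))\<^sup>2 \<le> (cmod (a * f x) + cmod (b * g x))\<^sup>2"
        by (intro power_mono norm_triangle_ineq) simp
      also have "\<dots> \<le> 2 * (cmod (a * f x))\<^sup>2 + 2 * (cmod (b * g x))\<^sup>2"
        using sum_squares_ge_zero[of "cmod (a * f x) - cmod (b * g x)" 0] by (simp add: power2_eq_square algebra_simps)
      finally show "norm ((cmod (a * f x + b * g x))\<^sup>2) \<le> norm (2 * (cmod a)\<^sup>2 * (cmod (f x))\<^sup>2 + 2 * (cmod b)\<^sup>2 * (cmod (g x))\<^sup>2)"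
        by (simp add: norm_mult power_mult_distrib)
    qed
  qed simp
  then show ?thesis by (simp add: L2_def)
qed

lemma L2_scale: "f \<in> L2 M \<Longrightarrow> (\<lambda>x. a * f x) \<in> L2 M"
  using L2_lincomb[of f M f a 0] by simp

lemma L2_diff: "f \<in> L2 M \<Longrightarrow> g \<in> L2 M \<Longrightarrow> (\<lambda>x. f x - a * g x) \<in> L2 M"
  using L2_lincomb[of f M g 1 "- a"] by simp

lemma L2_zero: "(\<lambda>x. 0) \<in> L2 M"
  by (simp add: L2_def)

lemma L2_integrable_mult:
  assumes "f \<in> L2 M" "g \<in> L2 M"
  shows "integrable M (\<lambda>x. f x * cnj (g x))"
proof -
  note [measurable] = assms[THEN L2_D(1)]
  have "integrable M (\<lambda>x. (cmod (f x))\<^sup>2 + (cmod (g x))\<^sup>2)" using assms by (auto simp: L2_def)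
  then show ?thesis
  proof (rule Bochner_Integration.integrable_bound)
    show "AE x in M. norm (f x * cnj (g x)) \<le> norm ((cmod (f x))\<^sup>2 + (cmod (g x))\<^sup>2)"
    proof (rule AE_I2)
      fix x
      have "0 \<le> (cmod (f x) - cmod (g x))\<^sup>2" by simp
      then have "2 * (cmod (f x) * cmod (g x)) \<le> (cmod (f x))\<^sup>2 + (cmod (g x))\<^sup>2" by (simp add: power2_diff)
      moreover have "0 \<le> cmod (f x) * cmod (g x)" by simp
      ultimately have "cmod (f x) * cmod (g x) \<le> (cmod (f x))\<^sup>2 + (cmod (g x))\<^sup>2" by linarith
      then show "norm (f x * cnj (g x)) \<le> norm ((cmod (f x))\<^sup>2 + (cmod (g x))\<^sup>2)" by (simp add: norm_mult)
    qed
  qed simp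
qed

lemma l2_inner_lincomb:
  assumes "f \<in> L2 M" "g \<in> L2 M" "h \<in> L2 M"
  shows "l2_inner M (\<lambda>x. a * f x + b * g x) h = a * l2_inner M f h + b * l2_inner M g h"
proof -
  have "(\<lambda>x. (a * f x + b * g x) * cnj (h x)) = (\<lambda>x. a * (f x * cnj (h x)) + b * (g x * cnj (h x)))"
    by (simp add: algebra_simps)
  then show ?thesis using L2_integrable_mult[OF assms(1,3)] L2_integrable_mult[OF assms(2,3)]
    by (simp add: l2_inner_def)
qed

lemma l2_inner_cnj: "l2_inner M g f = cnj (l2_inner M f g)"
  unfolding l2_inner_def Bochner_Integration.integral_cnj[symmetric]
  by (simp add: mult.commute del: Bochner_Integration.integral_cnj)

lemma l2_inner_cong_AE:
  assumes "f \<in> L2 M" "f' \<in> L2 M" "g \<in> L2 M" "g' \<in> L2 M" "AE x in M. f x = f' x" "AE x in M. g x = g' x"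
  shows "l2_inner M f g = l2_inner M f' g'"
proof -
  note [measurable] = assms(1-4)[THEN L2_D(1)]
  show ?thesis unfolding l2_inner_def
    by (rule integral_cong_AE) (use assms(5,6) in \<open>auto elim: eventually_elim2\<close>)
qed

lemma l2_inner_self: "f \<in> L2 M \<Longrightarrow> l2_inner M f f = of_real ((l2_norm M f)\<^sup>2)"
  by (simp add: l2_inner_def l2_norm_def complex_norm_square[symmetric] del: of_real_power)


lemma l2_norm_nonneg: "l2_norm M f \<ge> 0"
  by (simp add: l2_norm_def)

lemma l2_norm_eq_0_iff:
  assumes "f \<in> L2 M"
  shows "l2_norm M f = 0 \<longleftrightarrow> (AE x in M. f x = 0)"
  using integral_nonneg_eq_0_iff_AE[OF L2_D(2)[OF assms]] by (simp add: l2_norm_def)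

lemma l2_norm_cong_AE:
  assumes "f \<in> L2 M" "g \<in> L2 M" "AE x in M. f x = g x"
  shows "l2_norm M f = l2_norm M g"
proof -
  note [measurable] = assms(1,2)[THEN L2_D(1)]
  have "(LINT x|M. (cmod (f x))\<^sup>2) = (LINT x|M. (cmod (g x))\<^sup>2)"
    by (rule integral_cong_AE) (use assms(3) in \<open>auto elim: eventually_mono\<close>)
  then show ?thesis by (simp add: l2_norm_def)
qed

lemma l2_norm_scale: "l2_norm M (\<lambda>x. a * f x) = cmod a * l2_norm M f"
  by (simp add: l2_norm_def norm_mult power_mult_distrib real_sqrt_mult)

lemma l2_norm_add_scaled:
  assumes "f \<in> L2 M" "g \<in> L2 M"
  shows "(l2_norm M (\<lambda>x. f x + a * g x))\<^sup>2 = (l2_norm M f)\<^sup>2 + 2 * Re (cnj a * l2_inner M f g) + (cmod a)\<^sup>2 * (l2_norm M g)\<^sup>2"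
proof -
  let ?h = "\<lambda>x. f x + a * g x"
  have h: "?h \<in> L2 M" using L2_lincomb[OF assms, of 1 a] by simp
  have hl: "l2_inner M ?h k = l2_inner M f k + a * l2_inner M g k" if "k \<in> L2 M" for k
    using l2_inner_lincomb[OF assms that, of 1 a] by simp
  have "l2_inner M ?h ?h = l2_inner M f ?h + a * l2_inner M g ?h" by (rule hl[OF h])
  also have "l2_inner M f ?h = cnj (l2_inner M f f + a * l2_inner M g f)"
    unfolding hl[OF assms(1), symmetric] by (rule l2_inner_cnj)
  also have "l2_inner M g ?h = cnj (l2_inner M f g + a * l2_inner M g g)"
    unfolding hl[OF assms(2), symmetric] by (rule l2_inner_cnj)
  finally have "of_real ((l2_norm M ?h)\<^sup>2) = of_real ((l2_norm M f)\<^sup>2) + cnj a * l2_inner M f g +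
      a * cnj (l2_inner M f g) + a * cnj a * of_real ((l2_norm M g)\<^sup>2)"
    using l2_inner_self[OF h] l2_inner_self[OF assms(1)] l2_inner_self[OF assms(2)]
    by (simp add: l2_inner_cnj[of M g f] algebra_simps)
  from arg_cong[OF this, of Re] show ?thesis
    by (simp add: algebra_simps flip: complex_norm_square of_real_power of_real_mult)
qed

lemma l2_cauchy_schwarz:
  assumes "f \<in> L2 M" "g \<in> L2 M"
  shows "cmod (l2_inner M f g) \<le> l2_norm M f * l2_norm M g"
proof (cases "l2_norm M g = 0")
  case True
  then have "AE x in M. g x = 0" using l2_norm_eq_0_iff[OF assms(2)] by simp
  then have "l2_inner M f g = l2_inner M f (\<lambda>x. 0)"
    by (intro l2_inner_cong_AE assms L2_zero) auto
  then show ?thesis using True by (simp add: l2_inner_def)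
next
  case False
  define G where "G = (l2_norm M g)\<^sup>2"
  have G: "G > 0" using False by (simp add: G_def)
  define I where "I = l2_inner M f g"
  \<comment> \<open>\<open>- I / G\<close> is the coefficient \<open>a\<close> that minimises the
    norm of \<open>f + a g\<close>.\<close>
  have "0 \<le> (l2_norm M (\<lambda>x. f x + (- I / G) * g x))\<^sup>2" by simp
  also have "\<dots> = (l2_norm M f)\<^sup>2 + 2 * Re (cnj (- I / G) * I) + (cmod (- I / G))\<^sup>2 * G"
    using l2_norm_add_scaled[OF assms, of "- I / G"] by (simp add: I_def G_def)
  also have "Re (cnj (- I / G) * I) = - (cmod I)\<^sup>2 / G"
  proof -
    have "cnj (- I / G) * I = - (I * cnj I) / G" by simp
    also have "\<dots> = of_real (- (cmod I)\<^sup>2 / G)" by (simp flip: complex_norm_square)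
    finally show ?thesis by (simp only: Re_complex_of_real)
  qed
  also have "(cmod (- I / G))\<^sup>2 * G = (cmod I)\<^sup>2 / G"
    using G by (simp add: norm_divide power_divide power2_eq_square)
  finally have "(cmod I)\<^sup>2 / G \<le> (l2_norm M f)\<^sup>2" by simp
  then have "(cmod I)\<^sup>2 \<le> (l2_norm M f * l2_norm M g)\<^sup>2"
    using G by (simp add: G_def field_simps power_mult_distrib)
  then show ?thesis unfolding I_def by (rule power2_le_imp_le) (simp add: l2_norm_nonneg)
qed

lemma l2_norm_triangle:
  assumes "f \<in> L2 M" "g \<in> L2 M"
  shows "l2_norm M (\<lambda>x. f x + g x) \<le> l2_norm M f + l2_norm M g"
proof (rule power2_le_imp_le)
  have "(l2_norm M (\<lambda>x. f x + g x))\<^sup>2 = (l2_norm M f)\<^sup>2 + 2 * Re (l2_inner M f g) + (l2_norm M g)\<^sup>2"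
    using l2_norm_add_scaled[OF assms, of 1] by simp
  also have "Re (l2_inner M f g) \<le> l2_norm M f * l2_norm M g"
    using l2_cauchy_schwarz[OF assms] complex_Re_le_cmod[of "l2_inner M f g"] by linarith
  finally show "(l2_norm M (\<lambda>x. f x + g x))\<^sup>2 \<le> (l2_norm M f + l2_norm M g)\<^sup>2"
    by (simp add: power2_sum)
qed (simp add: l2_norm_nonneg)

lemma l2_norm_triangle_diff:
  assumes "f \<in> L2 M" "g \<in> L2 M"
  shows "l2_norm M (\<lambda>x. f x - g x) \<le> l2_norm M f + l2_norm M g"
  using l2_norm_triangle[OF assms(1) L2_scale[OF assms(2), of "-1"]] l2_norm_scale[of M "-1" g] by simp

lemma l2_norm_reverse_triangle:
  assumes "f \<in> L2 M" "g \<in> L2 M"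
  shows "\<bar>l2_norm M f - l2_norm M g\<bar> \<le> l2_norm M (\<lambda>x. f x - g x)"
proof -
  have d: "(\<lambda>x. f x - g x) \<in> L2 M" using L2_diff[OF assms, of 1] by simp
  have "l2_norm M f \<le> l2_norm M (\<lambda>x. f x - g x) + l2_norm M g"
    using l2_norm_triangle[OF d assms(2)] by simp
  moreover have "l2_norm M g \<le> l2_norm M (\<lambda>x. f x - g x) + l2_norm M f"
    using l2_norm_triangle_diff[OF assms(1) d] by simp
  ultimately show ?thesis by linarith
qed

section \<open>Symmetric operators for a semi-inner product\<close>

text \<open>A real form on complex functions: the real part of a Hermitian form already carries all
  the quadratic information, so real combinations suffice. The instances are
  \<open>\<eta> * Re [P f, g]\<close>, \<open>Re [S u, v]\<close> and, inside
  \<open>rayleigh_bound\<close>, the form of \<open>m - S\<close>.\<close>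

locale semi_inner =
  fixes K :: "(real \<Rightarrow> complex) set" and \<sigma> :: "(real \<Rightarrow> complex) \<Rightarrow> (real \<Rightarrow> complex) \<Rightarrow> real"
  assumes closed: "u \<in> K \<Longrightarrow> v \<in> K \<Longrightarrow> (\<lambda>x. of_real a * u x + of_real b * v x) \<in> K"
    and lincomb: "u \<in> K \<Longrightarrow> v \<in> K \<Longrightarrow> w \<in> K \<Longrightarrow>
      \<sigma> (\<lambda>x. of_real a * u x + of_real b * v x) w = a * \<sigma> u w + b * \<sigma> v w"
    and sym: "u \<in> K \<Longrightarrow> v \<in> K \<Longrightarrow> \<sigma> u v = \<sigma> v u"
    and nonneg: "u \<in> K \<Longrightarrow> \<sigma> u u \<ge> 0"
begin

lemma quadratic:
  assumes "u \<in> K" "v \<in> K"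
  shows "0 \<le> a\<^sup>2 * \<sigma> u u + 2 * a * b * \<sigma> u v + b\<^sup>2 * \<sigma> v v"
proof -
  let ?w = "\<lambda>x. of_real a * u x + of_real b * v x"
  have w: "?w \<in> K" by (rule closed[OF assms])
  have "\<sigma> ?w ?w = a * \<sigma> ?w u + b * \<sigma> ?w v"
    using lincomb[OF assms w, of a b] sym[OF w] assms by simp
  also have "\<dots> = a\<^sup>2 * \<sigma> u u + 2 * a * b * \<sigma> u v + b\<^sup>2 * \<sigma> v v"
    using lincomb[OF assms assms(1), of a b] lincomb[OF assms assms(2), of a b] sym[OF assms]
    by (simp add: algebra_simps power2_eq_square)
  finally show ?thesis using nonneg[OF w] by simp
qed

lemma cauchy_schwarz:
  assumes "u \<in> K" "v \<in> K"
  shows "(\<sigma> u v)\<^sup>2 \<le> \<sigma> u u * \<sigma> v v"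
proof (cases "\<sigma> v v = 0")
  case True
  have *: "0 \<le> \<sigma> u u + 2 * b * \<sigma> u v" for b
    using quadratic[OF assms, of 1 b] True by simp
  \<comment> \<open>An affine function of \<open>b\<close> that is bounded below on the whole line
    is constant.\<close>
  have "\<sigma> u v = 0"
  proof (rule ccontr)
    assume "\<sigma> u v \<noteq> 0"
    then have "2 * (- (\<sigma> u u + 1) / (2 * \<sigma> u v)) * \<sigma> u v = - (\<sigma> u u + 1)" by simp
    with *[of "- (\<sigma> u u + 1) / (2 * \<sigma> u v)"] show False by linarith
  qed
  then show ?thesis using True by simp
next
  case False
  then have "\<sigma> v v > 0" using nonneg[OF assms(2)] by simp
  moreover have "0 \<le> \<sigma> v v * (\<sigma> u u * \<sigma> v v - (\<sigma> u v)\<^sup>2)"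
    using quadratic[OF assms, of "\<sigma> v v" "- \<sigma> u v"] by (simp add: algebra_simps power2_eq_square)
  ultimately show ?thesis by (simp add: zero_le_mult_iff)
qed

text \<open>Lax's lemma: the sequence \<open>\<sigma> (S ^^ n u) (S ^^ n u)\<close> is log-convex, so its initial growth
  rate is a lower bound for its exponential growth rate, which the stronger norm \<open>N\<close> controls.\<close>

lemma lax:
  assumes S: "\<And>u. u \<in> K \<Longrightarrow> S u \<in> K" "\<And>u v. u \<in> K \<Longrightarrow> v \<in> K \<Longrightarrow> \<sigma> (S u) v = \<sigma> u (S v)"
    and N: "\<And>u. u \<in> K \<Longrightarrow> \<sigma> u u \<le> D * (N u)\<^sup>2" "\<And>u. u \<in> K \<Longrightarrow> 0 \<le> N u" "\<And>u. u \<in> K \<Longrightarrow> N (S u) \<le> c * N u"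
    and "c > 0" "u \<in> K"
  shows "\<sigma> (S u) (S u) \<le> c\<^sup>2 * \<sigma> u u"
proof (rule ccontr)
  assume neg: "\<not> ?thesis"
  define a where "a n = \<sigma> ((S ^^ n) u) ((S ^^ n) u)" for n
  have K: "(S ^^ n) u \<in> K" for n using S(1) \<open>u \<in> K\<close> by (induction n) auto
  \<comment> \<open>Symmetry moves one factor \<open>S\<close> across, so \<open>a (Suc n)\<close>
    pairs the iterates of order \<open>n\<close> and \<open>n + 2\<close>, and Cauchy-Schwarz gives
    log-convexity.\<close>
  have conv: "(a (Suc n))\<^sup>2 \<le> a n * a (Suc (Suc n))" for n
  proof -
    have "a (Suc n) = \<sigma> ((S ^^ n) u) ((S ^^ Suc (Suc n)) u)"
      using S(2)[OF K[of n] K[of "Suc n"]] by (simp add: a_def)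
    then show ?thesis using cauchy_schwarz[OF K[of n] K[of "Suc (Suc n)"]] by (simp add: a_def)
  qed
  have a1: "c\<^sup>2 * a 0 < a 1" using neg by (simp add: a_def)
  have a0: "a 0 > 0"
  proof (rule ccontr)
    assume "\<not> a 0 > 0"
    then have "a 0 = 0" using nonneg[OF K[of 0]] by (simp add: a_def)
    then have "(a 1)\<^sup>2 \<le> 0" using conv[of 0] by simp
    then show False using a1 \<open>a 0 = 0\<close> by simp
  qed
  define \<theta> where "\<theta> = a 1 / a 0"
  have \<theta>: "\<theta> > c\<^sup>2" using a0 a1 by (simp add: \<theta>_def field_simps)
  then have \<theta>0: "\<theta> > 0" using zero_le_power2[of c] by linarith
  have step: "a n > 0 \<and> \<theta> * a n \<le> a (Suc n)" for n
  proof (induction n)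
    case 0
    then show ?case using a0 by (simp add: \<theta>_def)
  next
    case (Suc n)
    then have p: "a (Suc n) > 0" using \<theta>0 by (meson less_le_trans mult_pos_pos)
    have "\<theta> * a (Suc n) * a n \<le> a (Suc n) * a (Suc n)"
      using Suc p by (simp add: mult.commute mult.left_commute)
    also have "\<dots> \<le> a (Suc (Suc n)) * a n" using conv[of n] by (simp add: power2_eq_square mult.commute)
    finally show ?case using Suc p by simp
  qed
  have lower: "a 0 * \<theta> ^ n \<le> a n" for n
  proof (induction n)
    case (Suc n)
    have "a 0 * \<theta> ^ Suc n = \<theta> * (a 0 * \<theta> ^ n)" by simp
    also have "\<dots> \<le> \<theta> * a n" using Suc \<theta>0 by simp
    also have "\<dots> \<le> a (Suc n)" using step by blast
    finally show ?case .
  qed simp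
  have Nn: "N ((S ^^ n) u) \<le> c ^ n * N u" for n
  proof (induction n)
    case (Suc n)
    have "N ((S ^^ Suc n) u) \<le> c * N ((S ^^ n) u)" using N(3)[OF K[of n]] by simp
    also have "\<dots> \<le> c * (c ^ n * N u)" using Suc \<open>c > 0\<close> by simp
    finally show ?case by (simp add: mult.assoc)
  qed simp
  have "D \<ge> 0"
  proof (rule ccontr)
    assume "\<not> D \<ge> 0"
    then have "D * (N u)\<^sup>2 \<le> 0" by (simp add: mult_nonpos_nonneg)
    then show False using N(1)[OF \<open>u \<in> K\<close>] a0 by (simp add: a_def)
  qed
  have upper: "a n \<le> (c\<^sup>2) ^ n * (D * (N u)\<^sup>2)" for n
  proof -
    have "a n \<le> D * (N ((S ^^ n) u))\<^sup>2" using N(1)[OF K] by (simp add: a_def)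
    also have "\<dots> \<le> D * (c ^ n * N u)\<^sup>2"
      using Nn N(2)[OF K] \<open>D \<ge> 0\<close> by (intro mult_left_mono power_mono) auto
    also have "\<dots> = (c\<^sup>2) ^ n * (D * (N u)\<^sup>2)"
      by (simp add: power_mult_distrib mult.commute mult.left_commute flip: power_mult)
    finally show ?thesis .
  qed
  \<comment> \<open>The ratio of the initial growth rate to the admissible one; a ratio above 1
    would have bounded powers.\<close>
  define t where "t = \<theta> / c\<^sup>2"
  have t: "t > 1" using \<theta> \<open>c > 0\<close> by (simp add: t_def)
  have "t ^ n \<le> D * (N u)\<^sup>2 / a 0" for n
  proof -
    have "a 0 * \<theta> ^ n \<le> (c\<^sup>2) ^ n * (D * (N u)\<^sup>2)" using lower upper by (rule order_trans)
    moreover have "(c\<^sup>2) ^ n > 0" using \<open>c > 0\<close> by simp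
    ultimately show ?thesis using a0 by (simp add: t_def power_divide field_simps)
  qed
  moreover obtain n where "D * (N u)\<^sup>2 / a 0 < t ^ n" using real_arch_pow[OF t] by blast
  ultimately show False by (meson leD)
qed

text \<open>If the supremum \<open>m\<close> of the Rayleigh quotient of \<open>S\<close> exceeded \<open>\<rho>\<close>, then \<open>m - S\<close> would be
  nonnegative and boundedly invertible, hence bounded below, and \<open>m\<close> could be decreased.\<close>

lemma rayleigh_bound:
  assumes S: "\<And>u. u \<in> K \<Longrightarrow> S u \<in> K" "\<And>u v. u \<in> K \<Longrightarrow> v \<in> K \<Longrightarrow> \<sigma> (S u) v = \<sigma> u (S v)"
    and N: "\<And>u. u \<in> K \<Longrightarrow> \<sigma> u u \<le> D * (N u)\<^sup>2" "\<And>u. u \<in> K \<Longrightarrow> 0 \<le> N u" "\<And>u. u \<in> K \<Longrightarrow> N (S u) \<le> c * N u"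
    and "c > 0" "\<rho> \<ge> 0"
    and inv: "\<And>m. m > \<rho> \<Longrightarrow> \<exists>C k. k > 0 \<and> (\<forall>u\<in>K. C u \<in> K \<and> N (C u) \<le> k * N u \<and>
       (\<forall>v\<in>K. \<sigma> (C (\<lambda>x. of_real m * u x - S u x)) v = \<sigma> u v \<and>
              m * \<sigma> (C u) v - \<sigma> (S (C u)) v = \<sigma> u v))"
    and "u \<in> K"
  shows "\<sigma> (S u) u \<le> \<rho> * \<sigma> u u"
proof -
  define X where "X = {m. m > \<rho> \<and> (\<forall>u\<in>K. \<sigma> (S u) u \<le> m * \<sigma> u u)}"
  \<comment> \<open>Lax's lemma turns the bound \<open>c\<close> of \<open>S\<close> for the
    stronger norm \<open>N\<close> into a bound for \<sigma>, so that \<open>X\<close> is not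
    empty.\<close>
  have Sb: "\<sigma> (S u) u \<le> c * \<sigma> u u" if u: "u \<in> K" for u
  proof -
    have "(\<sigma> (S u) u)\<^sup>2 \<le> \<sigma> (S u) (S u) * \<sigma> u u" by (rule cauchy_schwarz) (use S u in auto)
    also have "\<dots> \<le> c\<^sup>2 * \<sigma> u u * \<sigma> u u"
      using lax[where S = S and N = N and D = D and c = c, OF S N \<open>c > 0\<close> u] nonneg[OF u] by (rule mult_right_mono)
    finally have "(\<sigma> (S u) u)\<^sup>2 \<le> (c * \<sigma> u u)\<^sup>2" by (simp add: power2_eq_square algebra_simps)
    then show ?thesis by (rule power2_le_imp_le) (use nonneg[OF u] \<open>c > 0\<close> in simp)
  qed
  have "max c (\<rho> + 1) \<in> X"
  proof -
    have "\<sigma> (S u) u \<le> max c (\<rho> + 1) * \<sigma> u u" if u: "u \<in> K" for u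
      using Sb[OF u] mult_right_mono[OF max.cobounded1[of c "\<rho> + 1"] nonneg[OF u]] by linarith
    then show ?thesis by (auto simp: X_def)
  qed
  then have Xne: "X \<noteq> {}" by blast
  have bdd: "bdd_below X" by (rule bdd_belowI[of _ \<rho>]) (auto simp: X_def)
  define m where "m = Inf X"
  have "m \<ge> \<rho>" unfolding m_def by (rule cInf_greatest[OF Xne]) (auto simp: X_def)
  have mS: "\<sigma> (S u) u \<le> m * \<sigma> u u" if u: "u \<in> K" for u
  proof (rule field_le_epsilon)
    fix e :: real assume "e > 0"
    define e' where "e' = e / (\<sigma> u u + 1)"
    have e': "e' > 0" "e' * \<sigma> u u \<le> e"
      using \<open>e > 0\<close> nonneg[OF u] by (auto simp: e'_def field_simps)
    then obtain m' where m': "m' \<in> X" "m' < m + e'"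
      using cInf_lessD[OF Xne, of "m + e'"] by (auto simp: m_def)
    have "\<sigma> (S u) u \<le> m' * \<sigma> u u" using m'(1) u by (auto simp: X_def)
    also have "\<dots> \<le> (m + e') * \<sigma> u u" using m'(2) nonneg[OF u] by (intro mult_right_mono) auto
    finally show "\<sigma> (S u) u \<le> m * \<sigma> u u + e" using e'(2) by (simp add: distrib_right)
  qed
  have "m = \<rho>"
  proof (rule ccontr)
    assume "m \<noteq> \<rho>"
    then have "m > \<rho>" using \<open>m \<ge> \<rho>\<close> by simp
    obtain C k where "k > 0" and C: "\<And>u. u \<in> K \<Longrightarrow> C u \<in> K" "\<And>u. u \<in> K \<Longrightarrow> N (C u) \<le> k * N u"
      and CT: "\<And>u v. u \<in> K \<Longrightarrow> v \<in> K \<Longrightarrow> \<sigma> (C (\<lambda>x. of_real m * u x - S u x)) v = \<sigma> u v"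
      and TC: "\<And>u v. u \<in> K \<Longrightarrow> v \<in> K \<Longrightarrow> m * \<sigma> (C u) v - \<sigma> (S (C u)) v = \<sigma> u v"
      using inv[OF \<open>m > \<rho>\<close>] by blast
    define T where "T u = (\<lambda>x. of_real m * u x - S u x)" for u :: "real \<Rightarrow> complex"
    have TK: "T u \<in> K" if "u \<in> K" for u
      using closed[OF that S(1)[OF that], of m "-1"] by (simp add: T_def)
    have T\<sigma>: "\<sigma> (T u) v = m * \<sigma> u v - \<sigma> (S u) v" if "u \<in> K" "v \<in> K" for u v
      using lincomb[OF that(1) S(1)[OF that(1)] that(2), of m "-1"] by (simp add: T_def)
    have Tsym: "\<sigma> (T u) v = \<sigma> u (T v)" if "u \<in> K" "v \<in> K" for u v
      using T\<sigma>[OF that] T\<sigma>[OF that(2,1)] sym that TK S by simp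
    \<comment> \<open>In the applications the inverse is known up to a.e. equality; testing against
      \<sigma> expresses this.\<close>
    have CT': "\<sigma> (C (T u)) v = \<sigma> u v" if "u \<in> K" "v \<in> K" for u v
      using CT[OF that] by (simp add: T_def)
    have TC': "\<sigma> (T (C u)) v = \<sigma> u v" if "u \<in> K" "v \<in> K" for u v
      using TC[OF that] T\<sigma>[OF C(1)[OF that(1)] that(2)] by simp
    have Csym: "\<sigma> (C u) v = \<sigma> u (C v)" if "u \<in> K" "v \<in> K" for u v
    proof -
      have "\<sigma> (C u) v = \<sigma> (C u) (T (C v))" using TC'[OF that(2) C(1)[OF that(1)]] sym that C TK by simp
      also have "\<dots> = \<sigma> (T (C u)) (C v)" using Tsym that C by simp
      also have "\<dots> = \<sigma> u (C v)" using TC' that C by simp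
      finally show ?thesis .
    qed
    \<comment> \<open>Lax's lemma for the inverse \<open>C\<close>: a bound on \<open>C\<close> in
      the norm \<open>N\<close> bounds \<open>T\<close> from below in \<sigma>.\<close>
    have lower: "\<sigma> u u \<le> k\<^sup>2 * \<sigma> (T u) (T u)" if u: "u \<in> K" for u
    proof -
      have "\<sigma> (C (T u)) (C (T u)) = \<sigma> u (C (T u))" using CT'[OF u C(1)[OF TK[OF u]]] .
      also have "\<dots> = \<sigma> u u" using CT'[OF u u] sym[OF u C(1)[OF TK[OF u]]] by simp
      finally show ?thesis using lax[where S = C and N = N and D = D and c = k, OF C(1) Csym N(1,2) C(2) \<open>k > 0\<close> TK[OF u]] by simp
    qed
    define B where "B = \<bar>m\<bar> + c"
    have B: "B > 0" using \<open>c > 0\<close> by (simp add: B_def)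
    have Tupper: "\<sigma> (T u) u \<le> B * \<sigma> u u" if u: "u \<in> K" for u
    proof -
      have "(\<sigma> (S u) u)\<^sup>2 \<le> \<sigma> (S u) (S u) * \<sigma> u u" by (rule cauchy_schwarz) (use S u in auto)
      also have "\<dots> \<le> c\<^sup>2 * \<sigma> u u * \<sigma> u u"
        using lax[where S = S and N = N and D = D and c = c, OF S N \<open>c > 0\<close> u] nonneg[OF u] by (rule mult_right_mono)
      finally have "\<bar>\<sigma> (S u) u\<bar>\<^sup>2 \<le> (c * \<sigma> u u)\<^sup>2" by (simp add: power2_eq_square algebra_simps)
      then have "\<bar>\<sigma> (S u) u\<bar> \<le> c * \<sigma> u u"
        by (rule power2_le_imp_le) (use nonneg[OF u] \<open>c > 0\<close> in simp)
      moreover have "m * \<sigma> u u \<le> \<bar>m\<bar> * \<sigma> u u" using nonneg[OF u] by (intro mult_right_mono) auto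
      ultimately show ?thesis using T\<sigma>[OF u u] by (simp add: B_def distrib_right)
    qed
    \<comment> \<open>Since \<open>m\<close> bounds the Rayleigh quotient,
      \<open>\<sigma> (T u) v\<close> is again a semi-inner product; Cauchy-Schwarz in it compares
      \<open>\<sigma> (T u) (T u)\<close> with \<open>\<sigma> (T u) u\<close>.\<close>
    interpret T: semi_inner K "\<lambda>u v. \<sigma> (T u) v"
    proof
      show "\<sigma> (T u) v = \<sigma> (T v) u" if "u \<in> K" "v \<in> K" for u v
        using Tsym that sym TK by metis
      show "\<sigma> (T u) u \<ge> 0" if "u \<in> K" for u using T\<sigma>[OF that that] mS[OF that] by simp
      show "\<sigma> (T (\<lambda>x. of_real a * u x + of_real b * v x)) w = a * \<sigma> (T u) w + b * \<sigma> (T v) w"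
        if "u \<in> K" "v \<in> K" "w \<in> K" for u v w a b
        using Tsym[OF closed[OF that(1,2)] that(3)] lincomb[OF that(1,2) TK[OF that(3)]] Tsym that by simp
    qed (rule closed)
    have TT: "\<sigma> (T u) (T u) \<le> B * \<sigma> (T u) u" if u: "u \<in> K" for u
    proof -
      have "(\<sigma> (T u) (T u))\<^sup>2 \<le> \<sigma> (T u) u * \<sigma> (T (T u)) (T u)"
        using T.cauchy_schwarz[OF u TK[OF u]] .
      also have "\<dots> \<le> \<sigma> (T u) u * (B * \<sigma> (T u) (T u))"
        using Tupper[OF TK[OF u]] T.nonneg[OF u] by (rule mult_left_mono)
      finally have "\<sigma> (T u) (T u) * \<sigma> (T u) (T u) \<le> (B * \<sigma> (T u) u) * \<sigma> (T u) (T u)"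
        by (simp add: power2_eq_square algebra_simps)
      then show ?thesis
        using nonneg[OF TK[OF u]] T.nonneg[OF u] B by (cases "\<sigma> (T u) (T u) = 0") auto
    qed
    \<comment> \<open>\<open>lower\<close> and \<open>TT\<close> give
      \<open>\<sigma> u u \<le> k\<^sup>2 * B * \<sigma> (T u) u\<close>, so \<open>T - d\<close> is
      still nonnegative; the second term keeps \<open>m - d\<close> above \<rho>.\<close>
    define d where "d = min (1 / (k\<^sup>2 * B)) ((m - \<rho>) / 2)"
    have d: "d > 0" "m - d > \<rho>" "d * (k\<^sup>2 * B) \<le> 1"
      using \<open>k > 0\<close> B \<open>m > \<rho>\<close> by (auto simp: d_def min_def field_simps)
    have "m - d \<in> X"
    proof -
      have "\<sigma> (S u) u \<le> (m - d) * \<sigma> u u" if u: "u \<in> K" for u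
      proof -
        have "d * \<sigma> u u \<le> d * (k\<^sup>2 * (B * \<sigma> (T u) u))"
          using lower[OF u] TT[OF u] d(1) \<open>k > 0\<close>
          by (intro mult_left_mono) (auto intro: order_trans mult_left_mono)
        also have "\<dots> = d * (k\<^sup>2 * B) * \<sigma> (T u) u" by simp
        also have "\<dots> \<le> \<sigma> (T u) u" using d(3) T.nonneg[OF u] by (simp add: mult_left_le_one_le mult_le_cancel_right2)
        finally show ?thesis using T\<sigma>[OF u u] by (simp add: algebra_simps)
      qed
      then show ?thesis using d(2) by (auto simp: X_def)
    qed
    then have "m \<le> m - d" unfolding m_def by (rule cInf_lower[OF _ bdd])
    then show False using d(1) by simp
  qed
  then show ?thesis using mS[OF \<open>u \<in> K\<close>] by simp
qed

end

section \<open>Nonnegative operators in Krein spaces\<close>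

definition lin_subspace :: "real measure \<Rightarrow> (real \<Rightarrow> complex) set \<Rightarrow> bool" where
  "lin_subspace M K \<longleftrightarrow> K \<subseteq> L2 M \<and> (\<forall>f\<in>K. \<forall>g\<in>K. \<forall>a b. (\<lambda>x. a * f x + b * g x) \<in> K)"

lemma lin_subspace_L2: "lin_subspace M (L2 M)"
  by (simp add: lin_subspace_def L2_lincomb)

lemma bounded_op_bound:
  assumes "bounded_op M K B"
  obtains C where "C > 0" "\<And>f. f \<in> K \<Longrightarrow> l2_norm M (B f) \<le> C * l2_norm M f"
proof -
  obtain C where C: "\<And>f. f \<in> K \<Longrightarrow> l2_norm M (B f) \<le> C * l2_norm M f"
    using assms unfolding bounded_op_def by blast
  show thesis
  proof (rule that)
    show "l2_norm M (B f) \<le> (\<bar>C\<bar> + 1) * l2_norm M f" if "f \<in> K" for f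
    proof -
      have "C * l2_norm M f \<le> (\<bar>C\<bar> + 1) * l2_norm M f"
        by (intro mult_right_mono l2_norm_nonneg) simp
      then show ?thesis using C[OF that] by simp
    qed
  qed simp
qed

lemma bounded_op_cong:
  assumes B: "bounded_op M K B" and K: "lin_subspace M K" and fg: "f \<in> K" "g \<in> K" "AE x in M. f x = g x"
  shows "AE x in M. B f x = B g x"
proof -
  let ?h = "\<lambda>x. 1 * f x + (- 1) * g x"
  have h: "?h \<in> K" using K fg by (auto simp only: lin_subspace_def)
  obtain C where C: "C > 0" "\<And>f. f \<in> K \<Longrightarrow> l2_norm M (B f) \<le> C * l2_norm M f"
    using bounded_op_bound[OF B] by blast
  have L: "K \<subseteq> L2 M" using K by (simp add: lin_subspace_def)
  have "AE x in M. ?h x = 0" using fg(3) by eventually_elim simp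
  then have "l2_norm M ?h = 0" using l2_norm_eq_0_iff[of ?h M] h L by blast
  then have "l2_norm M (B ?h) = 0" using C(2)[OF h] l2_norm_nonneg[of M "B ?h"] by simp
  moreover have "B ?h \<in> L2 M" using B h L unfolding bounded_op_def by blast
  ultimately have "AE x in M. B ?h x = 0" using l2_norm_eq_0_iff by blast
  moreover have "AE x in M. B ?h x = 1 * B f x + (- 1) * B g x"
    using B fg(1,2) unfolding bounded_op_def by blast
  ultimately show ?thesis by eventually_elim simp
qed

lemma bounded_op_lincomb:
  assumes K: "lin_subspace M K" and B: "bounded_op M K B"
  shows "bounded_op M K (\<lambda>f x. a * f x + b * B f x)"
  unfolding bounded_op_def
proof (intro conjI ballI allI)
  have KL: "f \<in> L2 M" if "f \<in> K" for f using K that by (auto simp: lin_subspace_def)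
  have BK: "B f \<in> K" if "f \<in> K" for f using B that by (auto simp: bounded_op_def)
  show "(\<lambda>x. a * f x + b * B f x) \<in> K" if "f \<in> K" for f
    using K BK[OF that] that unfolding lin_subspace_def by blast
  show "AE x in M. a * (c * f x + d * g x) + b * B (\<lambda>t. c * f t + d * g t) x =
      c * (a * f x + b * B f x) + d * (a * g x + b * B g x)" if "f \<in> K" "g \<in> K" for f g c d
  proof -
    have "AE x in M. B (\<lambda>t. c * f t + d * g t) x = c * B f x + d * B g x"
      using B that unfolding bounded_op_def by blast
    then show ?thesis by eventually_elim (simp add: algebra_simps)
  qed
  obtain C where C: "C > 0" "\<And>f. f \<in> K \<Longrightarrow> l2_norm M (B f) \<le> C * l2_norm M f"
    using bounded_op_bound[OF B] by blast
  show "\<exists>C. \<forall>f\<in>K. l2_norm M (\<lambda>x. a * f x + b * B f x) \<le> C * l2_norm M f"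
  proof (intro exI ballI)
    fix f assume f: "f \<in> K"
    have "l2_norm M (\<lambda>x. a * f x + b * B f x) \<le> cmod a * l2_norm M f + cmod b * l2_norm M (B f)"
      using l2_norm_triangle[OF L2_scale[OF KL[OF f], of a] L2_scale[OF KL[OF BK[OF f]], of b]]
      by (simp add: l2_norm_scale)
    also have "\<dots> \<le> cmod a * l2_norm M f + cmod b * (C * l2_norm M f)"
      using C(2)[OF f] by (intro add_left_mono mult_left_mono) auto
    finally show "l2_norm M (\<lambda>x. a * f x + b * B f x) \<le> (cmod a + cmod b * C) * l2_norm M f"
      by (simp add: algebra_simps)
  qed
qed

section \<open>The extended line and the spectral ring\<close>

lemma openin_Alexandroff_Some:
  assumes "open (U :: real set)"
  shows "openin (Alexandroff_compactification euclideanreal) (Some ` U)"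
  using assms by (auto simp: openin_Alexandroff_compactification)

text \<open>Images of open real sets are open in the compactification, so a finite point is in the
  closure of \<Delta> only through the finite points of \<Delta>.\<close>

lemma closure_of_Alexandroff_Some:
  assumes "Some t \<in> Alexandroff_compactification euclideanreal closure_of \<Delta>"
  shows "t \<in> closure {s. Some s \<in> \<Delta>}"
proof (rule ccontr)
  assume t: "t \<notin> closure {s. Some s \<in> \<Delta>}"
  let ?U = "- closure {s. Some s \<in> \<Delta>}"
  have "Some t \<in> Some ` ?U \<and> openin (Alexandroff_compactification euclideanreal) (Some ` ?U)"
    using t by (intro conjI openin_Alexandroff_Some) (simp_all add: open_Compl)
  from assms[unfolded in_closure_of, THEN conjunct2, rule_format, OF this]
  obtain y where "y \<in> \<Delta>" "y \<in> Some ` ?U" by (elim exE conjE)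
  then show False using closure_subset[of "{s. Some s \<in> \<Delta>}"] by auto
qed

lemma spec_ring_intervals:
  fixes a b :: real
  assumes "a \<noteq> 0" "b \<noteq> 0" "a \<le> b"
  shows "Some ` {a..b} \<in> spec_ring" "Some ` {a<..<b} \<in> spec_ring" "Some ` {a..<b} \<in> spec_ring" "Some ` {a<..b} \<in> spec_ring"
    "- (Some ` {a..b}) \<in> spec_ring" "- (Some ` {a<..<b}) \<in> spec_ring"
    "{a<..<b} \<in> bounded_intervals"
proof -
  have "{{a..b}, {a..<b}, {a<..b}, {a<..<b}} \<subseteq> bounded_intervals"
    unfolding bounded_intervals_def by (rule order_trans[OF UN_upper[of b] UN_upper[of a]]) (use assms in auto)
  then show "Some ` {a..b} \<in> spec_ring" "Some ` {a<..<b} \<in> spec_ring" "Some ` {a..<b} \<in> spec_ring" "Some ` {a<..b} \<in> spec_ring"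
    "- (Some ` {a..b}) \<in> spec_ring" "- (Some ` {a<..<b}) \<in> spec_ring"
    "{a<..<b} \<in> bounded_intervals"
    unfolding spec_ring_def by auto
qed

text \<open>The empty set is the degenerate open interval from 1 to 1, and the whole extended line
  is its complement.\<close>

lemma spec_ring_empty_UNIV: "{} \<in> spec_ring" "UNIV \<in> spec_ring"
  using spec_ring_intervals(2,6)[of 1 1] by auto

section \<open>Operators with a spectral function in a Krein space\<close>

text \<open>What the abstract argument uses of \<open>A\<close>: a linear graph, single-valued up to
  a.e. equality (\<open>T_single\<close>), symmetric and nonnegative for \<open>[.,.]\<close>.
  Resolvents are supplied by the spectral function.\<close>

locale krein_operator =
  fixes M :: "real measure" and T :: l2_graph and E :: "real option set \<Rightarrow> l2_op"
  assumes sets_M: "sets M = sets lebesgue"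
    and AE_nonzero: "AE x in M. x \<noteq> 0"
    and T_L2: "(f, g) \<in> T \<Longrightarrow> f \<in> L2 M \<and> g \<in> L2 M"
    and T_lincomb: "(f, f') \<in> T \<Longrightarrow> (g, g') \<in> T \<Longrightarrow> (\<lambda>x. a * f x + b * g x, \<lambda>x. a * f' x + b * g' x) \<in> T"
    and T_cong: "(f, f') \<in> T \<Longrightarrow> g \<in> L2 M \<Longrightarrow> g' \<in> L2 M \<Longrightarrow> AE x in M. f x = g x \<Longrightarrow> AE x in M. f' x = g' x \<Longrightarrow> (g, g') \<in> T"
    and T_single: "(f, g) \<in> T \<Longrightarrow> AE x in M. f x = 0 \<Longrightarrow> AE x in M. g x = 0"
    and T_sym: "(f, f') \<in> T \<Longrightarrow> (g, g') \<in> T \<Longrightarrow> j_inner M f' g = j_inner M f g'"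
    and T_nonneg: "(f, f') \<in> T \<Longrightarrow> Re (j_inner M f' f) \<ge> 0"
    and E: "spectral_function M T E"
begin

abbreviation nrm :: "(real \<Rightarrow> complex) \<Rightarrow> real" where "nrm \<equiv> l2_norm M"

abbreviation ae_eq :: "(real \<Rightarrow> complex) \<Rightarrow> (real \<Rightarrow> complex) \<Rightarrow> bool" (infix "\<simeq>" 50) where
  "f \<simeq> g \<equiv> (AE x in M. f x = g x)"

lemma measurable_sgn [measurable]: "(\<lambda>x::real. sgn x) \<in> borel_measurable M"
proof -
  have "(\<lambda>x::real. sgn x) \<in> borel_measurable lebesgue" by (rule measurable_completion) simp
  then show ?thesis by (simp add: measurable_cong_sets[OF sets_M refl])
qed

lemma Jop_norm_sq: "AE x in M. (cmod (Jop f x))\<^sup>2 = (cmod (f x))\<^sup>2"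
  using AE_nonzero by eventually_elim (auto simp: Jop_def norm_mult sgn_if)

lemma Jop_L2: "f \<in> L2 M \<Longrightarrow> Jop f \<in> L2 M"
proof -
  assume f: "f \<in> L2 M"
  note [measurable] = L2_D(1)[OF f]
  have "integrable M (\<lambda>x. (cmod (Jop f x))\<^sup>2)"
    using L2_D(2)[OF f]
  proof (rule Bochner_Integration.integrable_bound)
    show "AE x in M. norm ((cmod (Jop f x))\<^sup>2) \<le> norm ((cmod (f x))\<^sup>2)"
      using Jop_norm_sq[of f] by eventually_elim simp
  qed (simp add: Jop_def)
  then show ?thesis by (simp add: L2_def Jop_def)
qed

lemma Jop_norm:
  assumes "f \<in> L2 M"
  shows "nrm (Jop f) = nrm f"
proof -
  note [measurable] = L2_D(1)[OF assms] L2_D(1)[OF Jop_L2[OF assms]]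
  have "(LINT x|M. (cmod (Jop f x))\<^sup>2) = (LINT x|M. (cmod (f x))\<^sup>2)"
    by (rule Bochner_Integration.integral_cong_AE) (measurable, rule Jop_norm_sq)
  then show ?thesis by (simp add: l2_norm_def)
qed

lemma j_lincomb:
  assumes "f \<in> L2 M" "g \<in> L2 M" "h \<in> L2 M"
  shows "j_inner M (\<lambda>x. a * f x + b * g x) h = a * j_inner M f h + b * j_inner M g h"
proof -
  have "Jop (\<lambda>x. a * f x + b * g x) = (\<lambda>x. a * Jop f x + b * Jop g x)"
    by (simp add: Jop_def algebra_simps)
  then show ?thesis using l2_inner_lincomb[OF Jop_L2[OF assms(1)] Jop_L2[OF assms(2)] assms(3)]
    by (simp add: j_inner_def)
qed

lemma j_cnj: "j_inner M g f = cnj (j_inner M f g)"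
proof -
  have "j_inner M g f = (LINT x|M. cnj (Jop f x * cnj (g x)))"
    unfolding j_inner_def l2_inner_def Jop_def by (simp add: mult_ac del: Bochner_Integration.integral_cnj)
  also have "\<dots> = cnj (j_inner M f g)"
    unfolding j_inner_def l2_inner_def by (rule Bochner_Integration.integral_cnj)
  finally show ?thesis .
qed

lemma j_cong:
  assumes "f \<in> L2 M" "f' \<in> L2 M" "g \<in> L2 M" "g' \<in> L2 M" "f \<simeq> f'" "g \<simeq> g'"
  shows "j_inner M f g = j_inner M f' g'"
  unfolding j_inner_def
  by (rule l2_inner_cong_AE) (use assms Jop_L2 in \<open>auto simp: Jop_def elim: eventually_mono\<close>)

lemma j_bound: "f \<in> L2 M \<Longrightarrow> g \<in> L2 M \<Longrightarrow> cmod (j_inner M f g) \<le> nrm f * nrm g"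
  using l2_cauchy_schwarz[OF Jop_L2, of f g] Jop_norm[of f] by (simp add: j_inner_def)

text \<open>Pairing with \<open>Jop f\<close> recovers the Hilbert norm from the indefinite form;
  this is how bounds on forms become bounds on norms.\<close>

lemma j_Jop: "f \<in> L2 M \<Longrightarrow> j_inner M f (Jop f) = of_real ((nrm f)\<^sup>2)"
  using l2_inner_self[OF Jop_L2, of f] Jop_norm[of f] by (simp add: j_inner_def)

lemma T_zero: "((\<lambda>x. 0), (\<lambda>x. 0)) \<in> T" if "(f, g) \<in> T"
  using T_lincomb[OF that that, of 0 0] by simp

lemma E_bounded: "\<Delta> \<in> spec_ring \<Longrightarrow> bounded_op M (L2 M) (E \<Delta>)"
  using E unfolding spectral_function_def by (elim conjE) blast

lemma E_mult: "\<Delta> \<in> spec_ring \<Longrightarrow> \<Delta>' \<in> spec_ring \<Longrightarrow> \<Delta> \<inter> \<Delta>' \<in> spec_ring \<Longrightarrow> f \<in> L2 M \<Longrightarrow>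
    E (\<Delta> \<inter> \<Delta>') f \<simeq> E \<Delta> (E \<Delta>' f)"
  using E unfolding spectral_function_def op_eq_def o_def by (elim conjE) blast

lemma E_UNIV: "f \<in> L2 M \<Longrightarrow> E UNIV f \<simeq> f"
  using E unfolding spectral_function_def op_eq_def o_def by (elim conjE) blast

lemma E_graph: "\<Delta> \<in> spec_ring \<Longrightarrow> op_graph M (L2 M) (E \<Delta>) =
        {(f, g). f \<in> L2 M \<and> g \<in> L2 M \<and>
           (Jop f, Jop g) \<in> adjoint_graph M (op_graph M (L2 M) (E \<Delta>))}"
  using E unfolding spectral_function_def by (elim conjE) blast

lemma E_add: "\<Delta> \<in> spec_ring \<Longrightarrow> \<Delta>' \<in> spec_ring \<Longrightarrow> \<Delta> \<union> \<Delta>' \<in> spec_ring \<Longrightarrow> \<Delta> \<inter> \<Delta>' = {} \<Longrightarrow> f \<in> L2 M \<Longrightarrow>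
    E (\<Delta> \<union> \<Delta>') f \<simeq> (\<lambda>x. E \<Delta> f x + E \<Delta>' f x)"
  using E unfolding spectral_function_def op_eq_def by (elim conjE) blast

lemma E_pos: "\<Delta> \<in> spec_ring \<Longrightarrow> \<Delta> \<subseteq> Some ` {0<..} \<Longrightarrow> f \<in> op_range M (E \<Delta>) \<Longrightarrow> \<not> (f \<simeq> (\<lambda>x. 0)) \<Longrightarrow> Re (j_inner M f f) > 0"
  using E unfolding spectral_function_def by (elim conjE) blast

lemma E_neg: "\<Delta> \<in> spec_ring \<Longrightarrow> \<Delta> \<subseteq> Some ` {..<0} \<Longrightarrow> f \<in> op_range M (E \<Delta>) \<Longrightarrow> \<not> (f \<simeq> (\<lambda>x. 0)) \<Longrightarrow> Re (j_inner M f f) < 0"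
  using E unfolding spectral_function_def by (elim conjE) blast

lemma E_bicommutant: "\<Delta> \<in> spec_ring \<Longrightarrow> in_bicommutant M T (E \<Delta>)"
  using E unfolding spectral_function_def by (elim conjE) blast

lemma E_spectrum:
  assumes "\<Delta> \<in> spec_ring" "\<And>t. z = of_real t \<Longrightarrow> t \<notin> closure {s. Some s \<in> \<Delta>}"
  obtains R where "is_resolvent M (op_range M (E \<Delta>)) T z R"
proof -
  have "\<forall>z\<in>restr_spectrum M (op_range M (E \<Delta>)) T.
      \<exists>t. z = of_real t \<and> Some t \<in> Alexandroff_compactification euclideanreal closure_of \<Delta>"
    using E assms(1) unfolding spectral_function_def by (elim conjE) blast
  then have "z \<notin> restr_spectrum M (op_range M (E \<Delta>)) T"
    using assms(2) closure_of_Alexandroff_Some by blast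
  then show thesis using that by (auto simp: restr_spectrum_def)
qed

lemma E_bounded_interval:
  assumes "I \<in> bounded_intervals"
  shows "op_range M (E (Some ` I)) \<subseteq> Domain T"
    "\<exists>C. \<forall>(f, g)\<in>T. f \<in> op_range M (E (Some ` I)) \<longrightarrow> nrm g \<le> C * nrm f"
  using E assms unfolding spectral_function_def by (elim conjE; blast)+

lemma E_L2: "\<Delta> \<in> spec_ring \<Longrightarrow> f \<in> L2 M \<Longrightarrow> E \<Delta> f \<in> L2 M"
  using E_bounded unfolding bounded_op_def by blast

lemma E_lincomb: "\<Delta> \<in> spec_ring \<Longrightarrow> f \<in> L2 M \<Longrightarrow> g \<in> L2 M \<Longrightarrow> E \<Delta> (\<lambda>x. a * f x + b * g x) \<simeq> (\<lambda>x. a * E \<Delta> f x + b * E \<Delta> g x)"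
  using E_bounded unfolding bounded_op_def by blast

lemma E_cong: "\<Delta> \<in> spec_ring \<Longrightarrow> f \<in> L2 M \<Longrightarrow> g \<in> L2 M \<Longrightarrow> f \<simeq> g \<Longrightarrow> E \<Delta> f \<simeq> E \<Delta> g"
  using bounded_op_cong[OF E_bounded lin_subspace_L2] .

text \<open>Idempotence of \<open>E \<Delta>\<close> turns its range into its set of fixed
  points.\<close>

lemma op_range_iff:
  assumes \<Delta>: "\<Delta> \<in> spec_ring"
  shows "f \<in> op_range M (E \<Delta>) \<longleftrightarrow> f \<in> L2 M \<and> E \<Delta> f \<simeq> f"
proof
  assume "f \<in> op_range M (E \<Delta>)"
  then obtain g where g: "f \<in> L2 M" "g \<in> L2 M" "f \<simeq> E \<Delta> g" by (auto simp: op_range_def)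
  have "E \<Delta> f \<simeq> E \<Delta> (E \<Delta> g)" using E_cong[OF \<Delta> g(1) E_L2[OF \<Delta> g(2)] g(3)] .
  moreover have "E \<Delta> g \<simeq> E \<Delta> (E \<Delta> g)" using E_mult[OF \<Delta> \<Delta> _ g(2)] \<Delta> by simp
  ultimately have "E \<Delta> f \<simeq> f" using g(3) by eventually_elim simp
  then show "f \<in> L2 M \<and> E \<Delta> f \<simeq> f" using g by simp
next
  assume "f \<in> L2 M \<and> E \<Delta> f \<simeq> f"
  then show "f \<in> op_range M (E \<Delta>)" by (auto simp: op_range_def intro!: bexI[of _ f] elim: eventually_mono)
qed

lemma E_in_range: "\<Delta> \<in> spec_ring \<Longrightarrow> f \<in> L2 M \<Longrightarrow> E \<Delta> f \<in> op_range M (E \<Delta>)"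
  by (auto simp: op_range_def E_L2)

lemma op_range_cong: "f \<in> op_range M (E \<Delta>) \<Longrightarrow> g \<in> L2 M \<Longrightarrow> f \<simeq> g \<Longrightarrow> g \<in> op_range M (E \<Delta>)"
proof -
  assume "f \<in> op_range M (E \<Delta>)" and g: "g \<in> L2 M" "f \<simeq> g"
  then obtain h where h: "h \<in> L2 M" "f \<simeq> E \<Delta> h" by (auto simp: op_range_def)
  have "g \<simeq> E \<Delta> h" using g(2) h(2) by eventually_elim simp
  then show "g \<in> op_range M (E \<Delta>)" using g h by (auto simp: op_range_def)
qed

lemma lin_subspace_range:
  assumes \<Delta>: "\<Delta> \<in> spec_ring"
  shows "lin_subspace M (op_range M (E \<Delta>))"
  unfolding lin_subspace_def
proof (intro conjI ballI allI)
  show "op_range M (E \<Delta>) \<subseteq> L2 M" by (auto simp: op_range_def)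
  fix f g a b assume "f \<in> op_range M (E \<Delta>)" "g \<in> op_range M (E \<Delta>)"
  then have fg: "f \<in> L2 M" "g \<in> L2 M" "E \<Delta> f \<simeq> f" "E \<Delta> g \<simeq> g" by (auto simp: op_range_iff[OF \<Delta>])
  have "E \<Delta> (\<lambda>x. a * f x + b * g x) \<simeq> (\<lambda>x. a * f x + b * g x)"
    using E_lincomb[OF \<Delta> fg(1,2), of a b] fg(3,4) by eventually_elim simp
  then show "(\<lambda>x. a * f x + b * g x) \<in> op_range M (E \<Delta>)"
    using fg by (simp add: op_range_iff[OF \<Delta>] L2_lincomb)
qed

lemma op_range_UNIV: "op_range M (E UNIV) = L2 M"
  using E_UNIV by (auto simp: op_range_iff[OF spec_ring_empty_UNIV(2)])

lemma j_E:
  assumes \<Delta>: "\<Delta> \<in> spec_ring" and f: "f \<in> L2 M" and g: "g \<in> L2 M"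
  shows "j_inner M (E \<Delta> f) g = j_inner M f (E \<Delta> g)"
proof -
  have gr: "(h, E \<Delta> h) \<in> op_graph M (L2 M) (E \<Delta>)" if "h \<in> L2 M" for h
    using that E_L2[OF \<Delta>] by (auto simp: op_graph_def)
  have "(Jop f, Jop (E \<Delta> f)) \<in> adjoint_graph M (op_graph M (L2 M) (E \<Delta>))"
    using equalityD1[OF E_graph[OF \<Delta>], THEN subsetD, OF gr[OF f]] by simp
  then have "l2_inner M (E \<Delta> g) (Jop f) = l2_inner M g (Jop (E \<Delta> f))"
    using gr[OF g] by (auto simp: adjoint_graph_def)
  then have "cnj (l2_inner M (Jop f) (E \<Delta> g)) = cnj (l2_inner M (Jop (E \<Delta> f)) g)"
    by (simp add: l2_inner_cnj[of M "E \<Delta> g" "Jop f"] l2_inner_cnj[of M g "Jop (E \<Delta> f)"])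
  then show ?thesis by (simp add: j_inner_def)
qed

section \<open>Resolvents, and commutation of the spectral function with the operator\<close>

lemma resolventD:
  assumes "is_resolvent M K T z R"
  shows "bounded_op M K R" "f \<in> K \<Longrightarrow> g \<in> K \<Longrightarrow> (f, \<lambda>x. g x + z * f x) \<in> T \<longleftrightarrow> f \<simeq> R g"
    "g \<in> K \<Longrightarrow> R g \<in> K" "g \<in> K \<Longrightarrow> (R g, \<lambda>x. g x + z * R g x) \<in> T"
  using assms unfolding is_resolvent_def bounded_op_def by auto

text \<open>\<open>E UNIV\<close> is the identity, so the spectrum condition for the whole extended
  line says that the spectrum of \<open>T\<close> is real.\<close>

lemma nonreal_resolvent:
  assumes "z \<notin> \<real>"
  obtains R where "is_resolvent M (L2 M) T z R"
proof (rule E_spectrum[OF spec_ring_empty_UNIV(2)])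
  show "t \<notin> closure {s. Some s \<in> UNIV}" if "z = of_real t" for t
    using that assms by simp
qed (use that in \<open>simp add: op_range_UNIV\<close>)

lemma resolvent_zero:
  assumes R: "is_resolvent M (L2 M) T z R" and d: "(d, \<lambda>x. z * d x) \<in> T"
  shows "d \<simeq> (\<lambda>x. 0)"
proof -
  have dL: "d \<in> L2 M" using T_L2[OF d] by simp
  have 1: "d \<simeq> R (\<lambda>x. 0)" using resolventD(2)[OF R dL L2_zero] d by simp
  have "((\<lambda>x. 0), (\<lambda>x. 0)) \<in> T" by (rule T_zero[OF d])
  then have "(\<lambda>x. 0) \<simeq> R (\<lambda>x. 0)" using resolventD(2)[OF R L2_zero L2_zero] by simp
  with 1 show ?thesis by eventually_elim simp
qed

text \<open>With \<open>u = R f\<close>, \<open>v = S f\<close> and \<open>p = S u\<close>, the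
  defect \<open>d = u - v - (z - w) p\<close> in the resolvent identity satisfies
  \<open>T d = w d\<close>, hence vanishes; then \<open>p\<close> solves the equation that defines
  \<open>R v\<close>.\<close>

lemma resolvents_commute:
  assumes R: "is_resolvent M (L2 M) T z R" and S: "is_resolvent M (L2 M) T w S" and f: "f \<in> L2 M"
  shows "R (S f) \<simeq> S (R f)"
proof -
  define u v p where "u = R f" and "v = S f" and "p = S u"
  have L: "u \<in> L2 M" "v \<in> L2 M" "p \<in> L2 M"
    using resolventD(3)[OF R] resolventD(3)[OF S] f by (auto simp: u_def v_def p_def)
  have u: "(u, \<lambda>x. f x + z * u x) \<in> T" unfolding u_def by (rule resolventD(4)[OF R f])
  have v: "(v, \<lambda>x. f x + w * v x) \<in> T" unfolding v_def by (rule resolventD(4)[OF S f])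
  have p: "(p, \<lambda>x. u x + w * p x) \<in> T" unfolding p_def by (rule resolventD(4)[OF S L(1)])
  let ?d = "\<lambda>x. 1 * (1 * u x + (- 1) * v x) + (- (z - w)) * p x"
  have "(?d, \<lambda>x. 1 * (1 * (f x + z * u x) + (- 1) * (f x + w * v x)) + (- (z - w)) * (u x + w * p x)) \<in> T"
    by (intro T_lincomb u v p)
  also have "(\<lambda>x. 1 * (1 * (f x + z * u x) + (- 1) * (f x + w * v x)) + (- (z - w)) * (u x + w * p x)) = (\<lambda>x. w * ?d x)"
    by (rule ext) (simp add: algebra_simps)
  finally have d: "?d \<simeq> (\<lambda>x. 0)" by (rule resolvent_zero[OF S])
  have "(p, \<lambda>x. v x + z * p x) \<in> T"
  proof (rule T_cong[OF p L(3)])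
    show "(\<lambda>x. v x + z * p x) \<in> L2 M" using L2_lincomb[OF L(2,3), of 1 z] by simp
    show "(\<lambda>x. u x + w * p x) \<simeq> (\<lambda>x. v x + z * p x)" using d by eventually_elim (simp add: algebra_simps)
  qed simp
  then have "p \<simeq> R v" using resolventD(2)[OF R L(3,2)] by simp
  then show ?thesis unfolding p_def u_def v_def by eventually_elim simp
qed

text \<open>\<open>R\<close> commutes with every resolvent, so the bicommutant condition makes it
  commute with \<open>E \<Delta>\<close>.\<close>

lemma E_resolvent_commute:
  assumes R: "is_resolvent M (L2 M) T z R" and \<Delta>: "\<Delta> \<in> spec_ring" and f: "f \<in> L2 M"
  shows "R (E \<Delta> f) \<simeq> E \<Delta> (R f)"
proof -
  have "op_eq M (R \<circ> S) (S \<circ> R)" if "is_resolvent M (L2 M) T w S" for w S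
    unfolding op_eq_def o_def using resolvents_commute[OF R that] by blast
  then have "op_eq M (R \<circ> E \<Delta>) (E \<Delta> \<circ> R)"
    using E_bicommutant[OF \<Delta>] resolventD(1)[OF R] unfolding in_bicommutant_def by blast
  then show ?thesis using f by (auto simp: op_eq_def)
qed

text \<open>Reduced to the bounded resolvent at \<open>\<i>\<close>: membership of
  \<open>(u, v)\<close> in \<open>T\<close> means \<open>u = R (v - \<i> u)\<close>, and
  \<open>E \<Delta>\<close> passes through \<open>R\<close>.\<close>

lemma E_T:
  assumes \<Delta>: "\<Delta> \<in> spec_ring" and uv: "(u, v) \<in> T"
  shows "(E \<Delta> u, E \<Delta> v) \<in> T"
proof -
  obtain R where R: "is_resolvent M (L2 M) T \<i> R" using nonreal_resolvent[of \<i>] by (auto simp: complex_is_Real_iff)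
  have L: "u \<in> L2 M" "v \<in> L2 M" using T_L2[OF uv] by auto
  define g where "g = (\<lambda>x. 1 * v x + (- \<i>) * u x)"
  have g: "g \<in> L2 M" unfolding g_def by (intro L2_lincomb L)
  have "(\<lambda>x. g x + \<i> * u x) = v" by (simp add: g_def fun_eq_iff algebra_simps)
  then have uR: "u \<simeq> R g" using resolventD(2)[OF R L(1) g] uv by simp
  have EL: "E \<Delta> u \<in> L2 M" "E \<Delta> g \<in> L2 M" "E \<Delta> v \<in> L2 M" using E_L2[OF \<Delta>] L g by auto
  have "E \<Delta> u \<simeq> E \<Delta> (R g)" using E_cong[OF \<Delta> L(1) resolventD(3)[OF R g] uR] .
  with E_resolvent_commute[OF R \<Delta> g] have "E \<Delta> u \<simeq> R (E \<Delta> g)" by eventually_elim simp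
  then have "(E \<Delta> u, \<lambda>x. E \<Delta> g x + \<i> * E \<Delta> u x) \<in> T" using resolventD(2)[OF R EL(1,2)] by simp
  then show ?thesis
  proof (rule T_cong[OF _ EL(1,3)])
    show "(\<lambda>x. E \<Delta> g x + \<i> * E \<Delta> u x) \<simeq> E \<Delta> v"
      using E_lincomb[OF \<Delta> L(2,1), of 1 "- \<i>"] unfolding g_def by eventually_elim (simp add: algebra_simps)
  qed simp
qed

text \<open>The relation \<open>u = R (v - \<i> u)\<close>, which characterises the graph, survives
  the limit because \<open>R\<close> is bounded.\<close>

lemma T_closed:
  assumes L: "u \<in> L2 M" "v \<in> L2 M" and F: "F \<noteq> bot" "\<forall>\<^sub>F s in F. (u' s, v' s) \<in> T"
    and u: "((\<lambda>s. nrm (\<lambda>x. u' s x - u x)) \<longlongrightarrow> 0) F" and v: "((\<lambda>s. nrm (\<lambda>x. v' s x - v x)) \<longlongrightarrow> 0) F"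
  shows "(u, v) \<in> T"
proof -
  obtain R where R: "is_resolvent M (L2 M) T \<i> R" using nonreal_resolvent[of \<i>] by (auto simp: complex_is_Real_iff)
  obtain C where C: "C > 0" "\<And>f. f \<in> L2 M \<Longrightarrow> nrm (R f) \<le> C * nrm f"
    using bounded_op_bound[OF resolventD(1)[OF R]] by blast
  define g where "g = (\<lambda>x. 1 * v x + (- \<i>) * u x)"
  have g: "g \<in> L2 M" unfolding g_def by (intro L2_lincomb L)
  have Rg: "R g \<in> L2 M" by (rule resolventD(3)[OF R g])
  have bound: "nrm (\<lambda>x. u x - R g x) \<le> (1 + C) * nrm (\<lambda>x. u' s x - u x) + C * nrm (\<lambda>x. v' s x - v x)"
    if T: "(u' s, v' s) \<in> T" for s
  proof -
    have L': "u' s \<in> L2 M" "v' s \<in> L2 M" using T_L2[OF T] by auto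
    define h where "h = (\<lambda>x. 1 * v' s x + (- \<i>) * u' s x)"
    have h: "h \<in> L2 M" unfolding h_def by (intro L2_lincomb L')
    have "(\<lambda>x. h x + \<i> * u' s x) = v' s" by (simp add: h_def fun_eq_iff algebra_simps)
    then have uh: "u' s \<simeq> R h" using resolventD(2)[OF R L'(1) h] T by simp
    have du: "(\<lambda>x. u' s x - u x) \<in> L2 M" "(\<lambda>x. v' s x - v x) \<in> L2 M"
      using L2_diff[OF L'(1) L(1), of 1] L2_diff[OF L'(2) L(2), of 1] by auto
    have dh: "(\<lambda>x. 1 * h x + (- 1) * g x) \<in> L2 M" by (intro L2_lincomb h g)
    have "R (\<lambda>x. 1 * h x + (- 1) * g x) \<simeq> (\<lambda>x. 1 * R h x + (- 1) * R g x)"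
      using resolventD(1)[OF R] h g unfolding bounded_op_def by blast
    then have eq: "(\<lambda>x. u x - R g x) \<simeq> (\<lambda>x. R (\<lambda>x. 1 * h x + (- 1) * g x) x - (u' s x - u x))"
      using uh by eventually_elim simp
    have RdL: "R (\<lambda>x. 1 * h x + (- 1) * g x) \<in> L2 M" by (rule resolventD(3)[OF R dh])
    have "nrm (\<lambda>x. u x - R g x) = nrm (\<lambda>x. R (\<lambda>x. 1 * h x + (- 1) * g x) x - (u' s x - u x))"
      using L2_diff[OF L(1) Rg, of 1] L2_diff[OF RdL du(1), of 1] eq by (intro l2_norm_cong_AE) auto
    also have "\<dots> \<le> nrm (R (\<lambda>x. 1 * h x + (- 1) * g x)) + nrm (\<lambda>x. u' s x - u x)"
      by (rule l2_norm_triangle_diff[OF RdL du(1)])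
    also have "nrm (R (\<lambda>x. 1 * h x + (- 1) * g x)) \<le> C * nrm (\<lambda>x. 1 * h x + (- 1) * g x)" by (rule C(2)[OF dh])
    also have "(\<lambda>x. 1 * h x + (- 1) * g x) = (\<lambda>x. (v' s x - v x) + (- \<i>) * (u' s x - u x))"
      by (auto simp: h_def g_def algebra_simps)
    also have "nrm \<dots> \<le> nrm (\<lambda>x. v' s x - v x) + nrm (\<lambda>x. u' s x - u x)"
      using l2_norm_triangle[OF du(2) L2_scale[OF du(1), of "- \<i>"]] l2_norm_scale[of M "- \<i>" "\<lambda>x. u' s x - u x"] by simp
    finally show ?thesis using C(1) by (simp add: algebra_simps)
  qed
  have lim: "((\<lambda>s. (1 + C) * nrm (\<lambda>x. u' s x - u x) + C * nrm (\<lambda>x. v' s x - v x)) \<longlongrightarrow> (1 + C) * 0 + C * 0) F"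
    by (intro tendsto_intros u v)
  have "nrm (\<lambda>x. u x - R g x) \<le> (1 + C) * 0 + C * 0"
    by (rule tendsto_lowerbound[OF lim _ F(1)]) (use F(2) bound in \<open>auto elim: eventually_mono\<close>)
  then have "nrm (\<lambda>x. u x - R g x) = 0" using l2_norm_nonneg[of M "\<lambda>x. u x - R g x"] by linarith
  then have "(\<lambda>x. u x - R g x) \<simeq> (\<lambda>x. 0)"
    using l2_norm_eq_0_iff[of "\<lambda>x. u x - R g x" M] L2_diff[OF L(1) Rg, of 1] by simp
  then have "u \<simeq> R g" by eventually_elim simp
  then have "(u, \<lambda>x. g x + \<i> * u x) \<in> T" using resolventD(2)[OF R L(1) g] by simp
  moreover have "(\<lambda>x. g x + \<i> * u x) = v" by (simp add: g_def fun_eq_iff algebra_simps)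
  ultimately show ?thesis by simp
qed

lemma L2_minus: "f \<in> L2 M \<Longrightarrow> g \<in> L2 M \<Longrightarrow> (\<lambda>x. f x - g x) \<in> L2 M"
  using L2_diff[of f M g 1] by simp

lemma j_diff: "f \<in> L2 M \<Longrightarrow> g \<in> L2 M \<Longrightarrow> h \<in> L2 M \<Longrightarrow> j_inner M (\<lambda>x. f x - a * g x) h = j_inner M f h - a * j_inner M g h"
  using j_lincomb[of f g h 1 "- a"] by simp

text \<open>The range is the set of fixed points of a bounded operator.\<close>

lemma range_closed:
  assumes \<Delta>: "\<Delta> \<in> spec_ring" and f: "f \<in> L2 M" and F: "F \<noteq> bot" "\<forall>\<^sub>F s in F. h s \<in> op_range M (E \<Delta>)"
    and lim: "((\<lambda>s. nrm (\<lambda>x. h s x - f x)) \<longlongrightarrow> 0) F"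
  shows "f \<in> op_range M (E \<Delta>)"
proof -
  obtain C where C: "C > 0" "\<And>f. f \<in> L2 M \<Longrightarrow> nrm (E \<Delta> f) \<le> C * nrm f"
    using bounded_op_bound[OF E_bounded[OF \<Delta>]] by blast
  have Ef: "E \<Delta> f \<in> L2 M" by (rule E_L2[OF \<Delta> f])
  have bound: "nrm (\<lambda>x. E \<Delta> f x - f x) \<le> (C + 1) * nrm (\<lambda>x. h s x - f x)" if "h s \<in> op_range M (E \<Delta>)" for s
  proof -
    have hs: "h s \<in> L2 M" "E \<Delta> (h s) \<simeq> h s" using that by (auto simp: op_range_iff[OF \<Delta>])
    let ?d = "\<lambda>x. 1 * h s x + (- 1) * f x"
    have d: "?d \<in> L2 M" by (intro L2_lincomb hs f)
    have "(\<lambda>x. E \<Delta> f x - f x) \<simeq> (\<lambda>x. ?d x - E \<Delta> ?d x)"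
      using E_lincomb[OF \<Delta> hs(1) f, of 1 "-1"] hs(2) by eventually_elim simp
    then have "nrm (\<lambda>x. E \<Delta> f x - f x) = nrm (\<lambda>x. ?d x - E \<Delta> ?d x)"
      by (intro l2_norm_cong_AE L2_minus Ef f d E_L2[OF \<Delta> d])
    also have "\<dots> \<le> nrm ?d + nrm (E \<Delta> ?d)" by (intro l2_norm_triangle_diff d E_L2[OF \<Delta> d])
    also have "\<dots> \<le> (C + 1) * nrm ?d" using C(2)[OF d] by (simp add: algebra_simps)
    finally show ?thesis by simp
  qed
  have l: "((\<lambda>s. (C + 1) * nrm (\<lambda>x. h s x - f x)) \<longlongrightarrow> (C + 1) * 0) F" by (intro tendsto_intros lim)
  have "nrm (\<lambda>x. E \<Delta> f x - f x) \<le> (C + 1) * 0"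
    by (rule tendsto_lowerbound[OF l _ F(1)]) (use F(2) bound in \<open>auto elim: eventually_mono\<close>)
  then have "nrm (\<lambda>x. E \<Delta> f x - f x) = 0" using l2_norm_nonneg[of M "\<lambda>x. E \<Delta> f x - f x"] by linarith
  then have "(\<lambda>x. E \<Delta> f x - f x) \<simeq> (\<lambda>x. 0)" using l2_norm_eq_0_iff[OF L2_minus[OF Ef f]] by simp
  then have "E \<Delta> f \<simeq> f" by eventually_elim simp
  then show ?thesis using f by (simp add: op_range_iff[OF \<Delta>])
qed

lemma range_mono:
  assumes "\<Delta> \<in> spec_ring" "\<Delta>' \<in> spec_ring" "\<Delta> \<subseteq> \<Delta>'" "f \<in> op_range M (E \<Delta>)"
  shows "f \<in> op_range M (E \<Delta>')"
proof -
  have f: "f \<in> L2 M" "E \<Delta> f \<simeq> f" using assms by (auto simp: op_range_iff)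
  have "\<Delta>' \<inter> \<Delta> = \<Delta>" using assms(3) by blast
  then have "E \<Delta> f \<simeq> E \<Delta>' (E \<Delta> f)" using E_mult[OF assms(2,1) _ f(1)] assms(1) by simp
  moreover have "E \<Delta>' (E \<Delta> f) \<simeq> E \<Delta>' f" by (rule E_cong[OF assms(2) E_L2[OF assms(1) f(1)] f])
  ultimately have "E \<Delta>' f \<simeq> f" using f(2) by eventually_elim simp
  then show ?thesis using f by (simp add: op_range_iff[OF assms(2)])
qed

section \<open>Estimates on definite and on bounded-away spectral subspaces\<close>

text \<open>On a subspace on which the indefinite form is \<open>\<eta>\<close>-definite and which is exhausted by ranges of
  \<open>J\<close>-selfadjoint projections converging to a bounded operator, the form is equivalent to the
  Hilbert norm, and the restriction of \<open>T\<close> is symmetric for it.\<close>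

lemma definite_estimate:
  fixes \<eta> :: real and \<Delta> :: "real \<Rightarrow> real option set"
  assumes \<eta>: "\<bar>\<eta>\<bar> = 1" and F: "F \<noteq> bot" and P: "bounded_op M (L2 M) P"
    and lim: "\<And>f. f \<in> L2 M \<Longrightarrow> ((\<lambda>s. nrm (\<lambda>x. E (\<Delta> s) f x - P f x)) \<longlongrightarrow> 0) F"
    and ring: "\<forall>\<^sub>F s in F. \<Delta> s \<in> spec_ring"
    and nest: "\<forall>\<^sub>F s in F. \<forall>\<^sub>F s' in F. \<Delta> s \<subseteq> \<Delta> s'"
    and def: "\<forall>\<^sub>F s in F. \<forall>f\<in>op_range M (E (\<Delta> s)). \<eta> * Re (j_inner M f f) \<ge> 0"
  obtains C where "C > 0" "\<And>u v z. (u, v) \<in> T \<Longrightarrow> \<bar>Im z\<bar> * nrm (P u) \<le> C * nrm (\<lambda>x. v x - z * u x)"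
proof -
  obtain k where k: "k > 0" "\<And>f. f \<in> L2 M \<Longrightarrow> nrm (P f) \<le> k * nrm f"
    using bounded_op_bound[OF P] by blast
  have PL: "P f \<in> L2 M" if "f \<in> L2 M" for f using P that by (auto simp: bounded_op_def)
  have Plin: "P (\<lambda>x. a * f x + b * g x) \<simeq> (\<lambda>x. a * P f x + b * P g x)" if "f \<in> L2 M" "g \<in> L2 M" for f g a b
    using P that unfolding bounded_op_def by blast
  have jlim: "((\<lambda>s. j_inner M (E (\<Delta> s) f) g) \<longlongrightarrow> j_inner M (P f) g) F" if f: "f \<in> L2 M" and g: "g \<in> L2 M" for f g
  proof -
    have 1: "\<forall>\<^sub>F s in F. norm (j_inner M (E (\<Delta> s) f) g - j_inner M (P f) g) \<le> nrm (\<lambda>x. E (\<Delta> s) f x - P f x) * nrm g"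
      using ring
    proof eventually_elim
      case (elim s)
      have "j_inner M (E (\<Delta> s) f) g - j_inner M (P f) g = j_inner M (\<lambda>x. E (\<Delta> s) f x - 1 * P f x) g"
        using j_diff[OF E_L2[OF elim f] PL[OF f] g, of 1] by simp
      then show ?case using j_bound[OF L2_minus[OF E_L2[OF elim f] PL[OF f]] g] by simp
    qed
    have 2: "((\<lambda>s. nrm (\<lambda>x. E (\<Delta> s) f x - P f x) * nrm g) \<longlongrightarrow> 0) F"
      by (rule tendsto_mult_left_zero[OF lim[OF f]])
    have "((\<lambda>s. j_inner M (E (\<Delta> s) f) g - j_inner M (P f) g) \<longlongrightarrow> 0) F"
      by (rule Lim_null_comparison[OF 1 2])
    then show ?thesis by (rule LIM_zero_cancel)
  qed
  have jsym: "j_inner M (P f) g = j_inner M f (P g)" if f: "f \<in> L2 M" and g: "g \<in> L2 M" for f g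
  proof (rule tendsto_unique[OF F jlim[OF f g]])
    have "((\<lambda>s. cnj (j_inner M (E (\<Delta> s) g) f)) \<longlongrightarrow> cnj (j_inner M (P g) f)) F"
      by (intro tendsto_cnj jlim f g)
    then have *: "((\<lambda>s. cnj (j_inner M (E (\<Delta> s) g) f)) \<longlongrightarrow> j_inner M f (P g)) F"
      using j_cnj[of f "P g"] by simp
    have "\<forall>\<^sub>F s in F. cnj (j_inner M (E (\<Delta> s) g) f) = j_inner M (E (\<Delta> s) f) g"
      using ring by eventually_elim (use j_E[OF _ f g] j_cnj[of f] in simp)
    then show "((\<lambda>s. j_inner M (E (\<Delta> s) f) g) \<longlongrightarrow> j_inner M f (P g)) F"
      using * by (rule Lim_transform_eventually[rotated])
  qed
  \<comment> \<open>The limit form. It is nonnegative on all of \<open>L2 M\<close>, since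
    \<open>[E f, f] = [E f, E f]\<close> for a projection that is symmetric for
    \<open>[.,.]\<close>.\<close>
  let ?\<sigma> = "\<lambda>f g. \<eta> * Re (j_inner M (P f) g)"
  interpret semi_inner "L2 M" ?\<sigma>
  proof
    show "(\<lambda>x. complex_of_real a * u x + complex_of_real b * v x) \<in> L2 M" if "u \<in> L2 M" "v \<in> L2 M" for u v a b
      by (intro L2_lincomb that)
    show "?\<sigma> (\<lambda>x. complex_of_real a * u x + complex_of_real b * v x) w = a * ?\<sigma> u w + b * ?\<sigma> v w"
      if uvw: "u \<in> L2 M" "v \<in> L2 M" "w \<in> L2 M" for u v w a b
    proof -
      have "j_inner M (P (\<lambda>x. complex_of_real a * u x + complex_of_real b * v x)) w =
          j_inner M (\<lambda>x. complex_of_real a * P u x + complex_of_real b * P v x) w"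
        using uvw by (intro j_cong PL L2_lincomb Plin) auto
      then show ?thesis using j_lincomb[OF PL[OF uvw(1)] PL[OF uvw(2)] uvw(3)] by (simp add: algebra_simps)
    qed
    show "?\<sigma> u v = ?\<sigma> v u" if "u \<in> L2 M" "v \<in> L2 M" for u v
      using jsym[OF that] j_cnj[of u "P v"] by simp
    show "?\<sigma> u u \<ge> 0" if u: "u \<in> L2 M" for u
    proof (rule tendsto_lowerbound[OF _ _ F])
      show "((\<lambda>s. \<eta> * Re (j_inner M (E (\<Delta> s) u) u)) \<longlongrightarrow> ?\<sigma> u u) F"
        by (intro tendsto_intros jlim u)
      show "\<forall>\<^sub>F s in F. 0 \<le> \<eta> * Re (j_inner M (E (\<Delta> s) u) u)"
        using ring def
      proof eventually_elim
        case (elim s)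
        have "j_inner M (E (\<Delta> s) u) u = j_inner M (E (\<Delta> s) (E (\<Delta> s) u)) u"
          using E_mult[OF elim(1) elim(1) _ u] elim(1) by (intro j_cong E_L2 u) auto
        also have "\<dots> = j_inner M (E (\<Delta> s) u) (E (\<Delta> s) u)"
          by (rule j_E[OF elim(1) E_L2[OF elim(1) u] u])
        finally show ?case using elim(2) E_in_range[OF elim(1) u] by simp
      qed
    qed
  qed
  \<comment> \<open>Uniform definiteness, where regularity is used: Cauchy-Schwarz for \<sigma>
    between \<open>f\<close> and \<open>Jop f\<close> bounds the fourth power of the norm by
    \<open>\<sigma> f f * \<sigma> (Jop f) (Jop f)\<close>, and the constant \<open>k\<close> is the
    bound of the limit \<open>P\<close>, hence independent of \<open>s\<close>.\<close>
  have upos: "(nrm f)\<^sup>2 \<le> k * (\<eta> * Re (j_inner M f f))"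
    if s: "\<Delta> s \<in> spec_ring" "\<forall>\<^sub>F s' in F. \<Delta> s \<subseteq> \<Delta> s'" and f: "f \<in> op_range M (E (\<Delta> s))" for s f
  proof -
    have fL: "f \<in> L2 M" "E (\<Delta> s) f \<simeq> f" using f by (auto simp: op_range_iff[OF s(1)])
    \<comment> \<open>Later ranges contain \<open>f\<close>, so \<open>E (\<Delta> s') f\<close> is
      eventually \<open>f\<close> itself and \<open>P f = f\<close>.\<close>
    have "\<forall>\<^sub>F s' in F. nrm (\<lambda>x. E (\<Delta> s') f x - P f x) = nrm (\<lambda>x. f x - P f x)"
      using s(2) ring
    proof eventually_elim
      case (elim s')
      have "E (\<Delta> s') f \<simeq> f" using range_mono[OF s(1) elim(2,1) f] by (simp add: op_range_iff[OF elim(2)])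
      then show ?case by (intro l2_norm_cong_AE L2_minus E_L2[OF elim(2)] fL PL) auto
    qed
    then have "((\<lambda>s'. nrm (\<lambda>x. E (\<Delta> s') f x - P f x)) \<longlongrightarrow> nrm (\<lambda>x. f x - P f x)) F"
      by (rule tendsto_eventually)
    then have "nrm (\<lambda>x. f x - P f x) = 0" using lim[OF fL(1)] tendsto_unique[OF F] by blast
    then have "(\<lambda>x. f x - P f x) \<simeq> (\<lambda>x. 0)" using l2_norm_eq_0_iff[OF L2_minus[OF fL(1) PL[OF fL(1)]]] by simp
    then have Pf: "P f \<simeq> f" by eventually_elim simp
    have JL: "Jop f \<in> L2 M" by (rule Jop_L2[OF fL(1)])
    define X where "X = \<eta> * Re (j_inner M f f)"
    have 1: "?\<sigma> f (Jop f) = \<eta> * (nrm f)\<^sup>2"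
      using j_cong[OF PL[OF fL(1)] fL(1) JL JL Pf] j_Jop[OF fL(1)] by simp
    have 2: "?\<sigma> f f = X"
      using j_cong[OF PL[OF fL(1)] fL(1) fL(1) fL(1) Pf] by (simp add: X_def)
    have X: "X \<ge> 0" using nonneg[OF fL(1)] 2 by simp
    have 3: "?\<sigma> (Jop f) (Jop f) \<le> k * (nrm f)\<^sup>2"
    proof -
      have "?\<sigma> (Jop f) (Jop f) \<le> \<bar>?\<sigma> (Jop f) (Jop f)\<bar>" by simp
      also have "\<dots> \<le> cmod (j_inner M (P (Jop f)) (Jop f))" using \<eta> abs_Re_le_cmod by (simp add: abs_mult)
      also have "\<dots> \<le> nrm (P (Jop f)) * nrm (Jop f)" by (intro j_bound PL JL)
      also have "\<dots> \<le> k * nrm (Jop f) * nrm (Jop f)" by (intro mult_right_mono k JL l2_norm_nonneg)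
      finally show ?thesis using Jop_norm[OF fL(1)] by (simp add: power2_eq_square)
    qed
    have "\<eta>\<^sup>2 = 1" using \<eta> by (simp add: power2_eq_1_iff abs_if split: if_splits)
    then have "(nrm f)\<^sup>2 * (nrm f)\<^sup>2 = (?\<sigma> f (Jop f))\<^sup>2"
      unfolding 1 by (simp only: power_mult_distrib power2_eq_square[of "(nrm f)\<^sup>2"] mult_1)
    also have "\<dots> \<le> X * ?\<sigma> (Jop f) (Jop f)" using cauchy_schwarz[OF fL(1) JL] unfolding 2 .
    also have "\<dots> \<le> X * (k * (nrm f)\<^sup>2)" using 3 X by (rule mult_left_mono)
    finally have 4: "(nrm f)\<^sup>2 * (nrm f)\<^sup>2 \<le> (k * X) * (nrm f)\<^sup>2" by (simp only: mult_ac)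
    have "(nrm f)\<^sup>2 \<le> k * X"
    proof (cases "nrm f = 0")
      case True
      then show ?thesis using X k(1) by simp
    next
      case False
      then have "(nrm f)\<^sup>2 > 0" by simp
      with 4 show ?thesis by (rule mult_right_le_imp_le)
    qed
    then show ?thesis by (simp add: X_def)
  qed
  have est: "\<bar>Im z\<bar> * nrm (E (\<Delta> s) u) \<le> k * nrm (E (\<Delta> s) (\<lambda>x. v x - z * u x))"
    if s: "\<Delta> s \<in> spec_ring" "\<forall>\<^sub>F s' in F. \<Delta> s \<subseteq> \<Delta> s'" and uv: "(u, v) \<in> T" for s u v z
  proof -
    have L: "u \<in> L2 M" "v \<in> L2 M" using T_L2[OF uv] by auto
    define U V W where "U = E (\<Delta> s) u" and "V = E (\<Delta> s) v" and "W = (\<lambda>x. V x - z * U x)"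
    have UV: "(U, V) \<in> T" unfolding U_def V_def by (rule E_T[OF s(1) uv])
    have UL: "U \<in> L2 M" "V \<in> L2 M" using T_L2[OF UV] by auto
    have WL: "W \<in> L2 M" unfolding W_def by (rule L2_diff[OF UL(2,1)])
    have "j_inner M W U = j_inner M V U - z * j_inner M U U" unfolding W_def by (rule j_diff[OF UL(2,1,1)])
    moreover have "Im (j_inner M V U) = 0" using T_sym[OF UV UV] j_cnj[of V U] by (simp add: complex_eq_iff)
    moreover have "Im (j_inner M U U) = 0" using j_cnj[of U U] by (simp add: complex_eq_iff)
    \<comment> \<open>By symmetry \<open>[V, U]\<close> and \<open>[U, U]\<close> are real, so only
      the term with \<open>Im z\<close> survives.\<close>
    ultimately have "Im (j_inner M W U) = - Im z * Re (j_inner M U U)" by simp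
    then have "\<bar>Im z\<bar> * (\<eta> * Re (j_inner M U U)) \<le> \<bar>Im (j_inner M W U)\<bar>"
      using \<eta> by (simp add: abs_mult abs_if split: if_splits)
        (smt (verit) mult_minus_right mult_nonneg_nonneg mult_nonpos_nonneg zero_le_mult_iff)
    also have "\<dots> \<le> nrm W * nrm U" using abs_Im_le_cmod j_bound[OF WL UL(1)] by (rule order_trans)
    finally have 1: "\<bar>Im z\<bar> * (\<eta> * Re (j_inner M U U)) \<le> nrm W * nrm U" .
    have "\<bar>Im z\<bar> * (nrm U)\<^sup>2 \<le> \<bar>Im z\<bar> * (k * (\<eta> * Re (j_inner M U U)))"
      using upos[OF s E_in_range[OF s(1) L(1)]] unfolding U_def by (rule mult_left_mono) simp
    also have "\<dots> \<le> k * (nrm W * nrm U)" using 1 k(1) by (simp add: mult.left_commute)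
    finally have "(\<bar>Im z\<bar> * nrm U) * nrm U \<le> (k * nrm W) * nrm U" by (simp add: power2_eq_square mult_ac)
    then have "\<bar>Im z\<bar> * nrm U \<le> k * nrm W"
      using l2_norm_nonneg[of M U] l2_norm_nonneg[of M W] k(1)
      by (cases "nrm U = 0") (auto simp: mult_le_cancel_right)
    also have "nrm W = nrm (E (\<Delta> s) (\<lambda>x. 1 * v x + (- z) * u x))"
      using E_lincomb[OF s(1) L(2,1), of 1 "- z"]
      by (intro l2_norm_cong_AE WL E_L2[OF s(1)] L2_lincomb L) (auto simp: W_def U_def V_def elim: eventually_mono)
    finally show ?thesis by (simp add: U_def)
  qed
  have nlim: "((\<lambda>s. nrm (E (\<Delta> s) f)) \<longlongrightarrow> nrm (P f)) F" if f: "f \<in> L2 M" for f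
  proof -
    have "\<forall>\<^sub>F s in F. norm (nrm (E (\<Delta> s) f) - nrm (P f)) \<le> nrm (\<lambda>x. E (\<Delta> s) f x - P f x)"
      using ring by eventually_elim (simp add: l2_norm_reverse_triangle E_L2 PL f)
    then have "((\<lambda>s. nrm (E (\<Delta> s) f) - nrm (P f)) \<longlongrightarrow> 0) F" using lim[OF f] by (rule Lim_null_comparison)
    then show ?thesis by (rule LIM_zero_cancel)
  qed
  show thesis
  \<comment> \<open>One factor \<open>k\<close> comes from definiteness, the other from the bound of
    \<open>P\<close>.\<close>
  proof (rule that[of "k * k"])
    fix u v z assume uv: "(u, v) \<in> T"
    have L: "u \<in> L2 M" "v \<in> L2 M" using T_L2[OF uv] by auto
    have W: "(\<lambda>x. v x - z * u x) \<in> L2 M" by (rule L2_diff[OF L(2,1)])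
    have "\<bar>Im z\<bar> * nrm (P u) \<le> k * nrm (P (\<lambda>x. v x - z * u x))"
    proof (rule tendsto_le[OF F])
      show "((\<lambda>s. \<bar>Im z\<bar> * nrm (E (\<Delta> s) u)) \<longlongrightarrow> \<bar>Im z\<bar> * nrm (P u)) F"
        by (intro tendsto_intros nlim L)
      show "((\<lambda>s. k * nrm (E (\<Delta> s) (\<lambda>x. v x - z * u x))) \<longlongrightarrow> k * nrm (P (\<lambda>x. v x - z * u x))) F"
        by (intro tendsto_intros nlim W)
      show "\<forall>\<^sub>F s in F. \<bar>Im z\<bar> * nrm (E (\<Delta> s) u) \<le> k * nrm (E (\<Delta> s) (\<lambda>x. v x - z * u x))"
        using ring nest by eventually_elim (rule est[OF _ _ uv])
    qed
    also have "\<dots> \<le> k * (k * nrm (\<lambda>x. v x - z * u x))" using k W by (intro mult_left_mono) auto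
    finally show "\<bar>Im z\<bar> * nrm (P u) \<le> k * k * nrm (\<lambda>x. v x - z * u x)" by simp
  qed (use k in simp)
qed

text \<open>A resolvent bound \<open>C z\<close> at one point persists with a factor 2 on the ball
  of radius \<open>1 / (2 * C z)\<close>; finitely many such balls cover \<open>Z\<close>.\<close>

lemma compact_lower_bound:
  assumes \<Delta>: "\<Delta> \<in> spec_ring" and "compact Z"
    and Z: "\<And>z t. z \<in> Z \<Longrightarrow> z = of_real t \<Longrightarrow> t \<notin> closure {s. Some s \<in> \<Delta>}"
  obtains c where "c > 0" "\<And>z u v. z \<in> Z \<Longrightarrow> (u, v) \<in> T \<Longrightarrow> u \<in> op_range M (E \<Delta>) \<Longrightarrow> v \<in> op_range M (E \<Delta>) \<Longrightarrow>
    c * nrm u \<le> nrm (\<lambda>x. v x - z * u x)"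
proof -
  let ?K = "op_range M (E \<Delta>)"
  have KL: "f \<in> L2 M" if "f \<in> ?K" for f using that by (simp add: op_range_def)
  have "\<exists>C>0. \<forall>u v. (u, v) \<in> T \<longrightarrow> u \<in> ?K \<longrightarrow> v \<in> ?K \<longrightarrow> nrm u \<le> C * nrm (\<lambda>x. v x - z * u x)" if z: "z \<in> Z" for z
  proof -
    obtain R where R: "is_resolvent M ?K T z R" using E_spectrum[OF \<Delta> Z[OF z]] by blast
    obtain C where C: "C > 0" "\<And>f. f \<in> ?K \<Longrightarrow> nrm (R f) \<le> C * nrm f"
      using bounded_op_bound[OF resolventD(1)[OF R]] by blast
    have "nrm u \<le> C * nrm (\<lambda>x. v x - z * u x)" if uv: "(u, v) \<in> T" "u \<in> ?K" "v \<in> ?K" for u v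
    proof -
      have "(\<lambda>x. 1 * v x + (- z) * u x) \<in> ?K"
        using lin_subspace_range[OF \<Delta>] uv(2,3) unfolding lin_subspace_def by blast
      then have w: "(\<lambda>x. v x - z * u x) \<in> ?K" by simp
      have "u \<simeq> R (\<lambda>x. v x - z * u x)" using resolventD(2)[OF R uv(2) w] uv(1) by simp
      then have "nrm u = nrm (R (\<lambda>x. v x - z * u x))" by (intro l2_norm_cong_AE KL uv resolventD(3)[OF R w])
      then show ?thesis using C(2)[OF w] by simp
    qed
    then show ?thesis using C(1) by blast
  qed
  then obtain C where C: "\<And>z. z \<in> Z \<Longrightarrow> C z > 0"
    "\<And>z u v. z \<in> Z \<Longrightarrow> (u, v) \<in> T \<Longrightarrow> u \<in> ?K \<Longrightarrow> v \<in> ?K \<Longrightarrow> nrm u \<le> C z * nrm (\<lambda>x. v x - z * u x)"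
    by metis
  obtain D where D: "D \<subseteq> Z" "finite D" "Z \<subseteq> (\<Union>z\<in>D. ball z (1 / (2 * C z)))"
    by (rule compactE_image[OF \<open>compact Z\<close>, of Z "\<lambda>z. ball z (1 / (2 * C z))"]) (use C(1) in auto)
  \<comment> \<open>The extra 1 keeps \<open>Min\<close> meaningful when \<open>D\<close> is
    empty.\<close>
  define c where "c = Min (insert 1 ((\<lambda>z. 1 / (2 * C z)) ` D))"
  have c: "c > 0" "\<And>z. z \<in> D \<Longrightarrow> c \<le> 1 / (2 * C z)"
    using D C(1) by (auto simp: c_def subset_iff)
  show thesis
  proof (rule that[OF c(1)])
    fix z u v assume z: "z \<in> Z" and uv: "(u, v) \<in> T" "u \<in> ?K" "v \<in> ?K"
    obtain z0 where z0: "z0 \<in> D" "dist z0 z < 1 / (2 * C z0)" using D(3) z by auto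
    have p: "C z0 > 0" using C(1) z0(1) D(1) by blast
    have L: "u \<in> L2 M" "v \<in> L2 M" using T_L2[OF uv(1)] by auto
    have "(\<lambda>x. v x - z0 * u x) = (\<lambda>x. (v x - z * u x) + (z - z0) * u x)" by (simp add: algebra_simps)
    then have "nrm (\<lambda>x. v x - z0 * u x) \<le> nrm (\<lambda>x. v x - z * u x) + cmod (z - z0) * nrm u"
      using l2_norm_triangle[OF L2_diff[OF L(2,1), of z] L2_scale[OF L(1), of "z - z0"]] by (simp add: l2_norm_scale)
    also have "\<dots> \<le> nrm (\<lambda>x. v x - z * u x) + 1 / (2 * C z0) * nrm u"
      using z0(2) by (intro add_left_mono mult_right_mono l2_norm_nonneg) (simp add: dist_norm norm_minus_commute)
    finally have "C z0 * nrm (\<lambda>x. v x - z0 * u x) \<le> C z0 * (nrm (\<lambda>x. v x - z * u x) + 1 / (2 * C z0) * nrm u)"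
      using p by simp
    then have "nrm u \<le> C z0 * nrm (\<lambda>x. v x - z * u x) + nrm u / 2"
      using C(2)[OF _ uv, of z0] z0(1) D(1) p by (auto simp: algebra_simps)
    then have "1 / (2 * C z0) * nrm u \<le> nrm (\<lambda>x. v x - z * u x)" using p by (simp add: field_simps)
    moreover have "c * nrm u \<le> 1 / (2 * C z0) * nrm u" by (intro mult_right_mono c z0 l2_norm_nonneg)
    ultimately show "c * nrm u \<le> nrm (\<lambda>x. v x - z * u x)" by linarith
  qed
qed

section \<open>The parts concentrated at the critical points\<close>

lemma form_semi_inner:
  assumes K: "lin_subspace M K" and S: "bounded_op M K S"
    and Ssym: "\<And>u v. u \<in> K \<Longrightarrow> v \<in> K \<Longrightarrow> j_inner M (S u) v = j_inner M u (S v)"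
    and Spos: "\<And>u. u \<in> K \<Longrightarrow> Re (j_inner M (S u) u) \<ge> 0"
  shows "semi_inner K (\<lambda>u v. Re (j_inner M (S u) v))"
proof -
  have KL: "f \<in> L2 M" if "f \<in> K" for f using K that by (auto simp: lin_subspace_def)
  have lin: "(\<lambda>x. a * f x + b * g x) \<in> K" if "f \<in> K" "g \<in> K" for f g a b
    using K that unfolding lin_subspace_def by blast
  have SK: "S f \<in> K" if "f \<in> K" for f using S that by (auto simp: bounded_op_def)
  have Slin: "S (\<lambda>x. a * f x + b * g x) \<simeq> (\<lambda>x. a * S f x + b * S g x)" if "f \<in> K" "g \<in> K" for f g a b
    using S that unfolding bounded_op_def by blast
  let ?\<sigma> = "\<lambda>u v. Re (j_inner M (S u) v)"
  show "semi_inner K ?\<sigma>"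
  proof
    show "?\<sigma> (\<lambda>x. complex_of_real a * u x + complex_of_real b * v x) w = a * ?\<sigma> u w + b * ?\<sigma> v w"
      if uvw: "u \<in> K" "v \<in> K" "w \<in> K" for u v w a b
    proof -
      have "j_inner M (S (\<lambda>x. complex_of_real a * u x + complex_of_real b * v x)) w =
          j_inner M (\<lambda>x. complex_of_real a * S u x + complex_of_real b * S v x) w"
        using uvw by (intro j_cong KL lin SK Slin) auto
      then show ?thesis using j_lincomb[OF KL[OF SK[OF uvw(1)]] KL[OF SK[OF uvw(2)]] KL[OF uvw(3)]] by simp
    qed
    show "?\<sigma> u v = ?\<sigma> v u" if "u \<in> K" "v \<in> K" for u v
      using Ssym[OF that] j_cnj[of u "S v"] by simp
  qed (use lin Spos in auto)
qed

text \<open>In the form \<open>[S u, v]\<close> the Rayleigh quotient of \<open>S\<close> is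
  \<open>[S S u, u] / [S u, u]\<close>. Real points \<open>m\<close> of modulus above \<rho> are
  resolvent points of \<open>S\<close>, so \<open>rayleigh_bound\<close>, which is one-sided,
  applies both to \<open>S\<close> and to \<open>- S\<close>.\<close>

lemma form_bound:
  assumes K: "lin_subspace M K" and S: "bounded_op M K S"
    and Ssym: "\<And>u v. u \<in> K \<Longrightarrow> v \<in> K \<Longrightarrow> j_inner M (S u) v = j_inner M u (S v)"
    and Spos: "\<And>u. u \<in> K \<Longrightarrow> Re (j_inner M (S u) u) \<ge> 0" and "\<rho> \<ge> 0"
    and inv: "\<And>m. \<bar>m\<bar> > \<rho> \<Longrightarrow> \<exists>C. bounded_op M K C \<and> (\<forall>u\<in>K. C (\<lambda>x. of_real m * u x - S u x) \<simeq> u \<and>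
      (\<lambda>x. of_real m * C u x - S (C u) x) \<simeq> u)"
    and u: "u \<in> K"
  shows "\<bar>Re (j_inner M (S (S u)) u)\<bar> \<le> \<rho> * Re (j_inner M (S u) u)"
proof -
  have KL: "f \<in> L2 M" if "f \<in> K" for f using K that by (auto simp: lin_subspace_def)
  have lin: "(\<lambda>x. a * f x + b * g x) \<in> K" if "f \<in> K" "g \<in> K" for f g a b
    using K that unfolding lin_subspace_def by blast
  have SK: "S f \<in> K" if "f \<in> K" for f using S that by (auto simp: bounded_op_def)
  let ?\<sigma> = "\<lambda>u v. Re (j_inner M (S u) v)"
  interpret semi_inner K ?\<sigma> by (rule form_semi_inner[OF K S Ssym Spos])
  obtain c where c: "c > 0" "\<And>f. f \<in> K \<Longrightarrow> nrm (S f) \<le> c * nrm f" using bounded_op_bound[OF S] by blast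
  have bnd: "?\<sigma> f f \<le> c * (nrm f)\<^sup>2" if f: "f \<in> K" for f
  proof -
    have "?\<sigma> f f \<le> cmod (j_inner M (S f) f)" by (rule complex_Re_le_cmod)
    also have "\<dots> \<le> nrm (S f) * nrm f" by (intro j_bound KL SK f)
    also have "\<dots> \<le> c * nrm f * nrm f" by (intro mult_right_mono c f l2_norm_nonneg)
    finally show ?thesis by (simp add: power2_eq_square)
  qed
  have sS: "?\<sigma> (S f) g = ?\<sigma> f (S g)" if "f \<in> K" "g \<in> K" for f g
    using Ssym[OF SK[OF that(1)] that(2)] by simp
  have \<sigma>cong: "?\<sigma> f h = ?\<sigma> g h" if "f \<in> K" "g \<in> K" "h \<in> K" "f \<simeq> g" for f g h
    using that bounded_op_cong[OF S K that(1,2,4)] by (auto intro!: arg_cong[where f = Re] j_cong KL SK)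
  have upper: "?\<sigma> (S u) u \<le> \<rho> * ?\<sigma> u u"
  proof (rule rayleigh_bound[where S = S and N = nrm and D = c and c = c])
    fix m :: real assume "m > \<rho>"
    then have "\<bar>m\<bar> > \<rho>" using \<open>\<rho> \<ge> 0\<close> by simp
    then obtain C where C: "bounded_op M K C"
      "\<And>u. u \<in> K \<Longrightarrow> C (\<lambda>x. of_real m * u x - S u x) \<simeq> u"
      "\<And>u. u \<in> K \<Longrightarrow> (\<lambda>x. of_real m * C u x - S (C u) x) \<simeq> u" using inv by blast
    obtain k where k: "k > 0" "\<And>f. f \<in> K \<Longrightarrow> nrm (C f) \<le> k * nrm f" using bounded_op_bound[OF C(1)] by blast
    have CK: "C f \<in> K" if "f \<in> K" for f using C(1) that by (auto simp: bounded_op_def)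
    have TK: "(\<lambda>x. of_real m * f x - S f x) \<in> K" if "f \<in> K" for f using lin[OF that SK[OF that], of "of_real m" "-1"] by simp
    have "m * ?\<sigma> (C f) g - ?\<sigma> (S (C f)) g = ?\<sigma> f g" if "f \<in> K" "g \<in> K" for f g
    proof -
      have "m * ?\<sigma> (C f) g - ?\<sigma> (S (C f)) g = ?\<sigma> (\<lambda>x. of_real m * C f x - S (C f) x) g"
        using lincomb[OF CK[OF that(1)] SK[OF CK[OF that(1)]] that(2), of m "-1"] by simp
      also have "\<dots> = ?\<sigma> f g" by (intro \<sigma>cong TK CK that C(3))
      finally show ?thesis .
    qed
    moreover have "?\<sigma> (C (\<lambda>x. of_real m * f x - S f x)) g = ?\<sigma> f g" if "f \<in> K" "g \<in> K" for f g
      by (intro \<sigma>cong CK TK that C(2))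
    ultimately show "\<exists>C k. k > 0 \<and> (\<forall>u\<in>K. C u \<in> K \<and> nrm (C u) \<le> k * nrm u \<and>
       (\<forall>v\<in>K. ?\<sigma> (C (\<lambda>x. of_real m * u x - S u x)) v = ?\<sigma> u v \<and>
              m * ?\<sigma> (C u) v - ?\<sigma> (S (C u)) v = ?\<sigma> u v))"
      using k CK by (intro exI[of _ C] exI[of _ k]) auto
  qed (use SK sS bnd c \<open>\<rho> \<ge> 0\<close> u l2_norm_nonneg in auto)
  define S' where "S' u = (\<lambda>x. - S u x)" for u
  have neg: "(\<lambda>x. - f x) \<in> K" if "f \<in> K" for f using lin[OF that that, of "-1" 0] by simp
  have S'K: "S' f \<in> K" if "f \<in> K" for f unfolding S'_def by (intro neg SK that)
  have negl: "?\<sigma> (\<lambda>x. - f x) g = - ?\<sigma> f g" if "f \<in> K" "g \<in> K" for f g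
    using lincomb[OF that(1,1,2), of "-1" 0] by simp
  have S's: "?\<sigma> (S' f) g = - ?\<sigma> (S f) g" if "f \<in> K" "g \<in> K" for f g
    unfolding S'_def by (rule negl[OF SK[OF that(1)] that(2)])
  have "?\<sigma> (S' u) u \<le> \<rho> * ?\<sigma> u u"
  proof (rule rayleigh_bound[where S = S' and N = nrm and D = c and c = c])
    fix m :: real assume "m > \<rho>"
    then have "\<bar>- m\<bar> > \<rho>" using \<open>\<rho> \<ge> 0\<close> by simp
    then obtain C where C: "bounded_op M K C"
      "\<And>u. u \<in> K \<Longrightarrow> C (\<lambda>x. of_real (- m) * u x - S u x) \<simeq> u"
      "\<And>u. u \<in> K \<Longrightarrow> (\<lambda>x. of_real (- m) * C u x - S (C u) x) \<simeq> u" using inv by blast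
    obtain k where k: "k > 0" "\<And>f. f \<in> K \<Longrightarrow> nrm (C f) \<le> k * nrm f" using bounded_op_bound[OF C(1)] by blast
    \<comment> \<open>\<open>m - S'\<close> is the negative of \<open>- m - S\<close>, so its
      inverse is the inverse \<open>C\<close> of the latter applied to \<open>- u\<close>.\<close>
    define C' where "C' u = C (\<lambda>x. - u x)" for u
    have CK: "C f \<in> K" if "f \<in> K" for f using C(1) that by (auto simp: bounded_op_def)
    have C'K: "C' f \<in> K" if "f \<in> K" for f unfolding C'_def by (intro CK neg that)
    have TK: "(\<lambda>x. of_real (- m) * f x - S f x) \<in> K" if "f \<in> K" for f using lin[OF that SK[OF that], of "of_real (- m)" "-1"] by simp
    have "m * ?\<sigma> (C' f) g - ?\<sigma> (S' (C' f)) g = ?\<sigma> f g" if fg: "f \<in> K" "g \<in> K" for f g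
    proof -
      have "- m * ?\<sigma> (C' f) g - ?\<sigma> (S (C' f)) g = ?\<sigma> (\<lambda>x. of_real (- m) * C' f x - S (C' f) x) g"
        using lincomb[OF C'K[OF that(1)] SK[OF C'K[OF that(1)]] that(2), of "- m" "-1"] by simp
      also have "\<dots> = ?\<sigma> (\<lambda>x. - f x) g" using C(3)[OF neg[OF fg(1)]] unfolding C'_def
        by (intro \<sigma>cong TK CK fg neg)
      finally show ?thesis using S's[OF C'K[OF fg(1)] fg(2)] negl[OF fg] by simp
    qed
    moreover have "?\<sigma> (C' (\<lambda>x. of_real m * f x - S' f x)) g = ?\<sigma> f g" if "f \<in> K" "g \<in> K" for f g
    proof -
      have "C' (\<lambda>x. of_real m * f x - S' f x) = C (\<lambda>x. of_real (- m) * f x - S f x)"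
        unfolding C'_def S'_def by (rule arg_cong[of _ _ C]) auto
      then show ?thesis using \<sigma>cong[OF CK[OF TK[OF that(1)]] that C(2)[OF that(1)]] by simp
    qed
    moreover have "nrm (C' f) \<le> k * nrm f" if "f \<in> K" for f
      using k(2)[OF neg[OF that]] l2_norm_scale[of M "-1" f] by (simp add: C'_def)
    ultimately show "\<exists>C k. k > 0 \<and> (\<forall>u\<in>K. C u \<in> K \<and> nrm (C u) \<le> k * nrm u \<and>
       (\<forall>v\<in>K. ?\<sigma> (C (\<lambda>x. of_real m * u x - S' u x)) v = ?\<sigma> u v \<and>
              m * ?\<sigma> (C u) v - ?\<sigma> (S' (C u)) v = ?\<sigma> u v))"
      using k(1) C'K by (intro exI[of _ C'] exI[of _ k]) auto
  next
    show "?\<sigma> (S' f) g = ?\<sigma> f (S' g)" if "f \<in> K" "g \<in> K" for f g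
      using S's[OF that] S's[OF that(2,1)] sym that S'K sS SK by simp
    show "nrm (S' f) \<le> c * nrm f" if "f \<in> K" for f
      using c(2)[OF that] l2_norm_scale[of M "-1" "S f"] by (simp add: S'_def)
  qed (use S'K bnd c \<open>\<rho> \<ge> 0\<close> u l2_norm_nonneg in auto)
  then show "\<bar>Re (j_inner M (S (S u)) u)\<bar> \<le> \<rho> * Re (j_inner M (S u) u)"
    using upper S's[OF u u] by simp
qed

text \<open>The vanishing diagonal \<open>Re [S u, S u]\<close> on \<open>N\<close> polarises to
  \<open>Re [S u, S v] = 0\<close>. Hence \<open>w = S u\<close> is a null vector of the form
  \<open>Re [S u, v]\<close>, and by Cauchy-Schwarz \<open>Re [S w, h] = 0\<close> for every
  \<open>h\<close> in the range; a suitable \<open>h\<close> gives the norm of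
  \<open>S w\<close>.\<close>

lemma square_zero:
  assumes \<Delta>: "\<Delta> \<in> spec_ring" and S: "bounded_op M (op_range M (E \<Delta>)) S"
    and Ssym: "\<And>u v. u \<in> op_range M (E \<Delta>) \<Longrightarrow> v \<in> op_range M (E \<Delta>) \<Longrightarrow> j_inner M (S u) v = j_inner M u (S v)"
    and Spos: "\<And>u. u \<in> op_range M (E \<Delta>) \<Longrightarrow> Re (j_inner M (S u) u) \<ge> 0"
    and N: "N \<subseteq> op_range M (E \<Delta>)" "\<And>u. u \<in> N \<Longrightarrow> S u \<in> N" "\<And>u v. u \<in> N \<Longrightarrow> v \<in> N \<Longrightarrow> (\<lambda>x. 1 * u x + 1 * v x) \<in> N"
    and zero: "\<And>u. u \<in> N \<Longrightarrow> Re (j_inner M (S (S u)) u) = 0" and u: "u \<in> N"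
  shows "S (S u) \<simeq> (\<lambda>x. 0)"
proof -
  let ?K = "op_range M (E \<Delta>)" and ?\<sigma> = "\<lambda>u v. Re (j_inner M (S u) v)"
  interpret semi_inner ?K ?\<sigma>
    by (rule form_semi_inner[OF lin_subspace_range[OF \<Delta>] S Ssym Spos])
  have NK: "f \<in> ?K" if "f \<in> N" for f using N(1) that by blast
  have KL: "f \<in> L2 M" if "f \<in> ?K" for f using that by (simp add: op_range_def)
  have SK: "S f \<in> ?K" if "f \<in> ?K" for f using S that by (auto simp: bounded_op_def)
  have diag: "Re (j_inner M (S f) (S f)) = 0" if "f \<in> N" for f
    using zero[OF that] Ssym[OF SK[OF NK[OF that]] NK[OF that]] by simp
  have off: "Re (j_inner M (S f) (S g)) = 0" if fg: "f \<in> N" "g \<in> N" for f g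
  proof -
    let ?h = "\<lambda>x. 1 * f x + 1 * g x"
    have L: "S f \<in> L2 M" "S g \<in> L2 M" using KL SK NK fg by auto
    have h: "?h \<in> N" by (rule N(3)[OF fg])
    have eq: "S ?h \<simeq> (\<lambda>x. 1 * S f x + 1 * S g x)" using S NK[OF fg(1)] NK[OF fg(2)] unfolding bounded_op_def by blast
    have hL: "S ?h \<in> L2 M" "(\<lambda>x. 1 * S f x + 1 * S g x) \<in> L2 M"
      by (rule KL[OF SK[OF NK[OF h]]], rule L2_lincomb[OF L])
    have "j_inner M (S ?h) (S ?h) = j_inner M (\<lambda>x. 1 * S f x + 1 * S g x) (S ?h)"
      by (intro j_cong hL eq) simp
    also have "\<dots> = j_inner M (S f) (S ?h) + j_inner M (S g) (S ?h)"
      using j_lincomb[OF L hL(1), of 1 1] by simp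
    also have "j_inner M (S f) (S ?h) = cnj (j_inner M (S f) (S f) + j_inner M (S g) (S f))"
      using j_cong[OF hL L(1) L(1) eq] j_lincomb[OF L L(1), of 1 1] j_cnj[of "S f" "S ?h"] by simp
    also have "j_inner M (S g) (S ?h) = cnj (j_inner M (S f) (S g) + j_inner M (S g) (S g))"
      using j_cong[OF hL L(2) L(2) eq] j_lincomb[OF L L(2), of 1 1] j_cnj[of "S g" "S ?h"] by simp
    finally have "Re (j_inner M (S ?h) (S ?h)) = Re (j_inner M (S f) (S f)) + Re (j_inner M (S g) (S f))
        + Re (j_inner M (S f) (S g)) + Re (j_inner M (S g) (S g))" by simp
    moreover have "Re (j_inner M (S g) (S f)) = Re (j_inner M (S f) (S g))" using j_cnj[of "S g" "S f"] by simp
    ultimately show ?thesis using diag[OF fg(1)] diag[OF fg(2)] diag[OF h] by simp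
  qed
  define w where "w = S u"
  have w: "w \<in> N" "w \<in> ?K" using N(2)[OF u] NK by (auto simp: w_def)
  have "?\<sigma> w w = Re (j_inner M (S u) (S w))"
    using Ssym[OF w(2,2)] by (simp add: w_def)
  also have "\<dots> = 0" by (rule off[OF u w(1)])
  finally have ww: "?\<sigma> w w = 0" .
  have SwL: "S w \<in> L2 M" "E \<Delta> (S w) \<simeq> S w" using SK[OF w(2)] by (auto simp: op_range_iff[OF \<Delta>])
  have JL: "Jop (S w) \<in> L2 M" by (rule Jop_L2[OF SwL(1)])
  \<comment> \<open>\<open>Jop (S w)\<close> may leave the range; its projection has the same
    pairing with \<open>S w\<close>.\<close>
  let ?h = "E \<Delta> (Jop (S w))"
  have "(?\<sigma> w ?h)\<^sup>2 \<le> ?\<sigma> w w * ?\<sigma> ?h ?h" by (rule cauchy_schwarz[OF w(2) E_in_range[OF \<Delta> JL]])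
  then have "?\<sigma> w ?h = 0" using ww by simp
  moreover have "j_inner M (S w) ?h = j_inner M (S w) (Jop (S w))"
    using j_E[OF \<Delta> SwL(1) JL] j_cong[OF E_L2[OF \<Delta> SwL(1)] SwL(1) JL JL SwL(2)] by simp
  ultimately have "(nrm (S w))\<^sup>2 = 0" using j_Jop[OF SwL(1)] by simp
  then show ?thesis using l2_norm_eq_0_iff[OF SwL(1)] by (simp add: w_def)
qed

lemma range_lincomb: "\<Delta> \<in> spec_ring \<Longrightarrow> f \<in> op_range M (E \<Delta>) \<Longrightarrow> g \<in> op_range M (E \<Delta>) \<Longrightarrow> (\<lambda>x. a * f x + b * g x) \<in> op_range M (E \<Delta>)"
  using lin_subspace_range unfolding lin_subspace_def by blast

lemma abs_le_div_all:
  fixes x y :: real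
  assumes "\<And>t. t \<ge> e \<Longrightarrow> \<bar>x\<bar> \<le> 1 / t * y" "e > 0"
  shows "x = 0"
proof -
  have "((\<lambda>t. 1 / t * y) \<longlongrightarrow> 0 * y) at_top"
    by (intro tendsto_mult tendsto_const tendsto_divide_0[OF tendsto_const] filterlim_at_top_imp_at_infinity filterlim_ident)
  moreover have "\<forall>\<^sub>F t in at_top. \<bar>x\<bar> \<le> 1 / t * y"
    using eventually_ge_at_top[of e] by (rule eventually_mono) (rule assms(1))
  ultimately have "\<bar>x\<bar> \<le> 0 * y" by (rule tendsto_lowerbound) simp
  then show ?thesis by simp
qed

text \<open>At infinity, the restriction of \<open>T\<close> to the common part of the ranges of \<open>E\<close> has a
  quasi-nilpotent nonnegative inverse, which has square zero and is injective.\<close>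

lemma infinity_part:
  assumes "\<epsilon> > 0" and f: "\<And>t. t \<ge> \<epsilon> \<Longrightarrow> f \<in> op_range M (E (- (Some ` {-t..t})))"
  shows "f \<simeq> (\<lambda>x. 0)"
proof -
  define \<Delta> where "\<Delta> t = - (Some ` {-t..t})" for t :: real
  define K where "K t = op_range M (E (\<Delta> t))" for t
  have ring: "\<Delta> t \<in> spec_ring" if "t \<ge> \<epsilon>" for t
    using spec_ring_intervals(5)[of "-t" t] that \<open>\<epsilon> > 0\<close> by (simp add: \<Delta>_def)
  have KL: "g \<in> L2 M" if "g \<in> K t" for g t using that by (simp add: K_def op_range_def)
  have Klin: "lin_subspace M (K t)" if "t \<ge> \<epsilon>" for t unfolding K_def by (rule lin_subspace_range[OF ring[OF that]])
  have res: "\<exists>R. is_resolvent M (K t) T (of_real x) R" if t: "t \<ge> \<epsilon>" "\<bar>x\<bar> < t" for t x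
  proof -
    have "closure {s. Some s \<in> \<Delta> t} \<subseteq> {s. t \<le> \<bar>s\<bar>}"
    proof (rule closure_minimal)
      have "{s. Some s \<in> \<Delta> t} = - {-t..t}" by (auto simp: \<Delta>_def)
      then show "{s. Some s \<in> \<Delta> t} \<subseteq> {s. t \<le> \<bar>s\<bar>}" by auto
    qed (intro closed_Collect_le continuous_intros)
    then have "x \<notin> closure {s. Some s \<in> \<Delta> t}" using t by auto
    then show ?thesis unfolding K_def using E_spectrum[OF ring[OF t(1)], of "of_real x"] by (metis of_real_eq_iff)
  qed
  have "\<forall>t. t \<ge> \<epsilon> \<longrightarrow> (\<exists>R. is_resolvent M (K t) T 0 R)" using res[of _ 0] \<open>\<epsilon> > 0\<close> by simp
  then obtain B where B: "\<And>t. t \<ge> \<epsilon> \<Longrightarrow> is_resolvent M (K t) T 0 (B t)" by metis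
  have BK: "B t u \<in> K t" "(B t u, u) \<in> T" if "t \<ge> \<epsilon>" "u \<in> K t" for t u
    using resolventD(3,4)[OF B[OF that(1)] that(2)] by auto
  have Beq: "B t u \<simeq> g" if "t \<ge> \<epsilon>" "u \<in> K t" "g \<in> K t" "(g, u) \<in> T" for t u g
    using resolventD(2)[OF B[OF that(1)] that(3,2)] that(4) by (auto elim: eventually_mono)
  \<comment> \<open>On \<open>K t\<close> the spectrum of \<open>T\<close> avoids the open interval
    from \<open>- t\<close> to \<open>t\<close>, so that of its inverse lies within distance
    \<open>1 / t\<close> of 0.\<close>
  have form: "\<bar>Re (j_inner M (B t (B t u)) u)\<bar> \<le> 1 / t * Re (j_inner M (B t u) u)" if t: "t \<ge> \<epsilon>" and u: "u \<in> K t" for t u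
  proof (rule form_bound[OF Klin[OF t] resolventD(1)[OF B[OF t]] _ _ _ _ u])
    show "j_inner M (B t u) v = j_inner M u (B t v)" if "u \<in> K t" "v \<in> K t" for u v
      using T_sym[OF BK(2)[OF t that(1)] BK(2)[OF t that(2)]] by simp
    show "Re (j_inner M (B t u) u) \<ge> 0" if "u \<in> K t" for u
      using T_nonneg[OF BK(2)[OF t that]] j_cnj[of "B t u" u] by simp
    show "0 \<le> 1 / t" using t \<open>\<epsilon> > 0\<close> by simp
    fix m :: real assume m: "\<bar>m\<bar> > 1 / t"
    have "m \<noteq> 0" using m t \<open>\<epsilon> > 0\<close> by auto
    then have "\<bar>1 / m\<bar> < t" using m t \<open>\<epsilon> > 0\<close> by (auto simp: field_simps)
    then obtain R where R: "is_resolvent M (K t) T (of_real (1 / m)) R" using res[OF t] by blast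
    define a where "a = complex_of_real (1 / m)"
    have am: "a * of_real m = 1" using \<open>m \<noteq> 0\<close> by (simp add: a_def)
    \<comment> \<open>With \<open>a = 1 / m\<close> and \<open>R\<close> the resolvent of
      \<open>T\<close> at \<open>a\<close>, the inverse of \<open>m - B t\<close> is
      \<open>a + a\<^sup>2 R\<close>.\<close>
    define C where "C f = (\<lambda>x. a * f x + a\<^sup>2 * R f x)" for f
    have Cb: "bounded_op M (K t) C" unfolding C_def by (rule bounded_op_lincomb[OF Klin[OF t] resolventD(1)[OF R]])
    have lin: "(\<lambda>x. b * f x + c * g x) \<in> K t" if "f \<in> K t" "g \<in> K t" for f g b c
      using Klin[OF t] that unfolding lin_subspace_def by blast
    have 1: "C (\<lambda>x. of_real m * u x - B t u x) \<simeq> u" if u: "u \<in> K t" for u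
    proof -
      let ?w = "\<lambda>x. of_real m * u x - B t u x" and ?g = "\<lambda>x. of_real m * B t u x"
      have w: "?w \<in> K t" using lin[OF u BK(1)[OF t u], of "of_real m" "-1"] by simp
      have g: "?g \<in> K t" using lin[OF BK(1)[OF t u] BK(1)[OF t u], of "of_real m" 0] by simp
      have "(?g, \<lambda>x. of_real m * u x) \<in> T"
        using T_lincomb[OF BK(2)[OF t u] BK(2)[OF t u], of "of_real m" 0] by simp
      also have "(\<lambda>x. of_real m * u x) = (\<lambda>x. ?w x + of_real (1 / m) * ?g x)" using \<open>m \<noteq> 0\<close> by auto
      finally have "?g \<simeq> R ?w" using resolventD(2)[OF R g w] by simp
      then show ?thesis unfolding C_def
      proof eventually_elim
        case (elim x)
        show ?case unfolding elim[symmetric] using am by algebra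
      qed
    qed
    have 2: "(\<lambda>x. of_real m * C u x - B t (C u) x) \<simeq> u" if u: "u \<in> K t" for u
    proof -
      have Ru: "R u \<in> K t" "(R u, \<lambda>x. u x + a * R u x) \<in> T"
        using resolventD(3,4)[OF R u] by (auto simp: a_def)
      have CK: "C u \<in> K t" unfolding C_def by (rule lin[OF u Ru(1)])
      have "((\<lambda>x. a * R u x), C u) \<in> T"
        using T_lincomb[OF Ru(2) Ru(2), of a 0] unfolding C_def by (simp add: algebra_simps power2_eq_square)
      moreover have "(\<lambda>x. a * R u x) \<in> K t" using lin[OF Ru(1) Ru(1), of a 0] by simp
      ultimately have "B t (C u) \<simeq> (\<lambda>x. a * R u x)" using Beq[OF t CK] by blast
      then show ?thesis
      proof eventually_elim
        case (elim x)
        have "C u x = a * u x + a\<^sup>2 * R u x" by (simp add: C_def)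
        then show ?case unfolding elim using am by algebra
      qed
    qed
    show "\<exists>C. bounded_op M (K t) C \<and> (\<forall>u\<in>K t. C (\<lambda>x. of_real m * u x - B t u x) \<simeq> u \<and>
      (\<lambda>x. of_real m * C u x - B t (C u) x) \<simeq> u)"
      using Cb 1 2 by blast
  qed
  \<comment> \<open>On the common part all the inverses \<open>B t\<close> agree a.e. and leave
    \<open>N\<close> invariant, so there the bound \<open>1 / t\<close> holds for
    \<open>B \<epsilon>\<close> with every \<open>t\<close>.\<close>
  define N where "N = (\<Inter>t\<in>{\<epsilon>..}. K t)"
  have NK: "u \<in> K t" if "u \<in> N" "t \<ge> \<epsilon>" for u t using that by (auto simp: N_def)
  have Kmono: "u \<in> K \<epsilon>" if "u \<in> K t" "t \<ge> \<epsilon>" for u t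
    unfolding K_def by (rule range_mono[OF ring[OF that(2)] ring[OF order_refl]]) (use that in \<open>auto simp: \<Delta>_def K_def\<close>)
  have Bt: "B \<epsilon> u \<simeq> B t u" if "u \<in> N" "t \<ge> \<epsilon>" for u t
    using Beq[OF order_refl NK[OF that(1) order_refl] Kmono[OF BK(1)[OF that(2) NK[OF that]] that(2)] BK(2)[OF that(2) NK[OF that]]] .
  have BN: "B \<epsilon> u \<in> N" if u: "u \<in> N" for u
    unfolding N_def
  proof (rule INT_I)
    fix t assume "t \<in> {\<epsilon>..}"
    then have t: "t \<ge> \<epsilon>" by simp
    have "B t u \<simeq> B \<epsilon> u" using Bt[OF u t] by eventually_elim simp
    then show "B \<epsilon> u \<in> K t" using op_range_cong[OF _ KL[OF BK(1)[OF order_refl NK[OF u order_refl]]]] BK(1)[OF t NK[OF u t]]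
      unfolding K_def by blast
  qed
  have zero: "Re (j_inner M (B \<epsilon> (B \<epsilon> u)) u) = 0" if u: "u \<in> N" for u
  proof (rule abs_le_div_all[OF _ \<open>\<epsilon> > 0\<close>])
    fix t assume t: "t \<ge> \<epsilon>"
    have uK: "u \<in> K t" "u \<in> K \<epsilon>" using NK[OF u] t by auto
    note u1 = Bt[OF u t]
    have BuN: "B \<epsilon> u \<in> N" by (rule BN[OF u])
    have "B \<epsilon> (B \<epsilon> u) \<simeq> B t (B \<epsilon> u)" by (rule Bt[OF BuN t])
    moreover have "B t (B \<epsilon> u) \<simeq> B t (B t u)"
      by (rule bounded_op_cong[OF resolventD(1)[OF B[OF t]] Klin[OF t] NK[OF BuN t] BK(1)[OF t uK(1)] u1])
    ultimately have u2: "B \<epsilon> (B \<epsilon> u) \<simeq> B t (B t u)" by eventually_elim simp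
    have L: "B \<epsilon> u \<in> L2 M" "B t u \<in> L2 M" "B \<epsilon> (B \<epsilon> u) \<in> L2 M" "B t (B t u) \<in> L2 M" "u \<in> L2 M"
      using KL NK[OF BuN order_refl] NK[OF BN[OF BuN] order_refl] BK(1)[OF t uK(1)] BK(1)[OF t BK(1)[OF t uK(1)]] uK by blast+
    show "\<bar>Re (j_inner M (B \<epsilon> (B \<epsilon> u)) u)\<bar> \<le> 1 / t * Re (j_inner M (B \<epsilon> u) u)"
      using form[OF t uK(1)] j_cong[OF L(3,4,5,5) u2] j_cong[OF L(1,2,5,5) u1] by simp
  qed
  have fN: "f \<in> N" using f by (auto simp: N_def K_def \<Delta>_def)
  have "B \<epsilon> (B \<epsilon> f) \<simeq> (\<lambda>x. 0)"
  proof (rule square_zero[OF ring[OF order_refl], where N = N and S = "B \<epsilon>"])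
    show "bounded_op M (op_range M (E (\<Delta> \<epsilon>))) (B \<epsilon>)" using resolventD(1)[OF B[OF order_refl]] by (simp add: K_def)
    show "j_inner M (B \<epsilon> u) v = j_inner M u (B \<epsilon> v)" if "u \<in> op_range M (E (\<Delta> \<epsilon>))" "v \<in> op_range M (E (\<Delta> \<epsilon>))" for u v
      using T_sym[OF BK(2)[OF order_refl] BK(2)[OF order_refl], of u v] that by (simp add: K_def)
    show "Re (j_inner M (B \<epsilon> u) u) \<ge> 0" if "u \<in> op_range M (E (\<Delta> \<epsilon>))" for u
      using T_nonneg[OF BK(2)[OF order_refl], of u] j_cnj[of "B \<epsilon> u" u] that by (simp add: K_def)
    show "N \<subseteq> op_range M (E (\<Delta> \<epsilon>))" by (auto simp: N_def K_def)
    show "(\<lambda>x. 1 * u x + 1 * v x) \<in> N" if "u \<in> N" "v \<in> N" for u v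
      unfolding N_def K_def by (rule INT_I) (rule range_lincomb, use ring NK[OF that(1)] NK[OF that(2)] in \<open>auto simp: K_def\<close>)
  qed (use BN zero fN in auto)
  \<comment> \<open>\<open>B \<epsilon>\<close> is injective, because \<open>T\<close> maps
    \<open>B \<epsilon> g\<close> back to \<open>g\<close>.\<close>
  then have "B \<epsilon> f \<simeq> (\<lambda>x. 0)" by (rule T_single[OF BK(2)[OF order_refl NK[OF BN[OF fN] order_refl]]])
  then show ?thesis by (rule T_single[OF BK(2)[OF order_refl NK[OF fN order_refl]]])
qed

text \<open>At zero, the restriction of \<open>T\<close> itself is quasi-nilpotent and nonnegative.\<close>

lemma zero_part:
  assumes "\<rho> > 0" and f: "\<And>t. 0 < t \<Longrightarrow> t \<le> \<rho> \<Longrightarrow> f \<in> op_range M (E (Some ` {-t<..<t}))"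
  obtains g h where "(f, g) \<in> T" "(g, h) \<in> T" "h \<simeq> (\<lambda>x. 0)"
proof -
  define \<Delta> where "\<Delta> t = (Some ` {-t<..<t})" for t :: real
  define K where "K t = op_range M (E (\<Delta> t))" for t
  have ring: "\<Delta> t \<in> spec_ring" if "t > 0" for t
    using spec_ring_intervals(2)[of "-t" t] that by (simp add: \<Delta>_def)
  have Klin: "lin_subspace M (K t)" if "t > 0" for t unfolding K_def by (rule lin_subspace_range[OF ring[OF that]])
  have lin: "(\<lambda>x. b * f x + c * g x) \<in> K t" if "t > 0" "f \<in> K t" "g \<in> K t" for f g b c t
    using Klin[OF that(1)] that unfolding lin_subspace_def by blast
  have bi: "{-t<..<t} \<in> bounded_intervals" if "t > 0" for t :: real
    using spec_ring_intervals(7)[of "-t" t] that by simp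
  have unique: "v \<simeq> v'" if "(u, v) \<in> T" "(u', v') \<in> T" "u \<simeq> u'" for u u' v v'
  proof -
    have "((\<lambda>x. 1 * u x + (- 1) * u' x), (\<lambda>x. 1 * v x + (- 1) * v' x)) \<in> T" by (rule T_lincomb[OF that(1,2)])
    moreover have "(\<lambda>x. 1 * u x + (- 1) * u' x) \<simeq> (\<lambda>x. 0)" using that(3) by eventually_elim simp
    ultimately have "(\<lambda>x. 1 * v x + (- 1) * v' x) \<simeq> (\<lambda>x. 0)" by (rule T_single)
    then show ?thesis by eventually_elim simp
  qed
  have TK: "v \<in> K t" if "t > 0" "u \<in> K t" "(u, v) \<in> T" for t u v
  proof -
    have u: "u \<in> L2 M" "E (\<Delta> t) u \<simeq> u" using that(2) ring[OF that(1)] by (auto simp: K_def op_range_iff)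
    have "E (\<Delta> t) v \<simeq> v" by (rule unique[OF E_T[OF ring[OF that(1)] that(3)] that(3) u(2)])
    then show ?thesis using T_L2[OF that(3)] ring[OF that(1)] by (simp add: K_def op_range_iff)
  qed
  \<comment> \<open>\<open>T\<close> is a graph; choosing values turns it into an operator on
    \<open>K t\<close>, all of which lies in the domain since the interval is bounded.\<close>
  define S where "S u = (SOME v. (u, v) \<in> T)" for u
  have ST: "(u, S u) \<in> T" if "t > 0" "u \<in> K t" for t u
  proof -
    have "u \<in> Domain T" using E_bounded_interval(1)[OF bi[OF that(1)]] that(2) by (auto simp: K_def \<Delta>_def)
    then obtain v where "(u, v) \<in> T" by blast
    then show ?thesis unfolding S_def by (rule someI[where P = "\<lambda>v. (u, v) \<in> T"])
  qed
  have SK: "S u \<in> K t" if "t > 0" "u \<in> K t" for t u by (rule TK[OF that ST[OF that]])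
  have Sb: "bounded_op M (K t) S" if t: "t > 0" for t
    unfolding bounded_op_def
  proof (intro conjI ballI allI)
    show "S u \<in> K t" if "u \<in> K t" for u by (rule SK[OF t that])
    show "S (\<lambda>x. a * u x + b * v x) \<simeq> (\<lambda>x. a * S u x + b * S v x)" if "u \<in> K t" "v \<in> K t" for u v a b
      by (rule unique[OF ST[OF t lin[OF t that]] T_lincomb[OF ST[OF t that(1)] ST[OF t that(2)]]]) simp
    show "\<exists>C. \<forall>u\<in>K t. nrm (S u) \<le> C * nrm u"
      using E_bounded_interval(2)[OF bi[OF t]] ST[OF t] unfolding K_def \<Delta>_def by blast
  qed
  have Ssym: "j_inner M (S u) v = j_inner M u (S v)" if "t > 0" "u \<in> K t" "v \<in> K t" for t u v
    by (rule T_sym[OF ST[OF that(1,2)] ST[OF that(1,3)]])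
  have Spos: "Re (j_inner M (S u) u) \<ge> 0" if "t > 0" "u \<in> K t" for t u by (rule T_nonneg[OF ST[OF that]])
  have form: "\<bar>Re (j_inner M (S (S u)) u)\<bar> \<le> t * Re (j_inner M (S u) u)" if t: "t > 0" and u: "u \<in> K t" for t u
  proof (rule form_bound[OF Klin[OF t] Sb[OF t] Ssym[OF t] Spos[OF t] _ _ u])
    fix m :: real assume m: "\<bar>m\<bar> > t"
    have "closure {s. Some s \<in> \<Delta> t} \<subseteq> {-t..t}" by (rule closure_minimal) (auto simp: \<Delta>_def)
    moreover have "m \<notin> {-t..t}" using m by auto
    ultimately have "m \<notin> closure {s. Some s \<in> \<Delta> t}" by blast
    then obtain R where R: "is_resolvent M (K t) T (of_real m) R"
      unfolding K_def using E_spectrum[OF ring[OF t], of "of_real m"] by (metis of_real_eq_iff)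
    \<comment> \<open>The inverse of \<open>m - S\<close> is minus the resolvent at
      \<open>m\<close>; the zero term fits the shape of \<open>bounded_op_lincomb\<close>.\<close>
    define C where "C f = (\<lambda>x. 0 * f x + (- 1) * R f x)" for f
    have Cb: "bounded_op M (K t) C" unfolding C_def by (rule bounded_op_lincomb[OF Klin[OF t] resolventD(1)[OF R]])
    have 1: "C (\<lambda>x. of_real m * u x - S u x) \<simeq> u" if u: "u \<in> K t" for u
    proof -
      let ?w = "\<lambda>x. of_real m * u x - S u x" and ?g = "\<lambda>x. - u x"
      have w: "?w \<in> K t" using lin[OF t u SK[OF t u], of "of_real m" "-1"] by simp
      have g: "?g \<in> K t" using lin[OF t u u, of "-1" 0] by simp
      have "(?g, \<lambda>x. - S u x) \<in> T"
        using T_lincomb[OF ST[OF t u] ST[OF t u], of "-1" 0] by simp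
      also have "(\<lambda>x. - S u x) = (\<lambda>x. ?w x + of_real m * ?g x)" by auto
      finally have "?g \<simeq> R ?w" using resolventD(2)[OF R g w] by simp
      then show ?thesis unfolding C_def by eventually_elim (metis add_0 minus_minus mult_minus1 mult_zero_left)
    qed
    have 2: "(\<lambda>x. of_real m * C u x - S (C u) x) \<simeq> u" if u: "u \<in> K t" for u
    proof -
      have Ru: "R u \<in> K t" "(R u, \<lambda>x. u x + of_real m * R u x) \<in> T"
        using resolventD(3,4)[OF R u] by auto
      have CK: "C u \<in> K t" unfolding C_def by (rule lin[OF t u Ru(1)])
      have "(C u, \<lambda>x. 0 * (u x + of_real m * R u x) + (- 1) * (u x + of_real m * R u x)) \<in> T"
        using T_lincomb[OF Ru(2) Ru(2), of 0 "-1"] unfolding C_def by simp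
      then have "S (C u) \<simeq> (\<lambda>x. 0 * (u x + of_real m * R u x) + (- 1) * (u x + of_real m * R u x))"
        by (rule unique[OF ST[OF t CK]]) simp
      then show ?thesis by eventually_elim (simp add: C_def)
    qed
    show "\<exists>C. bounded_op M (K t) C \<and> (\<forall>u\<in>K t. C (\<lambda>x. of_real m * u x - S u x) \<simeq> u \<and>
      (\<lambda>x. of_real m * C u x - S (C u) x) \<simeq> u)"
      using Cb 1 2 by blast
  qed (use t in auto)
  define N where "N = (\<Inter>t\<in>{0<..\<rho>}. K t)"
  have NK: "u \<in> K t" if "u \<in> N" "0 < t" "t \<le> \<rho>" for u t using that by (auto simp: N_def)
  have SN: "S u \<in> N" if u: "u \<in> N" for u unfolding N_def using SK NK[OF u] by auto
  have zero: "Re (j_inner M (S (S u)) u) = 0" if u: "u \<in> N" for u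
  proof (rule abs_le_div_all)
    \<comment> \<open>The radius of the interval is written \<open>1 / t\<close>, the form in which
      \<open>abs_le_div_all\<close> lets it shrink to 0.\<close>
    show "\<bar>Re (j_inner M (S (S u)) u)\<bar> \<le> 1 / t * Re (j_inner M (S u) u)" if "t \<ge> 1 / \<rho>" for t
    proof -
      have "1 / \<rho> > 0" using \<open>\<rho> > 0\<close> by simp
      then have t: "t > 0" using that by linarith
      have "1 / t \<le> \<rho>" using that t \<open>\<rho> > 0\<close> by (simp add: field_simps)
      then show ?thesis using form[OF _ NK[OF u], of "1 / t"] t by simp
    qed
  qed (use \<open>\<rho> > 0\<close> in simp)
  have fN: "f \<in> N" using f by (auto simp: N_def K_def \<Delta>_def)
  have "S (S f) \<simeq> (\<lambda>x. 0)"
  proof (rule square_zero[OF ring[OF \<open>\<rho> > 0\<close>], where N = N and S = S])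
    show "(\<lambda>x. 1 * u x + 1 * v x) \<in> N" if "u \<in> N" "v \<in> N" for u v
      unfolding N_def K_def by (rule INT_I) (rule range_lincomb, use ring NK[OF that(1)] NK[OF that(2)] in \<open>auto simp: K_def\<close>)
  qed (use Sb[OF \<open>\<rho> > 0\<close>] Ssym[OF \<open>\<rho> > 0\<close>] Spos[OF \<open>\<rho> > 0\<close>] SN zero fN NK \<open>\<rho> > 0\<close> in \<open>auto simp: K_def\<close>)
  then show thesis
    using that ST[OF \<open>\<rho> > 0\<close> NK[OF fN \<open>\<rho> > 0\<close> order_refl]] ST[OF \<open>\<rho> > 0\<close> NK[OF SN[OF fN] \<open>\<rho> > 0\<close> order_refl]] by blast
qed

section \<open>Resolvent estimates away from zero and away from infinity\<close>

lemma E_decomposition: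
  assumes "0 < a" "a \<le> b" and f: "f \<in> L2 M"
  shows "f \<simeq> (\<lambda>x. E (Some ` {-a<..<a}) f x + E (Some ` {a..b}) f x + E (Some ` {-b..-a}) f x + E (- (Some ` {-b..b})) f x)"
proof -
  have r: "Some ` {-a<..<a} \<in> spec_ring" "Some ` {a..b} \<in> spec_ring" "Some ` {-b..-a} \<in> spec_ring"
    "- (Some ` {-b..b}) \<in> spec_ring" "Some ` {-b..b} \<in> spec_ring" "Some ` {-a<..b} \<in> spec_ring"
    using assms by (auto intro!: spec_ring_intervals)
  have u: "Some ` {-a<..<a} \<union> Some ` {a..b} = Some ` {-a<..b}" "Some ` {-b..-a} \<union> Some ` {-a<..b} = Some ` {-b..b}"
    using assms by (auto simp flip: image_Un)
  have d: "Some ` {-a<..<a} \<inter> Some ` {a..b} = {}" "Some ` {-b..-a} \<inter> Some ` {-a<..b} = {}" by auto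
  have "E (Some ` {-a<..b}) f \<simeq> (\<lambda>x. E (Some ` {-a<..<a}) f x + E (Some ` {a..b}) f x)"
    using E_add[OF r(1,2) _ d(1) f] r(6) unfolding u by simp
  moreover have "E (Some ` {-b..b}) f \<simeq> (\<lambda>x. E (Some ` {-b..-a}) f x + E (Some ` {-a<..b}) f x)"
    using E_add[OF r(3,6) _ d(2) f] r(5) unfolding u by simp
  moreover have "E UNIV f \<simeq> (\<lambda>x. E (Some ` {-b..b}) f x + E (- (Some ` {-b..b})) f x)"
    using E_add[OF r(5,4) _ _ f] spec_ring_empty_UNIV by (simp add: Compl_partition)
  ultimately show ?thesis using E_UNIV[OF f] by eventually_elim simp
qed

text \<open>The piece at the critical point, \<open>E (Q s) f\<close>, is \<open>f\<close> minus the
  other three pieces, one of which is fixed while the other two converge.\<close>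

lemma remainder_limit:
  fixes A B Q :: "real \<Rightarrow> real option set"
  assumes ring: "D \<in> spec_ring" "\<forall>\<^sub>F s in F. A s \<in> spec_ring" "\<forall>\<^sub>F s in F. B s \<in> spec_ring" "\<forall>\<^sub>F s in F. Q s \<in> spec_ring"
    and dec: "\<forall>\<^sub>F s in F. f \<simeq> (\<lambda>x. E D f x + E (A s) f x + E (B s) f x + E (Q s) f x)"
    and lim: "((\<lambda>s. nrm (\<lambda>x. E (A s) f x - P1 f x)) \<longlongrightarrow> 0) F" "((\<lambda>s. nrm (\<lambda>x. E (B s) f x - P2 f x)) \<longlongrightarrow> 0) F"
    and L: "f \<in> L2 M" "P1 f \<in> L2 M" "P2 f \<in> L2 M"
  shows "((\<lambda>s. nrm (\<lambda>x. E (Q s) f x - (f x - E D f x - P1 f x - P2 f x))) \<longlongrightarrow> 0) F"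
proof (rule tendsto_sandwich[where f = "\<lambda>_. 0"])
  show "\<forall>\<^sub>F s in F. 0 \<le> nrm (\<lambda>x. E (Q s) f x - (f x - E D f x - P1 f x - P2 f x))"
    by (simp add: l2_norm_nonneg)
  show "\<forall>\<^sub>F s in F. nrm (\<lambda>x. E (Q s) f x - (f x - E D f x - P1 f x - P2 f x)) \<le>
      nrm (\<lambda>x. E (A s) f x - P1 f x) + nrm (\<lambda>x. E (B s) f x - P2 f x)"
    using ring(2-4) dec
  proof eventually_elim
    case (elim s)
    have EL: "E D f \<in> L2 M" "E (A s) f \<in> L2 M" "E (B s) f \<in> L2 M" "E (Q s) f \<in> L2 M"
      using E_L2 ring(1) elim L by auto
    have a: "(\<lambda>x. E (A s) f x - P1 f x) \<in> L2 M" "(\<lambda>x. E (B s) f x - P2 f x) \<in> L2 M"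
      by (intro L2_minus EL L)+
    have s: "(\<lambda>x. (E (A s) f x - P1 f x) + (E (B s) f x - P2 f x)) \<in> L2 M"
      using L2_lincomb[OF a, of 1 1] by simp
    have "nrm (\<lambda>x. E (Q s) f x - (f x - E D f x - P1 f x - P2 f x)) =
        nrm (\<lambda>x. (-1) * ((E (A s) f x - P1 f x) + (E (B s) f x - P2 f x)))"
    proof (rule l2_norm_cong_AE)
      show "(\<lambda>x. E (Q s) f x - (f x - E D f x - P1 f x - P2 f x)) \<in> L2 M" by (intro L2_minus EL L)
      show "(\<lambda>x. (-1) * ((E (A s) f x - P1 f x) + (E (B s) f x - P2 f x))) \<in> L2 M" by (rule L2_scale[OF s])
      show "(\<lambda>x. E (Q s) f x - (f x - E D f x - P1 f x - P2 f x)) \<simeq> (\<lambda>x. (-1) * ((E (A s) f x - P1 f x) + (E (B s) f x - P2 f x)))"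
        using elim(4) by eventually_elim (simp add: algebra_simps)
    qed
    also have "\<dots> = nrm (\<lambda>x. (E (A s) f x - P1 f x) + (E (B s) f x - P2 f x))"
      using l2_norm_scale[of M "-1" "\<lambda>x. (E (A s) f x - P1 f x) + (E (B s) f x - P2 f x)"] by simp
    also have "\<dots> \<le> nrm (\<lambda>x. E (A s) f x - P1 f x) + nrm (\<lambda>x. E (B s) f x - P2 f x)"
      by (rule l2_norm_triangle[OF a])
    finally show ?case .
  qed
  show "((\<lambda>s. nrm (\<lambda>x. E (A s) f x - P1 f x) + nrm (\<lambda>x. E (B s) f x - P2 f x)) \<longlongrightarrow> 0) F"
    using tendsto_add[OF lim] by simp
qed simp

lemma range_j_sign:
  assumes "f \<in> op_range M (E \<Delta>)" "\<Delta> \<in> spec_ring"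
  shows "\<Delta> \<subseteq> Some ` {0<..} \<Longrightarrow> 0 \<le> 1 * Re (j_inner M f f)" "\<Delta> \<subseteq> Some ` {..<0} \<Longrightarrow> 0 \<le> - 1 * Re (j_inner M f f)"
proof -
  have fL: "f \<in> L2 M" using assms by (simp add: op_range_def)
  have "Re (j_inner M f f) = 0" if "f \<simeq> (\<lambda>x. 0)"
    using j_cong[OF fL L2_zero fL L2_zero that that] by (simp add: j_inner_def l2_inner_def)
  then show "\<Delta> \<subseteq> Some ` {0<..} \<Longrightarrow> 0 \<le> 1 * Re (j_inner M f f)" "\<Delta> \<subseteq> Some ` {..<0} \<Longrightarrow> 0 \<le> - 1 * Re (j_inner M f f)"
    using E_pos[OF assms(2) _ assms(1)] E_neg[OF assms(2) _ assms(1)] by force+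
qed

lemma nrm_split4:
  assumes L: "f \<in> L2 M" "a \<in> L2 M" "b \<in> L2 M" "c \<in> L2 M"
  shows "nrm f \<le> nrm a + nrm b + nrm c + nrm (\<lambda>x. f x - a x - b x - c x)"
    "nrm (\<lambda>x. f x - a x - b x - c x) \<le> nrm f + nrm a + nrm b + nrm c"
proof -
  have L2: "(\<lambda>x. f x - a x) \<in> L2 M" "(\<lambda>x. f x - a x - b x) \<in> L2 M" "(\<lambda>x. f x - a x - b x - c x) \<in> L2 M"
    by (intro L2_minus L)+
  have "nrm f \<le> nrm (\<lambda>x. f x - a x) + nrm a" using l2_norm_triangle[OF L2(1) L(2)] by simp
  moreover have "nrm (\<lambda>x. f x - a x) \<le> nrm (\<lambda>x. f x - a x - b x) + nrm b" using l2_norm_triangle[OF L2(2) L(3)] by simp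
  moreover have "nrm (\<lambda>x. f x - a x - b x) \<le> nrm (\<lambda>x. f x - a x - b x - c x) + nrm c" using l2_norm_triangle[OF L2(3) L(4)] by simp
  ultimately show "nrm f \<le> nrm a + nrm b + nrm c + nrm (\<lambda>x. f x - a x - b x - c x)" by linarith
  show "nrm (\<lambda>x. f x - a x - b x - c x) \<le> nrm f + nrm a + nrm b + nrm c"
    using l2_norm_triangle_diff[OF L2(2) L(4)] l2_norm_triangle_diff[OF L2(1) L(3)] l2_norm_triangle_diff[OF L(1,2)] by linarith
qed

text \<open>\<open>E \<Delta>\<close> maps the graph of \<open>T\<close> into itself, so a lower
  bound for \<open>T - z\<close> on the range carries over to the component
  \<open>E \<Delta> u\<close> of an arbitrary \<open>u\<close>, at the price of the bound of
  \<open>E \<Delta>\<close>.\<close>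

lemma E_part_bound:
  assumes \<Delta>: "\<Delta> \<in> spec_ring" and "c > 0" "D \<ge> 0"
    and low: "\<And>z u v. Z z \<Longrightarrow> (u, v) \<in> T \<Longrightarrow> u \<in> op_range M (E \<Delta>) \<Longrightarrow> v \<in> op_range M (E \<Delta>) \<Longrightarrow>
      \<bar>Im z\<bar> * nrm u \<le> D * nrm (\<lambda>x. v x - z * u x)"
  obtains C where "C > 0" "\<And>z u v. Z z \<Longrightarrow> (u, v) \<in> T \<Longrightarrow> \<bar>Im z\<bar> * nrm (E \<Delta> u) \<le> C * nrm (\<lambda>x. v x - z * u x)"
proof -
  obtain k where k: "k > 0" "\<And>f. f \<in> L2 M \<Longrightarrow> nrm (E \<Delta> f) \<le> k * nrm f"
    using bounded_op_bound[OF E_bounded[OF \<Delta>]] by blast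
  show thesis
  proof (rule that[of "D * k + 1"])
    fix z u v assume z: "Z z" and uv: "(u, v) \<in> T"
    have L: "u \<in> L2 M" "v \<in> L2 M" using T_L2[OF uv] by auto
    let ?w = "\<lambda>x. 1 * v x + (- z) * u x"
    have w: "?w \<in> L2 M" by (rule L2_lincomb[OF L(2,1)])
    have "\<bar>Im z\<bar> * nrm (E \<Delta> u) \<le> D * nrm (\<lambda>x. E \<Delta> v x - z * E \<Delta> u x)"
      by (rule low[OF z E_T[OF \<Delta> uv] E_in_range[OF \<Delta> L(1)] E_in_range[OF \<Delta> L(2)]])
    also have "nrm (\<lambda>x. E \<Delta> v x - z * E \<Delta> u x) = nrm (E \<Delta> ?w)"
      using E_lincomb[OF \<Delta> L(2,1), of 1 "- z"]
      by (intro l2_norm_cong_AE L2_diff E_L2[OF \<Delta>] L w) (auto elim: eventually_mono)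
    also have "D * nrm (E \<Delta> ?w) \<le> D * (k * nrm ?w)" using k(2)[OF w] \<open>D \<ge> 0\<close> by (rule mult_left_mono)
    also have "\<dots> \<le> (D * k + 1) * nrm ?w" using l2_norm_nonneg[of M ?w] by (simp add: algebra_simps)
    finally show "\<bar>Im z\<bar> * nrm (E \<Delta> u) \<le> (D * k + 1) * nrm (\<lambda>x. v x - z * u x)" by simp
  qed (use k \<open>D \<ge> 0\<close> in \<open>simp add: add_nonneg_pos\<close>)
qed

lemma sot_convergentE:
  assumes "sot_convergent M B F"
  obtains P where "bounded_op M (L2 M) P" "\<And>f. f \<in> L2 M \<Longrightarrow> ((\<lambda>t. nrm (\<lambda>x. B t f x - P f x)) \<longlongrightarrow> 0) F"
    "\<And>f. f \<in> L2 M \<Longrightarrow> P f \<in> L2 M"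
  using assms unfolding sot_convergent_def bounded_op_def by blast

text \<open>\<open>u\<close> splits into a part with bounded spectrum, two definite parts
  \<open>P1 u\<close>, \<open>P2 u\<close> and a remainder. The remainder lies in the range of
  \<open>E\<close> for all large symmetric neighbourhoods of infinity, hence vanishes. On the
  bounded part, large \<open>z\<close> are handled by the bound of \<open>T\<close> and the others
  by compactness; \<open>\<epsilon> < R\<close> keeps the spectrum away from them.\<close>

theorem resolvent_estimate_infinity:
  assumes "0 < \<epsilon>" "\<epsilon> < R"
    and sot1: "sot_convergent M (\<lambda>t. E (Some ` {\<epsilon>..t})) at_top"
    and sot2: "sot_convergent M (\<lambda>t. E (Some ` {t..- \<epsilon>})) at_bot"
  obtains C where "C > 0" "\<And>z u v. cmod z > R \<Longrightarrow> (u, v) \<in> T \<Longrightarrow> \<bar>Im z\<bar> * nrm u \<le> C * nrm (\<lambda>x. v x - z * u x)"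
proof -
  obtain P1 where P1: "bounded_op M (L2 M) P1" "\<And>f. f \<in> L2 M \<Longrightarrow> ((\<lambda>t. nrm (\<lambda>x. E (Some ` {\<epsilon>..t}) f x - P1 f x)) \<longlongrightarrow> 0) at_top"
    "\<And>f. f \<in> L2 M \<Longrightarrow> P1 f \<in> L2 M" using sot_convergentE[OF sot1] by blast
  obtain P2 where P2: "bounded_op M (L2 M) P2" "\<And>f. f \<in> L2 M \<Longrightarrow> ((\<lambda>t. nrm (\<lambda>x. E (Some ` {t..- \<epsilon>}) f x - P2 f x)) \<longlongrightarrow> 0) at_bot"
    "\<And>f. f \<in> L2 M \<Longrightarrow> P2 f \<in> L2 M" using sot_convergentE[OF sot2] by blast
  \<comment> \<open>Substituting \<open>- t\<close> lets both limits run along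
    \<open>at_top\<close>.\<close>
  have P2': "((\<lambda>t. nrm (\<lambda>x. E (Some ` {- t..- \<epsilon>}) f x - P2 f x)) \<longlongrightarrow> 0) at_top" if "f \<in> L2 M" for f
    using filterlim_compose[OF P2(2)[OF that] filterlim_uminus_at_bot_at_top] .
  define \<Delta>0 where "\<Delta>0 = Some ` {- \<epsilon><..<\<epsilon>}"
  have r0: "\<Delta>0 \<in> spec_ring" "{- \<epsilon><..<\<epsilon>} \<in> bounded_intervals" using spec_ring_intervals(2,7)[of "- \<epsilon>" \<epsilon>] \<open>0 < \<epsilon>\<close> by (auto simp: \<Delta>0_def)
  have r: "Some ` {\<epsilon>..t} \<in> spec_ring" "Some ` {- t..- \<epsilon>} \<in> spec_ring" "- (Some ` {- t..t}) \<in> spec_ring" if "t \<ge> \<epsilon>" for t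
    using that \<open>0 < \<epsilon>\<close> by (auto intro!: spec_ring_intervals)
  obtain C1 where C1: "C1 > 0" "\<And>u v z. (u, v) \<in> T \<Longrightarrow> \<bar>Im z\<bar> * nrm (P1 u) \<le> C1 * nrm (\<lambda>x. v x - z * u x)"
  proof (rule definite_estimate[of 1 at_top P1 "\<lambda>t. Some ` {\<epsilon>..t}"])
    show "\<forall>\<^sub>F s in at_top. Some ` {\<epsilon>..s} \<in> spec_ring"
      using eventually_ge_at_top[of \<epsilon>] by eventually_elim (rule r)
    show "\<forall>\<^sub>F s in at_top. \<forall>\<^sub>F s' in at_top. Some ` {\<epsilon>..s} \<subseteq> Some ` {\<epsilon>..s'}"
    proof (rule always_eventually, rule allI)
      fix s show "\<forall>\<^sub>F s' in at_top. Some ` {\<epsilon>..s} \<subseteq> Some ` {\<epsilon>..s'}"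
        using eventually_ge_at_top[of s] by eventually_elim (intro image_mono, auto)
    qed
    show "\<forall>\<^sub>F s in at_top. \<forall>f\<in>op_range M (E (Some ` {\<epsilon>..s})). 0 \<le> 1 * Re (j_inner M f f)"
      using eventually_ge_at_top[of \<epsilon>]
    proof eventually_elim
      case (elim s)
      have "Some ` {\<epsilon>..s} \<subseteq> Some ` {0<..}" using \<open>0 < \<epsilon>\<close> by (intro image_mono) auto
      then show ?case using range_j_sign(1)[OF _ r(1)[OF elim]] by blast
    qed
  qed (use P1 in auto)
  obtain C2 where C2: "C2 > 0" "\<And>u v z. (u, v) \<in> T \<Longrightarrow> \<bar>Im z\<bar> * nrm (P2 u) \<le> C2 * nrm (\<lambda>x. v x - z * u x)"
  proof (rule definite_estimate[of "- 1" at_top P2 "\<lambda>t. Some ` {- t..- \<epsilon>}"])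
    show "\<forall>\<^sub>F s in at_top. Some ` {- s..- \<epsilon>} \<in> spec_ring"
      using eventually_ge_at_top[of \<epsilon>] by eventually_elim (rule r)
    show "\<forall>\<^sub>F s in at_top. \<forall>\<^sub>F s' in at_top. Some ` {- s..- \<epsilon>} \<subseteq> Some ` {- s'..- \<epsilon>}"
    proof (rule always_eventually, rule allI)
      fix s show "\<forall>\<^sub>F s' in at_top. Some ` {- s..- \<epsilon>} \<subseteq> Some ` {- s'..- \<epsilon>}"
        using eventually_ge_at_top[of s] by eventually_elim (intro image_mono, auto)
    qed
    show "\<forall>\<^sub>F s in at_top. \<forall>f\<in>op_range M (E (Some ` {- s..- \<epsilon>})). 0 \<le> - 1 * Re (j_inner M f f)"
      using eventually_ge_at_top[of \<epsilon>]
    proof eventually_elim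
      case (elim s)
      have "Some ` {- s..- \<epsilon>} \<subseteq> Some ` {..<0}" using \<open>0 < \<epsilon>\<close> by (intro image_mono) auto
      then show ?case using range_j_sign(2)[OF _ r(2)[OF elim]] by blast
    qed
  qed (use P2 P2' in auto)
  obtain D0 where D0: "\<forall>(f, g)\<in>T. f \<in> op_range M (E \<Delta>0) \<longrightarrow> nrm g \<le> D0 * nrm f"
    using E_bounded_interval(2)[OF r0(2)] unfolding \<Delta>0_def by blast
  define D where "D = \<bar>D0\<bar> + 1"
  have D: "D > 0" "nrm g \<le> D * nrm f" if "(f, g) \<in> T" "f \<in> op_range M (E \<Delta>0)" for f g
  proof -
    have "nrm g \<le> D0 * nrm f" using D0 that by blast
    also have "\<dots> \<le> D * nrm f" by (intro mult_right_mono l2_norm_nonneg) (simp add: D_def)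
    finally show "nrm g \<le> D * nrm f" .
  qed (simp add: D_def)
  have Dpos: "D > 0" by (simp add: D_def)
  have cl: "closure {s. Some s \<in> \<Delta>0} \<subseteq> {- \<epsilon>..\<epsilon>}"
    by (rule closure_minimal) (auto simp: \<Delta>0_def)
  \<comment> \<open>Beyond \<open>2 * D\<close> the bound \<open>D\<close> of \<open>T\<close>
    suffices, so only a compact annulus remains.\<close>
  obtain c where c: "c > 0" "\<And>z u v. z \<in> cball 0 (2 * D) - ball 0 R \<Longrightarrow> (u, v) \<in> T \<Longrightarrow> u \<in> op_range M (E \<Delta>0) \<Longrightarrow> v \<in> op_range M (E \<Delta>0) \<Longrightarrow>
    c * nrm u \<le> nrm (\<lambda>x. v x - z * u x)"
  proof (rule compact_lower_bound[OF r0(1), of "cball 0 (2 * D) - ball 0 R"])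
    show "compact (cball (0::complex) (2 * D) - ball 0 R)" by (intro compact_diff) auto
    show "t \<notin> closure {s. Some s \<in> \<Delta>0}" if "z \<in> cball 0 (2 * D) - ball 0 R" "z = of_real t" for z :: complex and t
      using cl that \<open>\<epsilon> < R\<close> by (auto simp: subset_iff)
  qed blast
  obtain C0 where C0: "C0 > 0" "\<And>z u v. cmod z > R \<Longrightarrow> (u, v) \<in> T \<Longrightarrow> \<bar>Im z\<bar> * nrm (E \<Delta>0 u) \<le> C0 * nrm (\<lambda>x. v x - z * u x)"
  proof (rule E_part_bound[OF r0(1) c(1), of "2 * D / c + 2" "\<lambda>z. cmod z > R"])
    fix z u v assume z: "cmod z > R" and uv: "(u, v) \<in> T" "u \<in> op_range M (E \<Delta>0)" "v \<in> op_range M (E \<Delta>0)"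
    have L: "u \<in> L2 M" "v \<in> L2 M" using T_L2[OF uv(1)] by auto
    let ?W = "nrm (\<lambda>x. v x - z * u x)"
    show "\<bar>Im z\<bar> * nrm u \<le> (2 * D / c + 2) * ?W"
    proof (cases "cmod z \<le> 2 * D")
      case True
      then have "c * nrm u \<le> ?W" using z by (intro c(2)[OF _ uv]) auto
      then have "nrm u \<le> ?W / c" using c(1) by (simp add: field_simps)
      moreover have "\<bar>Im z\<bar> \<le> 2 * D" using True abs_Im_le_cmod[of z] by linarith
      ultimately have "\<bar>Im z\<bar> * nrm u \<le> 2 * D * (?W / c)" using Dpos by (intro mult_mono l2_norm_nonneg) auto
      also have "\<dots> \<le> (2 * D / c + 2) * ?W" using l2_norm_nonneg[of M "\<lambda>x. v x - z * u x"] by (simp add: distrib_right)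
      finally show ?thesis .
    next
      case False
      have "cmod z * nrm u \<le> ?W + nrm v"
        using l2_norm_triangle_diff[OF L(2) L2_diff[OF L(2,1), of z]] by (simp add: l2_norm_scale)
      also have "nrm v \<le> D * nrm u" by (rule D(2)[OF uv(1,2)])
      \<comment> \<open>Half of \<open>cmod z * nrm u\<close> absorbs \<open>nrm v\<close>.\<close>
      also have "D * nrm u \<le> (cmod z / 2) * nrm u" using False by (intro mult_right_mono l2_norm_nonneg) auto
      finally have "cmod z * nrm u \<le> 2 * ?W" by simp
      moreover have "\<bar>Im z\<bar> * nrm u \<le> cmod z * nrm u" by (intro mult_right_mono l2_norm_nonneg abs_Im_le_cmod)
      moreover have "0 \<le> 2 * D / c * ?W" using c(1) Dpos by (simp add: l2_norm_nonneg)
      ultimately show ?thesis by (simp add: distrib_right)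
    qed
  qed (use c(1) Dpos in auto)
  have Q0: "(\<lambda>x. u x - E \<Delta>0 u x - P1 u x - P2 u x) \<simeq> (\<lambda>x. 0)" if u: "u \<in> L2 M" for u
  proof (rule infinity_part[OF \<open>0 < \<epsilon>\<close>])
    fix t assume t: "t \<ge> \<epsilon>"
    have L: "(\<lambda>x. u x - E \<Delta>0 u x - P1 u x - P2 u x) \<in> L2 M"
      by (intro L2_minus u E_L2[OF r0(1)] P1 P2)
    show "(\<lambda>x. u x - E \<Delta>0 u x - P1 u x - P2 u x) \<in> op_range M (E (- (Some ` {- t..t})))"
    \<comment> \<open>For \<open>s \<ge> t\<close> the pieces at infinity lie in the range belonging
      to \<open>t\<close>, which is closed.\<close>
    proof (rule range_closed[OF r(3)[OF t] L, of at_top "\<lambda>s. E (- (Some ` {- s..s})) u"])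
      show "\<forall>\<^sub>F s in at_top. E (- (Some ` {- s..s})) u \<in> op_range M (E (- (Some ` {- t..t})))"
        using eventually_ge_at_top[of t]
      proof eventually_elim
        case (elim s)
        have s: "s \<ge> \<epsilon>" using t elim by simp
        show ?case by (rule range_mono[OF r(3)[OF s] r(3)[OF t] _ E_in_range[OF r(3)[OF s] u]]) (use elim in auto)
      qed
      show "((\<lambda>s. nrm (\<lambda>x. E (- (Some ` {- s..s})) u x - (u x - E \<Delta>0 u x - P1 u x - P2 u x))) \<longlongrightarrow> 0) at_top"
      proof (rule remainder_limit[OF r0(1), where A = "\<lambda>s. Some ` {\<epsilon>..s}" and B = "\<lambda>s. Some ` {- s..- \<epsilon>}"])
        show "\<forall>\<^sub>F s in at_top. u \<simeq> (\<lambda>x. E \<Delta>0 u x + E (Some ` {\<epsilon>..s}) u x + E (Some ` {- s..- \<epsilon>}) u x + E (- (Some ` {- s..s})) u x)"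
          using eventually_ge_at_top[of \<epsilon>] unfolding \<Delta>0_def by eventually_elim (rule E_decomposition[OF \<open>0 < \<epsilon>\<close> _ u])
        show "\<forall>\<^sub>F s in at_top. Some ` {\<epsilon>..s} \<in> spec_ring" "\<forall>\<^sub>F s in at_top. Some ` {- s..- \<epsilon>} \<in> spec_ring"
          "\<forall>\<^sub>F s in at_top. - (Some ` {- s..s}) \<in> spec_ring"
          by (rule eventually_mono[OF eventually_ge_at_top[of \<epsilon>]], rule r, assumption)+
      qed (use P1 P2 P2' u in auto)
    qed simp
  qed
  show thesis
  proof (rule that[of "C0 + C1 + C2"])
    fix z u v assume z: "cmod z > R" and uv: "(u, v) \<in> T"
    have u: "u \<in> L2 M" using T_L2[OF uv] by simp
    have Q: "(\<lambda>x. u x - E \<Delta>0 u x - P1 u x - P2 u x) \<in> L2 M" by (intro L2_minus u E_L2[OF r0(1)] P1 P2)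
    have "nrm (\<lambda>x. u x - E \<Delta>0 u x - P1 u x - P2 u x) = 0"
      using l2_norm_eq_0_iff[OF Q] Q0[OF u] by simp
    then have "nrm u \<le> nrm (E \<Delta>0 u) + nrm (P1 u) + nrm (P2 u)"
      using nrm_split4(1)[OF u E_L2[OF r0(1) u] P1(3)[OF u] P2(3)[OF u]] by simp
    then have "\<bar>Im z\<bar> * nrm u \<le> \<bar>Im z\<bar> * (nrm (E \<Delta>0 u) + nrm (P1 u) + nrm (P2 u))" by (rule mult_left_mono) simp
    also have "\<dots> \<le> (C0 + C1 + C2) * nrm (\<lambda>x. v x - z * u x)"
      using C0(2)[OF z uv] C1(2)[OF uv, of z] C2(2)[OF uv, of z] by (simp add: algebra_simps)
    finally show "\<bar>Im z\<bar> * nrm u \<le> (C0 + C1 + C2) * nrm (\<lambda>x. v x - z * u x)" .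
  qed (use C0 C1 C2 in simp)
qed

text \<open>Here the remainder \<open>Q u\<close> may be nonzero, but the kernel condition puts it
  into the kernel of \<open>T\<close>. Then \<open>Q v = 0\<close> whenever \<open>(u, v)\<close> is
  in \<open>T\<close>, so \<open>Q (v - z u) = - z Q u\<close>, and boundedness of \<open>Q\<close>
  yields the estimate on this part.\<close>

theorem resolvent_estimate_zero:
  assumes "0 < R" "R < \<rho>"
    and sot1: "sot_convergent M (\<lambda>t. E (Some ` {- \<rho>..t})) (at_left 0)"
    and sot2: "sot_convergent M (\<lambda>t. E (Some ` {t..\<rho>})) (at_right 0)"
    and ker: "op_kernel T = op_kernel (T O T)"
  obtains C where "C > 0" "\<And>z u v. cmod z < R \<Longrightarrow> (u, v) \<in> T \<Longrightarrow> \<bar>Im z\<bar> * nrm u \<le> C * nrm (\<lambda>x. v x - z * u x)"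
proof -
  have "\<rho> > 0" using assms by simp
  obtain P1 where P1: "bounded_op M (L2 M) P1" "\<And>f. f \<in> L2 M \<Longrightarrow> ((\<lambda>t. nrm (\<lambda>x. E (Some ` {t..\<rho>}) f x - P1 f x)) \<longlongrightarrow> 0) (at_right 0)"
    "\<And>f. f \<in> L2 M \<Longrightarrow> P1 f \<in> L2 M" using sot_convergentE[OF sot2] by blast
  obtain P2 where P2: "bounded_op M (L2 M) P2" "\<And>f. f \<in> L2 M \<Longrightarrow> ((\<lambda>t. nrm (\<lambda>x. E (Some ` {- \<rho>..t}) f x - P2 f x)) \<longlongrightarrow> 0) (at_left 0)"
    "\<And>f. f \<in> L2 M \<Longrightarrow> P2 f \<in> L2 M" using sot_convergentE[OF sot1] by blast
  have um: "filterlim uminus (at_left (0::real)) (at_right 0)"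
    unfolding filterlim_def at_left_minus[of 0] by simp
  have P2': "((\<lambda>t. nrm (\<lambda>x. E (Some ` {- \<rho>..- t}) f x - P2 f x)) \<longlongrightarrow> 0) (at_right 0)" if "f \<in> L2 M" for f
    using filterlim_compose[OF P2(2)[OF that] um] .
  have ev: "\<forall>\<^sub>F t in at_right 0. 0 < t \<and> t \<le> r" if "r > 0" for r :: real
    using eventually_at_right_real[OF that] by eventually_elim auto
  define \<Delta>0 where "\<Delta>0 = - (Some ` {- \<rho>..\<rho>})"
  have r0: "\<Delta>0 \<in> spec_ring" using spec_ring_intervals(5)[of "- \<rho>" \<rho>] \<open>\<rho> > 0\<close> by (auto simp: \<Delta>0_def)
  have r: "Some ` {t..\<rho>} \<in> spec_ring" "Some ` {- \<rho>..- t} \<in> spec_ring" "Some ` {- t<..<t} \<in> spec_ring" if "0 < t \<and> t \<le> \<rho>" for t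
    using that by (auto intro!: spec_ring_intervals)
  obtain C1 where C1: "C1 > 0" "\<And>u v z. (u, v) \<in> T \<Longrightarrow> \<bar>Im z\<bar> * nrm (P1 u) \<le> C1 * nrm (\<lambda>x. v x - z * u x)"
  proof (rule definite_estimate[of 1 "at_right 0" P1 "\<lambda>t. Some ` {t..\<rho>}"])
    show "\<forall>\<^sub>F s in at_right 0. Some ` {s..\<rho>} \<in> spec_ring"
      using ev[OF \<open>\<rho> > 0\<close>] by eventually_elim (rule r)
    show "\<forall>\<^sub>F s in at_right 0. \<forall>\<^sub>F s' in at_right 0. Some ` {s..\<rho>} \<subseteq> Some ` {s'..\<rho>}"
      using ev[OF \<open>\<rho> > 0\<close>]
    proof eventually_elim
      case (elim s)
      have "\<forall>\<^sub>F s' in at_right 0. 0 < s' \<and> s' \<le> s" using ev elim by blast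
      then show ?case by eventually_elim auto
    qed
    show "\<forall>\<^sub>F s in at_right 0. \<forall>f\<in>op_range M (E (Some ` {s..\<rho>})). 0 \<le> 1 * Re (j_inner M f f)"
      using ev[OF \<open>\<rho> > 0\<close>]
    proof eventually_elim
      case (elim s)
      have "Some ` {s..\<rho>} \<subseteq> Some ` {0<..}" using elim by (intro image_mono) auto
      then show ?case using range_j_sign(1)[OF _ r(1)[OF elim]] by blast
    qed
  qed (use P1 in auto)
  obtain C2 where C2: "C2 > 0" "\<And>u v z. (u, v) \<in> T \<Longrightarrow> \<bar>Im z\<bar> * nrm (P2 u) \<le> C2 * nrm (\<lambda>x. v x - z * u x)"
  proof (rule definite_estimate[of "- 1" "at_right 0" P2 "\<lambda>t. Some ` {- \<rho>..- t}"])
    show "\<forall>\<^sub>F s in at_right 0. Some ` {- \<rho>..- s} \<in> spec_ring"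
      using ev[OF \<open>\<rho> > 0\<close>] by eventually_elim (rule r)
    show "\<forall>\<^sub>F s in at_right 0. \<forall>\<^sub>F s' in at_right 0. Some ` {- \<rho>..- s} \<subseteq> Some ` {- \<rho>..- s'}"
      using ev[OF \<open>\<rho> > 0\<close>]
    proof eventually_elim
      case (elim s)
      have "\<forall>\<^sub>F s' in at_right 0. 0 < s' \<and> s' \<le> s" using ev elim by blast
      then show ?case by eventually_elim auto
    qed
    show "\<forall>\<^sub>F s in at_right 0. \<forall>f\<in>op_range M (E (Some ` {- \<rho>..- s})). 0 \<le> - 1 * Re (j_inner M f f)"
      using ev[OF \<open>\<rho> > 0\<close>]
    proof eventually_elim
      case (elim s)
      have "Some ` {- \<rho>..- s} \<subseteq> Some ` {..<0}" using elim by (intro image_mono) auto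
      then show ?case using range_j_sign(2)[OF _ r(2)[OF elim]] by blast
    qed
  qed (use P2 P2' in auto)
  have cl: "closure {s. Some s \<in> \<Delta>0} \<subseteq> {s. \<rho> \<le> \<bar>s\<bar>}"
  proof (rule closure_minimal)
    have "{s. Some s \<in> \<Delta>0} = - {- \<rho>..\<rho>}" by (auto simp: \<Delta>0_def)
    then show "{s. Some s \<in> \<Delta>0} \<subseteq> {s. \<rho> \<le> \<bar>s\<bar>}" by auto
  qed (intro closed_Collect_le continuous_intros)
  obtain c where c: "c > 0" "\<And>z u v. z \<in> cball 0 R \<Longrightarrow> (u, v) \<in> T \<Longrightarrow> u \<in> op_range M (E \<Delta>0) \<Longrightarrow> v \<in> op_range M (E \<Delta>0) \<Longrightarrow>
    c * nrm u \<le> nrm (\<lambda>x. v x - z * u x)"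
  proof (rule compact_lower_bound[OF r0, of "cball 0 R"])
    show "t \<notin> closure {s. Some s \<in> \<Delta>0}" if "z \<in> cball 0 R" "z = of_real t" for z :: complex and t
      using cl that \<open>R < \<rho>\<close> by (auto simp: subset_iff)
  qed (auto)
  obtain C0 where C0: "C0 > 0" "\<And>z u v. cmod z < R \<Longrightarrow> (u, v) \<in> T \<Longrightarrow> \<bar>Im z\<bar> * nrm (E \<Delta>0 u) \<le> C0 * nrm (\<lambda>x. v x - z * u x)"
  proof (rule E_part_bound[OF r0 c(1), of "R / c" "\<lambda>z. cmod z < R"])
    fix z u v assume z: "cmod z < R" and uv: "(u, v) \<in> T" "u \<in> op_range M (E \<Delta>0)" "v \<in> op_range M (E \<Delta>0)"
    let ?W = "nrm (\<lambda>x. v x - z * u x)"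
    have "c * nrm u \<le> ?W" using z by (intro c(2)[OF _ uv]) auto
    then have "nrm u \<le> ?W / c" using c(1) by (simp add: field_simps)
    moreover have "\<bar>Im z\<bar> \<le> R" using z abs_Im_le_cmod[of z] by linarith
    ultimately have "\<bar>Im z\<bar> * nrm u \<le> R * (?W / c)" using \<open>0 < R\<close> by (intro mult_mono l2_norm_nonneg) auto
    then show "\<bar>Im z\<bar> * nrm u \<le> R / c * ?W" by simp
  qed (use c(1) \<open>0 < R\<close> in auto)
  define Q where "Q u = (\<lambda>x. u x - E \<Delta>0 u x - P1 u x - P2 u x)" for u
  have QL: "Q u \<in> L2 M" if u: "u \<in> L2 M" for u unfolding Q_def by (intro L2_minus u E_L2[OF r0] P1 P2)
  have Qlim: "((\<lambda>s. nrm (\<lambda>x. E (Some ` {- s<..<s}) u x - Q u x)) \<longlongrightarrow> 0) (at_right 0)" if u: "u \<in> L2 M" for u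
    unfolding Q_def
  proof (rule remainder_limit[OF r0, where A = "\<lambda>s. Some ` {s..\<rho>}" and B = "\<lambda>s. Some ` {- \<rho>..- s}"])
    show "\<forall>\<^sub>F s in at_right 0. u \<simeq> (\<lambda>x. E \<Delta>0 u x + E (Some ` {s..\<rho>}) u x + E (Some ` {- \<rho>..- s}) u x + E (Some ` {- s<..<s}) u x)"
      using ev[OF \<open>\<rho> > 0\<close>]
    proof eventually_elim
      case (elim s)
      then have "u \<simeq> (\<lambda>x. E (Some ` {-s<..<s}) u x + E (Some ` {s..\<rho>}) u x + E (Some ` {-\<rho>..-s}) u x + E (- (Some ` {-\<rho>..\<rho>})) u x)"
        using E_decomposition[of s \<rho> u] u by simp
      then show ?case unfolding \<Delta>0_def by eventually_elim (simp add: algebra_simps)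
    qed
    show "\<forall>\<^sub>F s in at_right 0. Some ` {s..\<rho>} \<in> spec_ring" "\<forall>\<^sub>F s in at_right 0. Some ` {- \<rho>..- s} \<in> spec_ring"
      "\<forall>\<^sub>F s in at_right 0. Some ` {- s<..<s} \<in> spec_ring"
      by (rule eventually_mono[OF ev[OF \<open>\<rho> > 0\<close>]], rule r, assumption)+
  qed (use P1 P2 P2' u in auto)
  \<comment> \<open>Closedness of \<open>T\<close> carries the graph relation from the approximating
    projections to the limit \<open>Q\<close>.\<close>
  have QT: "(Q u, Q v) \<in> T" if uv: "(u, v) \<in> T" for u v
  proof (rule T_closed)
    show "\<forall>\<^sub>F s in at_right 0. (E (Some ` {- s<..<s}) u, E (Some ` {- s<..<s}) v) \<in> T"
      using ev[OF \<open>\<rho> > 0\<close>] by eventually_elim (rule E_T[OF r(3) uv])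
  qed (use T_L2[OF uv] QL Qlim in auto)
  have Qker: "(Q u, \<lambda>x. 0) \<in> T" if u: "u \<in> L2 M" for u
  proof -
    have "Q u \<in> op_range M (E (Some ` {- t<..<t}))" if t: "0 < t" "t \<le> \<rho>" for t
    proof (rule range_closed[OF r(3) QL[OF u] _ _ Qlim[OF u]])
      show "\<forall>\<^sub>F s in at_right 0. E (Some ` {- s<..<s}) u \<in> op_range M (E (Some ` {- t<..<t}))"
        using ev[OF t(1)]
      proof eventually_elim
        case (elim s)
        then have s: "0 < s \<and> s \<le> \<rho>" using t by auto
        have "Some ` {- s<..<s} \<subseteq> Some ` {- t<..<t}" using elim by auto
        then show ?case using t by (intro range_mono[OF r(3)[OF s] r(3) _ E_in_range[OF r(3)[OF s] u]]) auto
      qed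
    qed (use t in auto)
    \<comment> \<open>\<open>zero_part\<close> puts \<open>Q u\<close> into the kernel of the square
      of \<open>T\<close>.\<close>
    then obtain g h where gh: "(Q u, g) \<in> T" "(g, h) \<in> T" "h \<simeq> (\<lambda>x. 0)" using zero_part[OF \<open>\<rho> > 0\<close>] by blast
    have "(g, \<lambda>x. 0) \<in> T" by (rule T_cong[OF gh(2) _ L2_zero _ gh(3)]) (use T_L2[OF gh(2)] in auto)
    then have "Q u \<in> op_kernel (T O T)" using gh(1) by (auto simp: op_kernel_def)
    then show ?thesis using ker by (auto simp: op_kernel_def)
  qed
  obtain k0 where k0: "k0 > 0" "\<And>f. f \<in> L2 M \<Longrightarrow> nrm (E \<Delta>0 f) \<le> k0 * nrm f"
    using bounded_op_bound[OF E_bounded[OF r0]] by blast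
  obtain k1 where k1: "k1 > 0" "\<And>f. f \<in> L2 M \<Longrightarrow> nrm (P1 f) \<le> k1 * nrm f"
    using bounded_op_bound[OF P1(1)] by blast
  obtain k2 where k2: "k2 > 0" "\<And>f. f \<in> L2 M \<Longrightarrow> nrm (P2 f) \<le> k2 * nrm f"
    using bounded_op_bound[OF P2(1)] by blast
  define k where "k = 1 + k0 + k1 + k2"
  have k: "k > 0" "nrm (Q f) \<le> k * nrm f" if "f \<in> L2 M" for f
    using nrm_split4(2)[OF that E_L2[OF r0 that] P1(3)[OF that] P2(3)[OF that]] k0(2)[OF that] k1(2)[OF that] k2(2)[OF that] k0 k1 k2
    by (auto simp: Q_def k_def algebra_simps)
  have Qest: "\<bar>Im z\<bar> * nrm (Q u) \<le> k * nrm (\<lambda>x. v x - z * u x)" if uv: "(u, v) \<in> T" for u v z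
  proof -
    have L: "u \<in> L2 M" "v \<in> L2 M" using T_L2[OF uv] by auto
    \<comment> \<open>Both \<open>(Q u, Q v)\<close> and \<open>(Q u, 0)\<close> are in the graph,
      so single-valuedness gives \<open>Q v = 0\<close>.\<close>
    have "((\<lambda>x. 1 * Q u x + (- 1) * Q u x), (\<lambda>x. 1 * Q v x + (- 1) * 0)) \<in> T"
      by (rule T_lincomb[OF QT[OF uv] Qker[OF L(1)]])
    then have Qv: "Q v \<simeq> (\<lambda>x. 0)" using T_single by fastforce
    let ?w = "\<lambda>x. 1 * v x + (- z) * u x"
    have w: "?w \<in> L2 M" by (rule L2_lincomb[OF L(2,1)])
    have "P1 ?w \<simeq> (\<lambda>x. 1 * P1 v x + (- z) * P1 u x)" "P2 ?w \<simeq> (\<lambda>x. 1 * P2 v x + (- z) * P2 u x)"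
      using P1(1) P2(1) L unfolding bounded_op_def by blast+
    moreover have "E \<Delta>0 ?w \<simeq> (\<lambda>x. 1 * E \<Delta>0 v x + (- z) * E \<Delta>0 u x)" by (rule E_lincomb[OF r0 L(2,1)])
    ultimately have "Q ?w \<simeq> (\<lambda>x. 1 * Q v x + (- z) * Q u x)"
      unfolding Q_def by eventually_elim (simp add: algebra_simps)
    then have "Q ?w \<simeq> (\<lambda>x. - z * Q u x)" using Qv by eventually_elim simp
    then have "nrm (Q ?w) = nrm (\<lambda>x. - z * Q u x)" by (intro l2_norm_cong_AE QL w L2_scale L)
    also have "\<dots> = cmod (- z) * nrm (Q u)" by (rule l2_norm_scale)
    finally have "cmod z * nrm (Q u) \<le> k * nrm ?w" using k(2)[OF w] by (simp only: norm_minus_cancel)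
    moreover have "\<bar>Im z\<bar> * nrm (Q u) \<le> cmod z * nrm (Q u)" by (intro mult_right_mono l2_norm_nonneg abs_Im_le_cmod)
    ultimately show ?thesis by simp
  qed
  show thesis
  proof (rule that[of "C0 + C1 + C2 + k"])
    fix z u v assume z: "cmod z < R" and uv: "(u, v) \<in> T"
    have u: "u \<in> L2 M" using T_L2[OF uv] by simp
    have "nrm u \<le> nrm (E \<Delta>0 u) + nrm (P1 u) + nrm (P2 u) + nrm (Q u)"
      using nrm_split4(1)[OF u E_L2[OF r0 u] P1(3)[OF u] P2(3)[OF u]] by (simp add: Q_def)
    then have "\<bar>Im z\<bar> * nrm u \<le> \<bar>Im z\<bar> * (nrm (E \<Delta>0 u) + nrm (P1 u) + nrm (P2 u) + nrm (Q u))" by (rule mult_left_mono) simp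
    also have "\<dots> \<le> (C0 + C1 + C2 + k) * nrm (\<lambda>x. v x - z * u x)"
      using C0(2)[OF z uv] C1(2)[OF uv, of z] C2(2)[OF uv, of z] Qest[OF uv, of z] by (simp add: algebra_simps)
    finally show "\<bar>Im z\<bar> * nrm u \<le> (C0 + C1 + C2 + k) * nrm (\<lambda>x. v x - z * u x)" .
  qed (use C0 C1 C2 k(1)[OF L2_zero] in simp)
qed

end

section \<open>Sturm--Liouville operators and Weyl solutions\<close>

locale sl_weight =
  fixes q r :: "real \<Rightarrow> real"
  assumes r_loc: "\<And>a b. r absolutely_integrable_on {a..b}"
    and r_sign: "\<And>x. x \<noteq> 0 \<Longrightarrow> x * r x > 0"
begin

abbreviation W :: "real measure" where "W \<equiv> weighted r"

lemma r_nonzero: "x \<noteq> 0 \<Longrightarrow> r x \<noteq> 0"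
  using r_sign[of x] by auto

lemma r_abs: "x \<noteq> 0 \<Longrightarrow> r x = sgn x * \<bar>r x\<bar>"
  using r_sign[of x] by (cases "x > 0") (auto simp: zero_less_mult_iff sgn_if)

lemma r_measurable [measurable]: "r \<in> borel_measurable lebesgue"
proof (rule borel_measurable_LIMSEQ_real)
  show "(\<lambda>x. indicator {- real n..real n} x *\<^sub>R r x) \<in> borel_measurable lebesgue" for n
    using r_loc[of "- real n" "real n"] unfolding set_integrable_def by (rule borel_measurable_integrable)
  fix x
  obtain N :: nat where N: "\<bar>x\<bar> \<le> real N" using real_arch_simple by blast
  have "\<forall>\<^sub>F n in sequentially. indicator {- real n..real n} x *\<^sub>R r x = r x"
    using eventually_ge_at_top[of N]
  proof eventually_elim
    case (elim n)
    then have "real N \<le> real n" by simp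
    then have "x \<in> {- real n..real n}" using N by auto
    then show ?case by simp
  qed
  then show "(\<lambda>n. indicator {- real n..real n} x *\<^sub>R r x) \<longlonglongrightarrow> r x" by (rule tendsto_eventually)
qed

lemma sets_W [simp, measurable_cong]: "sets W = sets lebesgue"
  by (simp add: weighted_def)

lemma measurable_W: "f \<in> borel_measurable W \<longleftrightarrow> f \<in> borel_measurable lebesgue"
  by (simp add: measurable_cong_sets[OF sets_W refl])

lemma AE_lebesgue_nonzero: "AE x::real in lebesgue. x \<noteq> 0"
proof (rule AE_I)
  show "emeasure lebesgue {0::real} = 0" by simp
qed auto

text \<open>The density vanishes at most at 0, so weighted and Lebesgue null sets coincide and a.e.
  statements can be moved to Lebesgue measure.\<close>

lemma AE_W: "(AE x in W. P x) \<longleftrightarrow> (AE x in lebesgue. P x)"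
proof -
  have "(AE x in W. P x) \<longleftrightarrow> (AE x in lebesgue. 0 < ennreal \<bar>r x\<bar> \<longrightarrow> P x)"
    unfolding weighted_def by (rule AE_density) measurable
  also have "\<dots> \<longleftrightarrow> (AE x in lebesgue. P x)"
  proof
    assume "AE x in lebesgue. 0 < ennreal \<bar>r x\<bar> \<longrightarrow> P x"
    then show "AE x in lebesgue. P x" using AE_lebesgue_nonzero
      by eventually_elim (simp add: r_nonzero)
  qed (auto elim: eventually_mono)
  finally show ?thesis .
qed

lemma continuous_measurable: "continuous_on UNIV f \<Longrightarrow> f \<in> borel_measurable lebesgue"
  for f :: "real \<Rightarrow> 'a::euclidean_space"
  using measurable_completion[of f lborel borel] borel_measurable_continuous_onI[of f] by simp

lemma integrable_W:
  fixes f :: "real \<Rightarrow> 'a::{banach, second_countable_topology}"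
  assumes "f \<in> borel_measurable lebesgue"
  shows "integrable W f \<longleftrightarrow> integrable lebesgue (\<lambda>x. \<bar>r x\<bar> *\<^sub>R f x)"
    "integral\<^sup>L W f = (LINT x|lebesgue. \<bar>r x\<bar> *\<^sub>R f x)"
  unfolding weighted_def using assms by (intro integrable_density integral_density; auto)+

lemma integrable_r_continuous:
  fixes h :: "real \<Rightarrow> 'a::euclidean_space"
  assumes h: "continuous_on UNIV h"
  shows "integrable lebesgue (\<lambda>x. indicator {a..b} x *\<^sub>R (\<bar>r x\<bar> *\<^sub>R h x))"
proof -
  note [measurable] = continuous_measurable[OF h]
  have "bounded (h ` {a..b})"
    by (intro compact_imp_bounded compact_continuous_image continuous_on_subset[OF h]) auto
  then obtain B where B: "\<And>x. x \<in> {a..b} \<Longrightarrow> norm (h x) \<le> B" unfolding bounded_iff by blast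
  have "integrable lebesgue (\<lambda>x. B * \<bar>indicator {a..b} x *\<^sub>R r x\<bar>)"
    using r_loc[of a b] unfolding set_integrable_def by (intro integrable_mult_right integrable_abs)
  then show ?thesis
  proof (rule Bochner_Integration.integrable_bound)
    show "AE x in lebesgue. norm (indicator {a..b} x *\<^sub>R (\<bar>r x\<bar> *\<^sub>R h x)) \<le> norm (B * \<bar>indicator {a..b} x *\<^sub>R r x\<bar>)"
    proof (rule AE_I2)
      fix x
      show "norm (indicator {a..b} x *\<^sub>R (\<bar>r x\<bar> *\<^sub>R h x)) \<le> norm (B * \<bar>indicator {a..b} x *\<^sub>R r x\<bar>)"
      proof (cases "x \<in> {a..b}")
        case True
        have "\<bar>r x\<bar> * norm (h x) \<le> \<bar>r x\<bar> * \<bar>B\<bar>" using B[OF True] by (intro mult_left_mono) auto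
        then show ?thesis using True by (simp add: abs_mult mult.commute)
      qed simp
    qed
  qed (intro borel_measurable_scaleR borel_measurable_indicator borel_measurable_abs r_measurable continuous_measurable h, simp)
qed

lemma L2_continuous_iff:
  assumes "continuous_on UNIV f"
  shows "f \<in> L2 W \<longleftrightarrow> integrable lebesgue (\<lambda>x. \<bar>r x\<bar> * (cmod (f x))\<^sup>2)"
proof -
  note [measurable] = continuous_measurable[OF assms]
  show ?thesis using integrable_W(1)[of "\<lambda>x. (cmod (f x))\<^sup>2"] by (simp add: L2_def measurable_W)
qed

lemma L2_AE_cong:
  assumes f: "f \<in> L2 W" and eq: "AE x in lebesgue. f x = g x"
  shows "g \<in> L2 W"
proof -
  have fm: "f \<in> borel_measurable lebesgue" using L2_D(1)[OF f] by (simp add: measurable_W)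
  have gm: "g \<in> borel_measurable lebesgue" by (rule borel_measurable_AE[OF fm eq])
  have "integrable W (\<lambda>x. (cmod (g x))\<^sup>2)"
  proof (rule iffD1[OF integrable_cong_AE L2_D(2)[OF f]])
    show "AE x in W. (cmod (f x))\<^sup>2 = (cmod (g x))\<^sup>2"
      unfolding AE_W using eq by eventually_elim simp
  qed (use fm gm in \<open>auto simp: measurable_W\<close>)
  then show ?thesis using gm by (simp add: L2_def measurable_W)
qed

lemma AE_lincomb_expr:
  assumes "AC_loc_deriv f" "AC_loc_deriv g"
  shows "AE x in lebesgue. ell q r (\<lambda>x. a * f x + b * g x) x = a * ell q r f x + b * ell q r g x"
    "AE x in lebesgue. a_expr q r (\<lambda>x. a * f x + b * g x) x = a * a_expr q r f x + b * a_expr q r g x"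
proof -
  show "AE x in lebesgue. ell q r (\<lambda>x. a * f x + b * g x) x = a * ell q r f x + b * ell q r g x"
    using AC_loc_deriv_lincomb(3)[OF assms, of a b]
    by (rule eventually_mono) (simp add: ell_def algebra_simps add_divide_distrib diff_divide_distrib)
  show "AE x in lebesgue. a_expr q r (\<lambda>x. a * f x + b * g x) x = a * a_expr q r f x + b * a_expr q r g x"
    using AC_loc_deriv_lincomb(3)[OF assms, of a b]
    by (rule eventually_mono) (simp add: a_expr_def algebra_simps add_divide_distrib diff_divide_distrib)
qed

lemma max_dom_lincomb:
  assumes f: "f \<in> max_dom q r" and g: "g \<in> max_dom q r"
  shows "(\<lambda>x. a * f x + b * g x) \<in> max_dom q r"
proof -
  have AC: "AC_loc_deriv f" "AC_loc_deriv g" using f g by (auto simp: max_dom_def)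
  have l: "(\<lambda>x. a * ell q r f x + b * ell q r g x) \<in> L2 W"
    using f g by (intro L2_lincomb) (auto simp: max_dom_def)
  have "ell q r (\<lambda>x. a * f x + b * g x) \<in> L2 W"
    by (rule L2_AE_cong[OF l]) (use AE_lincomb_expr(1)[OF AC, of a b] in \<open>auto elim: eventually_mono\<close>)
  then show ?thesis using f g AC_loc_deriv_lincomb(1)[OF AC] by (auto simp: max_dom_def intro: L2_lincomb)
qed

lemma a_expr_ell: "x \<noteq> 0 \<Longrightarrow> a_expr q r y x = of_real (sgn x) * ell q r y x"
  using r_abs[of x] r_nonzero[of x] by (cases "x > 0") (auto simp: a_expr_def ell_def sgn_if divide_simps)

lemma measurable_sgn_lebesgue [measurable]: "(\<lambda>x::real. sgn x) \<in> borel_measurable lebesgue"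
  by (rule measurable_completion) simp

lemma L2_sgn:
  assumes "f \<in> L2 W" shows "(\<lambda>x. of_real (sgn x) * f x) \<in> L2 W"
proof -
  have [measurable]: "f \<in> borel_measurable lebesgue" using L2_D(1)[OF assms] by (simp add: measurable_W)
  have "integrable W (\<lambda>x. (cmod (of_real (sgn x) * f x))\<^sup>2)"
  proof (rule Bochner_Integration.integrable_bound[OF L2_D(2)[OF assms]])
    show "(\<lambda>x. (cmod (of_real (sgn x) * f x))\<^sup>2) \<in> borel_measurable W" by (simp add: measurable_W)
  qed (auto simp: norm_mult sgn_if)
  then show ?thesis by (simp add: L2_def measurable_W)
qed

text \<open>A nonempty open set is not negligible. Consequently an a.e. class contains at most one
  function of the domain, which makes the graph of \<open>A\<close> single-valued.\<close>

lemma AC_loc_deriv_AE_zero: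
  assumes y: "AC_loc_deriv y" and z: "AE x in lebesgue. y x = 0"
  shows "y = (\<lambda>x. 0)"
proof
  fix x
  have "continuous_on UNIV y" by (rule AC_loc_imp_continuous_on[OF AC_loc_derivD(1)[OF y]])
  then have "open (y -` (- {0}))" by (intro open_vimage) (auto simp: open_Compl)
  moreover have "negligible (y -` (- {0}))"
  proof -
    obtain N where "{x. y x \<noteq> 0} \<subseteq> N" "N \<in> null_sets lebesgue" using z by (auto elim!: AE_E simp: null_sets_def)
    then have "negligible {x. y x \<noteq> 0}" using negligible_subset negligible_iff_null_sets by blast
    moreover have "y -` (- {0}) = {x. y x \<noteq> 0}" by auto
    ultimately show ?thesis by simp
  qed
  ultimately have "y -` (- {0}) = {}" using open_not_negligible by blast
  then show "y x = 0" by auto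
qed

lemma A_op_iff: "(f, g) \<in> A_op q r \<longleftrightarrow> f \<in> L2 W \<and> g \<in> L2 W \<and>
    (\<exists>y\<in>max_dom q r. (AE x in lebesgue. f x = y x) \<and> (AE x in lebesgue. g x = a_expr q r y x))"
  by (simp add: A_op_def op_graph_def AE_W)

lemma a_expr_L2:
  assumes "y \<in> max_dom q r" shows "a_expr q r y \<in> L2 W"
proof -
  have l: "(\<lambda>x. of_real (sgn x) * ell q r y x) \<in> L2 W" using assms by (intro L2_sgn) (simp add: max_dom_def)
  show ?thesis
    by (rule L2_AE_cong[OF l], rule eventually_mono[OF AE_lebesgue_nonzero]) (simp add: a_expr_ell)
qed

lemma max_dom_A_op: "y \<in> max_dom q r \<Longrightarrow> (y, a_expr q r y) \<in> A_op q r"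
  using a_expr_L2[of y] by (auto simp: A_op_iff max_dom_def)

lemma A_op_L_op:
  assumes "(f, g) \<in> A_op q r"
  shows "(f, Jop g) \<in> L_op q r"
proof -
  obtain y where y: "f \<in> L2 W" "g \<in> L2 W" "y \<in> max_dom q r" "AE x in lebesgue. f x = y x" "AE x in lebesgue. g x = a_expr q r y x"
    using assms by (auto simp: A_op_iff)
  have "Jop g \<in> L2 W" unfolding Jop_def by (rule L2_sgn[OF y(2)])
  moreover have "AE x in lebesgue. Jop g x = ell q r y x"
    using y(5) AE_lebesgue_nonzero by eventually_elim (auto simp: Jop_def a_expr_ell sgn_if)
  ultimately show ?thesis using y by (auto simp: L_op_def op_graph_def AE_W)
qed

text \<open>Single-valuedness comes from the uniqueness of continuous representatives, and symmetry
  for \<open>[.,.]\<close> from the symmetry of \<open>L\<close>, because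
  \<open>A = J L\<close>.\<close>

lemma krein_operator_A:
  assumes L: "self_adjoint W (L_op q r)" and A: "j_nonnegative W (A_op q r)" and E: "spectral_function W (A_op q r) E"
  shows "krein_operator W (A_op q r) E"
proof
  show "AE x in W. x \<noteq> 0" unfolding AE_W by (rule AE_lebesgue_nonzero)
  show "f \<in> L2 W \<and> g \<in> L2 W" if "(f, g) \<in> A_op q r" for f g using that by (simp add: A_op_iff)
  show "(\<lambda>x. a * f x + b * g x, \<lambda>x. a * f' x + b * g' x) \<in> A_op q r" if A1: "(f, f') \<in> A_op q r" and A2: "(g, g') \<in> A_op q r" for f f' g g' a b
  proof -
    obtain y where y: "f \<in> L2 W" "f' \<in> L2 W" "y \<in> max_dom q r" "AE x in lebesgue. f x = y x" "AE x in lebesgue. f' x = a_expr q r y x"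
      using A1 by (auto simp: A_op_iff)
    obtain w where w: "g \<in> L2 W" "g' \<in> L2 W" "w \<in> max_dom q r" "AE x in lebesgue. g x = w x" "AE x in lebesgue. g' x = a_expr q r w x"
      using A2 by (auto simp: A_op_iff)
    have AC: "AC_loc_deriv y" "AC_loc_deriv w" using y(3) w(3) by (auto simp: max_dom_def)
    have "AE x in lebesgue. a * f x + b * g x = a * y x + b * w x" using y(4) w(4) by eventually_elim simp
    moreover have "AE x in lebesgue. a * f' x + b * g' x = a_expr q r (\<lambda>x. a * y x + b * w x) x"
      using y(5) w(5) AE_lincomb_expr(2)[OF AC, of a b] by eventually_elim simp
    ultimately show ?thesis using max_dom_lincomb[OF y(3) w(3), of a b] L2_lincomb y w by (auto simp: A_op_iff)
  qed
  show "(g, g') \<in> A_op q r" if A1: "(f, f') \<in> A_op q r" and A2: "g \<in> L2 W" "g' \<in> L2 W" "AE x in W. f x = g x" "AE x in W. f' x = g' x" for f f' g g'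
  proof -
    obtain y where y: "y \<in> max_dom q r" "AE x in lebesgue. f x = y x" "AE x in lebesgue. f' x = a_expr q r y x"
      using A1 by (auto simp: A_op_iff)
    have "AE x in lebesgue. g x = y x" using y(2) A2(3) unfolding AE_W by eventually_elim simp
    moreover have "AE x in lebesgue. g' x = a_expr q r y x" using y(3) A2(4) unfolding AE_W by eventually_elim simp
    ultimately show ?thesis using y(1) A2(1,2) by (auto simp: A_op_iff)
  qed
  show "AE x in W. g x = 0" if A1: "(f, g) \<in> A_op q r" and A2: "AE x in W. f x = 0" for f g
  proof -
    obtain y where y: "y \<in> max_dom q r" "AE x in lebesgue. f x = y x" "AE x in lebesgue. g x = a_expr q r y x"
      using A1 by (auto simp: A_op_iff)
    have "AE x in lebesgue. y x = 0" using y(2) A2 unfolding AE_W by eventually_elim simp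
    then have y0: "y = (\<lambda>x. 0)" using AC_loc_deriv_AE_zero y(1) by (auto simp: max_dom_def)
    have "a_expr q r (\<lambda>x. 0) = (\<lambda>x. 0)" by (simp add: a_expr_def)
    then show ?thesis using y(3) unfolding y0 AE_W by simp
  qed
  show "j_inner W f' g = j_inner W f g'" if "(f, f') \<in> A_op q r" "(g, g') \<in> A_op q r" for f f' g g'
  proof -
    have "(g, Jop g') \<in> adjoint_graph W (L_op q r)"
      using A_op_L_op[OF that(2)] L by (simp add: self_adjoint_def)
    then have "l2_inner W (Jop f') g = l2_inner W f (Jop g')"
      using A_op_L_op[OF that(1)] by (auto simp: adjoint_graph_def)
    moreover have "l2_inner W f (Jop g') = l2_inner W (Jop f) g'"
      by (simp add: l2_inner_def Jop_def mult_ac)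
    ultimately show ?thesis by (simp add: j_inner_def)
  qed
  show "Re (j_inner W f' f) \<ge> 0" if "(f, f') \<in> A_op q r" for f f'
    using A that by (auto simp: j_nonnegative_def complex_nonneg_Reals_iff)
  show "spectral_function W (A_op q r) E" by (rule E)
qed simp

section \<open>Solutions, Lagrange's identity and the boundary form\<close>

text \<open>The weight is \<open>r\<close> itself, unlike the \<open>\<bar>r\<bar>\<close> of
  \<open>sl_solution\<close>: these are the formal eigenfunctions of the indefinite expression on
  the whole line.\<close>

definition sol :: "complex \<Rightarrow> (real \<Rightarrow> complex) \<Rightarrow> bool" where
  "sol z y \<longleftrightarrow> AC_loc_deriv y \<and>
     (AE x in lebesgue. vderiv (vderiv y) x = of_real (q x) * y x - of_real (r x) * (z * y x))"

definition L2on :: "real set \<Rightarrow> (real \<Rightarrow> complex) \<Rightarrow> bool" where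
  "L2on S f \<longleftrightarrow> set_integrable lebesgue S (\<lambda>x. \<bar>r x\<bar> * (cmod (f x))\<^sup>2)"

definition r_inner :: "real set \<Rightarrow> (real \<Rightarrow> complex) \<Rightarrow> (real \<Rightarrow> complex) \<Rightarrow> complex" where
  "r_inner S f g = (LINT x:S|lebesgue. of_real \<bar>r x\<bar> * (f x * cnj (g x)))"

lemma AE_lebesgue_neq: "AE x::real in lebesgue. x \<noteq> c"
  by (rule AE_I[of _ _ "{c}"]) auto

lemma AC_continuous: "AC_loc_deriv y \<Longrightarrow> continuous_on S y"
  by (rule AC_loc_imp_continuous_on[OF AC_loc_derivD(1)])

lemma L2on_lincomb:
  assumes "continuous_on UNIV f" "continuous_on UNIV g" "S \<in> sets lebesgue" "L2on S f" "L2on S g"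
    and h: "continuous_on UNIV h" "\<And>x. x \<in> S \<Longrightarrow> h x = a * f x + b * g x"
  shows "L2on S h"
proof -
  note [measurable] = continuous_measurable[OF assms(1)] continuous_measurable[OF assms(2)] continuous_measurable[OF h(1)] assms(3)
  have "set_integrable lebesgue S (\<lambda>x. 2 * (cmod a)\<^sup>2 * (\<bar>r x\<bar> * (cmod (f x))\<^sup>2) + 2 * (cmod b)\<^sup>2 * (\<bar>r x\<bar> * (cmod (g x))\<^sup>2))"
    using assms(4,5) unfolding L2on_def by (intro set_integral_add set_integrable_mult_right)
  then show ?thesis unfolding L2on_def
  proof (rule set_integrable_bound)
    show "set_borel_measurable lebesgue S (\<lambda>x. \<bar>r x\<bar> * (cmod (h x))\<^sup>2)"
      unfolding set_borel_measurable_def by measurable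
    show "AE x in lebesgue. x \<in> S \<longrightarrow> norm (\<bar>r x\<bar> * (cmod (h x))\<^sup>2) \<le>
        norm (2 * (cmod a)\<^sup>2 * (\<bar>r x\<bar> * (cmod (f x))\<^sup>2) + 2 * (cmod b)\<^sup>2 * (\<bar>r x\<bar> * (cmod (g x))\<^sup>2))"
    proof (rule AE_I2, rule impI)
      fix x assume x: "x \<in> S"
      have "(cmod (h x))\<^sup>2 \<le> (cmod (a * f x) + cmod (b * g x))\<^sup>2"
        unfolding h(2)[OF x] by (intro power_mono norm_triangle_ineq) simp
      also have "\<dots> \<le> 2 * (cmod (a * f x))\<^sup>2 + 2 * (cmod (b * g x))\<^sup>2"
        using sum_squares_ge_zero[of "cmod (a * f x) - cmod (b * g x)" 0] by (simp add: power2_eq_square algebra_simps)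
      finally have "\<bar>r x\<bar> * (cmod (h x))\<^sup>2 \<le> \<bar>r x\<bar> * (2 * (cmod (a * f x))\<^sup>2 + 2 * (cmod (b * g x))\<^sup>2)"
        by (rule mult_left_mono) simp
      then show "norm (\<bar>r x\<bar> * (cmod (h x))\<^sup>2) \<le>
        norm (2 * (cmod a)\<^sup>2 * (\<bar>r x\<bar> * (cmod (f x))\<^sup>2) + 2 * (cmod b)\<^sup>2 * (\<bar>r x\<bar> * (cmod (g x))\<^sup>2))"
        by (simp add: norm_mult power_mult_distrib algebra_simps)
    qed
  qed
qed

lemma L2on_interval:
  assumes "continuous_on UNIV f" shows "L2on {a..b} f"
proof -
  have "continuous_on UNIV (\<lambda>x. (cmod (f x))\<^sup>2)" by (intro continuous_intros assms)
  from integrable_r_continuous[OF this] show ?thesis by (simp add: L2on_def set_integrable_def)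
qed

lemma L2on_Un: "L2on A f \<Longrightarrow> L2on B f \<Longrightarrow> A \<in> sets lebesgue \<Longrightarrow> B \<in> sets lebesgue \<Longrightarrow> L2on (A \<union> B) f"
  unfolding L2on_def by (rule set_integrable_Un)

lemma L2on_subset: "L2on B f \<Longrightarrow> A \<in> sets lebesgue \<Longrightarrow> A \<subseteq> B \<Longrightarrow> L2on A f"
  unfolding L2on_def by (rule set_integrable_subset)

lemma L2on_UNIV: "continuous_on UNIV f \<Longrightarrow> L2on UNIV f \<longleftrightarrow> f \<in> L2 W"
  by (simp add: L2_continuous_iff L2on_def set_integrable_def)

lemma r_inner_integrable:
  assumes "continuous_on UNIV f" "continuous_on UNIV g"
  shows "set_integrable lebesgue {a..b} (\<lambda>x. of_real \<bar>r x\<bar> * (f x * cnj (g x)))"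
proof -
  have "continuous_on UNIV (\<lambda>x. f x * cnj (g x))" by (intro continuous_intros assms)
  from integrable_r_continuous[OF this] show ?thesis by (simp add: set_integrable_def scaleR_conv_of_real)
qed

lemma r_inner_self: "r_inner S f f = of_real (LINT x:S|lebesgue. \<bar>r x\<bar> * (cmod (f x))\<^sup>2)"
proof -
  have "(\<lambda>x. of_real \<bar>r x\<bar> * (f x * cnj (f x))) = (\<lambda>x. complex_of_real (\<bar>r x\<bar> * (cmod (f x))\<^sup>2))"
    by (simp only: of_real_mult complex_norm_square)
  then show ?thesis
    unfolding r_inner_def by (simp only: set_integral_complex_of_real)
qed

text \<open>Expansion of a 3 by 3 determinant with a repeated row, either the values or the
  derivatives of \<open>f\<close>, \<open>g\<close>, \<open>h\<close>. It expresses one solution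
  through two others.\<close>

lemma wronskian_plucker:
  "f x * wronskian g h x + g x * wronskian h f x + h x * wronskian f g x = 0"
  "vderiv f x * wronskian g h x + vderiv g x * wronskian h f x + vderiv h x * wronskian f g x = 0"
  unfolding wronskian_def by algebra+

lemma wronskian_swap: "wronskian g f x = - wronskian f g x"
  by (simp add: wronskian_def)

text \<open>The terms with \<open>q\<close> cancel. \<open>F\<close> is any integrable a.e. version
  of the remaining integrand, which allows \<open>r\<close> to be replaced by a signed
  \<open>\<bar>r\<bar>\<close> or the integrand to be written with a cut-off.\<close>

lemma lagrange:
  assumes y: "AC_loc_deriv y" "AC_loc_deriv w" and "a \<le> b"
    and eq: "AE x in lebesgue. x \<in> {a..b} \<longrightarrow> vderiv (vderiv y) x = of_real (q x) * y x - of_real (r x) * g x"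
      "AE x in lebesgue. x \<in> {a..b} \<longrightarrow> vderiv (vderiv w) x = of_real (q x) * w x - of_real (r x) * h x"
    and F: "set_integrable lebesgue {a..b} F" "AE x in lebesgue. x \<in> {a..b} \<longrightarrow> of_real (r x) * (g x * w x - y x * h x) = F x"
  shows "wronskian y w b - wronskian y w a = (LINT x:{a..b}|lebesgue. F x)"
proof -
  have "AE x in lebesgue. x \<in> {a..b} \<longrightarrow> y x * vderiv (vderiv w) x - vderiv (vderiv y) x * w x = F x"
    using eq F(2)
  proof eventually_elim
    case (elim x)
    show ?case
    proof
      assume x: "x \<in> {a..b}"
      have "y x * vderiv (vderiv w) x - vderiv (vderiv y) x * w x = of_real (r x) * (g x * w x - y x * h x)"
        unfolding elim(1)[rule_format, OF x] elim(2)[rule_format, OF x] by (simp add: algebra_simps)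
      then show "y x * vderiv (vderiv w) x - vderiv (vderiv y) x * w x = F x"
        using elim(3)[rule_format, OF x] by simp
    qed
  qed
  from wronskian_has_integral[OF y \<open>a \<le> b\<close> this] has_integral_set_lebesgue[OF F(1)]
  show ?thesis by (rule has_integral_unique)
qed

lemma max_dom_eq:
  assumes "y \<in> max_dom q r"
  shows "AE x in lebesgue. vderiv (vderiv y) x = of_real (q x) * y x - of_real (r x) * a_expr q r y x"
  using AE_lebesgue_nonzero by eventually_elim (simp add: a_expr_def r_nonzero)

lemma cnj_eq:
  assumes "AC_loc_deriv y" "AE x in lebesgue. x \<in> S \<longrightarrow> vderiv (vderiv y) x = of_real (q x) * y x - of_real (r x) * g x"
  shows "AE x in lebesgue. x \<in> S \<longrightarrow> vderiv (vderiv (\<lambda>x. cnj (y x))) x = of_real (q x) * cnj (y x) - of_real (r x) * cnj (g x)"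
  using assms(2) AC_loc_deriv_cnj(3)[OF assms(1)] by eventually_elim simp

lemma sol_lincomb:
  assumes "sol z f" "sol z g" shows "sol z (\<lambda>x. a * f x + b * g x)"
proof -
  have AC: "AC_loc_deriv f" "AC_loc_deriv g" using assms by (auto simp: sol_def)
  have "AE x in lebesgue. vderiv (vderiv (\<lambda>x. a * f x + b * g x)) x =
      of_real (q x) * (a * f x + b * g x) - of_real (r x) * (z * (a * f x + b * g x))"
    using AC_loc_deriv_lincomb(3)[OF AC, of a b] assms[unfolded sol_def, THEN conjunct2]
    by eventually_elim (simp add: algebra_simps)
  then show ?thesis using AC_loc_deriv_lincomb(1)[OF AC] by (simp add: sol_def)
qed

lemma sol_L2_eigen:
  assumes s: "sol z y" and L: "y \<in> L2 W"
  shows "(y, \<lambda>x. z * y x) \<in> A_op q r"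
proof -
  have eqa: "AE x in lebesgue. z * y x = a_expr q r y x"
    using s[unfolded sol_def, THEN conjunct2] AE_lebesgue_nonzero by eventually_elim (simp add: a_expr_def r_nonzero)
  have eql: "AE x in lebesgue. of_real (sgn x) * (z * y x) = ell q r y x"
    using eqa AE_lebesgue_nonzero by eventually_elim (auto simp: a_expr_ell sgn_if)
  have zy: "(\<lambda>x. z * y x) \<in> L2 W" by (rule L2_scale[OF L])
  have "y \<in> max_dom q r"
    using s L L2_AE_cong[OF L2_sgn[OF zy] eql] by (simp add: max_dom_def sol_def)
  then show ?thesis using L zy eqa by (auto simp: A_op_iff)
qed

lemma set_integral_exhaust:
  fixes H :: "real \<Rightarrow> 'a::euclidean_space"
  assumes "integrable lebesgue H"
  shows "(\<lambda>n. LINT x:{- real n..real n}|lebesgue. H x) \<longlonglongrightarrow> (LINT x|lebesgue. H x)"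
  unfolding set_lebesgue_integral_def
proof (rule integral_dominated_convergence[where w = "\<lambda>x. norm (H x)"])
  show "AE x in lebesgue. (\<lambda>n. indicator {- real n..real n} x *\<^sub>R H x) \<longlonglongrightarrow> H x"
  proof (rule AE_I2)
    fix x
    obtain N :: nat where N: "\<bar>x\<bar> \<le> real N" using real_arch_simple by blast
    have "\<forall>\<^sub>F n in sequentially. indicator {- real n..real n} x *\<^sub>R H x = H x"
      using eventually_ge_at_top[of N]
    proof eventually_elim
      case (elim n)
      then have "real N \<le> real n" by simp
      then have "x \<in> {- real n..real n}" using N by auto
      then show ?case by simp
    qed
    then show "(\<lambda>n. indicator {- real n..real n} x *\<^sub>R H x) \<longlonglongrightarrow> H x" by (rule tendsto_eventually)
  qed
  show "AE x in lebesgue. norm (indicator {- real n..real n} x *\<^sub>R H x) \<le> norm (H x)" for n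
    by (rule AE_I2) (simp add: indicator_def)
  show "(\<lambda>x. indicator {- real n..real n} x *\<^sub>R H x) \<in> borel_measurable lebesgue" for n
    by (intro borel_measurable_scaleR borel_measurable_indicator borel_measurable_integrable assms) simp
qed (use assms in auto)

lemma set_integral_exhaust_half:
  fixes H :: "real \<Rightarrow> 'a::euclidean_space"
  shows "set_integrable lebesgue {0..} H \<Longrightarrow> (\<lambda>n. LINT x:{0..real n}|lebesgue. H x) \<longlonglongrightarrow> (LINT x:{0..}|lebesgue. H x)"
    "set_integrable lebesgue {..0} H \<Longrightarrow> (\<lambda>n. LINT x:{- real n..0}|lebesgue. H x) \<longlonglongrightarrow> (LINT x:{..0}|lebesgue. H x)"
proof -
  have eq: "indicator {- real n..real n} x * indicator {0..} x = (indicator {0..real n} x :: real)"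
    "indicator {- real n..real n} x * indicator {..0} x = (indicator {- real n..0} x :: real)" for n x
    by (auto simp: indicator_def)
  show "set_integrable lebesgue {0..} H \<Longrightarrow> (\<lambda>n. LINT x:{0..real n}|lebesgue. H x) \<longlonglongrightarrow> (LINT x:{0..}|lebesgue. H x)"
    using set_integral_exhaust[of "\<lambda>x. indicator {0..} x *\<^sub>R H x"]
    by (simp add: set_integrable_def set_lebesgue_integral_def eq)
  show "set_integrable lebesgue {..0} H \<Longrightarrow> (\<lambda>n. LINT x:{- real n..0}|lebesgue. H x) \<longlonglongrightarrow> (LINT x:{..0}|lebesgue. H x)"
    using set_integral_exhaust[of "\<lambda>x. indicator {..0} x *\<^sub>R H x"]
    by (simp add: set_integrable_def set_lebesgue_integral_def eq)
qed

text \<open>This replaces the usual boundary-form characterisation of the limit point case.\<close>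

lemma wronskian_cnj_limit:
  assumes y: "y \<in> max_dom q r"
    and sym: "j_inner W (a_expr q r y) y = j_inner W y (a_expr q r y)"
  shows "(\<lambda>n. wronskian y (\<lambda>x. cnj (y x)) (real n) - wronskian y (\<lambda>x. cnj (y x)) (- real n)) \<longlonglongrightarrow> 0"
proof -
  let ?g = "a_expr q r y" and ?y = "\<lambda>x. cnj (y x)"
  have AC: "AC_loc_deriv y" "AC_loc_deriv ?y" using y AC_loc_deriv_cnj(1) by (auto simp: max_dom_def)
  have L: "y \<in> L2 W" "?g \<in> L2 W" "Jop y \<in> L2 W" "Jop ?g \<in> L2 W"
    using y a_expr_L2[OF y] L2_sgn unfolding Jop_def by (auto simp: max_dom_def)
  note [measurable] = L(1,2)[THEN L2_D(1), unfolded measurable_W] L(3,4)[THEN L2_D(1), unfolded measurable_W]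
  \<comment> \<open>The integrand of \<open>[A y, y] - [y, A y]\<close>. Its integral over the line
    vanishes by symmetry, and its integral over a bounded interval is the increment of the
    Wronskian.\<close>
  define H where "H x = \<bar>r x\<bar> *\<^sub>R (Jop ?g x * cnj (y x)) - \<bar>r x\<bar> *\<^sub>R (Jop y x * cnj (?g x))" for x
  have i: "integrable lebesgue (\<lambda>x. \<bar>r x\<bar> *\<^sub>R (Jop ?g x * cnj (y x)))" "integrable lebesgue (\<lambda>x. \<bar>r x\<bar> *\<^sub>R (Jop y x * cnj (?g x)))"
    using L2_integrable_mult[OF L(4,1)] L2_integrable_mult[OF L(3,2)]
      integrable_W(1)[of "\<lambda>x. Jop ?g x * cnj (y x)"] integrable_W(1)[of "\<lambda>x. Jop y x * cnj (?g x)"] by auto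
  have Hi: "integrable lebesgue H" unfolding H_def by (intro Bochner_Integration.integrable_diff i)
  have "(LINT x|lebesgue. H x) = j_inner W ?g y - j_inner W y ?g"
    unfolding H_def using i integrable_W(2)[of "\<lambda>x. Jop ?g x * cnj (y x)"] integrable_W(2)[of "\<lambda>x. Jop y x * cnj (?g x)"]
    by (simp add: j_inner_def l2_inner_def)
  then have H0: "(LINT x|lebesgue. H x) = 0" using sym by simp
  have "wronskian y ?y (real n) - wronskian y ?y (- real n) = (LINT x:{- real n..real n}|lebesgue. H x)" for n
  proof (rule lagrange[OF AC])
    show "AE x in lebesgue. x \<in> {- real n..real n} \<longrightarrow> vderiv (vderiv y) x = of_real (q x) * y x - of_real (r x) * ?g x"
      using max_dom_eq[OF y] by (auto elim: eventually_mono)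
    then show "AE x in lebesgue. x \<in> {- real n..real n} \<longrightarrow> vderiv (vderiv ?y) x = of_real (q x) * ?y x - of_real (r x) * cnj (?g x)"
      by (rule cnj_eq[OF AC(1)])
    show "set_integrable lebesgue {- real n..real n} H"
      unfolding set_integrable_def by (rule integrable_mult_indicator[OF _ Hi]) simp
    show "AE x in lebesgue. x \<in> {- real n..real n} \<longrightarrow> of_real (r x) * (?g x * ?y x - y x * cnj (?g x)) = H x"
      using AE_lebesgue_nonzero
    proof eventually_elim
      case (elim x)
      have "complex_of_real (r x) = of_real \<bar>r x\<bar> * of_real (sgn x)"
        using r_abs[OF elim] by (metis mult.commute of_real_mult)
      then show ?case by (simp add: H_def Jop_def scaleR_conv_of_real algebra_simps)
    qed
  qed simp
  then show ?thesis using set_integral_exhaust[OF Hi] H0 by simp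
qed

end

section \<open>Weyl solutions at a fixed nonreal point\<close>

text \<open>\<open>m1\<close> and \<open>m2\<close> stand for the values of \<open>M_plus\<close>
  and \<open>M_minus\<close> at \<open>z\<close>. \<open>distinct\<close> records that both
  solutions come from one family parametrised by the value at 0; the last three assumptions retain
  of the operator that \<open>z\<close> is no eigenvalue, that \<open>A\<close> is symmetric, and
  that \<open>A - z\<close> is onto.\<close>

locale weyl_solutions = sl_weight +
  fixes z m1 m2 :: complex and \<Psi>1 \<Psi>2 :: "real \<Rightarrow> complex"
  assumes Im_z: "Im z > 0"
    and sol1: "sol z \<Psi>1" and sol2: "sol z \<Psi>2"
    and init: "\<Psi>1 0 = - m1" "vderiv \<Psi>1 0 = 1" "\<Psi>2 0 = - m2" "vderiv \<Psi>2 0 = 1"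
    and L2_1: "L2on {0..} \<Psi>1" and L2_2: "L2on {..0} \<Psi>2"
    and distinct: "m1 = m2 \<Longrightarrow> \<Psi>1 = \<Psi>2"
    and no_eigen: "\<And>y. (y, \<lambda>x. z * y x) \<in> A_op q r \<Longrightarrow> AE x in lebesgue. y x = 0"
    and A_sym: "\<And>y. y \<in> max_dom q r \<Longrightarrow> j_inner W (a_expr q r y) y = j_inner W y (a_expr q r y)"
    and solvable: "\<And>f. f \<in> L2 W \<Longrightarrow> \<exists>y\<in>max_dom q r. AE x in lebesgue. a_expr q r y x = f x + z * y x"
begin

lemma AC1: "AC_loc_deriv \<Psi>1" and AC2: "AC_loc_deriv \<Psi>2"
  using sol1 sol2 by (auto simp: sol_def)

text \<open>Square-integrability on both parts would make \<open>y\<close> an eigenfunction, hence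
  zero, against the slope 1 at 0.\<close>

lemma not_global_L2:
  assumes "sol z y" "vderiv y 0 = 1" "L2on S y" "L2on (- S) y" "S \<in> sets lebesgue"
  shows False
proof -
  have AC: "AC_loc_deriv y" using assms(1) by (simp add: sol_def)
  have "- S \<in> sets lebesgue" using sets.compl_sets[OF assms(5)] by (simp add: Compl_eq_Diff_UNIV)
  then have "L2on (S \<union> - S) y" using assms by (intro L2on_Un) auto
  then have "y \<in> L2 W" using L2on_UNIV[OF AC_continuous[OF AC]] by simp
  then have "y = (\<lambda>x. 0)" using no_eigen[OF sol_L2_eigen[OF assms(1)]] AC_loc_deriv_AE_zero[OF AC] by blast
  then show False using assms(2) by simp
qed

text \<open>Uniqueness of square-integrable solutions on a half-line: two independent ones would make
  the solution square-integrable on the other half-line into an eigenfunction.\<close>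

lemma wronskian_zero:
  assumes S: "\<And>u v. u \<in> S \<Longrightarrow> v \<in> S \<Longrightarrow> {u..v} \<subseteq> S" "S \<in> sets lebesgue"
    and y: "AC_loc_deriv y" "AE x in lebesgue. x \<in> S \<longrightarrow> vderiv (vderiv y) x = of_real (q x) * y x - of_real (r x) * (z * y x)" "L2on S y"
    and \<Phi>: "sol z \<Phi>" "L2on S \<Phi>" and \<Psi>: "sol z \<Psi>" "L2on (- S) \<Psi>" "vderiv \<Psi> 0 = 1"
    and x0: "x0 \<in> S"
  shows "wronskian y \<Phi> x0 = 0"
proof (rule ccontr)
  assume nz: "wronskian y \<Phi> x0 \<noteq> 0"
  have AC: "AC_loc_deriv \<Phi>" "AC_loc_deriv \<Psi>" using \<Phi> \<Psi> by (auto simp: sol_def)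
  have const: "wronskian f g u = wronskian f g v"
    if f: "AC_loc_deriv f" "AE x in lebesgue. x \<in> S \<longrightarrow> vderiv (vderiv f) x = of_real (q x) * f x - of_real (r x) * (z * f x)"
      and g: "AC_loc_deriv g" "AE x in lebesgue. x \<in> S \<longrightarrow> vderiv (vderiv g) x = of_real (q x) * g x - of_real (r x) * (z * g x)"
      and uv: "u \<in> S" "v \<in> S" for f g u v
  proof -
    have *: "wronskian f g v = wronskian f g u" if uv: "u \<in> S" "v \<in> S" "u \<le> v" for u v
    proof -
      have sub: "{u..v} \<subseteq> S" using S(1) uv by blast
      have "wronskian f g v - wronskian f g u = (LINT x:{u..v}|lebesgue. (0::complex))"
      proof (rule lagrange[OF f(1) g(1) uv(3)])
        show "AE x in lebesgue. x \<in> {u..v} \<longrightarrow> vderiv (vderiv f) x = of_real (q x) * f x - of_real (r x) * (z * f x)"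
          using f(2) by (rule eventually_mono) (use sub in blast)
        show "AE x in lebesgue. x \<in> {u..v} \<longrightarrow> vderiv (vderiv g) x = of_real (q x) * g x - of_real (r x) * (z * g x)"
          using g(2) by (rule eventually_mono) (use sub in blast)
      qed (auto simp: set_integrable_def)
      then show ?thesis by (simp add: set_lebesgue_integral_def)
    qed
    show ?thesis using *[of u v] *[of v u] uv by (cases "u \<le> v") auto
  qed
  have e\<Phi>: "AE x in lebesgue. x \<in> S \<longrightarrow> vderiv (vderiv \<Phi>) x = of_real (q x) * \<Phi> x - of_real (r x) * (z * \<Phi> x)"
    and e\<Psi>: "AE x in lebesgue. x \<in> S \<longrightarrow> vderiv (vderiv \<Psi>) x = of_real (q x) * \<Psi> x - of_real (r x) * (z * \<Psi> x)"
    using \<Phi>(1) \<Psi>(1) by (auto simp: sol_def elim: eventually_mono)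
  define k a b where "k = wronskian y \<Phi> x0" and "a = wronskian \<Phi> \<Psi> x0" and "b = wronskian \<Psi> y x0"
  have "\<Psi> x = (- a / k) * y x + (- b / k) * \<Phi> x" if x: "x \<in> S" for x
  proof -
    have "wronskian y \<Phi> x = k" "wronskian \<Phi> \<Psi> x = a" "wronskian \<Psi> y x = b"
      unfolding k_def a_def b_def by (intro const y(1,2) AC e\<Phi> e\<Psi> x x0)+
    then have "y x * a + \<Phi> x * b + \<Psi> x * k = 0"
      using wronskian_plucker(1)[of y x \<Phi> \<Psi>] by simp
    then have "\<Psi> x * k = - a * y x - b * \<Phi> x" by (simp add: eq_neg_iff_add_eq_0 algebra_simps)
    then show ?thesis using nz by (simp add: k_def field_simps)
  qed
  then have "L2on S \<Psi>"
    by (intro L2on_lincomb[OF AC_continuous[OF y(1)] AC_continuous[OF AC(1)] S(2) y(3) \<Phi>(2) AC_continuous[OF AC(2)]])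
  then show False using not_global_L2[OF \<Psi>(1,3) _ \<Psi>(2) S(2)] by blast
qed

definition w :: complex where "w = wronskian \<Psi>1 \<Psi>2 0"

lemma w_eq: "w = m2 - m1"
  by (simp add: w_def wronskian_def init)

text \<open>Equal coefficients would give a single solution that is square-integrable at both
  ends.\<close>

lemma w_nonzero: "w \<noteq> 0"
proof
  assume "w = 0"
  then have "\<Psi>1 = \<Psi>2" using distinct by (simp add: w_eq)
  moreover have "L2on (- {0..}) \<Psi>2" by (rule L2on_subset[OF L2_2]) auto
  ultimately show False using not_global_L2[OF sol1 init(2) L2_1] by simp
qed

lemma wronskian_const: "wronskian \<Psi>1 \<Psi>2 x = w"
proof -
  have *: "wronskian \<Psi>1 \<Psi>2 v = wronskian \<Psi>1 \<Psi>2 u" if uv: "u \<le> v" for u v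
  proof -
    have "wronskian \<Psi>1 \<Psi>2 v - wronskian \<Psi>1 \<Psi>2 u = (LINT x:{u..v}|lebesgue. (0::complex))"
      by (rule lagrange[OF AC1 AC2 uv, where g = "\<lambda>x. z * \<Psi>1 x" and h = "\<lambda>x. z * \<Psi>2 x"])
        (use sol1 sol2 in \<open>auto simp: set_integrable_def sol_def elim: eventually_mono\<close>)
    then show ?thesis by (simp add: set_lebesgue_integral_def)
  qed
  show ?thesis using *[of 0 x] *[of x 0] by (cases "x \<ge> 0") (auto simp: w_def)
qed

text \<open>The conjugate of \<open>G\<close>, multiplied by the sign and cut off to
  \<open>{a..b}\<close>. The sign factor turns \<open>r\<close> into \<open>\<bar>r\<bar>\<close>,
  so that pairing this source with a solution \<Psi> gives
  \<open>r_inner {a..b} \<Psi> G\<close>.\<close>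

definition src :: "real \<Rightarrow> real \<Rightarrow> (real \<Rightarrow> complex) \<Rightarrow> real \<Rightarrow> complex" where
  "src a b G = (\<lambda>x. indicator {a..b} x * (of_real (sgn x) * cnj (G x)))"

lemma src_L2:
  assumes "continuous_on UNIV G"
  shows "src a b G \<in> L2 W" "(l2_norm W (src a b G))\<^sup>2 = (LINT x:{a..b}|lebesgue. \<bar>r x\<bar> * (cmod (G x))\<^sup>2)"
proof -
  have [measurable]: "G \<in> borel_measurable lebesgue" by (rule continuous_measurable[OF assms])
  have "(\<lambda>x. of_real (sgn x) * cnj (G x)) \<in> borel_measurable lebesgue" by measurable
  then have m: "src a b G \<in> borel_measurable lebesgue"
    unfolding src_def by (intro borel_measurable_times borel_measurable_indicator) auto
  have eq: "AE x in lebesgue. \<bar>r x\<bar> *\<^sub>R (cmod (src a b G x))\<^sup>2 = indicator {a..b} x *\<^sub>R (\<bar>r x\<bar> * (cmod (G x))\<^sup>2)"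
    using AE_lebesgue_nonzero by eventually_elim (auto simp: src_def norm_mult sgn_if indicator_def)
  have i: "integrable lebesgue (\<lambda>x. indicator {a..b} x *\<^sub>R (\<bar>r x\<bar> * (cmod (G x))\<^sup>2))"
    using L2on_interval[OF assms] by (simp add: L2on_def set_integrable_def)
  have m2: "(\<lambda>x. \<bar>r x\<bar> *\<^sub>R (cmod (src a b G x))\<^sup>2) \<in> borel_measurable lebesgue"
    using m by measurable
  have mi: "(\<lambda>x. (cmod (src a b G x))\<^sup>2) \<in> borel_measurable lebesgue" using m by measurable
  have "integrable lebesgue (\<lambda>x. \<bar>r x\<bar> *\<^sub>R (cmod (src a b G x))\<^sup>2)"
    by (rule iffD2[OF integrable_cong_AE[OF m2 borel_measurable_integrable[OF i] eq] i])
  then show L: "src a b G \<in> L2 W" using integrable_W(1)[OF mi] m by (simp add: L2_def measurable_W)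
  have "(l2_norm W (src a b G))\<^sup>2 = (LINT x|W. (cmod (src a b G x))\<^sup>2)"
    by (simp add: l2_norm_def)
  also have "\<dots> = (LINT x|lebesgue. \<bar>r x\<bar> *\<^sub>R (cmod (src a b G x))\<^sup>2)" by (rule integrable_W(2)[OF mi])
  also have "\<dots> = (LINT x|lebesgue. indicator {a..b} x *\<^sub>R (\<bar>r x\<bar> * (cmod (G x))\<^sup>2))"
    by (rule integral_cong_AE[OF m2 borel_measurable_integrable[OF i] eq])
  finally show "(l2_norm W (src a b G))\<^sup>2 = (LINT x:{a..b}|lebesgue. \<bar>r x\<bar> * (cmod (G x))\<^sup>2)"
    by (simp add: set_lebesgue_integral_def)
qed

text \<open>The solution of the inhomogeneous equation with right-hand side supported in \<open>{a..b}\<close> is a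
  multiple of a Weyl solution outside \<open>{a..b}\<close>, with the coefficient that Green's function predicts.\<close>

lemma resolvent_outside:
  assumes "a \<le> b" and G: "continuous_on UNIV G" and y: "y \<in> max_dom q r"
    and eq: "AE x in lebesgue. a_expr q r y x = src a b G x + z * y x"
  shows "x \<le> a \<Longrightarrow> w * y x = r_inner {a..b} \<Psi>1 G * \<Psi>2 x \<and> w * vderiv y x = r_inner {a..b} \<Psi>1 G * vderiv \<Psi>2 x"
    "x \<ge> b \<Longrightarrow> w * y x = r_inner {a..b} \<Psi>2 G * \<Psi>1 x \<and> w * vderiv y x = r_inner {a..b} \<Psi>2 G * vderiv \<Psi>1 x"
proof -
  have AC: "AC_loc_deriv y" using y by (simp add: max_dom_def)
  have ode: "AE x in lebesgue. vderiv (vderiv y) x = of_real (q x) * y x - of_real (r x) * (src a b G x + z * y x)"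
    using max_dom_eq[OF y] eq by eventually_elim simp
  have yL: "L2on UNIV y" using y L2on_UNIV[OF AC_continuous[OF AC]] by (simp add: max_dom_def)
  \<comment> \<open>To the right of \<open>b\<close> the source vanishes, so \<open>y\<close> is a
    square-integrable solution there and depends linearly on \<open>\<Psi>1\<close>.\<close>
  have right: "wronskian y \<Psi>1 x = 0" if "x \<ge> b" for x
  proof (rule wronskian_zero[of "{b..}" y \<Psi>1 \<Psi>2])
    show "AE x in lebesgue. x \<in> {b..} \<longrightarrow> vderiv (vderiv y) x = of_real (q x) * y x - of_real (r x) * (z * y x)"
      using ode AE_lebesgue_neq[of b] by eventually_elim (auto simp: src_def)
    have "L2on ({b..0} \<union> {0..}) \<Psi>1" by (intro L2on_Un L2on_interval AC_continuous AC1 L2_1) auto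
    then show "L2on {b..} \<Psi>1" by (rule L2on_subset) auto
    have "L2on ({0..b} \<union> {..0}) \<Psi>2" by (intro L2on_Un L2on_interval AC_continuous AC2 L2_2) auto
    then show "L2on (- {b..}) \<Psi>2" by (rule L2on_subset) auto
    show "L2on {b..} y" by (rule L2on_subset[OF yL]) auto
  qed (use AC sol1 sol2 init that in auto)
  have left: "wronskian y \<Psi>2 x = 0" if "x \<le> a" for x
  proof (rule wronskian_zero[of "{..a}" y \<Psi>2 \<Psi>1])
    show "AE x in lebesgue. x \<in> {..a} \<longrightarrow> vderiv (vderiv y) x = of_real (q x) * y x - of_real (r x) * (z * y x)"
      using ode AE_lebesgue_neq[of a] by eventually_elim (auto simp: src_def)
    have "L2on ({0..a} \<union> {..0}) \<Psi>2" by (intro L2on_Un L2on_interval AC_continuous AC2 L2_2) auto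
    then show "L2on {..a} \<Psi>2" by (rule L2on_subset) auto
    have "L2on ({a..0} \<union> {0..}) \<Psi>1" by (intro L2on_Un L2on_interval AC_continuous AC1 L2_1) auto
    then show "L2on (- {..a}) \<Psi>1" by (rule L2on_subset) auto
    show "L2on {..a} y" by (rule L2on_subset[OF yL]) auto
  qed (use AC sol1 sol2 init that in auto)
  \<comment> \<open>Across the support of the source, the Wronskian of \<open>y\<close> with a
    solution grows by the pairing of the source with that solution.\<close>
  have jump: "wronskian y \<Psi> v - wronskian y \<Psi> u = r_inner {a..b} \<Psi> G"
    if \<Psi>: "sol z \<Psi>" and uv: "u \<le> a" "b \<le> v" for \<Psi> u v
  proof -
    have AC\<Psi>: "AC_loc_deriv \<Psi>" using \<Psi> by (simp add: sol_def)
    let ?F = "\<lambda>x. indicator {a..b} x *\<^sub>R (of_real \<bar>r x\<bar> * (\<Psi> x * cnj (G x)))"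
    have i: "integrable lebesgue ?F"
      using r_inner_integrable[OF AC_continuous[OF AC\<Psi>] G, of a b] by (simp add: set_integrable_def)
    have "wronskian y \<Psi> v - wronskian y \<Psi> u = (LINT x:{u..v}|lebesgue. ?F x)"
    proof (rule lagrange[OF AC AC\<Psi>, where g = "\<lambda>x. src a b G x + z * y x" and h = "\<lambda>x. z * \<Psi> x"])
      show "set_integrable lebesgue {u..v} ?F"
        unfolding set_integrable_def by (rule integrable_mult_indicator[OF _ i]) simp
      show "AE x in lebesgue. x \<in> {u..v} \<longrightarrow> of_real (r x) * ((src a b G x + z * y x) * \<Psi> x - y x * (z * \<Psi> x)) = ?F x"
        using AE_lebesgue_nonzero
      proof eventually_elim
        case (elim x)
        have "complex_of_real (r x) * of_real (sgn x) = of_real \<bar>r x\<bar>"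
          using r_abs[OF elim] elim by (cases "x > 0") (auto simp: sgn_if)
        then have "of_real (r x) * (of_real (sgn x) * cnj (G x)) * \<Psi> x = of_real \<bar>r x\<bar> * (\<Psi> x * cnj (G x))"
          by (simp add: mult.assoc[symmetric])
        then show ?case by (auto simp: src_def indicator_def algebra_simps)
      qed
    qed (use ode \<Psi> uv \<open>a \<le> b\<close> in \<open>auto simp: sol_def elim: eventually_mono\<close>)
    also have "\<dots> = r_inner {a..b} \<Psi> G"
    proof -
      have "indicator {u..v} x * indicator {a..b} x = (indicator {a..b} x :: real)" for x
        using uv by (auto simp: indicator_def)
      then show ?thesis by (simp only: set_lebesgue_integral_def r_inner_def scaleR_scaleR)
    qed
    finally show ?thesis .
  qed
  show "x \<le> a \<Longrightarrow> w * y x = r_inner {a..b} \<Psi>1 G * \<Psi>2 x \<and> w * vderiv y x = r_inner {a..b} \<Psi>1 G * vderiv \<Psi>2 x"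
  proof -
    assume x: "x \<le> a"
    have 1: "wronskian y \<Psi>1 x = - r_inner {a..b} \<Psi>1 G" using jump[OF sol1 x order_refl, symmetric] right[OF order_refl] by simp
    have 2: "wronskian \<Psi>2 y x = 0" using left[OF x] wronskian_swap[of \<Psi>2 y x] by simp
    \<comment> \<open>With all three Wronskians known, the Plucker relation for \<open>y\<close>,
      \<open>\<Psi>1\<close>, \<open>\<Psi>2\<close> solves for \<open>y\<close>; its second form
      gives the derivative.\<close>
    show ?thesis using wronskian_plucker[of y x \<Psi>1 \<Psi>2] unfolding wronskian_const 1 2
      by (simp add: algebra_simps add_eq_0_iff2)
  qed
  show "x \<ge> b \<Longrightarrow> w * y x = r_inner {a..b} \<Psi>2 G * \<Psi>1 x \<and> w * vderiv y x = r_inner {a..b} \<Psi>2 G * vderiv \<Psi>1 x"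
  proof -
    assume x: "x \<ge> b"
    have "wronskian y \<Psi>2 x = r_inner {a..b} \<Psi>2 G" using jump[OF sol2 order_refl x] left[OF order_refl] by simp
    then have 1: "wronskian \<Psi>2 y x = - r_inner {a..b} \<Psi>2 G" using wronskian_swap[of \<Psi>2 y x] by simp
    have 2: "wronskian y \<Psi>1 x = 0" using right[OF x] .
    show ?thesis using wronskian_plucker[of y x \<Psi>1 \<Psi>2] unfolding wronskian_const 1 2
      by (simp add: algebra_simps add_eq_0_iff2)
  qed
qed

definition N1 :: real where "N1 = (LINT x:{0..}|lebesgue. \<bar>r x\<bar> * (cmod (\<Psi>1 x))\<^sup>2)"
definition N2 :: real where "N2 = (LINT x:{..0}|lebesgue. \<bar>r x\<bar> * (cmod (\<Psi>2 x))\<^sup>2)"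

text \<open>Lagrange's identity for \<Psi> and its conjugate, where
  \<open>z - cnj z = 2 \<i> Im z\<close>. The sign of \<open>r\<close> on the interval is
  \<open>e\<close>.\<close>

lemma wronskian_cnj_growth:
  assumes \<Psi>: "sol z \<Psi>" and ab: "a \<le> b" and sg: "\<And>x. a < x \<Longrightarrow> x < b \<Longrightarrow> r x = e * \<bar>r x\<bar>"
  shows "wronskian \<Psi> (\<lambda>x. cnj (\<Psi> x)) b - wronskian \<Psi> (\<lambda>x. cnj (\<Psi> x)) a =
    2 * \<i> * of_real (Im z) * of_real e * of_real (LINT x:{a..b}|lebesgue. \<bar>r x\<bar> * (cmod (\<Psi> x))\<^sup>2)"
proof -
  have AC: "AC_loc_deriv \<Psi>" using \<Psi> by (simp add: sol_def)
  let ?F = "\<lambda>x. 2 * \<i> * of_real (Im z) * of_real e * (of_real \<bar>r x\<bar> * (\<Psi> x * cnj (\<Psi> x)))"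
  have "wronskian \<Psi> (\<lambda>x. cnj (\<Psi> x)) b - wronskian \<Psi> (\<lambda>x. cnj (\<Psi> x)) a = (LINT x:{a..b}|lebesgue. ?F x)"
  proof (rule lagrange[OF AC AC_loc_deriv_cnj(1)[OF AC] ab])
    show ode: "AE x in lebesgue. x \<in> {a..b} \<longrightarrow> vderiv (vderiv \<Psi>) x = of_real (q x) * \<Psi> x - of_real (r x) * (z * \<Psi> x)"
      using \<Psi> by (auto simp: sol_def elim: eventually_mono)
    show "AE x in lebesgue. x \<in> {a..b} \<longrightarrow> vderiv (vderiv (\<lambda>x. cnj (\<Psi> x))) x = of_real (q x) * cnj (\<Psi> x) - of_real (r x) * cnj (z * \<Psi> x)"
      by (rule cnj_eq[OF AC ode])
    show "set_integrable lebesgue {a..b} ?F"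
      by (intro set_integrable_mult_right r_inner_integrable AC_continuous AC)
    show "AE x in lebesgue. x \<in> {a..b} \<longrightarrow> of_real (r x) * (z * \<Psi> x * cnj (\<Psi> x) - \<Psi> x * cnj (z * \<Psi> x)) = ?F x"
      using AE_lebesgue_neq[of a] AE_lebesgue_neq[of b]
    proof eventually_elim
      case (elim x)
      show ?case
      proof
        assume "x \<in> {a..b}"
        then have "r x = e * \<bar>r x\<bar>" using sg[of x] elim by auto
        then have "complex_of_real (r x) = of_real (e * \<bar>r x\<bar>)" by (rule arg_cong)
        then have "complex_of_real (r x) = of_real e * of_real \<bar>r x\<bar>" by (simp only: of_real_mult)
        moreover have "z * \<Psi> x * cnj (\<Psi> x) - \<Psi> x * cnj (z * \<Psi> x) = 2 * \<i> * of_real (Im z) * (\<Psi> x * cnj (\<Psi> x))"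
        proof -
          have "z * \<Psi> x * cnj (\<Psi> x) - \<Psi> x * cnj (z * \<Psi> x) = (z - cnj z) * (\<Psi> x * cnj (\<Psi> x))"
            by (simp add: algebra_simps)
          also have "z - cnj z = 2 * \<i> * of_real (Im z)" by (simp add: complex_eq_iff)
          finally show ?thesis .
        qed
        ultimately show "of_real (r x) * (z * \<Psi> x * cnj (\<Psi> x) - \<Psi> x * cnj (z * \<Psi> x)) = ?F x"
          by (simp add: mult_ac)
      qed
    qed
  qed
  also have "\<dots> = 2 * \<i> * of_real (Im z) * of_real e * r_inner {a..b} \<Psi> \<Psi>"
    unfolding r_inner_def by (rule set_integral_mult_right)
  finally show ?thesis by (simp add: r_inner_self)
qed

text \<open>At 0 the normalisation gives \<open>- 2 \<i> Im m\<close>. On the left half-line the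
  negative sign of \<open>r\<close> and the reversed direction of integration compensate each
  other.\<close>

lemma wronskian_cnj_limits:
  "(\<lambda>n. wronskian \<Psi>1 (\<lambda>x. cnj (\<Psi>1 x)) (real n)) \<longlonglongrightarrow> 2 * \<i> * of_real (Im z * N1 - Im m1)"
  "(\<lambda>n. wronskian \<Psi>2 (\<lambda>x. cnj (\<Psi>2 x)) (- real n)) \<longlonglongrightarrow> 2 * \<i> * of_real (Im z * N2 - Im m2)"
proof -
  have w0: "wronskian \<Psi>1 (\<lambda>x. cnj (\<Psi>1 x)) 0 = - 2 * \<i> * of_real (Im m1)"
    "wronskian \<Psi>2 (\<lambda>x. cnj (\<Psi>2 x)) 0 = - 2 * \<i> * of_real (Im m2)"
    using fun_cong[OF AC_loc_deriv_cnj(2)[OF AC1], of 0] fun_cong[OF AC_loc_deriv_cnj(2)[OF AC2], of 0]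
    by (simp_all add: wronskian_def init complex_eq_iff)
  have rs: "r x = 1 * \<bar>r x\<bar>" if "0 < x" for x using r_abs[of x] that by simp
  have rs': "r x = - 1 * \<bar>r x\<bar>" if "x < 0" for x using r_abs[of x] that by simp
  have e1: "wronskian \<Psi>1 (\<lambda>x. cnj (\<Psi>1 x)) (real n) = 2 * \<i> * of_real (Im z * (LINT x:{0..real n}|lebesgue. \<bar>r x\<bar> * (cmod (\<Psi>1 x))\<^sup>2) - Im m1)" for n
    using wronskian_cnj_growth[OF sol1, of 0 "real n" 1] rs w0 by (simp add: algebra_simps)
  have e2: "wronskian \<Psi>2 (\<lambda>x. cnj (\<Psi>2 x)) (- real n) = 2 * \<i> * of_real (Im z * (LINT x:{- real n..0}|lebesgue. \<bar>r x\<bar> * (cmod (\<Psi>2 x))\<^sup>2) - Im m2)" for n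
    using wronskian_cnj_growth[OF sol2, of "- real n" 0 "- 1"] rs' w0 by (simp add: algebra_simps)
  show "(\<lambda>n. wronskian \<Psi>1 (\<lambda>x. cnj (\<Psi>1 x)) (real n)) \<longlonglongrightarrow> 2 * \<i> * of_real (Im z * N1 - Im m1)"
    unfolding e1 N1_def by (intro tendsto_intros set_integral_exhaust_half(1) L2_1[unfolded L2on_def])
  show "(\<lambda>n. wronskian \<Psi>2 (\<lambda>x. cnj (\<Psi>2 x)) (- real n)) \<longlonglongrightarrow> 2 * \<i> * of_real (Im z * N2 - Im m2)"
    unfolding e2 N2_def by (intro tendsto_intros set_integral_exhaust_half(2) L2_2[unfolded L2on_def])
qed

text \<open>The difference of the boundary forms at the two ends vanishes for functions of the
  domain. For the solution \<open>y\<close> with source on \<open>{-1..1}\<close>,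
  \<open>w * y\<close> is a multiple of \<open>\<Psi>1\<close> to the right and of
  \<open>\<Psi>2\<close> to the left, which links the two defects \<open>Im z * N1 - Im m1\<close>
  and \<open>Im z * N2 - Im m2\<close>.\<close>

lemma boundary_relation:
  assumes G: "continuous_on UNIV G"
  shows "(cmod (r_inner {-1..1} \<Psi>2 G))\<^sup>2 * (Im z * N1 - Im m1) = (cmod (r_inner {-1..1} \<Psi>1 G))\<^sup>2 * (Im z * N2 - Im m2)"
proof -
  obtain y where y: "y \<in> max_dom q r" "AE x in lebesgue. a_expr q r y x = src (-1) 1 G x + z * y x"
    using solvable[OF src_L2(1)[OF G]] by blast
  have AC: "AC_loc_deriv y" using y(1) by (simp add: max_dom_def)
  let ?I1 = "r_inner {-1..1} \<Psi>1 G" and ?I2 = "r_inner {-1..1} \<Psi>2 G"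
  have scale: "(w * cnj w) * wronskian y (\<lambda>x. cnj (y x)) x = (k * cnj k) * wronskian \<Psi> (\<lambda>x. cnj (\<Psi> x)) x"
    if e: "w * y x = k * \<Psi> x" "w * vderiv y x = k * vderiv \<Psi> x" and A: "AC_loc_deriv \<Psi>" for x k \<Psi>
  proof -
    have c: "cnj w * cnj (y x) = cnj k * cnj (\<Psi> x)" "cnj w * cnj (vderiv y x) = cnj k * cnj (vderiv \<Psi> x)"
      using arg_cong[OF e(1), of cnj] arg_cong[OF e(2), of cnj] by simp_all
    have "(w * cnj w) * wronskian y (\<lambda>x. cnj (y x)) x = (w * y x) * (cnj w * cnj (vderiv y x)) - (w * vderiv y x) * (cnj w * cnj (y x))"
      using fun_cong[OF AC_loc_deriv_cnj(2)[OF AC], of x] by (simp add: wronskian_def algebra_simps)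
    also have "\<dots> = (k * \<Psi> x) * (cnj k * cnj (vderiv \<Psi> x)) - (k * vderiv \<Psi> x) * (cnj k * cnj (\<Psi> x))"
      unfolding e c ..
    also have "\<dots> = (k * cnj k) * wronskian \<Psi> (\<lambda>x. cnj (\<Psi> x)) x"
      using fun_cong[OF AC_loc_deriv_cnj(2)[OF A], of x] by (simp add: wronskian_def algebra_simps)
    finally show ?thesis .
  qed
  have "(\<lambda>n. (w * cnj w) * (wronskian y (\<lambda>x. cnj (y x)) (real n) - wronskian y (\<lambda>x. cnj (y x)) (- real n))) \<longlonglongrightarrow> (w * cnj w) * 0"
    by (intro tendsto_mult tendsto_const wronskian_cnj_limit y A_sym)
  moreover have "\<forall>\<^sub>F n in sequentially. (w * cnj w) * (wronskian y (\<lambda>x. cnj (y x)) (real n) - wronskian y (\<lambda>x. cnj (y x)) (- real n)) =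
      (?I2 * cnj ?I2) * wronskian \<Psi>1 (\<lambda>x. cnj (\<Psi>1 x)) (real n) - (?I1 * cnj ?I1) * wronskian \<Psi>2 (\<lambda>x. cnj (\<Psi>2 x)) (- real n)"
    using eventually_ge_at_top[of 1]
  proof eventually_elim
    case (elim n)
    then have n: "real n \<ge> 1" "- real n \<le> -1" by auto
    have o1: "w * y (real n) = ?I2 * \<Psi>1 (real n)" "w * vderiv y (real n) = ?I2 * vderiv \<Psi>1 (real n)"
      using resolvent_outside(2)[OF _ G y, of "real n"] n by auto
    have o2: "w * y (- real n) = ?I1 * \<Psi>2 (- real n)" "w * vderiv y (- real n) = ?I1 * vderiv \<Psi>2 (- real n)"
      using resolvent_outside(1)[OF _ G y, of "- real n"] n by auto
    show ?case using scale[OF o1 AC1] scale[OF o2 AC2] by (simp add: right_diff_distrib)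
  qed
  ultimately have "(\<lambda>n. (?I2 * cnj ?I2) * wronskian \<Psi>1 (\<lambda>x. cnj (\<Psi>1 x)) (real n) - (?I1 * cnj ?I1) * wronskian \<Psi>2 (\<lambda>x. cnj (\<Psi>2 x)) (- real n)) \<longlonglongrightarrow> 0"
    by (simp add: Lim_transform_eventually)
  moreover have "(\<lambda>n. (?I2 * cnj ?I2) * wronskian \<Psi>1 (\<lambda>x. cnj (\<Psi>1 x)) (real n) - (?I1 * cnj ?I1) * wronskian \<Psi>2 (\<lambda>x. cnj (\<Psi>2 x)) (- real n))
      \<longlonglongrightarrow> (?I2 * cnj ?I2) * (2 * \<i> * of_real (Im z * N1 - Im m1)) - (?I1 * cnj ?I1) * (2 * \<i> * of_real (Im z * N2 - Im m2))"
    by (intro tendsto_diff tendsto_mult tendsto_const wronskian_cnj_limits)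
  ultimately have "(?I2 * cnj ?I2) * (2 * \<i> * of_real (Im z * N1 - Im m1)) - (?I1 * cnj ?I1) * (2 * \<i> * of_real (Im z * N2 - Im m2)) = 0"
    using LIMSEQ_unique by blast
  then have "2 * \<i> * ((?I2 * cnj ?I2) * of_real (Im z * N1 - Im m1) - (?I1 * cnj ?I1) * of_real (Im z * N2 - Im m2)) = 0"
    by (simp only: right_diff_distrib mult_ac)
  then have "(?I2 * cnj ?I2) * of_real (Im z * N1 - Im m1) = (?I1 * cnj ?I1) * of_real (Im z * N2 - Im m2)" by simp
  then show ?thesis
    unfolding complex_norm_square[symmetric] of_real_mult[symmetric] of_real_eq_iff .
qed

text \<open>The weight \<open>\<bar>r\<bar>\<close> is positive off 0, so \<open>G\<close> vanishes
  a.e. on the interval and, by continuity, everywhere near 0.\<close>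

lemma r_inner_definite:
  assumes AC: "AC_loc_deriv G" and "r_inner {-1..1} G G = 0"
  shows "G 0 = 0 \<and> vderiv G 0 = 0"
proof -
  have i: "integrable lebesgue (\<lambda>x. indicator {-1..1} x *\<^sub>R (\<bar>r x\<bar> * (cmod (G x))\<^sup>2))"
    using L2on_interval[OF AC_continuous[OF AC]] by (simp add: L2on_def set_integrable_def)
  have "(LINT x|lebesgue. indicator {-1..1} x *\<^sub>R (\<bar>r x\<bar> * (cmod (G x))\<^sup>2)) = 0"
    using assms(2) unfolding r_inner_self by (simp add: set_lebesgue_integral_def)
  then have "AE x in lebesgue. indicator {-1..1} x *\<^sub>R (\<bar>r x\<bar> * (cmod (G x))\<^sup>2) = 0"
    using integral_nonneg_eq_0_iff_AE[OF i] by simp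
  then have ae: "AE x in lebesgue. x \<in> {-1..1} \<longrightarrow> G x = 0"
    using AE_lebesgue_nonzero by eventually_elim (auto simp: r_nonzero)
  have zero: "G x = 0" if "x \<in> {-1<..<1}" for x
  proof (rule ccontr)
    assume "G x \<noteq> 0"
    let ?U = "{-1<..<1} \<inter> G -` (- {0})"
    have "open (G -` (- {0}))" using AC_continuous[OF AC, of UNIV] by (intro open_vimage) (auto simp: open_Compl)
    then have "open ?U" by (intro open_Int) auto
    moreover have "negligible ?U"
    proof -
      obtain N where "{x. \<not> (x \<in> {-1..1} \<longrightarrow> G x = 0)} \<subseteq> N" "N \<in> null_sets lebesgue" using ae by (auto elim!: AE_E simp: null_sets_def)
      then have "negligible {x. \<not> (x \<in> {-1..1} \<longrightarrow> G x = 0)}" using negligible_subset negligible_iff_null_sets by blast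
      then show ?thesis by (rule negligible_subset) auto
    qed
    ultimately have "?U = {}" using open_not_negligible by blast
    then show False using that \<open>G x \<noteq> 0\<close> by auto
  qed
  have "vderiv G 0 = vderiv (\<lambda>x. 0) 0" by (rule vderiv_cong_open[of "{-1<..<1}"]) (use zero in auto)
  then show ?thesis using zero[of 0] by simp
qed

text \<open>In \<open>boundary_relation\<close>, a \<open>G\<close> orthogonal to
  \<open>\<Psi>2\<close> but not to \<open>\<Psi>1\<close> removes the defect at the left end, and
  then \<open>G = \<Psi>2\<close> removes the other.\<close>

lemma Im_m:
  "Im m1 = Im z * N1" "Im m2 = Im z * N2"
proof -
  let ?ip = "r_inner {-1..1}"
  have nz2: "?ip \<Psi>2 \<Psi>2 \<noteq> 0" using r_inner_definite[OF AC2] init by auto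
  \<comment> \<open>One Gram-Schmidt step on \<open>{-1..1}\<close>; the result \<open>G\<close> is
    not zero there, because \<open>m1\<close> and \<open>m2\<close> differ.\<close>
  define \<alpha> where "\<alpha> = cnj (?ip \<Psi>2 \<Psi>1 / ?ip \<Psi>2 \<Psi>2)"
  define G where "G = (\<lambda>x. 1 * \<Psi>1 x + (- \<alpha>) * \<Psi>2 x)"
  have ACG: "AC_loc_deriv G" "vderiv G = (\<lambda>x. 1 * vderiv \<Psi>1 x + (- \<alpha>) * vderiv \<Psi>2 x)"
    unfolding G_def by (rule AC_loc_deriv_lincomb[OF AC1 AC2])+
  have cG: "continuous_on UNIV G" by (rule AC_continuous[OF ACG(1)])
  have ipG: "?ip f G = ?ip f \<Psi>1 - cnj \<alpha> * ?ip f \<Psi>2" if f: "AC_loc_deriv f" for f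
  proof -
    have "(\<lambda>x. of_real \<bar>r x\<bar> * (f x * cnj (G x))) = (\<lambda>x. of_real \<bar>r x\<bar> * (f x * cnj (\<Psi>1 x)) - cnj \<alpha> * (of_real \<bar>r x\<bar> * (f x * cnj (\<Psi>2 x))))"
      by (simp add: G_def algebra_simps)
    then have "?ip f G = (LINT x:{-1..1}|lebesgue. of_real \<bar>r x\<bar> * (f x * cnj (\<Psi>1 x)) - cnj \<alpha> * (of_real \<bar>r x\<bar> * (f x * cnj (\<Psi>2 x))))"
      unfolding r_inner_def by simp
    also have "\<dots> = ?ip f \<Psi>1 - (LINT x:{-1..1}|lebesgue. cnj \<alpha> * (of_real \<bar>r x\<bar> * (f x * cnj (\<Psi>2 x))))"
      unfolding r_inner_def
      by (intro set_integral_diff set_integrable_mult_right r_inner_integrable AC_continuous f AC1 AC2)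
    finally show ?thesis unfolding r_inner_def set_integral_mult_right .
  qed
  have G2: "?ip \<Psi>2 G = 0" unfolding ipG[OF AC2] using nz2 by (simp add: \<alpha>_def)
  have "?ip G G = ?ip \<Psi>1 G - \<alpha> * ?ip \<Psi>2 G"
  proof -
    have "(\<lambda>x. of_real \<bar>r x\<bar> * (G x * cnj (G x))) = (\<lambda>x. of_real \<bar>r x\<bar> * (\<Psi>1 x * cnj (G x)) - \<alpha> * (of_real \<bar>r x\<bar> * (\<Psi>2 x * cnj (G x))))"
      unfolding G_def by (simp add: algebra_simps)
    then have "?ip G G = (LINT x:{-1..1}|lebesgue. of_real \<bar>r x\<bar> * (\<Psi>1 x * cnj (G x)) - \<alpha> * (of_real \<bar>r x\<bar> * (\<Psi>2 x * cnj (G x))))"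
      unfolding r_inner_def by simp
    also have "\<dots> = ?ip \<Psi>1 G - (LINT x:{-1..1}|lebesgue. \<alpha> * (of_real \<bar>r x\<bar> * (\<Psi>2 x * cnj (G x))))"
      unfolding r_inner_def
      by (intro set_integral_diff set_integrable_mult_right r_inner_integrable AC_continuous ACG AC1 AC2)
    finally show ?thesis unfolding r_inner_def set_integral_mult_right .
  qed
  moreover have "?ip G G \<noteq> 0"
  proof
    assume "?ip G G = 0"
    then have "G 0 = 0" "vderiv G 0 = 0" using r_inner_definite[OF ACG(1)] by auto
    then have "\<alpha> = 1" "m1 = \<alpha> * m2" using fun_cong[OF ACG(2), of 0] by (auto simp: G_def init)
    then show False using w_nonzero by (simp add: w_eq)
  qed
  ultimately have "?ip \<Psi>1 G \<noteq> 0" using G2 by simp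
  then have *: "Im z * N2 - Im m2 = 0" using boundary_relation[OF cG] G2 by simp
  then have "Im z * N1 - Im m1 = 0" using boundary_relation[OF AC_continuous[OF AC2]] nz2 by simp
  with * show "Im m1 = Im z * N1" "Im m2 = Im z * N2" by auto
qed

lemma N_nonneg: "N1 \<ge> 0" "N2 \<ge> 0"
  unfolding N1_def N2_def set_lebesgue_integral_def by (auto intro!: Bochner_Integration.integral_nonneg)

text \<open>The source built from \<open>\<Psi>1\<close> on \<open>{0..n}\<close> has squared norm
  \<open>n1 n\<close>, and its solution equals \<open>n1 n / w\<close> times \<open>\<Psi>2\<close>
  on the left half-line, with squared norm \<open>(n1 n)\<^sup>2 * N2 / (cmod w)\<^sup>2\<close>
  there. The resolvent bound therefore controls \<open>n1 n * N2\<close>; as \<open>n\<close> grows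
  this tends to \<open>N1 * N2\<close>.\<close>

theorem weyl_product_bound:
  assumes est: "\<And>f y. f \<in> L2 W \<Longrightarrow> y \<in> max_dom q r \<Longrightarrow> AE x in lebesgue. a_expr q r y x = f x + z * y x \<Longrightarrow>
      Im z * l2_norm W y \<le> C * l2_norm W f"
  shows "Im m1 * Im m2 \<le> C\<^sup>2 * (cmod (m1 - m2))\<^sup>2"
proof -
  define n1 where "n1 n = (LINT x:{0..real n}|lebesgue. \<bar>r x\<bar> * (cmod (\<Psi>1 x))\<^sup>2)" for n
  have c1: "continuous_on UNIV \<Psi>1" by (rule AC_continuous[OF AC1])
  have bound: "(Im z)\<^sup>2 * n1 n * N2 \<le> C\<^sup>2 * (cmod w)\<^sup>2" for n
  \<comment> \<open>A factor \<open>n1 n\<close> is cancelled at the end; if it is zero the bound is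
    trivial.\<close>
  proof (cases "n1 n = 0")
    case False
    have n0: "n1 n \<ge> 0" unfolding n1_def set_lebesgue_integral_def by (auto intro!: Bochner_Integration.integral_nonneg)
    let ?f = "src 0 (real n) \<Psi>1"
    have f: "?f \<in> L2 W" "(l2_norm W ?f)\<^sup>2 = n1 n" using src_L2[OF c1, of 0 "real n"] by (auto simp: n1_def)
    obtain y where y: "y \<in> max_dom q r" "AE x in lebesgue. a_expr q r y x = ?f x + z * y x"
      using solvable[OF f(1)] by blast
    have AC: "AC_loc_deriv y" "y \<in> L2 W" using y(1) by (auto simp: max_dom_def)
    have [measurable]: "y \<in> borel_measurable lebesgue" by (rule continuous_measurable[OF AC_continuous[OF AC(1)]])
    have I: "r_inner {0..real n} \<Psi>1 \<Psi>1 = of_real (n1 n)" by (simp add: r_inner_self n1_def)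
    have yeq: "(cmod w)\<^sup>2 * (cmod (y x))\<^sup>2 = (n1 n)\<^sup>2 * (cmod (\<Psi>2 x))\<^sup>2" if "x \<le> 0" for x
    proof -
      have "w * y x = of_real (n1 n) * \<Psi>2 x" using resolvent_outside(1)[OF _ c1 y that] I by simp
      from arg_cong[OF this, of "\<lambda>u. (cmod u)\<^sup>2"] show ?thesis by (simp add: norm_mult power_mult_distrib)
    qed
    have iy: "integrable lebesgue (\<lambda>x. \<bar>r x\<bar> * (cmod (y x))\<^sup>2)"
      using L2_continuous_iff[OF AC_continuous[OF AC(1)]] AC(2) by simp
    have "(n1 n)\<^sup>2 * N2 = (LINT x:{..0}|lebesgue. (n1 n)\<^sup>2 * (\<bar>r x\<bar> * (cmod (\<Psi>2 x))\<^sup>2))"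
      unfolding N2_def by simp
    also have "\<dots> = (LINT x:{..0}|lebesgue. (cmod w)\<^sup>2 * (\<bar>r x\<bar> * (cmod (y x))\<^sup>2))"
    proof (rule set_lebesgue_integral_cong)
      show "\<forall>x. x \<in> {..0} \<longrightarrow> (n1 n)\<^sup>2 * (\<bar>r x\<bar> * (cmod (\<Psi>2 x))\<^sup>2) = (cmod w)\<^sup>2 * (\<bar>r x\<bar> * (cmod (y x))\<^sup>2)"
        using yeq by (auto simp: algebra_simps)
    qed simp
    also have "\<dots> = (cmod w)\<^sup>2 * (LINT x:{..0}|lebesgue. \<bar>r x\<bar> * (cmod (y x))\<^sup>2)" by simp
    also have "(LINT x:{..0}|lebesgue. \<bar>r x\<bar> * (cmod (y x))\<^sup>2) \<le> (LINT x|lebesgue. \<bar>r x\<bar> * (cmod (y x))\<^sup>2)"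
      unfolding set_lebesgue_integral_def
      by (rule integral_mono[OF integrable_mult_indicator[OF _ iy] iy]) (auto simp: indicator_def)
    also have "(LINT x|lebesgue. \<bar>r x\<bar> * (cmod (y x))\<^sup>2) = (l2_norm W y)\<^sup>2"
      using integrable_W(2)[of "\<lambda>x. (cmod (y x))\<^sup>2"] by (simp add: l2_norm_def)
    finally have 1: "(n1 n)\<^sup>2 * N2 \<le> (cmod w)\<^sup>2 * (l2_norm W y)\<^sup>2" by (simp add: mult_left_mono)
    have "(Im z * l2_norm W y)\<^sup>2 \<le> (C * l2_norm W ?f)\<^sup>2"
      using est[OF f(1) y] Im_z by (intro power_mono) (auto simp: l2_norm_nonneg)
    then have 2: "(Im z)\<^sup>2 * (l2_norm W y)\<^sup>2 \<le> C\<^sup>2 * n1 n" by (simp add: power_mult_distrib f(2))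
    have "((Im z)\<^sup>2 * n1 n * N2) * n1 n = (Im z)\<^sup>2 * ((n1 n)\<^sup>2 * N2)" by (simp add: power2_eq_square algebra_simps)
    also have "\<dots> \<le> (Im z)\<^sup>2 * ((cmod w)\<^sup>2 * (l2_norm W y)\<^sup>2)" using 1 by (intro mult_left_mono) auto
    also have "\<dots> = (cmod w)\<^sup>2 * ((Im z)\<^sup>2 * (l2_norm W y)\<^sup>2)" by (simp add: algebra_simps)
    also have "\<dots> \<le> (cmod w)\<^sup>2 * (C\<^sup>2 * n1 n)" using 2 by (intro mult_left_mono) auto
    also have "\<dots> = (C\<^sup>2 * (cmod w)\<^sup>2) * n1 n" by (simp add: algebra_simps)
    finally show ?thesis using n0 False by (simp add: mult_le_cancel_right)
  qed simp
  have "n1 \<longlonglongrightarrow> N1" unfolding n1_def[abs_def] N1_def by (rule set_integral_exhaust_half(1)[OF L2_1[unfolded L2on_def]])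
  then have "(\<lambda>n. (Im z)\<^sup>2 * n1 n * N2) \<longlonglongrightarrow> (Im z)\<^sup>2 * N1 * N2" by (intro tendsto_intros)
  then have "(Im z)\<^sup>2 * N1 * N2 \<le> C\<^sup>2 * (cmod w)\<^sup>2"
    by (rule tendsto_upperbound) (use bound in auto)
  then show ?thesis by (simp add: Im_m w_eq norm_minus_commute power2_eq_square mult_ac)
qed

end

section \<open>From the Weyl coefficients to the quotients\<close>

context sl_weight begin

text \<open>To the left of 0 one has \<open>\<bar>r\<bar> = - r\<close>, so the parameter
  \<open>- z\<close> with weight \<open>\<bar>r\<bar>\<close> means \<open>z\<close> with weight
  \<open>r\<close>. This is why the left coefficient is evaluated at the negative of the spectral
  parameter.\<close>

lemma sol_glue:
  assumes f: "sl_solution q r z f" and g: "sl_solution q r (- z) g" and eq: "f 0 = g 0" "vderiv f 0 = vderiv g 0"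
  shows "sol z (\<lambda>x. if x \<ge> 0 then f x else g x)"
    "vderiv (\<lambda>x. if x \<ge> 0 then f x else g x) = (\<lambda>x. if x \<ge> 0 then vderiv f x else vderiv g x)"
proof -
  have AC: "AC_loc_deriv f" "AC_loc_deriv g" using f g by (auto simp: sl_solution_def)
  note glue = AC_loc_deriv_glue[OF AC eq]
  show "vderiv (\<lambda>x. if x \<ge> 0 then f x else g x) = (\<lambda>x. if x \<ge> 0 then vderiv f x else vderiv g x)" by (rule glue(2))
  have "AE x in lebesgue. vderiv (vderiv (\<lambda>x. if x \<ge> 0 then f x else g x)) x =
      of_real (q x) * (if x \<ge> 0 then f x else g x) - of_real (r x) * (z * (if x \<ge> 0 then f x else g x))"
    using f[unfolded sl_solution_def, THEN conjunct2] g[unfolded sl_solution_def, THEN conjunct2] AE_lebesgue_nonzero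
  proof eventually_elim
    case (elim x)
    show ?case
    proof (cases "x > 0")
      case True
      then have "\<bar>r x\<bar> = r x" using r_abs[of x] by simp
      then have "vderiv (vderiv f) x = of_real (q x) * f x - of_real (r x) * (z * f x)"
        using elim(1) by (simp add: algebra_simps)
      then show ?thesis using glue(3)[OF True] True by simp
    next
      case False
      then have x: "x < 0" using elim(3) by simp
      then have "\<bar>r x\<bar> = - r x" using r_abs[of x] by simp
      then have "vderiv (vderiv g) x = of_real (q x) * g x - of_real (r x) * (z * g x)"
        using elim(2) by (simp add: algebra_simps)
      then show ?thesis using glue(4)[OF x] x by simp
    qed
  qed
  then show "sol z (\<lambda>x. if x \<ge> 0 then f x else g x)" using glue(1) by (simp add: sol_def)
qed

lemma L2on_restrict_space:
  assumes f: "continuous_on UNIV f" and S: "S \<in> sets lebesgue" and L: "f' \<in> L2 (restrict_space W S)"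
    and eq: "\<And>x. x \<in> S \<Longrightarrow> f x = f' x"
  shows "L2on S f"
proof -
  have [measurable]: "f \<in> borel_measurable lebesgue" by (rule continuous_measurable[OF f])
  have "integrable W (\<lambda>x. indicator S x *\<^sub>R (cmod (f' x))\<^sup>2)"
    using L2_D(2)[OF L] integrable_restrict_space[of S W "\<lambda>x. (cmod (f' x))\<^sup>2"] S by simp
  moreover have "(\<lambda>x. indicator S x *\<^sub>R (cmod (f' x))\<^sup>2) = (\<lambda>x. indicator S x *\<^sub>R (cmod (f x))\<^sup>2)"
    using eq by (auto simp: indicator_def)
  ultimately have i: "integrable W (\<lambda>x. indicator S x *\<^sub>R (cmod (f x))\<^sup>2)" by simp
  have "(\<lambda>x. (cmod (f x))\<^sup>2) \<in> borel_measurable lebesgue" by measurable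
  then have "(\<lambda>x. indicator S x *\<^sub>R (cmod (f x))\<^sup>2) \<in> borel_measurable lebesgue"
    using S by (intro borel_measurable_scaleR borel_measurable_indicator)
  from integrable_W(1)[OF this] i have "integrable lebesgue (\<lambda>x. \<bar>r x\<bar> *\<^sub>R (indicator S x *\<^sub>R (cmod (f x))\<^sup>2))" by simp
  then show ?thesis by (simp add: L2on_def set_integrable_def mult.left_commute)
qed

text \<open>All solutions with slope 1 at 0 have the form \<open>St - m * Ct\<close>, where
  \<open>St\<close> and \<open>Ct\<close> are glued from the parameters \<open>z\<close> and
  \<open>- z\<close>; \<open>m1\<close> and \<open>m2\<close> select the members that are
  square-integrable at the right and at the left end.\<close>

lemma weyl_bound:
  assumes kr: "krein_operator W (A_op q r) E" and cs: "fundamental_system q r c s" and z: "Im z > 0"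
    and m1: "(\<lambda>x. s z x - m1 * c z x) \<in> L2 (restrict_space W {0..})"
    and m2: "(\<lambda>x. s (- z) x - m2 * c (- z) x) \<in> L2 (restrict_space W {..0})"
    and est: "\<And>u v. (u, v) \<in> A_op q r \<Longrightarrow> \<bar>Im z\<bar> * l2_norm W u \<le> C * l2_norm W (\<lambda>x. v x - z * u x)"
  shows "Im m1 \<ge> 0 \<and> Im m2 \<ge> 0 \<and> Im m1 * Im m2 \<le> C\<^sup>2 * (cmod (m1 - m2))\<^sup>2"
proof -
  interpret krein_operator W "A_op q r" E by (rule kr)
  define Ct St where "Ct = (\<lambda>x. if x \<ge> 0 then c z x else c (- z) x)" and "St = (\<lambda>x. if x \<ge> 0 then s z x else s (- z) x)"
  have cs': "sl_solution q r \<zeta> (c \<zeta>)" "c \<zeta> 0 = 1" "vderiv (c \<zeta>) 0 = 0" "sl_solution q r \<zeta> (s \<zeta>)" "s \<zeta> 0 = 0" "vderiv (s \<zeta>) 0 = 1" for \<zeta>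
    using cs unfolding fundamental_system_def by blast+
  have C: "sol z Ct" "vderiv Ct = (\<lambda>x. if x \<ge> 0 then vderiv (c z) x else vderiv (c (- z)) x)"
    unfolding Ct_def using sol_glue[OF cs'(1) cs'(1), of z] cs'(2) cs'(3) by simp_all
  have S: "sol z St" "vderiv St = (\<lambda>x. if x \<ge> 0 then vderiv (s z) x else vderiv (s (- z)) x)"
    unfolding St_def using sol_glue[OF cs'(4) cs'(4), of z] cs'(5,6) by simp_all
  have AC: "AC_loc_deriv Ct" "AC_loc_deriv St" using C S by (auto simp: sol_def)
  define \<Psi> where "\<Psi> m = (\<lambda>x. 1 * St x + (- m) * Ct x)" for m
  have sol\<Psi>: "sol z (\<Psi> m)" for m unfolding \<Psi>_def by (rule sol_lincomb[OF S(1) C(1)])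
  have v\<Psi>: "vderiv (\<Psi> m) 0 = 1" for m
    using fun_cong[OF AC_loc_deriv_lincomb(2)[OF AC(2,1), of 1 "- m"], of 0] fun_cong[OF C(2), of 0] fun_cong[OF S(2), of 0]
    by (simp add: \<Psi>_def cs')
  have cont: "continuous_on UNIV (\<Psi> m)" for m using sol\<Psi>[of m] by (auto simp: sol_def intro: AC_continuous)
  obtain R where R: "is_resolvent W (L2 W) (A_op q r) z R"
    using nonreal_resolvent[of z] z by (auto simp: complex_is_Real_iff)
  have at0: "\<Psi> m x = s (- z) x - m * c (- z) x" if "x \<le> 0" for m x
    using that by (cases "x = 0") (auto simp: \<Psi>_def St_def Ct_def cs')
  interpret weyl_solutions q r z m1 m2 "\<Psi> m1" "\<Psi> m2"
  proof
    show "\<Psi> m1 0 = - m1" "\<Psi> m2 0 = - m2" by (simp_all add: \<Psi>_def St_def Ct_def cs')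
    show "L2on {0..} (\<Psi> m1)"
      by (rule L2on_restrict_space[OF cont _ m1]) (auto simp: \<Psi>_def St_def Ct_def)
    show "L2on {..0} (\<Psi> m2)"
      by (rule L2on_restrict_space[OF cont _ m2]) (auto simp: at0)
    show "AE x in lebesgue. y x = 0" if "(y, \<lambda>x. z * y x) \<in> A_op q r" for y
      using resolvent_zero[OF R that] by (simp add: AE_W)
    show "j_inner W (a_expr q r y) y = j_inner W y (a_expr q r y)" if "y \<in> max_dom q r" for y
      by (rule T_sym[OF max_dom_A_op[OF that] max_dom_A_op[OF that]])
    show "\<exists>y\<in>max_dom q r. AE x in lebesgue. a_expr q r y x = f x + z * y x" if f: "f \<in> L2 W" for f
    proof -
      obtain y where y: "y \<in> max_dom q r" "AE x in lebesgue. R f x = y x" "AE x in lebesgue. f x + z * R f x = a_expr q r y x"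
        using resolventD(4)[OF R f] by (auto simp: A_op_iff)
      have "AE x in lebesgue. a_expr q r y x = f x + z * y x" using y(2,3) by eventually_elim simp
      then show ?thesis using y(1) by blast
    qed
  qed (simp_all add: z sol\<Psi> v\<Psi>)
  have "Im m1 * Im m2 \<le> C\<^sup>2 * (cmod (m1 - m2))\<^sup>2"
  proof (rule weyl_product_bound)
    fix f y assume f: "f \<in> L2 W" and y: "y \<in> max_dom q r" and eq: "AE x in lebesgue. a_expr q r y x = f x + z * y x"
    have L: "y \<in> L2 W" "a_expr q r y \<in> L2 W" using y a_expr_L2[OF y] by (auto simp: max_dom_def)
    have "l2_norm W (\<lambda>x. a_expr q r y x - z * y x) = l2_norm W f"
    proof (rule l2_norm_cong_AE[OF L2_diff[OF L(2,1)] f])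
      show "AE x in W. a_expr q r y x - z * y x = f x"
        unfolding AE_W using eq by eventually_elim simp
    qed
    then show "Im z * l2_norm W y \<le> C * l2_norm W f" using est[OF max_dom_A_op[OF y]] z by simp
  qed
  then show ?thesis using Im_m N_nonneg z by simp
qed

end

text \<open>Let \<open>a\<close>, \<open>b\<close> be the imaginary parts and \<open>d\<close> the
  distance of the two numbers, so that \<open>\<bar>a - b\<bar> \<le> d\<close>. If
  \<open>a \<ge> 2 * b\<close> then \<open>a \<le> 2 * (a - b) \<le> 2 * d\<close>; otherwise
  \<open>a\<^sup>2 \<le> 2 * a * b \<le> 2 * C\<^sup>2 * d\<^sup>2\<close>. The sum of the two
  constants covers both cases.\<close>

lemma ratio_bound:
  fixes m1 m2 :: complex
  assumes "Im m1 \<ge> 0" "Im m2 \<ge> 0" "Im m1 * Im m2 \<le> C\<^sup>2 * (cmod (m1 - m2))\<^sup>2" "C > 0"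
  shows "cmod (of_real (Im m1) / (m1 - m2)) \<le> 2 + 2 * C" "cmod (of_real (Im m2) / (m1 - m2)) \<le> 2 + 2 * C"
proof -
  have *: "a \<le> (2 + 2 * C) * d" if a: "a \<ge> 0" "b \<ge> 0" "a * b \<le> C\<^sup>2 * d\<^sup>2" "\<bar>a - b\<bar> \<le> d" for a b d :: real
  proof (cases "a \<ge> 2 * b")
    case True
    then have "a \<le> 2 * d" using a by (auto simp: abs_if split: if_splits)
    also have "\<dots> \<le> (2 + 2 * C) * d" using a(4) \<open>C > 0\<close> by (intro mult_right_mono) auto
    finally show ?thesis .
  next
    case False
    have d: "d \<ge> 0" using a(4) by linarith
    have "a\<^sup>2 \<le> 2 * (a * b)" using False a(1) mult_left_mono[of a "2 * b" a] by (simp add: power2_eq_square algebra_simps)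
    also have "\<dots> \<le> (2 * C * d)\<^sup>2" proof -
      have "0 \<le> C\<^sup>2 * d\<^sup>2" by simp
      then have "2 * (a * b) \<le> 4 * (C\<^sup>2 * d\<^sup>2)" using a(3) by linarith
      then show ?thesis by (simp add: power_mult_distrib)
    qed
    finally have "a \<le> 2 * C * d" by (rule power2_le_imp_le) (use d \<open>C > 0\<close> in simp)
    then show ?thesis using d by (simp add: distrib_right)
  qed
  have d: "\<bar>Im m1 - Im m2\<bar> \<le> cmod (m1 - m2)" using abs_Im_le_cmod[of "m1 - m2"] by simp
  show "cmod (of_real (Im m1) / (m1 - m2)) \<le> 2 + 2 * C"
    using *[OF assms(1,2,3) d] assms(1) \<open>C > 0\<close>
    by (cases "m1 = m2") (auto simp: norm_divide divide_le_eq)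
  show "cmod (of_real (Im m2) / (m1 - m2)) \<le> 2 + 2 * C"
    using *[OF assms(2,1), of "cmod (m1 - m2)"] assms d \<open>C > 0\<close>
    by (cases "m1 = m2") (auto simp: norm_divide divide_le_eq mult.commute abs_minus_commute)
qed

theorem theorem3p2:
  fixes q r :: "real \<Rightarrow> real"
    and c s :: "complex \<Rightarrow> real \<Rightarrow> complex"
    and m_plus m_minus M_plus M_minus :: "complex \<Rightarrow> complex"
    and E :: "real option set \<Rightarrow> (real \<Rightarrow> complex) \<Rightarrow> (real \<Rightarrow> complex)"
  assumes q_loc: "\<And>a b. q absolutely_integrable_on {a..b}"
    and r_loc: "\<And>a b. r absolutely_integrable_on {a..b}"
    and r_sign: "\<And>x. x \<noteq> 0 \<Longrightarrow> x * r x > 0"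
    and L_self_adjoint: "self_adjoint (weighted r) (L_op q r)"
    and A_nonneg: "j_nonnegative (weighted r) (A_op q r)"
    and cs: "fundamental_system q r c s"
    and m_plus: "weyl_coeff_plus r c s m_plus"
    and m_minus: "weyl_coeff_minus r c s m_minus"
    and M_plus: "\<And>z. z \<in> - \<real> \<Longrightarrow> M_plus z = m_plus z"
    and M_minus: "\<And>z. z \<in> - \<real> \<Longrightarrow> M_minus z = - m_minus (- z)"
    and E: "spectral_function (weighted r) (A_op q r) E"
  shows "(regular_critical_point (weighted r) E None \<longrightarrow>
      (\<forall>R>0.
        bounded ((\<lambda>z. of_real (Im (M_plus z)) / (M_plus z - M_minus z)) ` {z. Im z > 0 \<and> cmod z > R}) \<and>
        bounded ((\<lambda>z. of_real (Im (M_minus z)) / (M_plus z - M_minus z)) ` {z. Im z > 0 \<and> cmod z > R}))) \<and>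
    (regular_critical_point (weighted r) E (Some 0) \<and>
      op_kernel (A_op q r) = op_kernel (A_op q r O A_op q r) \<longrightarrow>
      (\<forall>R>0.
        bounded ((\<lambda>z. of_real (Im (M_plus z)) / (M_plus z - M_minus z)) ` {z. Im z > 0 \<and> cmod z < R}) \<and>
        bounded ((\<lambda>z. of_real (Im (M_minus z)) / (M_plus z - M_minus z)) ` {z. Im z > 0 \<and> cmod z < R})))"
proof -
  interpret sl_weight q r by unfold_locales (fact r_loc, fact r_sign)
  have kr: "krein_operator W (A_op q r) E" by (rule krein_operator_A[OF L_self_adjoint A_nonneg E])
  interpret krein_operator W "A_op q r" E by (rule kr)
  \<comment> \<open>\<open>P\<close> stands for either of the two regions; a resolvent estimate that
    is uniform on the region is what both parts of the theorem reduce to.\<close>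
  have main: "bounded ((\<lambda>z. of_real (Im (M_plus z)) / (M_plus z - M_minus z)) ` {z. Im z > 0 \<and> P z}) \<and>
      bounded ((\<lambda>z. of_real (Im (M_minus z)) / (M_plus z - M_minus z)) ` {z. Im z > 0 \<and> P z})"
    if C: "C > 0" "\<And>z u v. P z \<Longrightarrow> (u, v) \<in> A_op q r \<Longrightarrow> \<bar>Im z\<bar> * l2_norm W u \<le> C * l2_norm W (\<lambda>x. v x - z * u x)"
    for C P
  proof -
    have "cmod (of_real (Im (M_plus z)) / (M_plus z - M_minus z)) \<le> 2 + 2 * C \<and>
        cmod (of_real (Im (M_minus z)) / (M_plus z - M_minus z)) \<le> 2 + 2 * C" if z: "Im z > 0" "P z" for z
    proof -
      have nr: "z \<in> - \<real>" "- z \<in> - \<real>" using z by (auto simp: complex_is_Real_iff)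
      have "(\<lambda>x. s z x - M_plus z * c z x) \<in> L2 (restrict_space W {0..})"
        using m_plus nr(1) M_plus[OF nr(1)] by (simp add: weyl_coeff_plus_def)
      moreover have "(\<lambda>x. s (- z) x - M_minus z * c (- z) x) \<in> L2 (restrict_space W {..0})"
        using m_minus nr(2) M_minus[OF nr(1)] by (simp add: weyl_coeff_minus_def)
      ultimately have "Im (M_plus z) \<ge> 0 \<and> Im (M_minus z) \<ge> 0 \<and> Im (M_plus z) * Im (M_minus z) \<le> C\<^sup>2 * (cmod (M_plus z - M_minus z))\<^sup>2"
        by (rule weyl_bound[OF kr cs z(1) _ _ C(2)[OF z(2)]])
      then show ?thesis using ratio_bound[of "M_plus z" "M_minus z" C] C(1) by blast
    qed
    then show ?thesis unfolding bounded_iff by blast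
  qed
  \<comment> \<open>Only 0 and infinity can be critical, so every nonzero real cut point is
    admissible in the definition of regularity.\<close>
  have crit: "Some t \<notin> critical_points W E" if "t \<noteq> 0" for t using that by (simp add: critical_points_def)
  show ?thesis
  proof (intro conjI[of "_ \<longrightarrow> _"] impI allI)
    fix R :: real assume reg: "regular_critical_point W E None" and R: "R > 0"
    \<comment> \<open>Any cut strictly between 0 and \<open>R\<close> serves: the bounded part then
      has its spectrum inside the open disc of radius \<open>R\<close>.\<close>
    have "sot_convergent W (\<lambda>t. E (Some ` {R / 2..t})) at_top \<and> sot_convergent W (\<lambda>t. E (Some ` {t..- (R / 2)})) at_bot"
      using reg[unfolded regular_critical_point_def, THEN conjunct2, THEN spec[of _ "R / 2"], THEN spec[of _ "- (R / 2)"]]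
        crit[of "R / 2"] crit[of "- (R / 2)"] R by simp
    then obtain C where "C > 0" "\<And>z u v. cmod z > R \<Longrightarrow> (u, v) \<in> A_op q r \<Longrightarrow> \<bar>Im z\<bar> * l2_norm W u \<le> C * l2_norm W (\<lambda>x. v x - z * u x)"
      using resolvent_estimate_infinity[of "R / 2" R] R by auto
    from main[OF this] show "bounded ((\<lambda>z. of_real (Im (M_plus z)) / (M_plus z - M_minus z)) ` {z. Im z > 0 \<and> cmod z > R}) \<and>
        bounded ((\<lambda>z. of_real (Im (M_minus z)) / (M_plus z - M_minus z)) ` {z. Im z > 0 \<and> cmod z > R})" .
  next
    fix R :: real assume reg: "regular_critical_point W E (Some 0) \<and> op_kernel (A_op q r) = op_kernel (A_op q r O A_op q r)" and R: "R > 0"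
    \<comment> \<open>A cut beyond \<open>R\<close> keeps the spectrum of the part away from 0
      outside the closed disc of radius \<open>R\<close>.\<close>
    have "sot_convergent W (\<lambda>t. E (Some ` {- (R + 1)..t})) (at_left 0) \<and> sot_convergent W (\<lambda>t. E (Some ` {t..R + 1})) (at_right 0)"
      using reg[THEN conjunct1, unfolded regular_critical_point_def, THEN conjunct2,
          THEN spec[of _ "- (R + 1)"], THEN spec[of _ "R + 1"]]
        crit[of "R + 1"] crit[of "- (R + 1)"] R by simp
    then obtain C where "C > 0" "\<And>z u v. cmod z < R \<Longrightarrow> (u, v) \<in> A_op q r \<Longrightarrow> \<bar>Im z\<bar> * l2_norm W u \<le> C * l2_norm W (\<lambda>x. v x - z * u x)"
      using resolvent_estimate_zero[of R "R + 1"] R reg by auto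
    from main[OF this] show "bounded ((\<lambda>z. of_real (Im (M_plus z)) / (M_plus z - M_minus z)) ` {z. Im z > 0 \<and> cmod z < R}) \<and>
        bounded ((\<lambda>z. of_real (Im (M_minus z)) / (M_plus z - M_minus z)) ` {z. Im z > 0 \<and> cmod z < R})" .
  qed
qed

end
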